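(* Let $(\alpha|\beta)\in\mathscr P^2(n)$ and let $\lambda,\mu$ be partitions with $|\lambda|+p|\mu|=n$. Then $$[M(p\alpha|p\beta):Y(p\lambda|p^2\mu)]\le[M(\alpha|\beta):Y(\lambda|p\mu)].$$ Moreover, if $\boldsymbol\delta_0=\varnothing$ for every $(\boldsymbol\gamma|\boldsymbol\delta)\in\Lambda((\alpha|\beta),\rho)$, where $\rho$ is the composition attached to $(\lambda|p\mu)$ below, then equality holds.
   Context: $F$ is a field of odd prime characteristic $p$; $\mathfrak S_n$ is the symmetric group on $\{1,\dots,n\}$. Compositions are finite sequences of non-negative integers with nonzero last entry ($\varnothing$ is the composition of $0$), partitions are non-increasing compositions, entries beyond the length are $0$; $q\alpha=(q\alpha_1,q\alpha_2,\dots)$ and $\alpha+\beta$ is the componentwise sum (padding with zeros). $\mathscr P^2(n)$ is the set of pairs $(\alpha|\beta)$ of partitions with $|\alpha|+|\beta|=n$. For a pair of compositions $(\alpha|\beta)$ with $|\alpha|+|\beta|=n$, $M(\alpha|\beta)=\mathrm{Ind}_{\mathfrak S_\alpha\times\mathfrak S_\beta}^{\mathfrak S_n}(F\boxtimes\mathrm{sgn})$, where $\mathfrak S_\alpha$ is the Young subgroup permuting $\{1,\dots,|\alpha|\}$ and acting trivially and $\mathfrak S_\beta$ is the Young subgroup of $\{|\alpha|+1,\dots,n\}$ acting by sign. $[M:N]$ is the multiplicity of the indecomposable $N$ in a Krull–Schmidt decomposition of $M$. Dominance: $(\lambda|\nu)\trianglerighteq(\alpha|\beta)$ iff for all $k\ge1$,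 $\sum_{i\le k}\lambda_i\ge\sum_{i\le k}\alpha_i$ and $|\lambda|+\sum_{i\le k}\nu_i\ge|\alpha|+\sum_{i\le k}\beta_i$. Signed Young modules: for partitions $\lambda,\mu$ with $|\lambda|+p|\mu|=n$, $Y(\lambda|p\mu)$ denotes the unique (up to isomorphism) indecomposable direct summand of $M(\lambda|p\mu)$ which is a direct summand of $M(\alpha|\beta)$, $(\alpha|\beta)\in\mathscr P^2(n)$, only if $(\lambda|p\mu)\trianglerighteq(\alpha|\beta)$ (this exists and occurs with multiplicity one in $M(\lambda|p\mu)$; every indecomposable summand of every $M(\alpha|\beta)$ is some $Y(\lambda|p\mu)$). $p$-adic expansion: $\lambda=\sum_{i\ge0}p^i\lambda(i)$ uniquely with each $\lambda(i)$ $p$-restricted (consecutive parts differ by less than $p$). Given $(\lambda|p\mu)$ with $p$-adic expansions $\lambda=\sum p^i\lambda(i)$, $\mu=\sum p^i\mu(i)$, set $n_0=|\lambda(0)|$, $n_i=|\lambda(i)|+|\mu(i-1)|$ for $i\ge1$, $r$ maximal with $n_r\ne0$, and $\rho=(1^{n_0},p^{n_1},\dots,(p^r)^{n_r})$ (the composition with $n_0$ parts $1$, then $n_1$ parts $p$, etc.). For $(\alpha|\beta)$ compositions and such a $\rho$, $\Lambda((\alpha|\beta),\rho)$ is the set of pairs of tuples of compositions $(\boldsymbol\gamma_0,\dots,\boldsymbol\gamma_r|\boldsymbol\delta_0,\dots,\boldsymbol\delta_r)$ with $\alpha=\sum_{i=0}^rp^i\boldsymbol\gamma_i$, $\beta=\sum_{i=0}^rp^i\boldsymbol\delta_i$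 and $|\boldsymbol\gamma_i|+|\boldsymbol\delta_i|=n_i$ for each $i$. *)

theory Defs
  imports "Jordan_Normal_Form.Matrix" "HOL-Combinatorics.Permutations"
begin

definition nth0 :: "nat list \<Rightarrow> nat \<Rightarrow> nat" where
  "nth0 xs j = (if j < length xs then xs ! j else 0)"

definition is_composition :: "nat list \<Rightarrow> bool" where
  "is_composition xs \<longleftrightarrow> xs = [] \<or> last xs \<noteq> 0"

definition is_partition :: "nat list \<Rightarrow> bool" where
  "is_partition xs \<longleftrightarrow> is_composition xs \<and> sorted_wrt (\<ge>) xs"

definition scale :: "nat \<Rightarrow> nat list \<Rightarrow> nat list" where
  "scale q xs = map ((*) q) xs"

definition P2 :: "nat \<Rightarrow> (nat list \<times> nat list) set" where
  "P2 n = {(a, b). is_partition a \<and> is_partition b \<and> sum_list a + sum_list b = n}"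

definition dominates :: "nat list \<times> nat list \<Rightarrow> nat list \<times> nat list \<Rightarrow> bool" where
  "dominates lv ab \<longleftrightarrow> (case lv of (l, v) \<Rightarrow> case ab of (a, b) \<Rightarrow>
     (\<forall>k\<ge>1. sum_list (take k l) \<ge> sum_list (take k a) \<and>
            sum_list l + sum_list (take k v) \<ge> sum_list a + sum_list (take k b)))"

definition p_restricted :: "nat \<Rightarrow> nat list \<Rightarrow> bool" where
  "p_restricted p xs \<longleftrightarrow> is_partition xs \<and> (\<forall>j. nth0 xs j - nth0 xs (Suc j) < p)"

definition is_padic_expansion :: "nat \<Rightarrow> nat list \<Rightarrow> (nat \<Rightarrow> nat list) \<Rightarrow> bool" where
  "is_padic_expansion p lam L \<longleftrightarrow>
     (\<forall>i. p_restricted p (L i)) \<and> (\<forall>i. sum_list lam < i \<longrightarrow> L i = []) \<and>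
     (\<forall>j. nth0 lam j = (\<Sum>i\<le>sum_list lam. p ^ i * nth0 (L i) j))"

definition padic :: "nat \<Rightarrow> nat list \<Rightarrow> nat \<Rightarrow> nat list" where
  "padic p lam = (THE L. is_padic_expansion p lam L)"

definition nseq :: "nat \<Rightarrow> nat list \<Rightarrow> nat list \<Rightarrow> nat \<Rightarrow> nat" where
  "nseq p lam mu i = (if i = 0 then sum_list (padic p lam 0)
                      else sum_list (padic p lam i) + sum_list (padic p mu (i - 1)))"

text \<open>r = the maximal i with n_i nonzero (taken to be 0 if all n_i vanish, i.e. n = 0).\<close>
definition rmax :: "nat \<Rightarrow> nat list \<Rightarrow> nat list \<Rightarrow> nat" where
  "rmax p lam mu = Max ({i. nseq p lam mu i \<noteq> 0} \<union> {0})"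

text \<open>Membership in Lambda((a|b), rho), where rho is attached to (lam | p mu);
  the tuples (gamma_0..gamma_r | delta_0..delta_r) are given as functions on {0..r}.\<close>
definition in_Lambda :: "nat \<Rightarrow> nat list \<Rightarrow> nat list \<Rightarrow> nat list \<Rightarrow> nat list
    \<Rightarrow> (nat \<Rightarrow> nat list) \<Rightarrow> (nat \<Rightarrow> nat list) \<Rightarrow> bool" where
  "in_Lambda p lam mu a b g d \<longleftrightarrow> (let r = rmax p lam mu in
     (\<forall>i\<le>r. is_composition (g i) \<and> is_composition (d i)) \<and>
     (\<forall>j. nth0 a j = (\<Sum>i\<le>r. p ^ i * nth0 (g i) j)) \<and>
     (\<forall>j. nth0 b j = (\<Sum>i\<le>r. p ^ i * nth0 (d i) j)) \<and>
     (\<forall>i\<le>r. sum_list (g i) + sum_list (d i) = nseq p lam mu i))"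

type_synonym 'a rep = "nat \<times> ((nat \<Rightarrow> nat) \<Rightarrow> 'a mat)"

definition Sn :: "nat \<Rightarrow> (nat \<Rightarrow> nat) set" where
  "Sn n = {g. g permutes {1..n}}"

definition is_rep :: "nat \<Rightarrow> 'a::field rep \<Rightarrow> bool" where
  "is_rep n M \<longleftrightarrow> (case M of (d, \<rho>) \<Rightarrow>
     (\<forall>g\<in>Sn n. \<rho> g \<in> carrier_mat d d) \<and> \<rho> id = 1\<^sub>m d \<and>
     (\<forall>g\<in>Sn n. \<forall>h\<in>Sn n. \<rho> (g \<circ> h) = \<rho> g * \<rho> h))"

definition rep_iso :: "nat \<Rightarrow> 'a::field rep \<Rightarrow> 'a rep \<Rightarrow> bool" where
  "rep_iso n M N \<longleftrightarrow> (case M of (d, \<rho>) \<Rightarrow> case N of (e, \<sigma>) \<Rightarrow>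
     d = e \<and> (\<exists>P\<in>carrier_mat d d. invertible_mat P \<and> (\<forall>g\<in>Sn n. P * \<rho> g = \<sigma> g * P)))"

definition dsum :: "'a::field rep \<Rightarrow> 'a rep \<Rightarrow> 'a rep" where
  "dsum M N = (case M of (d, \<rho>) \<Rightarrow> case N of (e, \<sigma>) \<Rightarrow>
     (d + e, \<lambda>g. four_block_mat (\<rho> g) (0\<^sub>m d e) (0\<^sub>m e d) (\<sigma> g)))"

definition zero_rep :: "'a::field rep" where
  "zero_rep = (0, \<lambda>g. 1\<^sub>m 0)"

definition dsum_list :: "'a::field rep list \<Rightarrow> 'a rep" where
  "dsum_list Ns = foldr dsum Ns zero_rep"

definition indecomposable :: "nat \<Rightarrow> 'a::field rep \<Rightarrow> bool" where
  "indecomposable n M \<longleftrightarrow> is_rep n M \<and> fst M > 0 \<and>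
     \<not> (\<exists>A B. is_rep n A \<and> is_rep n B \<and> fst A > 0 \<and> fst B > 0 \<and> rep_iso n M (dsum A B))"

definition is_summand :: "nat \<Rightarrow> 'a::field rep \<Rightarrow> 'a rep \<Rightarrow> bool" where
  "is_summand n N M \<longleftrightarrow> (\<exists>K. is_rep n K \<and> rep_iso n M (dsum N K))"

definition ks_mult :: "nat \<Rightarrow> 'a::field rep \<Rightarrow> 'a rep \<Rightarrow> nat" where
  "ks_mult n M N = (THE k. \<exists>Ns. (\<forall>X\<in>set Ns. indecomposable n X) \<and>
      rep_iso n M (dsum_list Ns) \<and> k = length (filter (\<lambda>X. rep_iso n X N) Ns))"

definition induced :: "nat \<Rightarrow> (nat \<Rightarrow> nat) set \<Rightarrow> ((nat \<Rightarrow> nat) \<Rightarrow> 'a::field) \<Rightarrow> 'a rep" where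
  "induced n H \<chi> = (let C = (\<lambda>g. (\<lambda>h. g \<circ> h) ` H) ` Sn n;
       cs = (SOME cs. distinct cs \<and> set cs = C);
       r = (\<lambda>i. SOME x. x \<in> cs ! i);
       k = length cs
     in (k, \<lambda>g. mat k k (\<lambda>(i, j). if g \<circ> r j \<in> cs ! i then \<chi> (Hilbert_Choice.inv (r i) \<circ> g \<circ> r j) else 0)))"

definition block :: "nat \<Rightarrow> nat list \<Rightarrow> nat \<Rightarrow> nat set" where
  "block off xs k = {off + sum_list (take k xs) + 1 .. off + sum_list (take (Suc k) xs)}"

definition young_sub :: "nat list \<Rightarrow> nat list \<Rightarrow> (nat \<Rightarrow> nat) set" where
  "young_sub a b = {g \<in> Sn (sum_list a + sum_list b).
      (\<forall>k<length a. g ` block 0 a k = block 0 a k) \<and>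
      (\<forall>k<length b. g ` block (sum_list a) b k = block (sum_list a) b k)}"

definition sgn_part :: "nat list \<Rightarrow> nat list \<Rightarrow> (nat \<Rightarrow> nat) \<Rightarrow> 'a::field" where
  "sgn_part a b h = of_int (sign (\<lambda>x. if x \<in> {sum_list a + 1 .. sum_list a + sum_list b} then h x else x))"

definition Mmod :: "nat list \<Rightarrow> nat list \<Rightarrow> 'a::field rep" where
  "Mmod a b = induced (sum_list a + sum_list b) (young_sub a b) (sgn_part a b)"

definition is_signed_young :: "nat \<Rightarrow> nat \<Rightarrow> nat list \<Rightarrow> nat list \<Rightarrow> 'a::field rep \<Rightarrow> bool" where
  "is_signed_young p n lam mu Y \<longleftrightarrow>
     indecomposable n Y \<and> is_summand n Y (Mmod lam (scale p mu)) \<and>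
     (\<forall>(a, b)\<in>P2 n. is_summand n Y (Mmod a b) \<longrightarrow> dominates (lam, scale p mu) (a, b))"

end

theory Submission
  imports Defs "Jordan_Normal_Form.Determinant" "HOL-Library.Product_Lexorder"
begin

text \<open>Homomorphisms between the modules \<open>M(\<alpha>|\<beta>)\<close> are functions on the symmetric group that are
  equivariant on both sides under the Young subgroups, composed by convolution. Cut the rows of
  \<open>(\<lambda>|p\<mu>)\<close> into runs of \<open>p\<close>-power length according to the \<open>p\<close>-adic expansions, and let \<open>z\<close> rotate all
  runs. Summing an endomorphism of \<open>M(\<lambda>|p\<mu>)\<close> over the column group with the appropriate sign gives a
  linear functional \<open>\<phi>\<close>. As \<open>z\<close> has \<open>p\<close>-power order, only words fixed by \<open>z\<close> contribute to \<open>\<phi>\<close> of a map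
  through \<open>M(\<alpha>|\<beta>)\<close>; hence it vanishes unless \<open>(\<lambda>|p\<mu>)\<close> dominates \<open>(\<alpha>|\<beta>)\<close>. By straightening, every
  endomorphism of \<open>M(\<lambda>|p\<mu>)\<close> is a scalar plus maps through non-dominated modules, so \<open>\<phi>\<close> is
  multiplicative and equals 1 on the idempotent of \<open>Y(\<lambda>|p\<mu>)\<close>. Therefore \<open>[M(\<alpha>|\<beta>) : Y(\<lambda>|p\<mu>)]\<close> is the
  rank of the bilinear form \<open>\<phi>(v' v)\<close> on the maps between \<open>M(\<lambda>|p\<mu>)\<close> and \<open>M(\<alpha>|\<beta>)\<close>.

  Replacing each point by \<open>p\<close> points and letting the new rotation act inside these blocks, the form
  for \<open>(p\<alpha>|p\<beta>)\<close> is the pullback of the form for \<open>(\<alpha>|\<beta>)\<close> along restriction of functions to the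
  diagonal copy of the smaller symmetric group. This gives the inequality. A function extends from
  the diagonal copy if its support respects parities; for words fixed by \<open>z\<close> a failure of this
  yields an element of \<open>\<Lambda>\<close> with \<open>\<delta>\<^sub>0\<close> nonempty.\<close>

section \<open>Idempotents and group inverses of matrices\<close>

text \<open>The obstacle is parity. Call letters and rows of the sign part odd. A column sum kills a
  word that repeats a letter in a column only if letter and box have the same parity, so even
  letters in odd rows would spoil dominance. The rotation removes them: in a fixed word a moved box
  and its image share row and letter, and comparing the signs of the two transpositions involved
  forces equal parities. Rows of \<open>p\<mu>\<close> consist of runs of length at least
  \<open>p\<close>, so all their boxes move; this is where the factor \<open>p\<close> in the label
  enters. Only the boxes of \<open>\<lambda>(0)\<close> rest. Odd letters there do no harm to
  dominance, which ranks odd letters last, but they obstruct the extension of kernels to the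
  blown-up group. The functional needs only the axioms of the locale \<open>tableau\<close>. So
  \<open>(p\<lambda>|p^2\<mu>)\<close> may be given the blown-up tableau rather than the one of its
  own expansions, which makes the two forms comparable. A rank depends on no decomposition, so the
  same argument shows that \<open>ks_mult\<close>, a definite description, is well defined.\<close>

lemma singular_mat_factors:
  fixes D :: "'a::field mat"
  assumes D: "D \<in> carrier_mat k k" and "det D = 0"
  obtains k' D1 D2 where "k' < k" "D1 \<in> carrier_mat k k'" "D2 \<in> carrier_mat k' k" "D = D1 * D2"
proof -
  from assms det_0_iff_vec_prod_zero_field[OF D] obtain v
    where v: "v \<in> carrier_vec k" "v \<noteq> 0\<^sub>v k" "D *\<^sub>v v = 0\<^sub>v k" by auto
  then obtain i where i: "i < k" "v $ i \<noteq> 0" by (metis eq_vecI carrier_vecD index_zero_vec(1) index_zero_vec(2))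
  then obtain k' where k': "k = Suc k'" by (cases k) auto
  define N where "N r c = (if r = c then 1 else 0) - (if c = i then v $ r / v $ i else 0)" for r c
  define D1 where "D1 = mat k k' (\<lambda>(r, j). D $$ (r, insert_index i j))"
  define D2 where "D2 = mat k' k (\<lambda>(j, c). N (insert_index i j) c)"
  have Dv: "(\<Sum>j<k. D $$ (r, j) * v $ j) = 0" if "r < k" for r
  proof -
    have "(D *\<^sub>v v) $ r = 0" using v(3) that by simp
    then show ?thesis using that D v(1) by (simp add: scalar_prod_def atLeast0LessThan)
  qed
  have "D = D1 * D2"
  proof (rule eq_matI)
    fix r c assume "r < dim_row (D1 * D2)" "c < dim_col (D1 * D2)"
    then have r: "r < k" and c: "c < k" by (auto simp: D1_def D2_def)
    have "(D1 * D2) $$ (r, c) = (\<Sum>j\<in>{0..<k'}. D $$ (r, insert_index i j) * N (insert_index i j) c)"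
      using r c by (simp add: D1_def D2_def scalar_prod_def)
    also have "\<dots> = (\<Sum>j\<in>insert_index i ` {0..<k'}. D $$ (r, j) * N j c)"
      by (simp add: sum.reindex[OF insert_index_inj_on] o_def)
    also have "\<dots> = (\<Sum>j\<in>{0..<k} - {i}. D $$ (r, j) * N j c)"
      using insert_index_image[of i k'] i k' by simp
    also have "\<dots> = (\<Sum>j<k. D $$ (r, j) * N j c)"
      using i by (intro sum.mono_neutral_left) (auto simp: N_def)
    also have "\<dots> = D $$ (r, c)"
    proof (cases "c = i")
      case True
      have "(\<Sum>j<k. D $$ (r, j) * N j c) = (\<Sum>j<k. (if j = c then D $$ (r, j) else 0) - D $$ (r, j) * v $ j / v $ i)"
        by (intro sum.cong) (auto simp: N_def True algebra_simps)
      also have "\<dots> = D $$ (r, c) - (\<Sum>j<k. D $$ (r, j) * v $ j) / v $ i"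
        using c by (simp add: sum_subtractf sum_divide_distrib)
      finally show ?thesis using Dv[OF r] by simp
    next
      case False
      have "(\<Sum>j<k. D $$ (r, j) * N j c) = (\<Sum>j<k. (if j = c then D $$ (r, j) else 0))"
        using False by (intro sum.cong) (auto simp: N_def)
      then show ?thesis using c by simp
    qed
    finally show "D $$ (r, c) = (D1 * D2) $$ (r, c)" ..
  qed (use D in \<open>auto simp: D1_def D2_def\<close>)
  moreover have "D1 \<in> carrier_mat k k'" "D2 \<in> carrier_mat k' k" by (auto simp: D1_def D2_def)
  ultimately show thesis using that[of k' D1 D2] k' by blast
qed

lemma nonsingular_inverse:
  fixes D :: "'a::field mat"
  assumes D: "D \<in> carrier_mat k k" and "det D \<noteq> 0"
  obtains X where "X \<in> carrier_mat k k" "D * X = 1\<^sub>m k" "X * D = 1\<^sub>m k"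
  using det_non_zero_imp_unit[OF D assms(2), of undefined]
  by (auto simp: Units_def ring_mat_def)

text \<open>Take a factorization of \<open>E\<close> with least inner dimension \<open>k\<close>.
  Since \<open>E = B (C B) C\<close>, a singular \<open>C B\<close> would allow a smaller
  \<open>k\<close>; so \<open>C B\<close> is invertible, and idempotency makes its cube equal to its
  square, whence it is the identity.\<close>

lemma idempotent_factorization:
  fixes E :: "'a::field mat"
  assumes E: "E \<in> carrier_mat d d" "E * E = E"
  obtains k B C where "B \<in> carrier_mat d k" "C \<in> carrier_mat k d" "E = B * C" "C * B = 1\<^sub>m k"
proof -
  define P where "P k \<longleftrightarrow> (\<exists>B\<in>carrier_mat d k. \<exists>C\<in>carrier_mat k d. E = B * C)" for k
  have "P d" unfolding P_def using E by (intro bexI[of _ E] bexI[of _ "1\<^sub>m d"]) auto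
  then have P: "P (LEAST k. P k)" by (rule LeastI)
  define k where "k = (LEAST k. P k)"
  from P obtain B C where B: "B \<in> carrier_mat d k" and C: "C \<in> carrier_mat k d" and EBC: "E = B * C"
    unfolding P_def k_def by auto
  have D: "C * B \<in> carrier_mat k k" using B C by auto
  have "E = B * (C * B) * C"
    using E(2) B C by (simp add: EBC assoc_mult_mat[of _ d k _ k _ d] assoc_mult_mat[of _ k d _ k _ d] assoc_mult_mat[of _ d k _ d _ d])
  note E3 = this
  have "det (C * B) \<noteq> 0"
  proof
    assume "det (C * B) = 0"
    from singular_mat_factors[OF D this] obtain k' D1 D2 where
      k: "k' < k" "D1 \<in> carrier_mat k k'" "D2 \<in> carrier_mat k' k" "C * B = D1 * D2" .
    have "E = (B * D1) * (D2 * C)"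
      using E3 k B C by (simp add: assoc_mult_mat[of _ d k _ k' _ d] assoc_mult_mat[of _ d k _ k' _ k] assoc_mult_mat[of _ d k' _ k _ d] assoc_mult_mat[of _ k k' _ k _ d] assoc_mult_mat[of _ d k _ k _ d])
    then have "P k'" unfolding P_def using k B C
      by (intro bexI[of _ "B * D1"] bexI[of _ "D2 * C"]) auto
    then show False using k(1) not_less_Least unfolding k_def by blast
  qed
  then obtain X where X: "X \<in> carrier_mat k k" "C * B * X = 1\<^sub>m k" "X * (C * B) = 1\<^sub>m k"
    using nonsingular_inverse[OF D] by blast
  let ?D = "C * B"
  have "?D * ?D * ?D = ?D * ?D"
  proof -
    have "?D * ?D * ?D = C * (B * (C * B) * C) * B"
      using B C D by (simp add: assoc_mult_mat[of _ k d _ k _ k] assoc_mult_mat[of _ k k _ k _ k] assoc_mult_mat[of _ d k _ k _ d] assoc_mult_mat[of _ d k _ d _ k] assoc_mult_mat[of _ k d _ d _ k] assoc_mult_mat[of _ d k _ k _ k] assoc_mult_mat[of _ k d _ k _ d] assoc_mult_mat[of _ k k _ d _ k])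
    also have "\<dots> = C * (B * C) * B" by (simp only: E3[symmetric] EBC[symmetric])
    also have "\<dots> = ?D * ?D"
      using B C D by (simp add: assoc_mult_mat[of _ k d _ k _ k] assoc_mult_mat[of _ d k _ d _ k] assoc_mult_mat[of _ k d _ d _ k] assoc_mult_mat[of _ d k _ k _ k])
    finally show ?thesis .
  qed
  then have "X * (X * (?D * ?D * ?D)) = X * (X * (?D * ?D))" by simp
  moreover have "X * (X * (?D * ?D)) = 1\<^sub>m k" 
    using assoc_mult_mat[OF X(1) D D] X(3) left_mult_one_mat[OF D] by simp
  moreover have "X * (X * (?D * ?D * ?D)) = ?D"
  proof -
    have DD: "?D * ?D \<in> carrier_mat k k" using D by auto
    have "X * (?D * ?D * ?D) = X * ?D * ?D * ?D"
      using assoc_mult_mat[OF X(1) DD D] assoc_mult_mat[OF X(1) D D] by simp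
    also have "\<dots> = ?D * ?D" by (simp only: X(3) left_mult_one_mat[OF D])
    finally have "X * (X * (?D * ?D * ?D)) = X * ?D * ?D" using assoc_mult_mat[OF X(1) D D] by simp
    also have "\<dots> = ?D" by (simp only: X(3) left_mult_one_mat[OF D])
    finally show ?thesis .
  qed
  ultimately show thesis using that[OF B C EBC] by simp
qed

section \<open>Powers by repeated squaring and their group inverses\<close>

text \<open>\<open>sqpow i A\<close> is \<open>A\<close> to the power \<open>2 ^ i\<close>. Squaring
  is the only step needed, both to lower the inner dimension of a factorization and to express
  nilpotency.\<close>

definition sqpow :: "nat \<Rightarrow> 'a::field mat \<Rightarrow> 'a mat" where
  "sqpow i A = ((\<lambda>X. X * X) ^^ i) A"

lemma sqpow_Suc: "sqpow (Suc i) A = sqpow i A * sqpow i A"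
  by (simp add: sqpow_def)

lemma sqpow_Suc': "sqpow (Suc i) A = sqpow i (A * A)"
  by (simp add: sqpow_def funpow_Suc_right del: funpow.simps)

lemma mat_mult4:
  assumes "B \<in> carrier_mat d k" "X \<in> carrier_mat k l" "Y \<in> carrier_mat l m" "Z \<in> carrier_mat m o'"
  shows "(B * X) * (Y * Z) = B * (X * Y) * Z"
proof -
  have "B * X * (Y * Z) = B * (X * (Y * Z))" using assms by (intro assoc_mult_mat) auto
  also have "X * (Y * Z) = X * Y * Z" using assms by (intro assoc_mult_mat[symmetric]) auto
  also have "B * (X * Y * Z) = B * (X * Y) * Z" using assms by (intro assoc_mult_mat[symmetric]) auto
  finally show ?thesis .
qed

text \<open>A power of a square matrix always has a group inverse \<open>X\<close>; the induced idempotent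
  commutes with everything that commutes with the matrix.\<close>

lemma power_group_inverse:
  fixes A :: "'a::field mat"
  assumes A: "A \<in> carrier_mat d d"
  obtains i X where "X \<in> carrier_mat d d" "sqpow i A * X = X * sqpow i A"
    "sqpow i A * X * sqpow i A = sqpow i A" "X * sqpow i A * X = X"
proof -
  define P where "P k \<longleftrightarrow> (\<exists>i. \<exists>B\<in>carrier_mat d k. \<exists>C\<in>carrier_mat k d. sqpow i A = B * C)" for k
  have "P d" unfolding P_def using A
    by (intro exI[of _ 0] bexI[of _ A] bexI[of _ "1\<^sub>m d"]) (auto simp: sqpow_def)
  then have P: "P (LEAST k. P k)" by (rule LeastI)
  define k where "k = (LEAST k. P k)"
  from P obtain i B C where B: "B \<in> carrier_mat d k" and C: "C \<in> carrier_mat k d"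
    and T: "sqpow i A = B * C"
    unfolding P_def k_def by auto
  have D: "C * B \<in> carrier_mat k k" using B C by auto
  \<comment> \<open>\<open>k\<close> is least over all these powers at once, so squaring again,
    which puts \<open>C * B\<close> in the middle, cannot lower it.\<close>
  have "det (C * B) \<noteq> 0"
  proof
    assume "det (C * B) = 0"
    from singular_mat_factors[OF D this] obtain k' D1 D2 where
      k: "k' < k" "D1 \<in> carrier_mat k k'" "D2 \<in> carrier_mat k' k" "C * B = D1 * D2" .
    have "sqpow (Suc i) A = B * (D1 * D2) * C"
      using T B C k mat_mult4[OF B C B C] by (simp add: sqpow_Suc)
    also have "\<dots> = (B * D1) * (D2 * C)"
      using mat_mult4[OF B k(2,3) C] by simp
    finally have "P k'" unfolding P_def using k B C
      by (intro exI[of _ "Suc i"] bexI[of _ "B * D1"] bexI[of _ "D2 * C"]) auto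
    then show False using k(1) not_less_Least unfolding k_def by blast
  qed
  then obtain Y where Y: "Y \<in> carrier_mat k k" "C * B * Y = 1\<^sub>m k" "Y * (C * B) = 1\<^sub>m k"
    using nonsingular_inverse[OF D] by blast
  \<comment> \<open>With \<open>Y\<close> inverse to \<open>C * B\<close>, this \<open>X\<close>
    inverts \<open>B * C\<close> on the image of \<open>B\<close> and vanishes on the kernel of
    \<open>C\<close>.\<close>
  define X where "X = B * (Y * Y) * C"
  have YY: "Y * Y \<in> carrier_mat k k" using Y by auto
  have TX: "sqpow i A * X = B * Y * C"
  proof -
    have "sqpow i A * X = (B * C) * ((B * (Y * Y)) * C)" by (simp add: T X_def)
    also have "\<dots> = B * (C * (B * (Y * Y))) * C"
      using mat_mult4[OF B C _ C, of "B * (Y * Y)"] B YY by simp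
    also have "C * (B * (Y * Y)) = (C * B) * Y * Y"
    by (simp only: assoc_mult_mat[OF C B YY] assoc_mult_mat[OF D Y(1) Y(1)])
    finally show ?thesis using Y by simp
  qed
  have XT: "X * sqpow i A = B * Y * C"
  proof -
    have "X * sqpow i A = (B * (Y * Y) * C) * (B * C)" by (simp add: T X_def)
    also have "\<dots> = B * (Y * Y) * (C * B) * C"
      using mat_mult4[OF _ C B C, of "B * (Y * Y)" d] B YY by simp
    also have "B * (Y * Y) * (C * B) = B * (Y * (Y * (C * B)))"
      using B Y D by (simp add: assoc_mult_mat[of _ d k _ k _ k] assoc_mult_mat[of _ k k _ k _ k])
    finally show ?thesis using Y by simp
  qed
  have BY: "B * Y \<in> carrier_mat d k" using B Y by auto
  have "sqpow i A * X * sqpow i A = (B * Y * C) * (B * C)" by (simp only: TX) (simp only: T)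
  also have "\<dots> = (B * Y) * (C * B) * C" using mat_mult4[OF BY C B C] .
  also have "(B * Y) * (C * B) = B" using B Y D by (simp add: assoc_mult_mat[of _ d k _ k _ k])
  finally have 1: "sqpow i A * X * sqpow i A = sqpow i A" by (simp add: T)
  have "X * sqpow i A * X = (B * Y * C) * (B * (Y * Y) * C)" by (simp only: XT) (simp only: X_def)
  also have "\<dots> = (B * Y) * (C * (B * (Y * Y))) * C" using mat_mult4[OF BY C _ C, of "B * (Y*Y)"] B YY by simp
  also have "C * (B * (Y * Y)) = (C * B) * Y * Y"
    by (simp only: assoc_mult_mat[OF C B YY] assoc_mult_mat[OF D Y(1) Y(1)])
  also have "(B * Y) * (C * B * Y * Y) = B * (Y * Y)" using B Y by (simp add: assoc_mult_mat[of _ d k _ k _ k])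
  finally have 2: "X * sqpow i A * X = X" by (simp add: X_def)
  show thesis using that[of X i] 1 2 TX XT B C YY by (auto simp: X_def)
qed

text \<open>\<open>R\<close> preserves image and kernel of \<open>T\<close>, onto which
  \<open>E = T X\<close> splits the space; in matrices, both sides equal
  \<open>E R E\<close>.\<close>

lemma group_inverse_idempotent_commutes:
  fixes T :: "'a::field mat"
  assumes c: "T \<in> carrier_mat d d" "X \<in> carrier_mat d d" "R \<in> carrier_mat d d"
    and TX: "T * X = X * T" and TXT: "T * X * T = T" and RT: "R * T = T * R"
  shows "R * (T * X) = (T * X) * R"
proof -
  have E: "T * X \<in> carrier_mat d d" using c by auto
  note a = assoc_mult_mat[of _ d d _ d _ d]
  have "T * X * R = X * (T * R)" using c by (simp add: TX a)
  also have "\<dots> = X * (R * (T * X * T))" by (simp only: TXT RT[symmetric])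
  also have "\<dots> = X * ((R * T) * (X * T))" using c by (simp add: a)
  also have "\<dots> = (X * T) * (R * (X * T))" unfolding RT using c by (simp add: a)
  also have "\<dots> = (T * X) * (R * (T * X))" using TX by simp
  finally have 1: "T * X * R = (T * X) * (R * (T * X))" .
  have "R * (T * X) = (R * T) * X" using c by (simp add: a)
  also have "\<dots> = (T * X * T) * R * X" using TXT RT by simp
  also have "\<dots> = (T * X) * ((T * R) * X)" using c by (simp add: a)
  also have "\<dots> = (T * X) * (R * (T * X))" unfolding RT[symmetric] using c by (simp add: a)
  finally show ?thesis using 1 by simp
qed

text \<open>Padding the two factors by zeros to size \<open>r\<close> makes them square, so that a
  one-sided inverse is two-sided; but for \<open>k < r\<close> the reversed product has a zero at
  \<open>(k, k)\<close>.\<close>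

lemma dual_system_le:
  fixes A B :: "nat \<Rightarrow> nat \<Rightarrow> 'a::field"
  assumes "\<And>i j. i < r \<Longrightarrow> j < r \<Longrightarrow> (\<Sum>l<k. A l i * B l j) = (if i = j then 1 else 0)"
  shows "r \<le> k"
proof (rule ccontr)
  assume "\<not> r \<le> k"
  then have kr: "k < r" by simp
  define P where "P = mat r r (\<lambda>(i, l). if l < k then A l i else 0)"
  define Q where "Q = mat r r (\<lambda>(l, j). if l < k then B l j else 0)"
  have "P * Q = 1\<^sub>m r"
  proof (rule eq_matI)
    fix i j assume "i < dim_row (1\<^sub>m r :: 'a mat)" "j < dim_col (1\<^sub>m r :: 'a mat)"
    then have ij: "i < r" "j < r" by auto
    have "(P * Q) $$ (i, j) = (\<Sum>l\<in>{0..<r}. (if l < k then A l i else 0) * (if l < k then B l j else 0))"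
      using ij by (simp add: P_def Q_def scalar_prod_def)
    also have "\<dots> = (\<Sum>l<k. A l i * B l j)"
      using kr by (intro sum.mono_neutral_cong_right) auto
    finally show "(P * Q) $$ (i, j) = 1\<^sub>m r $$ (i, j)" using assms ij by simp
  qed (auto simp: P_def Q_def)
  then have "Q * P = 1\<^sub>m r"
    by (intro mat_mult_left_right_inverse[of P r Q]) (auto simp: P_def Q_def)
  then have "(Q * P) $$ (k, k) = 1" using kr by simp
  moreover have "(Q * P) $$ (k, k) = 0" using kr by (simp add: P_def Q_def scalar_prod_def)
  ultimately show False by simp
qed

section \<open>Homomorphisms of matrix representations\<close>

definition rhom :: "nat \<Rightarrow> 'a::field rep \<Rightarrow> 'a rep \<Rightarrow> 'a mat set" where
  "rhom n M N = {P \<in> carrier_mat (fst N) (fst M). \<forall>g\<in>Sn n. P * snd M g = snd N g * P}"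

lemma rhom_carrier: "P \<in> rhom n M N \<Longrightarrow> P \<in> carrier_mat (fst N) (fst M)"
  by (simp add: rhom_def)

lemma rep_carrier: "is_rep n M \<Longrightarrow> g \<in> Sn n \<Longrightarrow> snd M g \<in> carrier_mat (fst M) (fst M)"
  by (auto simp: is_rep_def split: prod.splits)

lemma rhom_eq: "P \<in> rhom n M N \<Longrightarrow> g \<in> Sn n \<Longrightarrow> P * snd M g = snd N g * P"
  by (simp add: rhom_def)

lemma rhom_mult:
  assumes "is_rep n M" "is_rep n N" "is_rep n K" "P \<in> rhom n M N" "Q \<in> rhom n N K"
  shows "Q * P \<in> rhom n M K"
proof -
  have "Q * P * snd M g = snd K g * (Q * P)" if g: "g \<in> Sn n" for g
  proof -
    note c = rep_carrier[OF assms(1) g] rep_carrier[OF assms(2) g] rep_carrier[OF assms(3) g]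
      rhom_carrier[OF assms(4)] rhom_carrier[OF assms(5)]
    have "Q * P * snd M g = Q * (P * snd M g)" using c by (intro assoc_mult_mat) auto
    also have "\<dots> = Q * (snd N g * P)" by (simp only: rhom_eq[OF assms(4) g])
    also have "\<dots> = Q * snd N g * P" using c by (intro assoc_mult_mat[symmetric]) auto
    also have "\<dots> = snd K g * Q * P" by (simp only: rhom_eq[OF assms(5) g])
    also have "\<dots> = snd K g * (Q * P)" using c by (intro assoc_mult_mat) auto
    finally show ?thesis .
  qed
  then show ?thesis using rhom_carrier[OF assms(4)] rhom_carrier[OF assms(5)] by (auto simp: rhom_def)
qed

lemma rhom_add:
  assumes "is_rep n M" "is_rep n N" "P \<in> rhom n M N" "Q \<in> rhom n M N"
  shows "P + Q \<in> rhom n M N"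
  using assms rep_carrier[OF assms(1)] rep_carrier[OF assms(2)]
  by (auto simp: rhom_def add_mult_distrib_mat[where nc="fst M" and nr="fst N" and n="fst M"] mult_add_distrib_mat[where nc="fst M" and nr="fst N" and n="fst N"])

lemma rhom_minus:
  assumes "is_rep n M" "is_rep n N" "P \<in> rhom n M N" "Q \<in> rhom n M N"
  shows "P - Q \<in> rhom n M N"
  using assms rep_carrier[OF assms(1)] rep_carrier[OF assms(2)]
  by (auto simp: rhom_def minus_mult_distrib_mat[where nc="fst M" and nr="fst N" and n="fst M"] mult_minus_distrib_mat[where nc="fst M" and nr="fst N" and n="fst N"])

lemma rhom_smult:
  assumes "is_rep n M" "is_rep n N" "P \<in> rhom n M N"
  shows "a \<cdot>\<^sub>m P \<in> rhom n M N"
  using assms rep_carrier[OF assms(1)] rep_carrier[OF assms(2)]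
  by (auto simp: rhom_def mult_smult_assoc_mat[where nr="fst N" and n="fst M" and nc="fst M"] mult_smult_distrib[where nr="fst N" and n="fst N" and nc="fst M"])

lemma rhom_zero: "is_rep n M \<Longrightarrow> is_rep n N \<Longrightarrow> 0\<^sub>m (fst N) (fst M) \<in> rhom n M N"
  by (auto simp: rhom_def left_mult_zero_mat[OF rep_carrier] right_mult_zero_mat[OF rep_carrier])

lemma rhom_one: "is_rep n M \<Longrightarrow> 1\<^sub>m (fst M) \<in> rhom n M M"
  by (auto simp: rhom_def left_mult_one_mat[OF rep_carrier] right_mult_one_mat[OF rep_carrier])

lemma rep_isoI:
  assumes "P \<in> rhom n M N" "Q \<in> rhom n N M" "P * Q = 1\<^sub>m (fst N)" "Q * P = 1\<^sub>m (fst M)"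
    and "fst M = fst N"
  shows "rep_iso n M N"
proof -
  have "invertible_mat P"
    using assms rhom_carrier[OF assms(1)] rhom_carrier[OF assms(2)]
    unfolding invertible_mat_def inverts_mat_def by (intro conjI exI[of _ Q]) auto
  then show ?thesis using assms unfolding rep_iso_def rhom_def by (auto split: prod.splits)
qed

lemma rep_isoE:
  assumes "rep_iso n M N" "is_rep n M" "is_rep n N"
  obtains P Q where "P \<in> rhom n M N" "Q \<in> rhom n N M" "P * Q = 1\<^sub>m (fst N)" "Q * P = 1\<^sub>m (fst M)" "fst M = fst N"
proof -
  define d where "d = fst M"
  from assms(1) have e: "fst N = d" by (auto simp: rep_iso_def d_def split: prod.splits)
  from assms(1) obtain P where P: "P \<in> carrier_mat d d" "invertible_mat P" "\<forall>g\<in>Sn n. P * snd M g = snd N g * P"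
    by (auto simp: rep_iso_def d_def split: prod.splits)
  from P(2) obtain Q where Q: "P * Q = 1\<^sub>m d" "Q * P = 1\<^sub>m (dim_row Q)"
    using P(1) by (auto simp: invertible_mat_def inverts_mat_def)
  have "dim_col Q = d" using Q(1) by (metis index_mult_mat(3) index_one_mat(3))
  moreover have "dim_row Q = d" using Q(2) P(1) by (metis carrier_matD(2) index_mult_mat(3) index_one_mat(3))
  ultimately have Qc: "Q \<in> carrier_mat d d" by auto
  have "Q * snd N g = snd M g * Q" if g: "g \<in> Sn n" for g
  proof -
    have c: "snd M g \<in> carrier_mat d d" "snd N g \<in> carrier_mat d d"
      using rep_carrier[OF assms(2) g] rep_carrier[OF assms(3) g] e d_def by auto
    have "Q * snd N g = Q * (snd N g * (P * Q))" using c Q by simp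
    also have "\<dots> = Q * ((snd N g * P) * Q)" using c P(1) Qc by (simp add: assoc_mult_mat[of _ d d _ d _ d])
    also have "\<dots> = Q * ((P * snd M g) * Q)" using P(3) g by simp
    also have "\<dots> = (Q * P) * (snd M g * Q)" using c P(1) Qc by (simp add: assoc_mult_mat[of _ d d _ d _ d])
    also have "\<dots> = snd M g * Q" using Q c Qc by simp
    finally show ?thesis .
  qed
  then have "Q \<in> rhom n N M" using Qc e d_def by (auto simp: rhom_def)
  moreover have "P \<in> rhom n M N" using P e d_def by (auto simp: rhom_def)
  moreover have "P * Q = 1\<^sub>m (fst N)" by (simp only: Q(1) e)
  moreover have "Q * P = 1\<^sub>m (fst M)" using Qc by (simp only: Q(2) carrier_matD d_def[symmetric])
  moreover have "fst M = fst N" by (simp only: e d_def)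
  ultimately show thesis using that[of P Q] by blast
qed

section \<open>Direct sums as biproducts\<close>

definition inj1 :: "nat \<Rightarrow> nat \<Rightarrow> 'a::field mat" where
  "inj1 d e = mat (d + e) d (\<lambda>(i, j). if i = j then 1 else 0)"
definition inj2 :: "nat \<Rightarrow> nat \<Rightarrow> 'a::field mat" where
  "inj2 d e = mat (d + e) e (\<lambda>(i, j). if i = j + d then 1 else 0)"
definition prj1 :: "nat \<Rightarrow> nat \<Rightarrow> 'a::field mat" where
  "prj1 d e = mat d (d + e) (\<lambda>(i, j). if i = j then 1 else 0)"
definition prj2 :: "nat \<Rightarrow> nat \<Rightarrow> 'a::field mat" where
  "prj2 d e = mat e (d + e) (\<lambda>(i, j). if i + d = j then 1 else 0)"

lemma inj_prj_carrier:
  "(inj1 d e :: 'a::field mat) \<in> carrier_mat (d + e) d" "(inj2 d e :: 'a mat) \<in> carrier_mat (d + e) e"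
  "(prj1 d e :: 'a mat) \<in> carrier_mat d (d + e)" "(prj2 d e :: 'a mat) \<in> carrier_mat e (d + e)"
  by (auto simp: inj1_def inj2_def prj1_def prj2_def)

lemma delta_mult: "(if P then 1 else 0) * (x::'a::field) = (if P then x else 0)"
  "x * (if P then 1 else 0) = (if P then x else 0)" by auto

lemma inj_prj_eqs:
  "prj1 d e * inj1 d e = (1\<^sub>m d :: 'a::field mat)" "prj2 d e * inj2 d e = (1\<^sub>m e :: 'a mat)"
  "prj1 d e * inj2 d e = (0\<^sub>m d e :: 'a mat)" "prj2 d e * inj1 d e = (0\<^sub>m e d :: 'a mat)"
  "inj1 d e * prj1 d e + inj2 d e * prj2 d e = (1\<^sub>m (d + e) :: 'a mat)"
proof -
  show "prj1 d e * inj1 d e = (1\<^sub>m d :: 'a mat)" "prj2 d e * inj2 d e = (1\<^sub>m e :: 'a mat)"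
  "prj1 d e * inj2 d e = (0\<^sub>m d e :: 'a mat)" "prj2 d e * inj1 d e = (0\<^sub>m e d :: 'a mat)"
    by (rule eq_matI, auto simp: inj1_def inj2_def prj1_def prj2_def scalar_prod_def delta_mult sum.delta)+
  show "inj1 d e * prj1 d e + inj2 d e * prj2 d e = (1\<^sub>m (d + e) :: 'a mat)"
  proof (rule eq_matI)
    fix i j assume "i < dim_row (1\<^sub>m (d + e) :: 'a mat)" "j < dim_col (1\<^sub>m (d + e) :: 'a mat)"
    then have ij: "i < d + e" "j < d + e" by auto
    have 1: "(inj1 d e * prj1 d e) $$ (i, j) = (if i = j \<and> i < d then 1 else 0 :: 'a)"
      using ij by (auto simp: inj1_def prj1_def scalar_prod_def delta_mult sum.delta)
    have "(inj2 d e * prj2 d e) $$ (i, j) = (\<Sum>k\<in>{0..<e}. if i = k + d then if k + d = j then 1 else 0 else 0 :: 'a)"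
      using ij by (auto simp: inj2_def prj2_def scalar_prod_def delta_mult intro!: sum.cong)
    also have "\<dots> = (\<Sum>k\<in>{0..<e}. if k = i - d then if d \<le> i \<and> i = j then 1 else 0 else 0)"
      by (intro sum.cong) auto
    also have "\<dots> = (if i = j \<and> d \<le> i then 1 else 0)" using ij by (subst sum.delta) auto
    finally have 2: "(inj2 d e * prj2 d e) $$ (i, j) = (if i = j \<and> d \<le> i then 1 else 0 :: 'a)" .
    show "(inj1 d e * prj1 d e + inj2 d e * prj2 d e) $$ (i, j) = (1\<^sub>m (d + e) :: 'a mat) $$ (i, j)"
      using 1 2 ij by (subst index_add_mat(1)) (auto simp: inj2_def prj2_def)
  qed (auto simp: inj2_def prj2_def)
qed

lemma four_block_inj_prj:
  assumes "A \<in> carrier_mat d d" "B \<in> carrier_mat e e"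
  shows "four_block_mat A (0\<^sub>m d e) (0\<^sub>m e d) B * inj1 d e = inj1 d e * A"
    "four_block_mat A (0\<^sub>m d e) (0\<^sub>m e d) B * inj2 d e = inj2 d e * B"
    "prj1 d e * four_block_mat A (0\<^sub>m d e) (0\<^sub>m e d) B = A * prj1 d e"
    "prj2 d e * four_block_mat A (0\<^sub>m d e) (0\<^sub>m e d) B = B * prj2 d e"
proof -
  have dim: "dim_row A = d" "dim_col A = d" "dim_row B = e" "dim_col B = e" using assms by auto
  show "four_block_mat A (0\<^sub>m d e) (0\<^sub>m e d) B * inj1 d e = inj1 d e * A"
    by (rule eq_matI) (auto simp: inj1_def scalar_prod_def delta_mult sum.delta dim)
  show "prj1 d e * four_block_mat A (0\<^sub>m d e) (0\<^sub>m e d) B = A * prj1 d e"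
    by (rule eq_matI) (auto simp: prj1_def scalar_prod_def delta_mult sum.delta dim)
  have s: "(\<Sum>k = 0..<e. if i = k + d then f k else 0) = (if d \<le> i \<and> i < d + e then f (i - d) else 0)"
    for i and f :: "nat \<Rightarrow> 'a"
  proof -
    have "(\<Sum>k = 0..<e. if i = k + d then f k else 0) = (\<Sum>k = 0..<e. if k = i - d then if d \<le> i then f (i - d) else 0 else 0)"
      by (intro sum.cong) auto
    also have "\<dots> = (if d \<le> i \<and> i < d + e then f (i - d) else 0)" by (subst sum.delta) auto
    finally show ?thesis .
  qed
  have s': "(\<Sum>k = 0..<e. if k + d = i then f k else 0) = (if d \<le> i \<and> i < d + e then f (i - d) else 0)"
    for i and f :: "nat \<Rightarrow> 'a"
    unfolding s[of i f, symmetric] by (intro sum.cong) auto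
  show "four_block_mat A (0\<^sub>m d e) (0\<^sub>m e d) B * inj2 d e = inj2 d e * B"
    by (rule eq_matI) (auto simp: inj2_def scalar_prod_def delta_mult sum.delta dim s)
  show "prj2 d e * four_block_mat A (0\<^sub>m d e) (0\<^sub>m e d) B = B * prj2 d e"
    by (rule eq_matI) (auto simp: prj2_def scalar_prod_def delta_mult sum.delta dim s')
qed

lemma fst_dsum: "fst (dsum A B) = fst A + fst B"
  by (auto simp: dsum_def split: prod.splits)

lemma snd_dsum: "snd (dsum A B) g = four_block_mat (snd A g) (0\<^sub>m (fst A) (fst B)) (0\<^sub>m (fst B) (fst A)) (snd B g)"
  by (auto simp: dsum_def split: prod.splits)

lemma is_repI:
  assumes "\<And>g. g \<in> Sn n \<Longrightarrow> snd M g \<in> carrier_mat (fst M) (fst M)" "snd M id = 1\<^sub>m (fst M)"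
    "\<And>g h. g \<in> Sn n \<Longrightarrow> h \<in> Sn n \<Longrightarrow> snd M (g \<circ> h) = snd M g * snd M h"
  shows "is_rep n M"
  using assms by (auto simp: is_rep_def split: prod.splits)

lemma rep_id: "is_rep n M \<Longrightarrow> snd M id = 1\<^sub>m (fst M)"
  by (auto simp: is_rep_def split: prod.splits)

lemma rep_comp: "is_rep n M \<Longrightarrow> g \<in> Sn n \<Longrightarrow> h \<in> Sn n \<Longrightarrow> snd M (g \<circ> h) = snd M g * snd M h"
  by (auto simp: is_rep_def split: prod.splits)

lemma is_rep_dsum: assumes "is_rep n A" "is_rep n B" shows "is_rep n (dsum A B)"
proof (rule is_repI)
  fix g assume g: "g \<in> Sn n"
  show "snd (dsum A B) g \<in> carrier_mat (fst (dsum A B)) (fst (dsum A B))"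
    using rep_carrier[OF assms(1) g] rep_carrier[OF assms(2) g] by (auto simp: fst_dsum snd_dsum)
next
  show "snd (dsum A B) id = 1\<^sub>m (fst (dsum A B))"
    using rep_id[OF assms(1)] rep_id[OF assms(2)] by (simp add: fst_dsum snd_dsum)
next
  fix g h assume g: "g \<in> Sn n" and h: "h \<in> Sn n"
  note c = rep_carrier[OF assms(1) g] rep_carrier[OF assms(2) g] rep_carrier[OF assms(1) h] rep_carrier[OF assms(2) h]
  show "snd (dsum A B) (g \<circ> h) = snd (dsum A B) g * snd (dsum A B) h"
    unfolding snd_dsum rep_comp[OF assms(1) g h] rep_comp[OF assms(2) g h]
    by (subst mult_four_block_mat[OF c(1) _ _ c(2) c(3) _ _ c(4)]) (use c in auto)
qed

lemma dsum_homs: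
  assumes "is_rep n A" "is_rep n B"
  shows "inj1 (fst A) (fst B) \<in> rhom n A (dsum A B)" "inj2 (fst A) (fst B) \<in> rhom n B (dsum A B)"
    "prj1 (fst A) (fst B) \<in> rhom n (dsum A B) A" "prj2 (fst A) (fst B) \<in> rhom n (dsum A B) B"
  using rep_carrier[OF assms(1)] rep_carrier[OF assms(2)]
  by (auto simp: rhom_def fst_dsum snd_dsum inj_prj_carrier four_block_inj_prj)

lemma left_inverse_dim_le:
  fixes U V :: "'a::field mat"
  assumes "U \<in> carrier_mat m k" "V \<in> carrier_mat k m" "U * V = 1\<^sub>m m"
  shows "m \<le> k"
proof (rule dual_system_le[where A = "\<lambda>l i. U $$ (i, l)" and B = "\<lambda>l j. V $$ (l, j)"])
  fix i j assume ij: "i < m" "j < m"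
  have "(\<Sum>l<k. U $$ (i, l) * V $$ (l, j)) = (U * V) $$ (i, j)"
    using ij assms(1,2) by (simp add: scalar_prod_def atLeast0LessThan)
  then show "(\<Sum>l<k. U $$ (i, l) * V $$ (l, j)) = (if i = j then 1 else 0)"
    using ij by (simp add: assms(3))
qed

text \<open>The maps into and out of \<open>X\<close> are glued by the matrix injections and
  projections; the five identities make the glued maps mutually inverse.\<close>

lemma biproduct_iso:
  assumes r: "is_rep n X" "is_rep n A" "is_rep n B"
    and h: "P1 \<in> rhom n A X" "Q1 \<in> rhom n X A" "R2 \<in> rhom n B X" "Q2 \<in> rhom n X B"
    and e: "Q1 * P1 = 1\<^sub>m (fst A)" "Q2 * R2 = 1\<^sub>m (fst B)" "Q1 * R2 = 0\<^sub>m (fst A) (fst B)" "Q2 * P1 = 0\<^sub>m (fst B) (fst A)"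
      "P1 * Q1 + R2 * Q2 = 1\<^sub>m (fst X)"
  shows "rep_iso n X (dsum A B)"
proof -
  let ?a = "fst A" and ?b = "fst B" and ?x = "fst X"
  let ?U = "inj1 ?a ?b * Q1 + inj2 ?a ?b * Q2" and ?V = "P1 * prj1 ?a ?b + R2 * prj2 ?a ?b"
  note r' = is_rep_dsum[OF r(2,3)]
  note d = dsum_homs[OF r(2,3)]
  note c = rhom_carrier[OF h(1)] rhom_carrier[OF h(2)] rhom_carrier[OF h(3)] rhom_carrier[OF h(4)]
    inj_prj_carrier[of ?a ?b]
  have U: "?U \<in> rhom n X (dsum A B)" by (intro rhom_add rhom_mult[OF r(1) r(2)] rhom_mult[OF r(1) r(3)] r r' d h)
  have V: "?V \<in> rhom n (dsum A B) X" by (intro rhom_add rhom_mult[OF r' r(2)] rhom_mult[OF r' r(3)] r r' d h)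
  have "?U * ?V = inj1 ?a ?b * Q1 * ?V + inj2 ?a ?b * Q2 * ?V"
    by (intro add_mult_distrib_mat[where nr = "?a + ?b" and n = ?x and nc = "?a + ?b"]) (use c in \<open>auto intro!: mult_carrier_mat add_carrier_mat\<close>)
  also have "inj1 ?a ?b * Q1 * ?V = inj1 ?a ?b * Q1 * (P1 * prj1 ?a ?b) + inj1 ?a ?b * Q1 * (R2 * prj2 ?a ?b)"
    by (intro mult_add_distrib_mat[where nr = "?a + ?b" and n = ?x and nc = "?a + ?b"]) (use c in \<open>auto intro!: mult_carrier_mat\<close>)
  also have "inj2 ?a ?b * Q2 * ?V = inj2 ?a ?b * Q2 * (P1 * prj1 ?a ?b) + inj2 ?a ?b * Q2 * (R2 * prj2 ?a ?b)"
    by (intro mult_add_distrib_mat[where nr = "?a + ?b" and n = ?x and nc = "?a + ?b"]) (use c in \<open>auto intro!: mult_carrier_mat\<close>)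
  also have "inj1 ?a ?b * Q1 * (P1 * prj1 ?a ?b) = inj1 ?a ?b * prj1 ?a ?b"
    unfolding mat_mult4[OF c(5) c(2) c(1) c(7)] e right_mult_one_mat[OF c(5)] ..
  also have "inj1 ?a ?b * Q1 * (R2 * prj2 ?a ?b) = 0\<^sub>m (?a + ?b) (?a + ?b)"
    unfolding mat_mult4[OF c(5) c(2) c(3) c(8)] e right_mult_zero_mat[OF c(5)] left_mult_zero_mat[OF c(8)] ..
  also have "inj2 ?a ?b * Q2 * (P1 * prj1 ?a ?b) = 0\<^sub>m (?a + ?b) (?a + ?b)"
    unfolding mat_mult4[OF c(6) c(4) c(1) c(7)] e right_mult_zero_mat[OF c(6)] left_mult_zero_mat[OF c(7)] ..
  also have "inj2 ?a ?b * Q2 * (R2 * prj2 ?a ?b) = inj2 ?a ?b * prj2 ?a ?b"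
    unfolding mat_mult4[OF c(6) c(4) c(3) c(8)] e right_mult_one_mat[OF c(6)] ..
  finally have UV: "?U * ?V = 1\<^sub>m (?a + ?b)"
    unfolding right_add_zero_mat[OF mult_carrier_mat[OF c(5,7)]] left_add_zero_mat[OF mult_carrier_mat[OF c(6,8)]] inj_prj_eqs .
  have "?V * ?U = P1 * prj1 ?a ?b * ?U + R2 * prj2 ?a ?b * ?U"
    by (intro add_mult_distrib_mat[where nr = ?x and n = "?a + ?b" and nc = ?x]) (use c in \<open>auto intro!: mult_carrier_mat add_carrier_mat\<close>)
  also have "P1 * prj1 ?a ?b * ?U = P1 * prj1 ?a ?b * (inj1 ?a ?b * Q1) + P1 * prj1 ?a ?b * (inj2 ?a ?b * Q2)"
    by (intro mult_add_distrib_mat[where nr = ?x and n = "?a + ?b" and nc = ?x]) (use c in \<open>auto intro!: mult_carrier_mat\<close>)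
  also have "R2 * prj2 ?a ?b * ?U = R2 * prj2 ?a ?b * (inj1 ?a ?b * Q1) + R2 * prj2 ?a ?b * (inj2 ?a ?b * Q2)"
    by (intro mult_add_distrib_mat[where nr = ?x and n = "?a + ?b" and nc = ?x]) (use c in \<open>auto intro!: mult_carrier_mat\<close>)
  also have "P1 * prj1 ?a ?b * (inj1 ?a ?b * Q1) = P1 * Q1"
    unfolding mat_mult4[OF c(1) c(7) c(5) c(2)] inj_prj_eqs right_mult_one_mat[OF c(1)] ..
  also have "P1 * prj1 ?a ?b * (inj2 ?a ?b * Q2) = 0\<^sub>m ?x ?x"
    unfolding mat_mult4[OF c(1) c(7) c(6) c(4)] inj_prj_eqs right_mult_zero_mat[OF c(1)] left_mult_zero_mat[OF c(4)] ..
  also have "R2 * prj2 ?a ?b * (inj1 ?a ?b * Q1) = 0\<^sub>m ?x ?x"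
    unfolding mat_mult4[OF c(3) c(8) c(5) c(2)] inj_prj_eqs right_mult_zero_mat[OF c(3)] left_mult_zero_mat[OF c(2)] ..
  also have "R2 * prj2 ?a ?b * (inj2 ?a ?b * Q2) = R2 * Q2"
    unfolding mat_mult4[OF c(3) c(8) c(6) c(4)] inj_prj_eqs right_mult_one_mat[OF c(3)] ..
  finally have VU: "?V * ?U = 1\<^sub>m ?x"
    unfolding right_add_zero_mat[OF mult_carrier_mat[OF c(1,2)]] left_add_zero_mat[OF mult_carrier_mat[OF c(3,4)]] e .
  \<comment> \<open>\<open>rep_iso\<close> asks for equal dimensions; they follow from the two
    one-sided inverses.\<close>
  have "?a + ?b \<le> ?x" "?x \<le> ?a + ?b"
    using left_inverse_dim_le[OF _ _ UV] left_inverse_dim_le[OF _ _ VU] rhom_carrier[OF U] rhom_carrier[OF V]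
    unfolding fst_dsum by blast+
  then have d: "?x = ?a + ?b" by (rule antisym[rotated])
  show ?thesis by (rule rep_isoI[OF U V], simp only: UV fst_dsum, rule VU, simp only: d fst_dsum)
qed

section \<open>Splitting of idempotents and Fitting's lemma\<close>

text \<open>\<open>K\<close> is the image of \<open>E\<close> in the coordinates given by
  \<open>B\<close>, with \<open>g\<close> acting as \<open>C g B\<close>. This is multiplicative
  because \<open>E = B C\<close> commutes with the action, so that
  \<open>B C g B = g B\<close>.\<close>

lemma idempotent_subrep:
  fixes X :: "'a::field rep"
  assumes r: "is_rep n X" and E: "E \<in> rhom n X X" and BC: "B \<in> carrier_mat (fst X) k" "C \<in> carrier_mat k (fst X)"
    "E = B * C" "C * B = 1\<^sub>m k"
  shows "\<exists>K. is_rep n K \<and> fst K = k \<and> B \<in> rhom n K X \<and> C \<in> rhom n X K"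
proof -
  let ?x = "fst X"
  define K where "K = (k, \<lambda>g. C * snd X g * B)"
  have EB: "E * B = B" unfolding BC(3) assoc_mult_mat[OF BC(1,2,1)] BC(4) by (rule right_mult_one_mat[OF BC(1)])
  have CE: "C * E = C" unfolding BC(3) assoc_mult_mat[OF BC(2,1,2), symmetric] BC(4) by (rule left_mult_one_mat[OF BC(2)])
  have Ec: "E \<in> carrier_mat ?x ?x" using E by (rule rhom_carrier)
  have 1: "B * (C * snd X g * B) = snd X g * B" if g: "g \<in> Sn n" for g
  proof -
    note c = rep_carrier[OF r g]
    have "B * (C * snd X g * B) = E * snd X g * B"
      unfolding BC(3) assoc_mult_mat[OF BC(2) c BC(1)]
        assoc_mult_mat[OF BC(1,2) mult_carrier_mat[OF c BC(1)], symmetric]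
      by (rule assoc_mult_mat[OF mult_carrier_mat[OF BC(1,2)] c BC(1), symmetric])
    also have "\<dots> = snd X g * (E * B)" unfolding rhom_eq[OF E g] by (rule assoc_mult_mat[OF c Ec BC(1)])
    finally show ?thesis by (simp add: EB)
  qed
  have 2: "C * snd X g * B * C = C * snd X g" if g: "g \<in> Sn n" for g
  proof -
    note c = rep_carrier[OF r g]
    have "C * snd X g * B * C = C * (snd X g * E)"
      unfolding BC(3) using mat_mult4[OF BC(2) c BC(1,2)] BC c
        assoc_mult_mat[of "C * snd X g" k ?x B k C ?x] assoc_mult_mat[of C k ?x "snd X g" ?x "B * C" ?x] by auto
    also have "\<dots> = C * E * snd X g" unfolding rhom_eq[OF E g, symmetric] by (rule assoc_mult_mat[OF BC(2) Ec c, symmetric])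
    finally show ?thesis by (simp add: CE)
  qed
  have "is_rep n K"
  proof (rule is_repI)
    fix g assume "g \<in> Sn n"
    then show "snd K g \<in> carrier_mat (fst K) (fst K)" using rep_carrier[OF r] BC by (auto simp: K_def)
  next
    show "snd K id = 1\<^sub>m (fst K)" using rep_id[OF r] BC by (simp add: K_def)
  next
    fix g h assume g: "g \<in> Sn n" and h: "h \<in> Sn n"
    note c = rep_carrier[OF r g] rep_carrier[OF r h]
    have "snd K g * snd K h = (C * snd X g * B) * (C * (snd X h * B))"
      unfolding K_def snd_conv assoc_mult_mat[OF BC(2) c(2) BC(1)] ..
    also have "\<dots> = (C * snd X g * B * C) * (snd X h * B)"
      using c BC by (intro assoc_mult_mat[of _ k k _ ?x _ k, symmetric]) auto
    also have "\<dots> = C * (snd X g * snd X h) * B"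
      unfolding 2[OF g] using mat_mult4[OF BC(2) c BC(1)] .
    finally show "snd K (g \<circ> h) = snd K g * snd K h" by (simp add: K_def rep_comp[OF r g h])
  qed
  moreover have "B \<in> rhom n K X" using BC 1 by (auto simp: rhom_def K_def)
  moreover have "C \<in> rhom n X K" using BC 2 by (auto simp: rhom_def K_def)
  ultimately show ?thesis by (intro exI[of _ K]) (auto simp: K_def)
qed

lemma one_minus_idempotent:
  fixes E :: "'a::field mat"
  assumes "E \<in> carrier_mat d d" "E * E = E"
  shows "(1\<^sub>m d - E) * (1\<^sub>m d - E) = 1\<^sub>m d - E" "E * (1\<^sub>m d - E) = 0\<^sub>m d d" "(1\<^sub>m d - E) * E = 0\<^sub>m d d"
proof -
  have c: "1\<^sub>m d - E \<in> carrier_mat d d" using assms by auto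
  show 1: "E * (1\<^sub>m d - E) = 0\<^sub>m d d" 
    using assms by (simp add: mult_minus_distrib_mat[of E d d "1\<^sub>m d" d E])
  show 2: "(1\<^sub>m d - E) * E = 0\<^sub>m d d"
    using assms by (simp add: minus_mult_distrib_mat[of "1\<^sub>m d" d d E E d])
  show "(1\<^sub>m d - E) * (1\<^sub>m d - E) = 1\<^sub>m d - E"
    using assms c unfolding minus_mult_distrib_mat[OF one_carrier_mat assms(1) c] 1
    by (intro eq_matI) auto
qed

text \<open>\<open>C B' = (C B)(C B')(C' B') = C (B C B' C') B'\<close>, and the bracket is the
  product of the two idempotents.\<close>

lemma idempotent_biproduct_orthogonal:
  fixes B C B' C' :: "'a::field mat"
  assumes BC: "B \<in> carrier_mat d k" "C \<in> carrier_mat k d" "C * B = 1\<^sub>m k"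
    and BC': "B' \<in> carrier_mat d k'" "C' \<in> carrier_mat k' d" "C' * B' = 1\<^sub>m k'"
    and z: "(B * C) * (B' * C') = 0\<^sub>m d d"
  shows "C * B' = 0\<^sub>m k k'"
proof -
  have CB: "C * B' \<in> carrier_mat k k'" using BC BC' by auto
  have "C * B' = C * B * (C * B') * (C' * B')" 
    unfolding BC(3) BC'(3) left_mult_one_mat[OF CB] right_mult_one_mat[OF CB] ..
  also have "C * B * (C * B') = C * (B * (C * B'))"
    by (rule assoc_mult_mat[OF BC(2,1) CB])
  also have "C * (B * (C * B')) * (C' * B') = C * (B * (C * B') * C') * B'"
    by (rule mat_mult4[OF BC(2) _ BC'(2,1)]) (use BC CB in auto)
  also have "B * (C * B') * C' = 0\<^sub>m d d" using mat_mult4[OF BC(1,2) BC'(1,2)] z by simp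
  finally show ?thesis unfolding right_mult_zero_mat[OF BC(2)] left_mult_zero_mat[OF BC'(1)] .
qed

lemma minus_add_cancel_one:
  fixes E :: "'a::field mat"
  assumes "E \<in> carrier_mat d d" shows "E + (1\<^sub>m d - E) = 1\<^sub>m d"
  using assms by (intro eq_matI) auto

text \<open>The complement \<open>K\<close> is cut out by the idempotent \<open>1 - P Q\<close>,
  which is orthogonal to \<open>P Q\<close>.\<close>

lemma idempotent_splits:
  fixes X Y :: "'a::field rep"
  assumes r: "is_rep n X" "is_rep n Y" and h: "P \<in> rhom n Y X" "Q \<in> rhom n X Y"
    and QP: "Q * P = 1\<^sub>m (fst Y)"
  obtains K P' Q' where "is_rep n K" "P' \<in> rhom n K X" "Q' \<in> rhom n X K" "Q' * P' = 1\<^sub>m (fst K)"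
    "1\<^sub>m (fst X) - P * Q = P' * Q'" "rep_iso n X (dsum Y K)"
proof -
  let ?x = "fst X" let ?y = "fst Y"
  define E where "E = P * Q"
  note c = rhom_carrier[OF h(1)] rhom_carrier[OF h(2)]
  have E: "E \<in> rhom n X X" unfolding E_def by (rule rhom_mult[OF r(1,2,1) h(2,1)])
  note Ec = rhom_carrier[OF E]
  have EE: "E * E = E" unfolding E_def mat_mult4[OF c c] QP right_mult_one_mat[OF c(1)] ..
  have F: "1\<^sub>m ?x - E \<in> rhom n X X" by (intro rhom_minus rhom_one r E)
  from idempotent_factorization[OF rhom_carrier[OF F] one_minus_idempotent(1)[OF Ec EE]]
  obtain k B C where BC: "B \<in> carrier_mat ?x k" "C \<in> carrier_mat k ?x" "1\<^sub>m ?x - E = B * C" "C * B = 1\<^sub>m k" .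
  from idempotent_subrep[OF r(1) F BC] obtain K where K: "is_rep n K" "fst K = k" "B \<in> rhom n K X" "C \<in> rhom n X K" by blast
  have 1: "Q * B = 0\<^sub>m ?y k"
    using one_minus_idempotent(2)[OF Ec EE] unfolding BC(3)
    by (intro idempotent_biproduct_orthogonal[OF c QP BC(1,2,4)]) (simp add: E_def)
  have 2: "C * P = 0\<^sub>m k ?y"
    using one_minus_idempotent(3)[OF Ec EE] unfolding BC(3)
    by (intro idempotent_biproduct_orthogonal[OF BC(1,2,4) c QP]) (simp add: E_def)
  have "rep_iso n X (dsum Y K)"
    by (intro biproduct_iso[OF r K(1) h K(3,4)])
      (simp_all only: 1 2 QP BC(4) K(2) BC(3)[symmetric] E_def[symmetric] minus_add_cancel_one[OF Ec])
  moreover have "C * B = 1\<^sub>m (fst K)" by (simp only: BC(4) K(2))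
  moreover have "1\<^sub>m ?x - P * Q = B * C" by (simp only: BC(3) E_def[symmetric])
  ultimately show thesis using that[OF K(1,3,4)] by blast
qed

lemma split_summand:
  assumes "is_rep n X" "is_rep n Y" "P \<in> rhom n Y X" "Q \<in> rhom n X Y" "Q * P = 1\<^sub>m (fst Y)"
  shows "is_summand n Y X"
  using idempotent_splits[OF assms] unfolding is_summand_def by blast

lemma summand_split:
  assumes "is_rep n X" "is_rep n Y" "is_summand n Y X"
  obtains P Q where "P \<in> rhom n Y X" "Q \<in> rhom n X Y" "Q * P = 1\<^sub>m (fst Y)"
proof -
  from assms(3) obtain K where K: "is_rep n K" "rep_iso n X (dsum Y K)" by (auto simp: is_summand_def)
  note d = is_rep_dsum[OF assms(2) K(1)]
  from rep_isoE[OF K(2) assms(1) d] obtain U V where UV: "U \<in> rhom n X (dsum Y K)" "V \<in> rhom n (dsum Y K) X"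
    "U * V = 1\<^sub>m (fst (dsum Y K))" "V * U = 1\<^sub>m (fst X)" by blast
  note h = dsum_homs[OF assms(2) K(1)]
  let ?i = "inj1 (fst Y) (fst K)" and ?p = "prj1 (fst Y) (fst K)"
  have "?p * U * (V * ?i) = ?p * (U * V) * ?i"
    by (rule mat_mult4[OF rhom_carrier[OF h(3)] rhom_carrier[OF UV(1)] rhom_carrier[OF UV(2)] rhom_carrier[OF h(1)]])
  also have "\<dots> = 1\<^sub>m (fst Y)"
    unfolding UV(3) fst_dsum right_mult_one_mat[OF inj_prj_carrier(3)] inj_prj_eqs ..
  finally show thesis
    using that[OF rhom_mult[OF assms(2) d assms(1) h(1) UV(2)] rhom_mult[OF assms(1) d assms(2) UV(1) h(3)]] by simp
qed

text \<open>The idempotents \<open>E\<close> and \<open>1 - E\<close> split \<open>Y\<close> into a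
  direct sum, one summand of which must have dimension zero.\<close>

lemma indecomposable_idempotent:
  assumes Y: "indecomposable n Y" and E: "E \<in> rhom n Y Y" "E * E = E"
  shows "E = 0\<^sub>m (fst Y) (fst Y) \<or> E = 1\<^sub>m (fst Y)"
proof -
  have r: "is_rep n Y" using Y by (simp add: indecomposable_def)
  let ?y = "fst Y"
  note Ec = rhom_carrier[OF E(1)]
  from idempotent_factorization[OF Ec E(2)] obtain k B C where
    BC: "B \<in> carrier_mat ?y k" "C \<in> carrier_mat k ?y" "E = B * C" "C * B = 1\<^sub>m k" .
  from idempotent_subrep[OF r E(1) BC] obtain K where K: "is_rep n K" "fst K = k" "B \<in> rhom n K Y" "C \<in> rhom n Y K" by blast
  have "C * B = 1\<^sub>m (fst K)" by (simp only: BC(4) K(2))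
  from idempotent_splits[OF r K(1,3,4) this]
  obtain L P' Q' where L: "is_rep n L" "P' \<in> rhom n L Y" "Q' \<in> rhom n Y L" "Q' * P' = 1\<^sub>m (fst L)" "1\<^sub>m ?y - B * C = P' * Q'" "rep_iso n Y (dsum K L)" .
  from Y K(1,2) L(1,6) have "k = 0 \<or> fst L = 0" unfolding indecomposable_def by blast
  then show ?thesis
  proof
    assume "k = 0"
    then have "E = 0\<^sub>m ?y ?y" using BC(1,2) unfolding BC(3) by (intro eq_matI) (auto simp: scalar_prod_def)
    then show ?thesis ..
  next
    assume "fst L = 0"
    then have "P' * Q' = 0\<^sub>m ?y ?y" using rhom_carrier[OF L(2)] rhom_carrier[OF L(3)]
      by (intro eq_matI) (auto simp: scalar_prod_def)
    then have "1\<^sub>m ?y - E = 0\<^sub>m ?y ?y" unfolding L(5)[symmetric] BC(3) .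
    then have "E = 1\<^sub>m ?y" using minus_add_cancel_one[OF Ec] right_add_zero_mat[OF Ec] by metis
    then show ?thesis ..
  qed
qed

text \<open>Some power \<open>T\<close> of \<open>A\<close> has a group inverse \<open>X\<close>,
  and \<open>T X\<close> is an idempotent endomorphism, hence 0 or 1. In the first case
  \<open>T = T X T\<close> vanishes, in the second \<open>A\<close> is invertible.\<close>

lemma fitting:
  assumes Y: "indecomposable n Y" and A: "A \<in> rhom n Y Y"
  shows "(\<exists>B\<in>rhom n Y Y. A * B = 1\<^sub>m (fst Y) \<and> B * A = 1\<^sub>m (fst Y)) \<or> (\<exists>i. sqpow i A = 0\<^sub>m (fst Y) (fst Y))"
proof -
  have r: "is_rep n Y" using Y by (simp add: indecomposable_def)
  let ?y = "fst Y"
  note Ac = rhom_carrier[OF A]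
  from power_group_inverse[OF Ac] obtain i X where X: "X \<in> carrier_mat ?y ?y" "sqpow i A * X = X * sqpow i A"
    "sqpow i A * X * sqpow i A = sqpow i A" "X * sqpow i A * X = X" .
  let ?T = "sqpow i A"
  have T: "sqpow j A \<in> rhom n Y Y" for j
    by (induction j) (auto simp: sqpow_Suc A sqpow_def[of 0] intro: rhom_mult[OF r r r])
  note Tc = rhom_carrier[OF T[of i]]
  have "?T * X \<in> rhom n Y Y"
    unfolding rhom_def using Tc X(1) group_inverse_idempotent_commutes[OF Tc X(1) rep_carrier[OF r] X(2,3) rhom_eq[OF T[of i], symmetric]]
    by (auto simp del: assoc_mult_mat)
  moreover have "?T * X * (?T * X) = ?T * X"
    unfolding assoc_mult_mat[OF mult_carrier_mat[OF Tc X(1)] Tc X(1), symmetric] X(3) ..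
  ultimately consider "?T * X = 0\<^sub>m ?y ?y" | "?T * X = 1\<^sub>m ?y" using indecomposable_idempotent[OF Y] by blast
  then show ?thesis
  proof cases
    case 1
    then have "?T = 0\<^sub>m ?y ?y" using X(3) left_mult_zero_mat[OF Tc] by metis
    then show ?thesis by blast
  next
    case 2
    \<comment> \<open>\<open>A\<close> is a left factor of each \<open>sqpow j A\<close>; with
      \<open>T X = 1\<close> this gives a right inverse of \<open>A\<close>.\<close>
    have "\<exists>Z\<in>carrier_mat ?y ?y. A * Z = 1\<^sub>m ?y"
    proof -
      have "\<exists>Z\<in>carrier_mat ?y ?y. A * Z = sqpow j A" for j
      proof (induction j)
        case 0 then show ?case using Ac by (intro bexI[of _ "1\<^sub>m ?y"]) (auto simp: sqpow_def)
      next
        case (Suc j)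
        then obtain Z where Z: "Z\<in>carrier_mat ?y ?y" "A * Z = sqpow j A" by blast
        have "A * (Z * sqpow j A) = sqpow (Suc j) A"
          unfolding assoc_mult_mat[OF Ac Z(1) rhom_carrier[OF T[of j]], symmetric] Z(2) sqpow_Suc ..
        then show ?case using Z rhom_carrier[OF T[of j]] by (intro bexI[of _ "Z * sqpow j A"]) auto
      qed
      from this[of i] obtain Z where Z: "Z\<in>carrier_mat ?y ?y" "A * Z = ?T" by blast
      then have "A * (Z * X) = 1\<^sub>m ?y" unfolding assoc_mult_mat[OF Ac Z(1) X(1), symmetric] Z(2) 2 by blast
      then show ?thesis using Z X by (intro bexI[of _ "Z * X"]) auto
    qed
    then obtain Z where Z: "Z\<in>carrier_mat ?y ?y" "A * Z = 1\<^sub>m ?y" by blast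
    then have ZA: "Z * A = 1\<^sub>m ?y" using mat_mult_left_right_inverse[OF Ac] by blast
    have "Z * snd Y g = snd Y g * Z" if g: "g \<in> Sn n" for g
    proof -
      note c = rep_carrier[OF r g]
      have "Z * snd Y g = Z * (snd Y g * (A * Z))" using c Z by simp
      also have "\<dots> = Z * ((snd Y g * A) * Z)" using c Ac Z(1) by (simp add: assoc_mult_mat[of _ ?y ?y _ ?y _ ?y])
      also have "\<dots> = Z * ((A * snd Y g) * Z)" using rhom_eq[OF A g] by simp
      also have "\<dots> = (Z * A) * (snd Y g * Z)" using c Ac Z(1) by (simp add: assoc_mult_mat[of _ ?y ?y _ ?y _ ?y])
      also have "\<dots> = snd Y g * Z" using ZA Z c by simp
      finally show ?thesis .
    qed
    then have "Z \<in> rhom n Y Y" using Z by (auto simp: rhom_def)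
    then show ?thesis using Z ZA by blast
  qed
qed

section \<open>Multiplicities through a functional\<close>

text \<open>Induction on the number of squarings: \<open>1 - N N = (1 + N)(1 - N)\<close>, so a left
  inverse of \<open>1 - N N\<close> times \<open>1 + N\<close> inverts \<open>1 - N\<close>.\<close>

lemma nilpotent_one_minus_unit:
  assumes r: "is_rep n Y"
  shows "N \<in> rhom n Y Y \<Longrightarrow> sqpow i N = 0\<^sub>m (fst Y) (fst Y) \<Longrightarrow> \<exists>Z\<in>rhom n Y Y. Z * (1\<^sub>m (fst Y) - N) = 1\<^sub>m (fst Y)"
proof (induction i arbitrary: N)
  case 0
  then have N: "N = 0\<^sub>m (fst Y) (fst Y)" by (simp add: sqpow_def)
  have "1\<^sub>m (fst Y) * (1\<^sub>m (fst Y) - N) = 1\<^sub>m (fst Y)" unfolding N by (intro eq_matI) auto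
  then show ?case using rhom_one[OF r] by blast
next
  case (Suc i)
  let ?I = "1\<^sub>m (fst Y)"
  have NN: "N * N \<in> rhom n Y Y" by (intro rhom_mult[OF r r r] Suc.prems)
  from Suc.IH[OF NN] Suc.prems obtain Z where Z: "Z \<in> rhom n Y Y" "Z * (?I - N * N) = ?I"
    unfolding sqpow_Suc' by blast
  note c = rhom_carrier[OF Suc.prems(1)] rhom_carrier[OF Z(1)]
  have a: "?I + N \<in> carrier_mat (fst Y) (fst Y)" "?I - N \<in> carrier_mat (fst Y) (fst Y)" using c by auto
  have "(?I + N) * (?I - N) = ?I * (?I - N) + N * (?I - N)" by (rule add_mult_distrib_mat[OF one_carrier_mat c(1) a(2)])
  also have "?I * (?I - N) = ?I - N" by (rule left_mult_one_mat[OF a(2)])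
  also have "N * (?I - N) = N * ?I - N * N" by (rule mult_minus_distrib_mat[OF c(1) one_carrier_mat c(1)])
  also have "N * ?I = N" by (rule right_mult_one_mat[OF c(1)])
  also have "?I - N + (N - N * N) = ?I - N * N" using c by (intro eq_matI) auto
  finally have e: "(?I + N) * (?I - N) = ?I - N * N" .
  have "Z * (?I + N) * (?I - N) = ?I" unfolding assoc_mult_mat[OF c(2) a] e by (rule Z(2))
  moreover have "Z * (?I + N) \<in> rhom n Y Y"
    by (intro rhom_mult[OF r r r] Z rhom_add[OF r r] rhom_one[OF r] Suc.prems)
  ultimately show ?case by blast
qed

lemma add_eq_imp_minus:
  fixes A B :: "'a::field mat"
  assumes "A \<in> carrier_mat d e" "B \<in> carrier_mat d e" "A + B = C"
  shows "A = C - B"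
  unfolding assms(3)[symmetric] using assms(1,2) by (intro eq_matI) auto

text \<open>Inductive, so that summands can be peeled off one at a time; the module passed through
  may change from summand to summand.\<close>

inductive factor_sum :: "nat \<Rightarrow> 'a::field rep set \<Rightarrow> 'a rep \<Rightarrow> 'a mat \<Rightarrow> bool" for n S Y where
  zero: "factor_sum n S Y (0\<^sub>m (fst Y) (fst Y))"
| add: "factor_sum n S Y A \<Longrightarrow> X \<in> S \<Longrightarrow> F \<in> rhom n Y X \<Longrightarrow> G \<in> rhom n X Y \<Longrightarrow> factor_sum n S Y (A + G * F)"

lemma factor_sum_rhom:
  assumes "factor_sum n S Y A" "is_rep n Y" "\<And>X. X \<in> S \<Longrightarrow> is_rep n X"
  shows "A \<in> rhom n Y Y"
  using assms(1)
proof induction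
  case zero show ?case by (rule rhom_zero[OF assms(2,2)])
next
  case (add A X F G)
  show ?case by (intro rhom_add[OF assms(2,2)] rhom_mult[OF assms(2) assms(3)[OF add(2)] assms(2)] add)
qed

text \<open>The endomorphism ring of \<open>Y\<close> is local. If \<open>Z A + Z G F = 1\<close>,
  then either \<open>Z G F\<close> is a unit and \<open>F\<close> splits, or it is nilpotent, so
  that \<open>Z A = 1 - Z G F\<close> is a unit and the sum has become shorter.\<close>

lemma indecomposable_factor_sum_unit:
  assumes Y: "indecomposable n Y" and S: "\<And>X. X \<in> S \<Longrightarrow> is_rep n X"
    and A: "factor_sum n S Y A" and Z: "Z \<in> rhom n Y Y" "Z * A = 1\<^sub>m (fst Y)"
  shows "\<exists>X\<in>S. is_summand n Y X"
  using A Z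
proof (induction arbitrary: Z)
  case zero
  have "Z * 0\<^sub>m (fst Y) (fst Y) = 0\<^sub>m (fst Y) (fst Y)" by (rule right_mult_zero_mat[OF rhom_carrier[OF zero(1)]])
  then have "(1\<^sub>m (fst Y) :: 'a mat) = 0\<^sub>m (fst Y) (fst Y)" using zero(2) by simp
  then have "(1\<^sub>m (fst Y) :: 'a mat) $$ (0, 0) = 0\<^sub>m (fst Y) (fst Y) $$ (0, 0)" by simp
  then show ?case using Y by (simp add: indecomposable_def)
next
  case (add A X F G)
  have r: "is_rep n Y" "is_rep n X" using Y S add(2) by (auto simp: indecomposable_def)
  let ?N = "Z * (G * F)"
  have GF: "G * F \<in> rhom n Y Y" by (rule rhom_mult[OF r(1,2,1) add(3,4)])
  have N: "?N \<in> rhom n Y Y" by (rule rhom_mult[OF r(1,1,1) GF add(6)])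
  note c = rhom_carrier[OF add(6)] rhom_carrier[OF add(4)] rhom_carrier[OF add(3)]
  from fitting[OF Y N] show ?case
  proof
    assume "\<exists>B\<in>rhom n Y Y. ?N * B = 1\<^sub>m (fst Y) \<and> B * ?N = 1\<^sub>m (fst Y)"
    then obtain W where W: "W \<in> rhom n Y Y" "W * ?N = 1\<^sub>m (fst Y)" by blast
    have "W * (Z * G) * F = W * (Z * (G * F))"
      by (simp only: assoc_mult_mat[OF rhom_carrier[OF W(1)] mult_carrier_mat[OF c(1,2)] c(3)] assoc_mult_mat[OF c(1,2,3)])
    then have "is_summand n Y X"
      by (intro split_summand[OF r(2,1) add(3), of "W * (Z * G)"] rhom_mult[OF r(2,1,1)] rhom_mult[OF r(2,1,1)] W add) (simp only: W)
    then show ?thesis using add(2) by blast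
  next
    assume "\<exists>i. sqpow i ?N = 0\<^sub>m (fst Y) (fst Y)"
    then obtain V where V: "V \<in> rhom n Y Y" "V * (1\<^sub>m (fst Y) - ?N) = 1\<^sub>m (fst Y)"
      using nilpotent_one_minus_unit[OF r(1) N] by blast
    have Ac: "A \<in> carrier_mat (fst Y) (fst Y)"
      using rhom_carrier[OF factor_sum_rhom[OF add(1) r(1) S]] by blast
    have "Z * A + ?N = 1\<^sub>m (fst Y)"
      using add(7) by (simp only: mult_add_distrib_mat[OF c(1) Ac rhom_carrier[OF GF]])
    then have "Z * A = 1\<^sub>m (fst Y) - ?N"
      using add_eq_imp_minus[OF mult_carrier_mat[OF c(1) Ac] rhom_carrier[OF N]] by blast
    then have "V * Z * A = 1\<^sub>m (fst Y)"
      by (simp only: assoc_mult_mat[OF rhom_carrier[OF V(1)] c(1) Ac] V(2))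
    then show ?thesis using add(5)[of "V * Z"] rhom_mult[OF r(1,1,1) add(6) V(1)] by blast
  qed
qed

text \<open>\<open>P Q\<close> is an idempotent of \<open>X\<close>, so 0 or 1; it is not 0, since
  \<open>Q P = 1\<close> on a nonzero space.\<close>

lemma indecomposable_split_iso:
  assumes X: "indecomposable n X" and Y: "indecomposable n Y"
    and P: "P \<in> rhom n Y X" and Q: "Q \<in> rhom n X Y" and QP: "Q * P = 1\<^sub>m (fst Y)"
  shows "rep_iso n X Y"
proof -
  have r: "is_rep n X" "is_rep n Y" and y: "fst Y > 0" using X Y by (auto simp: indecomposable_def)
  note c = rhom_carrier[OF P] rhom_carrier[OF Q]
  have E: "P * Q \<in> rhom n X X" by (rule rhom_mult[OF r(1,2,1) Q P])
  have "P * Q * (P * Q) = P * Q" unfolding mat_mult4[OF c c] QP right_mult_one_mat[OF c(1)] ..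
  from indecomposable_idempotent[OF X E this] show ?thesis
  proof
    assume z: "P * Q = 0\<^sub>m (fst X) (fst X)"
    have "1\<^sub>m (fst Y) = (Q * P) * (Q * P)" by (simp add: QP)
    also have "\<dots> = Q * (P * Q) * P" by (rule mat_mult4[OF c(2,1,2,1)])
    also have "\<dots> = 0\<^sub>m (fst Y) (fst Y)" unfolding z right_mult_zero_mat[OF c(2)] left_mult_zero_mat[OF c(1)] ..
    finally have "(1\<^sub>m (fst Y) :: 'a mat) $$ (0, 0) = 0\<^sub>m (fst Y) (fst Y) $$ (0, 0)" by simp
    then show ?thesis using y by simp
  next
    assume o: "P * Q = 1\<^sub>m (fst X)"
    have "fst X = fst Y" using left_inverse_dim_le[OF c o] left_inverse_dim_le[OF c(2,1) QP] by simp
    then show ?thesis by (intro rep_isoI[OF Q P QP o])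
  qed
qed

section \<open>Decompositions into indecomposables\<close>

lemma is_rep_zero: "is_rep n zero_rep"
  by (auto simp: is_rep_def zero_rep_def)

text \<open>Converse of \<open>biproduct_iso\<close>; with it a summand can be replaced by an
  isomorphic one without touching block matrices.\<close>

lemma rep_iso_biproduct:
  assumes r: "is_rep n X" "is_rep n A" "is_rep n K" "rep_iso n X (dsum A K)"
  obtains P1 Q1 R2 Q2 where "P1 \<in> rhom n A X" "Q1 \<in> rhom n X A" "R2 \<in> rhom n K X" "Q2 \<in> rhom n X K"
    "Q1 * P1 = 1\<^sub>m (fst A)" "Q2 * R2 = 1\<^sub>m (fst K)" "Q1 * R2 = 0\<^sub>m (fst A) (fst K)" "Q2 * P1 = 0\<^sub>m (fst K) (fst A)"
    "P1 * Q1 + R2 * Q2 = 1\<^sub>m (fst X)"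
proof -
  note d = is_rep_dsum[OF r(2,3)]
  from rep_isoE[OF r(4,1) d] obtain U V where UV: "U \<in> rhom n X (dsum A K)" "V \<in> rhom n (dsum A K) X"
    "U * V = 1\<^sub>m (fst (dsum A K))" "V * U = 1\<^sub>m (fst X)" .
  let ?a = "fst A" and ?k = "fst K"
  note h = dsum_homs[OF r(2,3)]
  note c = inj_prj_carrier[where ?'a = 'a, of ?a ?k]
  have Uc: "U \<in> carrier_mat (?a + ?k) (fst X)" and Vc: "V \<in> carrier_mat (fst X) (?a + ?k)"
    using rhom_carrier[OF UV(1)] rhom_carrier[OF UV(2)] by (auto simp: fst_dsum)
  have UV': "U * V = 1\<^sub>m (?a + ?k)" using UV(3) by (simp only: fst_dsum)
  have pp: "p * U * (V * i) = p * i" if "p \<in> carrier_mat x (?a + ?k)" "i \<in> carrier_mat (?a + ?k) y" for p i x y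
    unfolding mat_mult4[OF that(1) Uc Vc that(2)] UV' right_mult_one_mat[OF that(1)] ..
  have s: "V * inj1 ?a ?k * (prj1 ?a ?k * U) + V * inj2 ?a ?k * (prj2 ?a ?k * U) = 1\<^sub>m (fst X)"
  proof -
    have "V * inj1 ?a ?k * (prj1 ?a ?k * U) + V * inj2 ?a ?k * (prj2 ?a ?k * U)
      = V * (inj1 ?a ?k * prj1 ?a ?k) * U + V * (inj2 ?a ?k * prj2 ?a ?k) * U"
      by (simp only: mat_mult4[OF Vc c(1,3) Uc] mat_mult4[OF Vc c(2,4) Uc])
    also have "\<dots> = (V * (inj1 ?a ?k * prj1 ?a ?k) + V * (inj2 ?a ?k * prj2 ?a ?k)) * U"
      by (rule add_mult_distrib_mat[symmetric, OF mult_carrier_mat[OF Vc mult_carrier_mat[OF c(1,3)]] mult_carrier_mat[OF Vc mult_carrier_mat[OF c(2,4)]] Uc])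
    also have "V * (inj1 ?a ?k * prj1 ?a ?k) + V * (inj2 ?a ?k * prj2 ?a ?k) = V * 1\<^sub>m (?a + ?k)"
      unfolding inj_prj_eqs(5)[of ?a ?k, symmetric]
      by (rule mult_add_distrib_mat[symmetric, OF Vc mult_carrier_mat[OF c(1,3)] mult_carrier_mat[OF c(2,4)]])
    also have "V * 1\<^sub>m (?a + ?k) = V" by (rule right_mult_one_mat[OF Vc])
    finally show ?thesis by (simp only: UV(4))
  qed
  show thesis
    by (rule that[OF rhom_mult[OF r(2) d r(1) h(1) UV(2)] rhom_mult[OF r(1) d r(2) UV(1) h(3)]
        rhom_mult[OF r(3) d r(1) h(2) UV(2)] rhom_mult[OF r(1) d r(3) UV(1) h(4)]])
      (simp_all only: pp[OF c(3) c(1)] pp[OF c(4) c(2)] pp[OF c(3) c(2)] pp[OF c(4) c(1)] inj_prj_eqs s)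
qed

lemma dsum_cong_right:
  assumes r: "is_rep n X" "is_rep n A" "is_rep n K" "is_rep n L" "rep_iso n X (dsum A K)" "rep_iso n K L"
  shows "rep_iso n X (dsum A L)"
proof -
  from rep_iso_biproduct[OF r(1,2,3,5)] obtain P1 Q1 R2 Q2 where
    h: "P1 \<in> rhom n A X" "Q1 \<in> rhom n X A" "R2 \<in> rhom n K X" "Q2 \<in> rhom n X K" and
    e: "Q1 * P1 = 1\<^sub>m (fst A)" "Q2 * R2 = 1\<^sub>m (fst K)" "Q1 * R2 = 0\<^sub>m (fst A) (fst K)" "Q2 * P1 = 0\<^sub>m (fst K) (fst A)"
    "P1 * Q1 + R2 * Q2 = 1\<^sub>m (fst X)" .
  from rep_isoE[OF r(6,3,4)] obtain S T where
    ST: "S \<in> rhom n K L" "T \<in> rhom n L K" "S * T = 1\<^sub>m (fst L)" "T * S = 1\<^sub>m (fst K)" .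
  note c = rhom_carrier[OF h(1)] rhom_carrier[OF h(2)] rhom_carrier[OF h(3)] rhom_carrier[OF h(4)]
     rhom_carrier[OF ST(1)] rhom_carrier[OF ST(2)]
  show ?thesis
  proof (rule biproduct_iso[OF r(1,2,4) h(1,2) rhom_mult[OF r(4,3,1) ST(2) h(3)] rhom_mult[OF r(1,3,4) h(4) ST(1)] e(1)])
    show "S * Q2 * (R2 * T) = 1\<^sub>m (fst L)"
      by (simp only: mat_mult4[OF c(5,4,3,6)] e right_mult_one_mat[OF c(5)] ST)
    show "Q1 * (R2 * T) = 0\<^sub>m (fst A) (fst L)"
      by (simp only: assoc_mult_mat[OF c(2,3,6), symmetric] e left_mult_zero_mat[OF c(6)])
    show "S * Q2 * P1 = 0\<^sub>m (fst L) (fst A)"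
      by (simp only: assoc_mult_mat[OF c(5,4,1)] e right_mult_zero_mat[OF c(5)])
    show "P1 * Q1 + R2 * T * (S * Q2) = 1\<^sub>m (fst X)"
      by (simp only: mat_mult4[OF c(3,6,5,4)] ST right_mult_one_mat[OF c(3)] e)
  qed
qed

lemma is_rep_dsum_list: "(\<And>N. N \<in> set Ns \<Longrightarrow> is_rep n N) \<Longrightarrow> is_rep n (dsum_list Ns)"
  by (induction Ns) (auto simp: dsum_list_def is_rep_zero intro: is_rep_dsum)

lemma dsum_list_Cons: "dsum_list (N # Ns) = dsum N (dsum_list Ns)"
  by (simp add: dsum_list_def)

lemma summand_self: "is_rep n X \<Longrightarrow> is_summand n X X"
  using split_summand[of n X X "1\<^sub>m (fst X)" "1\<^sub>m (fst X)"] rhom_one[of n X] by simp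

lemma summand_trans:
  assumes r: "is_rep n X" "is_rep n A" "is_rep n B" and "is_summand n A B" "is_summand n B X"
  shows "is_summand n A X"
proof -
  from summand_split[OF r(3,2) assms(4)] obtain P Q where PQ: "P \<in> rhom n A B" "Q \<in> rhom n B A" "Q * P = 1\<^sub>m (fst A)" .
  from summand_split[OF r(1,3) assms(5)] obtain P' Q' where PQ': "P' \<in> rhom n B X" "Q' \<in> rhom n X B" "Q' * P' = 1\<^sub>m (fst B)" .
  note c = rhom_carrier[OF PQ(1)] rhom_carrier[OF PQ(2)] rhom_carrier[OF PQ'(1)] rhom_carrier[OF PQ'(2)]
  show ?thesis
    by (rule split_summand[OF r(1,2) rhom_mult[OF r(2,3,1) PQ(1) PQ'(1)] rhom_mult[OF r(1,3,2) PQ'(2) PQ(2)]])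
      (simp only: mat_mult4[OF c(2,4,3,1)] PQ' right_mult_one_mat[OF c(2)] PQ)
qed

lemma rep_iso_summand:
  assumes "is_rep n X" "is_rep n A" "is_rep n B" "rep_iso n X (dsum A B)"
  shows "is_summand n A X"
  using assms unfolding is_summand_def by blast

lemma decomposition_exists:
  assumes "is_rep n X"
  shows "\<exists>Ns. (\<forall>N\<in>set Ns. indecomposable n N) \<and> rep_iso n X (dsum_list Ns)"
  using assms
proof (induction "fst X" arbitrary: X rule: less_induct)
  case less
  show ?case
  proof (cases "fst X = 0")
    case True
    have "rep_iso n X (dsum_list [])"
    proof (rule rep_isoI)
      have z: "fst (dsum_list [] :: 'a rep) = 0" "snd (dsum_list [] :: 'a rep) = (\<lambda>g. 1\<^sub>m 0)"
        by (simp_all add: dsum_list_def zero_rep_def)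
      have d: "dim_row (snd X g) = 0" "dim_col (snd X g) = 0" if "g \<in> Sn n" for g
        using rep_carrier[OF less.prems that] True by auto
      show "1\<^sub>m 0 \<in> rhom n X (dsum_list [])" "1\<^sub>m 0 \<in> rhom n (dsum_list []) X"
        using d True by (auto simp: rhom_def z intro!: eq_matI)
      show "1\<^sub>m 0 * 1\<^sub>m 0 = (1\<^sub>m (fst (dsum_list [] :: 'a rep)) :: 'a mat)" "1\<^sub>m 0 * 1\<^sub>m 0 = (1\<^sub>m (fst X) :: 'a mat)"
        "fst X = fst (dsum_list [] :: 'a rep)" by (simp_all add: z True)
    qed
    then show ?thesis by (intro exI[of _ "[]"]) simp
  next
    case False
    \<comment> \<open>A nonzero summand of least dimension is indecomposable, because a summand of
      it is again a summand of \<open>X\<close>.\<close>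
    define P where "P d \<longleftrightarrow> d > 0 \<and> (\<exists>A. is_rep n A \<and> is_summand n A X \<and> fst A = d)" for d
    have "P (fst X)" using False less.prems summand_self[OF less.prems] unfolding P_def by blast
    then have "P (LEAST d. P d)" by (rule LeastI)
    then obtain A where A: "is_rep n A" "is_summand n A X" "fst A = (LEAST d. P d)" "fst A > 0"
      unfolding P_def by auto
    have "indecomposable n A" unfolding indecomposable_def
    proof (intro conjI A notI)
      assume "\<exists>B C. is_rep n B \<and> is_rep n C \<and> 0 < fst B \<and> 0 < fst C \<and> rep_iso n A (dsum B C)"
      then obtain B C where BC: "is_rep n B" "is_rep n C" "0 < fst B" "0 < fst C" "rep_iso n A (dsum B C)" by blast
      have "fst A = fst B + fst C" using BC(5) by (auto simp: rep_iso_def fst_dsum[symmetric] split: prod.splits)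
      moreover have "P (fst B)" unfolding P_def
        using summand_trans[OF less.prems BC(1) A(1) rep_iso_summand[OF A(1) BC(1,2,5)] A(2)] BC by blast
      ultimately show False using A(3) BC(4) Least_le[of P "fst B"] by simp
    qed
    moreover from A(2) obtain K where K: "is_rep n K" "rep_iso n X (dsum A K)" by (auto simp: is_summand_def)
    have "fst X = fst A + fst K" using K(2) by (auto simp: rep_iso_def fst_dsum[symmetric] split: prod.splits)
    then obtain Ns where Ns: "\<forall>N\<in>set Ns. indecomposable n N" "rep_iso n K (dsum_list Ns)"
      using less.hyps[OF _ K(1)] A(4) by auto
    have "is_rep n (dsum_list Ns)" using Ns(1) by (intro is_rep_dsum_list) (auto simp: indecomposable_def)
    then have "rep_iso n X (dsum_list (A # Ns))" unfolding dsum_list_Cons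
      by (intro dsum_cong_right[OF less.prems A(1) K(1) _ K(2) Ns(2)])
    ultimately show ?thesis using Ns(1) by (intro exI[of _ "A # Ns"]) auto
  qed
qed

lemma rhom_two_step_factor:
  assumes "F \<in> carrier_mat (d + e) m" "G \<in> carrier_mat m (d + e)"
  shows "G * F = (G * inj1 d e) * (prj1 d e * F) + (G * inj2 d e) * (prj2 d e * (F :: 'a::field mat))"
proof -
  note c = inj_prj_carrier[where ?'a = 'a, of d e]
  have "G * F = G * (inj1 d e * prj1 d e + inj2 d e * prj2 d e) * F"
    unfolding inj_prj_eqs right_mult_one_mat[OF assms(2)] ..
  also have "G * (inj1 d e * prj1 d e + inj2 d e * prj2 d e) = G * (inj1 d e * prj1 d e) + G * (inj2 d e * prj2 d e)"
    by (rule mult_add_distrib_mat[OF assms(2) mult_carrier_mat[OF c(1,3)] mult_carrier_mat[OF c(2,4)]])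
  also have "\<dots> * F = G * (inj1 d e * prj1 d e) * F + G * (inj2 d e * prj2 d e) * F"
    by (rule add_mult_distrib_mat[OF mult_carrier_mat[OF assms(2) mult_carrier_mat[OF c(1,3)]] mult_carrier_mat[OF assms(2) mult_carrier_mat[OF c(2,4)]] assms(1)])
  finally show ?thesis by (simp only: mat_mult4[OF assms(2) c(1,3) assms(1)] mat_mult4[OF assms(2) c(2,4) assms(1)])
qed

text \<open>Such a functional kills everything that factors through an indecomposable not isomorphic to \<open>Y\<close>,
  so it detects exactly the summands \<open>Y\<close>.\<close>

locale multiplicity_functional =
  fixes n :: nat and M Y :: "'a::field rep" and \<phi> :: "'a mat \<Rightarrow> 'a" and P0 Q0 :: "'a mat"
  assumes M: "is_rep n M" and Y: "indecomposable n Y"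
    and P0: "P0 \<in> rhom n Y M" and Q0: "Q0 \<in> rhom n M Y" and QP0: "Q0 * P0 = 1\<^sub>m (fst Y)"
    and phi_add: "\<And>A B. A \<in> rhom n M M \<Longrightarrow> B \<in> rhom n M M \<Longrightarrow> \<phi> (A + B) = \<phi> A + \<phi> B"
    and phi_mult: "\<And>A B. A \<in> rhom n M M \<Longrightarrow> B \<in> rhom n M M \<Longrightarrow> \<phi> (A * B) = \<phi> A * \<phi> B"
    and phi_e: "\<phi> (P0 * Q0) = 1"
begin

lemma Yrep: "is_rep n Y" using Y by (simp add: indecomposable_def)

lemma phi_zero: "\<phi> (0\<^sub>m (fst M) (fst M)) = 0"
  using phi_add[OF rhom_zero[OF M M] rhom_zero[OF M M]] unfolding left_add_zero_mat[OF zero_carrier_mat]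
  by (metis add_cancel_right_right)

text \<open>Sending \<open>N\<close> to \<open>\<phi> (P0 N Q0)\<close> is multiplicative because
  \<open>Q0 P0 = 1\<close>, and a nilpotent element of a field is zero.\<close>

lemma phi_sandwich_nilpotent:
  "N \<in> rhom n Y Y \<Longrightarrow> sqpow i N = 0\<^sub>m (fst Y) (fst Y) \<Longrightarrow> \<phi> (P0 * N * Q0) = 0"
proof (induction i arbitrary: N)
  case 0
  then have N: "N = 0\<^sub>m (fst Y) (fst Y)" by (simp add: sqpow_def)
  show ?case unfolding N right_mult_zero_mat[OF rhom_carrier[OF P0]] left_mult_zero_mat[OF rhom_carrier[OF Q0]]
    by (rule phi_zero)
next
  case (Suc i)
  note c = rhom_carrier[OF P0] rhom_carrier[OF Q0] rhom_carrier[OF Suc.prems(1)]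
  have PN: "P0 * N \<in> carrier_mat (fst M) (fst Y)" using c by auto
  have h: "P0 * N * Q0 \<in> rhom n M M"
    by (rule rhom_mult[OF M Yrep M Q0 rhom_mult[OF Yrep Yrep M Suc.prems(1) P0]])
  have "P0 * N * Q0 * (P0 * N * Q0) = P0 * N * (Q0 * (P0 * N)) * Q0"
    by (rule mat_mult4[OF PN c(2) PN c(2)])
  also have "Q0 * (P0 * N) = N"
    by (simp only: assoc_mult_mat[OF c(2,1,3), symmetric] QP0 left_mult_one_mat[OF c(3)])
  also have "P0 * N * N = P0 * (N * N)" by (rule assoc_mult_mat[OF c(1,3,3)])
  finally have "\<phi> (P0 * N * Q0) * \<phi> (P0 * N * Q0) = \<phi> (P0 * (N * N) * Q0)"
    using phi_mult[OF h h] by simp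
  also have "\<dots> = 0" using Suc.IH[of "N * N"] Suc.prems rhom_mult[OF Yrep Yrep Yrep Suc.prems(1) Suc.prems(1)]
    by (simp add: sqpow_Suc')
  finally show ?case by simp
qed

text \<open>Sandwiching between copies of \<open>P0 Q0\<close>, which has value 1, does not change
  \<open>\<phi>\<close>. So \<open>\<phi> (G F)\<close> is the value at an endomorphism of
  \<open>Y\<close> that factors through \<open>X\<close>. By Fitting's lemma it is nilpotent: were
  it invertible, \<open>X\<close> would be isomorphic to \<open>Y\<close>.\<close>

lemma phi_through_other:
  assumes X: "indecomposable n X" "\<not> rep_iso n X Y" and F: "F \<in> rhom n M X" and G: "G \<in> rhom n X M"
  shows "\<phi> (G * F) = 0"
proof -
  have Xr: "is_rep n X" using X by (simp add: indecomposable_def)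
  have e: "P0 * Q0 \<in> rhom n M M" by (rule rhom_mult[OF M Yrep M Q0 P0])
  have GF: "G * F \<in> rhom n M M" by (rule rhom_mult[OF M Xr M F G])
  note c = rhom_carrier[OF P0] rhom_carrier[OF Q0] rhom_carrier[OF F] rhom_carrier[OF G]
  let ?N = "Q0 * G * (F * P0)"
  have QG: "Q0 * G \<in> rhom n X Y" by (rule rhom_mult[OF Xr M Yrep G Q0])
  have FP: "F * P0 \<in> rhom n Y X" by (rule rhom_mult[OF Yrep M Xr P0 F])
  have N: "?N \<in> rhom n Y Y" by (rule rhom_mult[OF Yrep Xr Yrep FP QG])
  have "P0 * Q0 * (G * F) * (P0 * Q0) = P0 * (Q0 * (G * F)) * (P0 * Q0)"
    by (simp only: assoc_mult_mat[OF c(1,2) mult_carrier_mat[OF c(4,3)]])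
  also have "\<dots> = P0 * (Q0 * (G * F) * P0) * Q0"
    by (rule mat_mult4[OF c(1) mult_carrier_mat[OF c(2) mult_carrier_mat[OF c(4,3)]] c(1,2)])
  also have "Q0 * (G * F) * P0 = ?N" by (rule mat_mult4[OF c(2,4,3,1), symmetric])
  finally have *: "\<phi> (G * F) = \<phi> (P0 * ?N * Q0)"
    using phi_mult[OF rhom_mult[OF M M M GF e] e] phi_mult[OF e GF] phi_e by simp
  from fitting[OF Y N] show ?thesis
  proof
    assume "\<exists>B\<in>rhom n Y Y. ?N * B = 1\<^sub>m (fst Y) \<and> B * ?N = 1\<^sub>m (fst Y)"
    then obtain W where W: "W \<in> rhom n Y Y" "W * ?N = 1\<^sub>m (fst Y)" by blast
    have "W * (Q0 * G) * (F * P0) = 1\<^sub>m (fst Y)"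
      using W(2) by (simp only: assoc_mult_mat[OF rhom_carrier[OF W(1)] rhom_carrier[OF QG] rhom_carrier[OF FP]])
    then have "rep_iso n X Y"
      by (intro indecomposable_split_iso[OF X(1) Y FP rhom_mult[OF Xr Yrep Yrep QG W(1)]])
    then show ?thesis using X by blast
  next
    assume "\<exists>i. sqpow i ?N = 0\<^sub>m (fst Y) (fst Y)"
    then show ?thesis using phi_sandwich_nilpotent[OF N] * by auto
  qed
qed

text \<open>The largest such \<open>r\<close> is the rank of the bilinear form
  \<open>\<phi> (G F)\<close>; dual families avoid bases of the spaces of homomorphisms.\<close>

definition dual_system :: "'a rep \<Rightarrow> nat \<Rightarrow> (nat \<Rightarrow> 'a mat) \<Rightarrow> (nat \<Rightarrow> 'a mat) \<Rightarrow> bool" where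
  "dual_system X r F G \<longleftrightarrow> (\<forall>i<r. F i \<in> rhom n M X \<and> G i \<in> rhom n X M) \<and>
     (\<forall>i<r. \<forall>j<r. \<phi> (G i * F j) = (if i = j then 1 else 0))"

text \<open>Upper bound for the rank. Summands not isomorphic to \<open>Y\<close> contribute
  nothing. On a copy of \<open>Y\<close> one inserts \<open>1 = Q0 P0\<close>, and multiplicativity
  makes the form a product of a number depending on \<open>G\<close> and a number depending on
  \<open>F\<close>.\<close>

lemma dsum_list_rank:
  assumes "\<forall>N\<in>set Ns. indecomposable n N"
  shows "\<exists>A B. \<forall>F\<in>rhom n M (dsum_list Ns). \<forall>G\<in>rhom n (dsum_list Ns) M.
    \<phi> (G * F) = (\<Sum>l<length (filter (\<lambda>X. rep_iso n X Y) Ns). A l G * B l F)"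
  using assms
proof (induction Ns)
  case Nil
  have "\<phi> (G * F) = 0" if "F \<in> rhom n M (dsum_list [])" "G \<in> rhom n (dsum_list []) M" for F G :: "'a mat"
  proof -
    have "G * F = 0\<^sub>m (fst M) (fst M)"
      using rhom_carrier[OF that(1)] rhom_carrier[OF that(2)]
      by (intro eq_matI) (auto simp: dsum_list_def zero_rep_def scalar_prod_def)
    then show ?thesis by (simp add: phi_zero)
  qed
  then show ?case by auto
next
  case (Cons N Ns)
  let ?D = "dsum_list Ns" let ?k = "length (filter (\<lambda>X. rep_iso n X Y) Ns)"
  let ?d = "fst N" and ?e = "fst ?D"
  have N: "indecomposable n N" and Nr: "is_rep n N" using Cons.prems by (auto simp: indecomposable_def)
  have Dr: "is_rep n ?D" using Cons.prems by (intro is_rep_dsum_list) (auto simp: indecomposable_def)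
  note S = is_rep_dsum[OF Nr Dr]
  note h = dsum_homs[OF Nr Dr]
  from Cons obtain A B where AB: "\<forall>F\<in>rhom n M ?D. \<forall>G\<in>rhom n ?D M. \<phi> (G * F) = (\<Sum>l<?k. A l G * B l F)" by auto
  have split: "\<phi> (G * F) = \<phi> (G * inj1 ?d ?e * (prj1 ?d ?e * F)) + \<phi> (G * inj2 ?d ?e * (prj2 ?d ?e * F))"
    "\<phi> (G * inj2 ?d ?e * (prj2 ?d ?e * F)) = (\<Sum>l<?k. A l (G * inj2 ?d ?e) * B l (prj2 ?d ?e * F))"
    if F: "F \<in> rhom n M (dsum N ?D)" and G: "G \<in> rhom n (dsum N ?D) M" for F G
  proof -
    note m = rhom_mult[OF Nr S M h(1) G] rhom_mult[OF Dr S M h(2) G] rhom_mult[OF M S Nr F h(3)] rhom_mult[OF M S Dr F h(4)]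
    show "\<phi> (G * F) = \<phi> (G * inj1 ?d ?e * (prj1 ?d ?e * F)) + \<phi> (G * inj2 ?d ?e * (prj2 ?d ?e * F))"
      using rhom_carrier[OF F] rhom_carrier[OF G] phi_add[OF rhom_mult[OF M Nr M m(3,1)] rhom_mult[OF M Dr M m(4,2)]]
        rhom_two_step_factor[of F ?d ?e "fst M" G]
      by (simp only: fst_dsum)
    show "\<phi> (G * inj2 ?d ?e * (prj2 ?d ?e * F)) = (\<Sum>l<?k. A l (G * inj2 ?d ?e) * B l (prj2 ?d ?e * F))"
      using AB m by blast
  qed
  show ?case
  proof (cases "rep_iso n N Y")
    case False
    have "\<phi> (G * F) = (\<Sum>l<?k. A l (G * inj2 ?d ?e) * B l (prj2 ?d ?e * F))"
      if F: "F \<in> rhom n M (dsum N ?D)" and G: "G \<in> rhom n (dsum N ?D) M" for F G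
    proof -
      have "\<phi> (G * inj1 ?d ?e * (prj1 ?d ?e * F)) = 0"
        by (rule phi_through_other[OF N False rhom_mult[OF M S Nr F h(3)] rhom_mult[OF Nr S M h(1) G]])
      then show ?thesis by (simp only: split(1)[OF F G] split(2)[OF F G] add_0_left)
    qed
    then show ?thesis using False unfolding dsum_list_Cons
      by (intro exI[of _ "\<lambda>l G. A l (G * inj2 ?d ?e)"] exI[of _ "\<lambda>l F. B l (prj2 ?d ?e * F)"]) simp
  next
    case True
    from rep_isoE[OF True Nr Yrep] obtain T T' where
      T: "T \<in> rhom n N Y" "T' \<in> rhom n Y N" "T * T' = 1\<^sub>m (fst Y)" "T' * T = 1\<^sub>m (fst N)" .
    note c = rhom_carrier[OF T(1)] rhom_carrier[OF T(2)] rhom_carrier[OF P0] rhom_carrier[OF Q0]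
    have 1: "\<phi> (G * F) = \<phi> (G * T' * Q0) * \<phi> (P0 * (T * F))" if F: "F \<in> rhom n M N" and G: "G \<in> rhom n N M" for F G
    proof -
      note c' = rhom_carrier[OF F] rhom_carrier[OF G]
      note cT = mult_carrier_mat[OF c'(2) c(2)] mult_carrier_mat[OF c(1) c'(1)]
      have "G * T' * Q0 * (P0 * (T * F)) = G * T' * (Q0 * P0) * (T * F)"
        by (rule mat_mult4[OF cT(1) c(4,3) cT(2)])
      also have "\<dots> = G * T' * (T * F)" by (simp only: QP0 right_mult_one_mat[OF cT(1)])
      also have "\<dots> = G * (T' * T) * F" by (rule mat_mult4[OF c'(2) c(2,1) c'(1)])
      also have "\<dots> = G * F" by (simp only: T right_mult_one_mat[OF c'(2)])
      finally show ?thesis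
        using phi_mult[OF rhom_mult[OF M Yrep M Q0 rhom_mult[OF Yrep Nr M T(2) G]] rhom_mult[OF M Yrep M rhom_mult[OF M Nr Yrep F T(1)] P0]]
        by simp
    qed
    define A' where "A' l G = (if l < ?k then A l (G * inj2 ?d ?e) else \<phi> (G * inj1 ?d ?e * T' * Q0))" for l G
    define B' where "B' l F = (if l < ?k then B l (prj2 ?d ?e * F) else \<phi> (P0 * (T * (prj1 ?d ?e * F))))" for l F
    have "\<phi> (G * F) = (\<Sum>l<Suc ?k. A' l G * B' l F)"
      if F: "F \<in> rhom n M (dsum N ?D)" and G: "G \<in> rhom n (dsum N ?D) M" for F G
    proof -
      have "(\<Sum>l<?k. A' l G * B' l F) = (\<Sum>l<?k. A l (G * inj2 ?d ?e) * B l (prj2 ?d ?e * F))"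
        by (intro sum.cong) (simp_all add: A'_def B'_def)
      moreover have "A' ?k G * B' ?k F = \<phi> (G * inj1 ?d ?e * (prj1 ?d ?e * F))"
        unfolding 1[OF rhom_mult[OF M S Nr F h(3)] rhom_mult[OF Nr S M h(1) G]] A'_def B'_def by (simp only: less_irrefl if_False)
      ultimately show ?thesis by (simp only: sum.lessThan_Suc split(1)[OF F G] split(2)[OF F G] add.commute)
    qed
    then show ?thesis using True unfolding dsum_list_Cons
      by (intro exI[of _ A'] exI[of _ B']) simp
  qed
qed

text \<open>Lower bound for the rank: \<open>P0\<close> and \<open>Q0\<close>, transported to a copy
  of \<open>Y\<close>, form a pair of value 1, and pairs at different summands are
  orthogonal.\<close>

lemma dsum_list_system:
  assumes "\<forall>N\<in>set Ns. indecomposable n N"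
  shows "\<exists>F G. dual_system (dsum_list Ns) (length (filter (\<lambda>X. rep_iso n X Y) Ns)) F G"
  using assms
proof (induction Ns)
  case Nil
  then show ?case by (simp add: dual_system_def)
next
  case (Cons N Ns)
  let ?D = "dsum_list Ns" let ?k = "length (filter (\<lambda>X. rep_iso n X Y) Ns)"
  let ?d = "fst N" and ?e = "fst ?D"
  have N: "indecomposable n N" and Nr: "is_rep n N" using Cons.prems by (auto simp: indecomposable_def)
  have Dr: "is_rep n ?D" using Cons.prems by (intro is_rep_dsum_list) (auto simp: indecomposable_def)
  note S = is_rep_dsum[OF Nr Dr]
  note h = dsum_homs[OF Nr Dr]
  note ic = inj_prj_carrier[where ?'a = 'a, of ?d ?e]
  from Cons obtain F G where FG: "dual_system ?D ?k F G" by auto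
  then have FGh: "F i \<in> rhom n M ?D" "G i \<in> rhom n ?D M" if "i < ?k" for i
    using that by (auto simp: dual_system_def)
  define F1 where "F1 i = inj2 ?d ?e * F i" for i
  define G1 where "G1 i = G i * prj2 ?d ?e" for i
  have h1: "F1 i \<in> rhom n M (dsum N ?D)" "G1 i \<in> rhom n (dsum N ?D) M" if "i < ?k" for i
    unfolding F1_def G1_def
    by (rule rhom_mult[OF M Dr S FGh(1)[OF that] h(2)], rule rhom_mult[OF S Dr M h(4) FGh(2)[OF that]])
  have e1: "G1 i * F1 j = G i * F j" if "i < ?k" "j < ?k" for i j
    unfolding F1_def G1_def
      mat_mult4[OF rhom_carrier[OF FGh(2)[OF that(1)]] ic(4,2) rhom_carrier[OF FGh(1)[OF that(2)]]] inj_prj_eqs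
      right_mult_one_mat[OF rhom_carrier[OF FGh(2)[OF that(1)]]] ..
  show ?case
  proof (cases "rep_iso n N Y")
    case False
    have "dual_system (dsum N ?D) ?k F1 G1"
      using FG h1 e1 by (auto simp: dual_system_def)
    then show ?thesis using False unfolding dsum_list_Cons by auto
  next
    case True
    from rep_isoE[OF True Nr Yrep] obtain T T' where
      T: "T \<in> rhom n N Y" "T' \<in> rhom n Y N" "T * T' = 1\<^sub>m (fst Y)" "T' * T = 1\<^sub>m (fst N)" .
    note c = rhom_carrier[OF T(1)] rhom_carrier[OF T(2)] rhom_carrier[OF P0] rhom_carrier[OF Q0]
    define f where "f = inj1 ?d ?e * (T' * Q0)"
    define g where "g = P0 * T * prj1 ?d ?e"
    note cT = mult_carrier_mat[OF c(2,4)] mult_carrier_mat[OF c(3,1)]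
    have f: "f \<in> rhom n M (dsum N ?D)" unfolding f_def
      by (rule rhom_mult[OF M Nr S rhom_mult[OF M Yrep Nr Q0 T(2)] h(1)])
    have g: "g \<in> rhom n (dsum N ?D) M" unfolding g_def
      by (rule rhom_mult[OF S Nr M h(3) rhom_mult[OF Nr Yrep M T(1) P0]])
    have "g * f = P0 * T * (T' * Q0)" unfolding f_def g_def
      mat_mult4[OF cT(2) ic(3,1) cT(1)] inj_prj_eqs right_mult_one_mat[OF cT(2)] ..
    also have "\<dots> = P0 * Q0" unfolding mat_mult4[OF c(3,1,2,4)] T(3) right_mult_one_mat[OF c(3)] ..
    finally have gf: "\<phi> (g * f) = 1" by (simp add: phi_e)
    have gF: "\<phi> (g * F1 j) = 0" if "j < ?k" for j
      unfolding F1_def g_def mat_mult4[OF cT(2) ic(3,2) rhom_carrier[OF FGh(1)[OF that]]] inj_prj_eqs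
        right_mult_zero_mat[OF cT(2)] left_mult_zero_mat[OF rhom_carrier[OF FGh(1)[OF that]]] by (rule phi_zero)
    have Gf: "\<phi> (G1 j * f) = 0" if "j < ?k" for j
      unfolding G1_def f_def mat_mult4[OF rhom_carrier[OF FGh(2)[OF that]] ic(4,1) cT(1)] inj_prj_eqs
        right_mult_zero_mat[OF rhom_carrier[OF FGh(2)[OF that]]] left_mult_zero_mat[OF cT(1)] by (rule phi_zero)
    have "dual_system (dsum N ?D) (Suc ?k) (\<lambda>i. if i < ?k then F1 i else f) (\<lambda>i. if i < ?k then G1 i else g)"
      using FG h1 e1 f g gf gF Gf by (auto simp: dual_system_def less_Suc_eq)
    then show ?thesis using True unfolding dsum_list_Cons by auto
  qed
qed

lemma dual_system_transfer:
  assumes "is_rep n X" "is_rep n X'" "U \<in> rhom n X X'" "V \<in> rhom n X' X" "V * U = 1\<^sub>m (fst X)"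
    and "dual_system X r F G"
  shows "dual_system X' r (\<lambda>i. U * F i) (\<lambda>i. G i * V)"
proof -
  have h: "F i \<in> rhom n M X" "G i \<in> rhom n X M" if "i < r" for i using assms(6) that by (auto simp: dual_system_def)
  have "G i * V * (U * F j) = G i * F j" if "i < r" "j < r" for i j
    unfolding mat_mult4[OF rhom_carrier[OF h(2)[OF that(1)]] rhom_carrier[OF assms(4)] rhom_carrier[OF assms(3)] rhom_carrier[OF h(1)[OF that(2)]]]
     assms(5) right_mult_one_mat[OF rhom_carrier[OF h(2)[OF that(1)]]] ..
  then show ?thesis using assms(6) rhom_mult[OF M assms(1,2) h(1) assms(3)] rhom_mult[OF assms(2,1) M assms(4) h(2)]
    by (auto simp: dual_system_def)
qed

lemma dual_system_mono: "dual_system X r F G \<Longrightarrow> s \<le> r \<Longrightarrow> dual_system X s F G"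
  by (auto simp: dual_system_def)

text \<open>The left side does not mention the decomposition. This is the portion of the
  Krull-Schmidt theorem that makes the number described by \<open>ks_mult\<close> unique.\<close>

lemma decomposition_count:
  assumes X: "is_rep n X" and Ns: "\<forall>N\<in>set Ns. indecomposable n N" "rep_iso n X (dsum_list Ns)"
  shows "(\<exists>F G. dual_system X r F G) \<longleftrightarrow> r \<le> length (filter (\<lambda>X. rep_iso n X Y) Ns)"
proof -
  let ?D = "dsum_list Ns" let ?k = "length (filter (\<lambda>X. rep_iso n X Y) Ns)"
  have Dr: "is_rep n ?D" using Ns by (intro is_rep_dsum_list) (auto simp: indecomposable_def)
  from rep_isoE[OF Ns(2) X Dr] obtain U V where
    UV: "U \<in> rhom n X ?D" "V \<in> rhom n ?D X" "U * V = 1\<^sub>m (fst ?D)" "V * U = 1\<^sub>m (fst X)" .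
  show ?thesis
  proof
    assume "\<exists>F G. dual_system X r F G"
    then obtain F G where s: "dual_system ?D r F G" using dual_system_transfer[OF X Dr UV(1,2,4)] by blast
    from dsum_list_rank[OF Ns(1)] obtain A B where
      AB: "\<forall>F\<in>rhom n M ?D. \<forall>G\<in>rhom n ?D M. \<phi> (G * F) = (\<Sum>l<?k. A l G * B l F)" by blast
    show "r \<le> ?k"
      using s AB by (intro dual_system_le[where A = "\<lambda>l i. A l (G i)" and B = "\<lambda>l j. B l (F j)"])
        (auto simp: dual_system_def)
  next
    assume "r \<le> ?k"
    moreover obtain F G where "dual_system ?D ?k F G" using dsum_list_system[OF Ns(1)] by blast
    ultimately show "\<exists>F G. dual_system X r F G"
      using dual_system_transfer[OF Dr X UV(2,1,3)] dual_system_mono by blast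
  qed
qed

theorem le_ks_mult_iff:
  assumes X: "is_rep n X"
  shows "r \<le> ks_mult n X Y \<longleftrightarrow> (\<exists>F G. dual_system X r F G)"
proof -
  from decomposition_exists[OF X] obtain Ns where Ns: "\<forall>N\<in>set Ns. indecomposable n N" "rep_iso n X (dsum_list Ns)" by blast
  have "ks_mult n X Y = length (filter (\<lambda>X. rep_iso n X Y) Ns)"
    unfolding ks_mult_def
  proof (rule the_equality)
    show "\<exists>Ns'. (\<forall>X\<in>set Ns'. indecomposable n X) \<and> rep_iso n X (dsum_list Ns') \<and>
         length (filter (\<lambda>X. rep_iso n X Y) Ns) = length (filter (\<lambda>X. rep_iso n X Y) Ns')"
      using Ns by blast
  next
    fix k assume "\<exists>Ns'. (\<forall>X\<in>set Ns'. indecomposable n X) \<and> rep_iso n X (dsum_list Ns') \<and>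
         k = length (filter (\<lambda>X. rep_iso n X Y) Ns')"
    then have "(\<exists>F G. dual_system X r F G) \<longleftrightarrow> r \<le> k" for r using decomposition_count[OF X] by blast
    then have "r \<le> k \<longleftrightarrow> r \<le> length (filter (\<lambda>X. rep_iso n X Y) Ns)" for r
      using decomposition_count[OF X Ns, of r] by blast
    then show "k = length (filter (\<lambda>X. rep_iso n X Y) Ns)" by (meson order.antisym order.refl)
  qed
  then show ?thesis using decomposition_count[OF X Ns] by simp
qed

end

section \<open>Young subgroups and labellings\<close>

abbreviation iv :: "(nat \<Rightarrow> nat) \<Rightarrow> nat \<Rightarrow> nat" where "iv \<equiv> Hilbert_Choice.inv"

lemma Sn_comp: "g \<in> Sn n \<Longrightarrow> h \<in> Sn n \<Longrightarrow> g \<circ> h \<in> Sn n"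
  by (auto simp: Sn_def intro: permutes_compose)
lemma Sn_iv: "g \<in> Sn n \<Longrightarrow> iv g \<in> Sn n"
  by (auto simp: Sn_def intro: permutes_inv)
lemma Sn_id: "id \<in> Sn n" by (simp add: Sn_def permutes_id)
lemma Sn_bij: "g \<in> Sn n \<Longrightarrow> bij g" by (auto simp: Sn_def permutes_bij)
lemma Sn_iv_comp: "g \<in> Sn n \<Longrightarrow> iv g \<circ> g = id" by (auto simp: Sn_def permutes_inv_o)
lemma Sn_comp_iv: "g \<in> Sn n \<Longrightarrow> g \<circ> iv g = id" by (auto simp: Sn_def permutes_inv_o)
lemma Sn_iv_iv: "g \<in> Sn n \<Longrightarrow> iv (iv g) = g" by (simp add: Sn_bij inv_inv_eq)
lemma Sn_iv_distrib: "g \<in> Sn n \<Longrightarrow> h \<in> Sn n \<Longrightarrow> iv (g \<circ> h) = iv h \<circ> iv g"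
  by (simp add: Sn_bij o_inv_distrib)
lemma finite_Sn: "finite (Sn n)" unfolding Sn_def by (rule finite_permutations) simp
lemma Sn_in: "g \<in> Sn n \<Longrightarrow> g i \<in> {1..n} \<longleftrightarrow> i \<in> {1..n}"
  by (simp add: Sn_def permutes_in_image del: atLeastAtMost_iff)
lemma Sn_cancel: "g \<in> Sn n \<Longrightarrow> g \<circ> (iv g \<circ> h) = h" "g \<in> Sn n \<Longrightarrow> iv g \<circ> (g \<circ> h) = h"
  by (simp_all add: o_assoc Sn_iv_comp Sn_comp_iv)
lemma Sn_permutation: "g \<in> Sn n \<Longrightarrow> permutation g"
  by (auto simp: Sn_def permutation_permutes)
lemmas Sn_intros = Sn_comp Sn_iv Sn_id

definition res :: "nat set \<Rightarrow> (nat \<Rightarrow> nat) \<Rightarrow> nat \<Rightarrow> nat" where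
  "res A h = (\<lambda>x. if x \<in> A then h x else x)"

definition rsgn :: "nat set \<Rightarrow> (nat \<Rightarrow> nat) \<Rightarrow> 'a::field" where
  "rsgn A h = of_int (sign (res A h))"

lemma res_Sn:
  assumes "h \<in> Sn n" "\<And>x. h x \<in> A \<longleftrightarrow> x \<in> A"
  shows "res A h \<in> Sn n"
proof -
  have b: "bij h" using assms Sn_bij by blast
  have "bij (res A h)"
  proof (rule bijI')
    fix x y show "(res A h x = res A h y) = (x = y)"
      using assms(2) b by (metis bij_pointE res_def)
  next
    fix y show "\<exists>x. y = res A h x"
      using assms(2) b by (metis bij_pointE res_def)
  qed
  moreover have "res A h x = x" if "x \<notin> {1..n}" for x
    using assms(1) that by (auto simp: res_def Sn_def permutes_def)
  ultimately show ?thesis unfolding Sn_def mem_Collect_eq permutes_def by (metis bij_pointE)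
qed

lemma res_comp: "(\<And>x. h x \<in> A \<longleftrightarrow> x \<in> A) \<Longrightarrow> res A (g \<circ> h) = res A g \<circ> res A h"
  by (auto simp: res_def)

lemma rsgn_comp:
  assumes "g \<in> Sn n" "\<And>x. g x \<in> A \<longleftrightarrow> x \<in> A" "h \<in> Sn n" "\<And>x. h x \<in> A \<longleftrightarrow> x \<in> A"
  shows "rsgn A (g \<circ> h) = rsgn A g * (rsgn A h :: 'a::field)"
  using assms unfolding rsgn_def
  by (simp add: res_comp sign_compose Sn_permutation[OF res_Sn])

lemma res_id: "res A id = id" by (auto simp: res_def)
lemma rsgn_id: "rsgn A id = (1 :: 'a::field)" by (simp add: rsgn_def res_id)

lemma rsgn_square: "rsgn A h * rsgn A h = (1 :: 'a::field)"
  by (simp add: rsgn_def sign_def)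

lemma rsgn_conj:
  assumes "f \<in> Sn n" "h \<in> Sn n" "\<And>x. h x \<in> A \<longleftrightarrow> x \<in> A"
  shows "rsgn (f ` A) (f \<circ> h \<circ> iv f) = (rsgn A h :: 'a::field)"
proof -
  have b: "bij f" using assms Sn_bij by blast
  have "res (f ` A) (f \<circ> h \<circ> iv f) = f \<circ> res A h \<circ> iv f"
  proof
    fix x
    have "x \<in> f ` A \<longleftrightarrow> iv f x \<in> A" using b by (metis bij_inv_eq_iff image_iff)
    then show "res (f ` A) (f \<circ> h \<circ> iv f) x = (f \<circ> res A h \<circ> iv f) x"
      using b by (simp add: res_def bij_is_surj surj_f_inv_f)
  qed
  then have "sign (res (f ` A) (f \<circ> h \<circ> iv f)) = sign (f \<circ> res A h \<circ> iv f)" by simp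
  also have "\<dots> = sign f * sign (res A h) * sign (iv f)"
    using Sn_permutation[OF assms(1)] Sn_permutation[OF res_Sn[OF assms(2,3)]] Sn_permutation[OF Sn_iv[OF assms(1)]]
    by (simp add: sign_compose permutation_compose)
  also have "\<dots> = sign (res A h)"
    using Sn_permutation[OF assms(1)] by (simp add: sign_inverse sign_def evenperm_inv)
  finally show ?thesis by (simp add: rsgn_def)
qed

text \<open>A labelling splits the points into the blocks of a Young subgroup, which acts trivially on the
  blocks \<open>(False, k)\<close> and by sign on the blocks \<open>(True, k)\<close>.\<close>

type_synonym labelling = "nat \<Rightarrow> bool \<times> nat"

text \<open>The type of labels is left open because column groups have this form too. Elements of
  \<open>Sn n\<close> fix the points outside \<open>{1..n}\<close>, so labels there impose
  nothing.\<close>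

definition Hs :: "nat \<Rightarrow> (nat \<Rightarrow> 'b) \<Rightarrow> (nat \<Rightarrow> nat) set" where
  "Hs n c = {h \<in> Sn n. c \<circ> h = c}"

definition oddp :: "nat \<Rightarrow> labelling \<Rightarrow> nat set" where
  "oddp n c = {i \<in> {1..n}. fst (c i)}"

definition chi :: "nat \<Rightarrow> labelling \<Rightarrow> (nat \<Rightarrow> nat) \<Rightarrow> 'a::field" where
  "chi n c h = rsgn (oddp n c) h"

text \<open>Arbitrary labellings are allowed because straightening passes through modules whose
  labels are not sorted into partitions.\<close>

definition Ind :: "nat \<Rightarrow> labelling \<Rightarrow> 'a::field rep" where
  "Ind n c = induced n (Hs n c) (chi n c)"

lemma Hs_Sn: "h \<in> Hs n c \<Longrightarrow> h \<in> Sn n" by (simp add: Hs_def)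
lemma Hs_eq: "h \<in> Hs n c \<Longrightarrow> c (h i) = c i" by (auto simp: Hs_def o_def fun_eq_iff)
lemma Hs_comp: "g \<in> Hs n c \<Longrightarrow> h \<in> Hs n c \<Longrightarrow> g \<circ> h \<in> Hs n c"
  by (auto simp: Hs_def Sn_comp o_assoc)
lemma Hs_id: "id \<in> Hs n c" by (simp add: Hs_def Sn_id)
lemma Hs_iv: "h \<in> Hs n c \<Longrightarrow> iv h \<in> Hs n c"
proof -
  assume h: "h \<in> Hs n c"
  have "c \<circ> iv h = c \<circ> h \<circ> iv h" using h by (simp add: Hs_def)
  also have "\<dots> = c" by (simp only: o_assoc[symmetric] Sn_comp_iv[OF Hs_Sn[OF h]] comp_id)
  finally show ?thesis using h by (simp add: Hs_def Sn_iv)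
qed
lemma finite_Hs: "finite (Hs n c)" using finite_Sn by (auto simp: Hs_def)

lemma Hs_oddp: "h \<in> Hs n c \<Longrightarrow> h x \<in> oddp n c \<longleftrightarrow> x \<in> oddp n c"
  using Sn_in[OF Hs_Sn, of h n c x] by (auto simp: oddp_def Hs_eq)

lemma chi_comp: "g \<in> Hs n c \<Longrightarrow> h \<in> Hs n c \<Longrightarrow> chi n c (g \<circ> h) = chi n c g * (chi n c h :: 'a::field)"
  unfolding chi_def by (rule rsgn_comp[of _ n]) (auto simp: Hs_Sn Hs_oddp)

lemma chi_id: "chi n c id = (1::'a::field)" by (simp add: chi_def rsgn_id)
lemma chi_square: "chi n c h * chi n c h = (1::'a::field)" by (simp add: chi_def rsgn_square)
lemma chi_iv: "h \<in> Hs n c \<Longrightarrow> chi n c (iv h) = (chi n c h :: 'a::field)"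
proof -
  assume h: "h \<in> Hs n c"
  have "chi n c (iv h) * chi n c h = (1::'a)" using chi_comp[OF Hs_iv[OF h] h] Sn_iv_comp[OF Hs_Sn[OF h]] by (simp add: chi_id)
  then show ?thesis by (metis chi_square mult.left_neutral mult.assoc)
qed

text \<open>The Young subgroup is the stabilizer of \<open>c\<close> under rearrangement, so its
  left cosets correspond to the words \<open>c \<circ> iv g\<close>. From here on equality of words
  replaces membership in cosets.\<close>

lemma same_word_iff:
  assumes "g \<in> Sn n" "g' \<in> Sn n"
  shows "c \<circ> iv g = c \<circ> iv g' \<longleftrightarrow> iv g \<circ> g' \<in> Hs n c"
proof
  assume e: "c \<circ> iv g = c \<circ> iv g'"
  have "c \<circ> (iv g \<circ> g') = (c \<circ> iv g') \<circ> g'" using e by (simp add: o_assoc)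
  also have "\<dots> = c" using assms by (simp add: o_assoc[symmetric] Sn_iv_comp)
  finally show "iv g \<circ> g' \<in> Hs n c" using assms by (simp add: Hs_def Sn_comp Sn_iv)
next
  assume "iv g \<circ> g' \<in> Hs n c"
  then have "c \<circ> iv g \<circ> g' = c" by (simp add: Hs_def o_assoc)
  then have "c \<circ> iv g \<circ> (g' \<circ> iv g') = c \<circ> iv g'" by (simp add: o_assoc)
  then show "c \<circ> iv g = c \<circ> iv g'" using assms by (simp add: Sn_comp_iv)
qed

section \<open>The induced module in coordinates\<close>

text \<open>The choices made inside \<open>induced\<close> are given names, so that its dimension
  and entries become accessible.\<close>

definition csl :: "nat \<Rightarrow> labelling \<Rightarrow> (nat \<Rightarrow> nat) set list" where
  "csl n c = (SOME cs. distinct cs \<and> set cs = (\<lambda>g. (\<lambda>h. g \<circ> h) ` Hs n c) ` Sn n)"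
definition tdim :: "nat \<Rightarrow> labelling \<Rightarrow> nat" where "tdim n c = length (csl n c)"
definition tr :: "nat \<Rightarrow> labelling \<Rightarrow> nat \<Rightarrow> (nat \<Rightarrow> nat)" where "tr n c i = (SOME x. x \<in> csl n c ! i)"

lemma csl: "distinct (csl n c)" "set (csl n c) = (\<lambda>g. (\<lambda>h. g \<circ> h) ` Hs n c) ` Sn n"
proof -
  have "\<exists>cs. distinct cs \<and> set cs = (\<lambda>g. (\<lambda>h. g \<circ> h) ` Hs n c) ` Sn n"
    using finite_distinct_list[of "(\<lambda>g. (\<lambda>h. g \<circ> h) ` Hs n c) ` Sn n"] finite_Sn by blast
  then have "distinct (csl n c) \<and> set (csl n c) = (\<lambda>g. (\<lambda>h. g \<circ> h) ` Hs n c) ` Sn n"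
    unfolding csl_def by (rule someI_ex)
  then show "distinct (csl n c)" "set (csl n c) = (\<lambda>g. (\<lambda>h. g \<circ> h) ` Hs n c) ` Sn n" by auto
qed

lemma coset_words: "g \<in> Sn n \<Longrightarrow> (\<lambda>h. g \<circ> h) ` Hs n c = {x \<in> Sn n. c \<circ> iv x = c \<circ> iv g}"
proof safe
  fix h assume g: "g \<in> Sn n" and h: "h \<in> Hs n c"
  show "g \<circ> h \<in> Sn n" using g h by (simp add: Sn_comp Hs_Sn)
  show "c \<circ> iv (g \<circ> h) = c \<circ> iv g"
    using same_word_iff[of g n "g \<circ> h" c] g h by (simp add: Sn_comp Hs_Sn Sn_cancel)
next
  fix x assume g: "g \<in> Sn n" and x: "x \<in> Sn n" "c \<circ> iv x = c \<circ> iv g"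
  then have "iv g \<circ> x \<in> Hs n c" using same_word_iff[of g n x c] by simp
  then show "x \<in> (\<lambda>h. g \<circ> h) ` Hs n c" using g by (intro image_eqI[of _ _ "iv g \<circ> x"]) (simp_all add: Sn_cancel)
qed

lemma tr_mem:
  assumes "i < tdim n c"
  shows "tr n c i \<in> Sn n" "csl n c ! i = {x \<in> Sn n. c \<circ> iv x = c \<circ> iv (tr n c i)}"
proof -
  have "csl n c ! i \<in> set (csl n c)" using assms by (simp add: tdim_def)
  then obtain g where g: "g \<in> Sn n" "csl n c ! i = (\<lambda>h. g \<circ> h) ` Hs n c" using csl(2) by blast
  then have e: "csl n c ! i = {x \<in> Sn n. c \<circ> iv x = c \<circ> iv g}" using coset_words by blast
  then have "g \<in> csl n c ! i" using g by simp
  then have "tr n c i \<in> csl n c ! i" unfolding tr_def by (rule someI[of "\<lambda>x. x \<in> csl n c ! i"])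
  then show "tr n c i \<in> Sn n" "csl n c ! i = {x \<in> Sn n. c \<circ> iv x = c \<circ> iv (tr n c i)}" using e by auto
qed

lemma tr_exists:
  assumes "x \<in> Sn n"
  shows "\<exists>i<tdim n c. c \<circ> iv x = c \<circ> iv (tr n c i)"
proof -
  have "(\<lambda>h. x \<circ> h) ` Hs n c \<in> set (csl n c)" using csl(2) assms by blast
  then obtain i where i: "i < tdim n c" "csl n c ! i = (\<lambda>h. x \<circ> h) ` Hs n c"
    by (auto simp: tdim_def in_set_conv_nth)
  have "x \<in> csl n c ! i" unfolding i(2) coset_words[OF assms] using assms by simp
  then show ?thesis using tr_mem(2)[OF i(1)] i(1) by auto
qed

lemma tr_inj:
  assumes "i < tdim n c" "j < tdim n c" "c \<circ> iv (tr n c i) = c \<circ> iv (tr n c j)"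
  shows "i = j"
proof -
  have "csl n c ! i = csl n c ! j" using tr_mem(2)[OF assms(1)] tr_mem(2)[OF assms(2)] assms(3) by simp
  then show ?thesis using csl(1) assms(1,2) by (simp add: tdim_def nth_eq_iff_index_eq)
qed

lemma fst_Ind: "fst (Ind n c) = tdim n c"
  by (simp add: Ind_def induced_def Let_def tdim_def csl_def)

lemma snd_Ind:
  assumes "g \<in> Sn n"
  shows "snd (Ind n c) g = mat (tdim n c) (tdim n c) (\<lambda>(i, j).
    if c \<circ> iv (g \<circ> tr n c j) = c \<circ> iv (tr n c i) then chi n c (iv (tr n c i) \<circ> g \<circ> tr n c j) else (0::'a::field))"
proof -
  have "snd (Ind n c) g = mat (tdim n c) (tdim n c) (\<lambda>(i, j).
    if g \<circ> tr n c j \<in> csl n c ! i then chi n c (iv (tr n c i) \<circ> g \<circ> tr n c j) else (0::'a))"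
    unfolding Ind_def induced_def Let_def tdim_def tr_def csl_def by simp
  also have "\<dots> = mat (tdim n c) (tdim n c) (\<lambda>(i, j).
    if c \<circ> iv (g \<circ> tr n c j) = c \<circ> iv (tr n c i) then chi n c (iv (tr n c i) \<circ> g \<circ> tr n c j) else 0)"
    using assms by (intro cong_mat) (auto simp: tr_mem Sn_comp)
  finally show ?thesis .
qed

definition idx :: "nat \<Rightarrow> labelling \<Rightarrow> (nat \<Rightarrow> nat) \<Rightarrow> nat" where
  "idx n c x = (SOME i. i < tdim n c \<and> c \<circ> iv x = c \<circ> iv (tr n c i))"

lemma idx:
  assumes "x \<in> Sn n"
  shows "idx n c x < tdim n c" "c \<circ> iv x = c \<circ> iv (tr n c (idx n c x))"
  using someI_ex[OF tr_exists[OF assms, of c, unfolded Bex_def]] by (auto simp: idx_def)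

lemma idx_eqI: "x \<in> Sn n \<Longrightarrow> i < tdim n c \<Longrightarrow> c \<circ> iv x = c \<circ> iv (tr n c i) \<Longrightarrow> idx n c x = i"
  using idx[of x n c] tr_inj[of "idx n c x" n c i] by simp

lemma idx_Hs: "x \<in> Sn n \<Longrightarrow> iv (tr n c (idx n c x)) \<circ> x \<in> Hs n c"
  using same_word_iff[of "tr n c (idx n c x)" n x c] idx[of x n c] tr_mem(1)[of "idx n c x" n c] by simp

lemma word_mult_right: "x \<in> Sn n \<Longrightarrow> h \<in> Hs n c \<Longrightarrow> c \<circ> iv (x \<circ> h) = c \<circ> iv x"
  using same_word_iff[of x n "x \<circ> h" c] by (simp add: Sn_comp Hs_Sn Sn_cancel)

lemma idx_mult_right: "x \<in> Sn n \<Longrightarrow> h \<in> Hs n c \<Longrightarrow> idx n c (x \<circ> h) = idx n c x"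
  using idx[of x n c] word_mult_right[of x n h c] by (intro idx_eqI) (simp_all add: Sn_comp Hs_Sn)

lemma idx_tr: "i < tdim n c \<Longrightarrow> idx n c (tr n c i) = i"
  by (rule idx_eqI) (auto simp: tr_mem)

lemma sum_idx:
  assumes "x \<in> Sn n"
  shows "(\<Sum>l<tdim n c. if c \<circ> iv x = c \<circ> iv (tr n c l) then F l else 0) = (F (idx n c x) :: 'b::comm_monoid_add)"
proof -
  have "(\<Sum>l<tdim n c. if c \<circ> iv x = c \<circ> iv (tr n c l) then F l else 0) = (\<Sum>l<tdim n c. if l = idx n c x then F l else 0)"
    using idx[OF assms, of c] idx_eqI[OF assms, of _ c] by (intro sum.cong refl) auto
  then show ?thesis using idx[OF assms, of c] by simp
qed

text \<open>In general the value depends on the chosen representatives; it does not when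
  \<open>F\<close> is invariant on the right under \<open>Hs n c\<close>, which is what
  \<open>rinv\<close> records.\<close>

definition csum :: "nat \<Rightarrow> labelling \<Rightarrow> ((nat \<Rightarrow> nat) \<Rightarrow> 'b::comm_monoid_add) \<Rightarrow> 'b" where
  "csum n c F = (\<Sum>l<tdim n c. F (tr n c l))"

definition rinv :: "nat \<Rightarrow> labelling \<Rightarrow> ((nat \<Rightarrow> nat) \<Rightarrow> 'b) \<Rightarrow> bool" where
  "rinv n c F \<longleftrightarrow> (\<forall>x\<in>Sn n. \<forall>h\<in>Hs n c. F (x \<circ> h) = F x)"

lemma rinv_word: "rinv n c F \<Longrightarrow> x \<in> Sn n \<Longrightarrow> y \<in> Sn n \<Longrightarrow> c \<circ> iv x = c \<circ> iv y \<Longrightarrow> F x = F y"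
  using same_word_iff[of x n y c] Sn_cancel(1)[of x n y] unfolding rinv_def by metis

lemma csum_translate:
  assumes F: "rinv n c F" and z: "z \<in> Sn n"
  shows "csum n c (\<lambda>x. F (z \<circ> x)) = csum n c F"
proof -
  have inj: "i = j" if "i < tdim n c" "j < tdim n c" "idx n c (z \<circ> tr n c i) = idx n c (z \<circ> tr n c j)" for i j
  proof -
    have "c \<circ> iv (z \<circ> tr n c i) = c \<circ> iv (z \<circ> tr n c j)"
      using idx(2)[of "z \<circ> tr n c i" n c] idx(2)[of "z \<circ> tr n c j" n c] that z by (simp add: Sn_comp tr_mem)
    then have "c \<circ> iv (tr n c i) = c \<circ> iv (tr n c j)"
      using same_word_iff[of "z \<circ> tr n c i" n "z \<circ> tr n c j" c] same_word_iff[of "tr n c i" n "tr n c j" c] that z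
      by (simp add: Sn_comp tr_mem Sn_iv_distrib o_assoc[symmetric] Sn_cancel)
    then show ?thesis using tr_inj that by blast
  qed
  have b: "bij_betw (\<lambda>i. idx n c (z \<circ> tr n c i)) {..<tdim n c} {..<tdim n c}"
    unfolding bij_betw_def
  proof
    show i: "inj_on (\<lambda>i. idx n c (z \<circ> tr n c i)) {..<tdim n c}" using inj by (auto simp: inj_on_def)
    show "(\<lambda>i. idx n c (z \<circ> tr n c i)) ` {..<tdim n c} = {..<tdim n c}"
      using z by (intro endo_inj_surj i) (auto simp: idx Sn_comp tr_mem)
  qed
  have "csum n c F = (\<Sum>i<tdim n c. F (tr n c (idx n c (z \<circ> tr n c i))))"
    unfolding csum_def by (rule sum.reindex_bij_betw[OF b, symmetric])
  also have "\<dots> = (\<Sum>i<tdim n c. F (z \<circ> tr n c i))"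
    using z by (intro sum.cong refl rinv_word[OF F] idx(2)[symmetric]) (auto simp: Sn_comp tr_mem idx)
  finally show ?thesis by (simp add: csum_def)
qed

text \<open>Sums over cosets are rewritten over words because a permutation acts on words by
  composition, with no choice of representatives; the rotation will act this way.\<close>

definition words :: "nat \<Rightarrow> labelling \<Rightarrow> labelling set" where
  "words n c = (\<lambda>g. c \<circ> iv g) ` Sn n"

definition wrep :: "nat \<Rightarrow> labelling \<Rightarrow> labelling \<Rightarrow> nat \<Rightarrow> nat" where
  "wrep n c w = (SOME g. g \<in> Sn n \<and> c \<circ> iv g = w)"

lemma wrep: assumes "w \<in> words n c" shows "wrep n c w \<in> Sn n" "c \<circ> iv (wrep n c w) = w"
proof -
  have "\<exists>g. g \<in> Sn n \<and> c \<circ> iv g = w" using assms by (auto simp: words_def)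
  then have "wrep n c w \<in> Sn n \<and> c \<circ> iv (wrep n c w) = w" unfolding wrep_def by (rule someI_ex)
  then show "wrep n c w \<in> Sn n" "c \<circ> iv (wrep n c w) = w" by auto
qed

lemma finite_words: "finite (words n c)" using finite_Sn by (simp add: words_def)

lemma csum_words:
  assumes F: "rinv n c F"
  shows "csum n c F = (\<Sum>w\<in>words n c. F (wrep n c w))"
proof -
  have b: "bij_betw (\<lambda>i. c \<circ> iv (tr n c i)) {..<tdim n c} (words n c)"
    unfolding bij_betw_def inj_on_def words_def
  proof (intro conjI equalityI subsetI)
    fix w assume "w \<in> (\<lambda>g. c \<circ> iv g) ` Sn n"
    then obtain g where g: "g \<in> Sn n" "w = c \<circ> iv g" by blast
    then show "w \<in> (\<lambda>i. c \<circ> iv (tr n c i)) ` {..<tdim n c}" using idx[OF g(1), of c] by blast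
  qed (use tr_inj[of _ n c] tr_mem(1)[of _ n c] in \<open>auto\<close>)
  have "(\<Sum>w\<in>words n c. F (wrep n c w)) = (\<Sum>i<tdim n c. F (wrep n c (c \<circ> iv (tr n c i))))"
    by (rule sum.reindex_bij_betw[OF b, symmetric])
  also have "\<dots> = csum n c F" unfolding csum_def
    using tr_mem(1) by (intro sum.cong refl rinv_word[OF F]) (auto simp: words_def wrep)
  finally show ?thesis by simp
qed

lemma is_rep_Ind: "is_rep n (Ind n c :: 'a::field rep)"
proof (rule is_repI)
  fix g assume "g \<in> Sn n" then show "snd (Ind n c :: 'a rep) g \<in> carrier_mat (fst (Ind n c :: 'a rep)) (fst (Ind n c :: 'a rep))"
    by (simp add: snd_Ind fst_Ind)
next
  show "snd (Ind n c) id = (1\<^sub>m (fst (Ind n c :: 'a rep)) :: 'a mat)"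
    unfolding snd_Ind[OF Sn_id] fst_Ind
    using tr_inj[of _ n c] by (intro eq_matI) (auto simp: Sn_iv_comp[OF tr_mem(1)] chi_id)
next
  fix g h assume g: "g \<in> Sn n" and h: "h \<in> Sn n"
  show "snd (Ind n c) (g \<circ> h) = snd (Ind n c) g * (snd (Ind n c) h :: 'a mat)"
  proof (rule eq_matI)
    fix i j assume "i < dim_row (snd (Ind n c) g * (snd (Ind n c) h :: 'a mat))" "j < dim_col (snd (Ind n c) g * (snd (Ind n c) h :: 'a mat))"
    then have ij: "i < tdim n c" "j < tdim n c" using g h by (auto simp: snd_Ind)
    let ?r = "tr n c"
    have x: "h \<circ> ?r j \<in> Sn n" using h ij by (simp add: Sn_comp tr_mem)
    let ?l = "idx n c (h \<circ> ?r j)"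
    have l: "?l < tdim n c" using idx x by blast
    have k: "iv (?r ?l) \<circ> (h \<circ> ?r j) \<in> Hs n c" by (rule idx_Hs[OF x])
    have rl: "?r ?l \<in> Sn n" and ri: "?r i \<in> Sn n" and rj: "?r j \<in> Sn n" using tr_mem(1) l ij by auto
    \<comment> \<open>Only the coset of \<open>h \<circ> tr n c j\<close> contributes to the sum
      over \<open>l\<close>; there the arguments of the two characters multiply to the argument
      belonging to \<open>g \<circ> h\<close>.\<close>
    have "(snd (Ind n c) g * (snd (Ind n c) h :: 'a mat)) $$ (i, j) =
      (\<Sum>l<tdim n c. (if c \<circ> iv (g \<circ> ?r l) = c \<circ> iv (?r i) then chi n c (iv (?r i) \<circ> g \<circ> ?r l) else 0) *
         (if c \<circ> iv (h \<circ> ?r j) = c \<circ> iv (?r l) then chi n c (iv (?r l) \<circ> h \<circ> ?r j) else 0))"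
      using ij g h by (simp add: snd_Ind scalar_prod_def atLeast0LessThan)
    also have "\<dots> = (\<Sum>l<tdim n c. if c \<circ> iv (h \<circ> ?r j) = c \<circ> iv (?r l) then
         (if c \<circ> iv (g \<circ> ?r l) = c \<circ> iv (?r i) then chi n c (iv (?r i) \<circ> g \<circ> ?r l) else 0) * chi n c (iv (?r l) \<circ> h \<circ> ?r j) else 0)"
      by (intro sum.cong) auto
    also have "\<dots> = (if c \<circ> iv (g \<circ> ?r ?l) = c \<circ> iv (?r i) then chi n c (iv (?r i) \<circ> g \<circ> ?r ?l) else 0) * chi n c (iv (?r ?l) \<circ> h \<circ> ?r j)"
      by (rule sum_idx[OF x])
    also have "\<dots> = (if c \<circ> iv (g \<circ> h \<circ> ?r j) = c \<circ> iv (?r i) then chi n c (iv (?r i) \<circ> (g \<circ> h) \<circ> ?r j) else 0)"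
    proof -
      have e: "g \<circ> h \<circ> ?r j = g \<circ> ?r ?l \<circ> (iv (?r ?l) \<circ> (h \<circ> ?r j))"
        using rl by (simp add: o_assoc[symmetric] Sn_cancel)
      have w: "c \<circ> iv (g \<circ> h \<circ> ?r j) = c \<circ> iv (g \<circ> ?r ?l)"
        unfolding e using word_mult_right[OF _ k, of "g \<circ> ?r ?l"] g rl by (simp add: Sn_comp)
      show ?thesis
      proof (cases "c \<circ> iv (g \<circ> ?r ?l) = c \<circ> iv (?r i)")
        case True
        have "iv (?r i) \<circ> (g \<circ> ?r ?l) \<in> Hs n c" using same_word_iff[of "?r i" n "g \<circ> ?r ?l" c] True ri g rl by (simp add: Sn_comp)
        from chi_comp[OF this k, symmetric] have "chi n c (iv (?r i) \<circ> (g \<circ> ?r ?l)) * chi n c (iv (?r ?l) \<circ> (h \<circ> ?r j)) = (chi n c (iv (?r i) \<circ> (g \<circ> (h \<circ> ?r j))) :: 'a)"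
          using rl by (simp add: o_assoc[symmetric] Sn_cancel)
        then show ?thesis using True w by (simp add: o_assoc)
      next
        case False
        then show ?thesis using w by simp
      qed
    qed
    also have "\<dots> = snd (Ind n c) (g \<circ> h) $$ (i, j)" using ij g h by (simp add: snd_Ind Sn_comp)
    finally show "snd (Ind n c) (g \<circ> h) $$ (i, j) = (snd (Ind n c) g * (snd (Ind n c) h :: 'a mat)) $$ (i, j)" by simp
  qed (use g h in \<open>auto simp: snd_Ind Sn_comp\<close>)
qed

section \<open>Homomorphisms between signed permutation modules\<close>

text \<open>Mackey's description of the homomorphisms from \<open>Ind n c\<close> to
  \<open>Ind n c'\<close>, free of coset representatives.\<close>

definition biequiv :: "nat \<Rightarrow> labelling \<Rightarrow> labelling \<Rightarrow> ((nat \<Rightarrow> nat) \<Rightarrow> 'a::field) set" where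
  "biequiv n c c' = {v. \<forall>h\<in>Hs n c. \<forall>g\<in>Sn n. \<forall>k\<in>Hs n c'. v (h \<circ> g \<circ> k) = chi n c h * v g * chi n c' k}"

lemma biequivD:
  "v \<in> biequiv n c c' \<Longrightarrow> h \<in> Hs n c \<Longrightarrow> g \<in> Sn n \<Longrightarrow> k \<in> Hs n c' \<Longrightarrow> v (h \<circ> g \<circ> k) = chi n c h * v g * chi n c' k"
  by (simp add: biequiv_def)

lemma biequiv_left: "v \<in> biequiv n c c' \<Longrightarrow> h \<in> Hs n c \<Longrightarrow> g \<in> Sn n \<Longrightarrow> v (h \<circ> g) = chi n c h * v g"
  using biequivD[of v n c c' h g id] by (simp add: Hs_id chi_id)

lemma biequiv_right: "v \<in> biequiv n c c' \<Longrightarrow> g \<in> Sn n \<Longrightarrow> k \<in> Hs n c' \<Longrightarrow> v (g \<circ> k) = v g * chi n c' k"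
  using biequivD[of v n c c' id g k] by (simp add: Hs_id chi_id)

lemma biequivI:
  assumes "\<And>h g. h \<in> Hs n c \<Longrightarrow> g \<in> Sn n \<Longrightarrow> v (h \<circ> g) = chi n c h * v g"
    "\<And>g k. g \<in> Sn n \<Longrightarrow> k \<in> Hs n c' \<Longrightarrow> v (g \<circ> k) = v g * chi n c' k"
  shows "v \<in> biequiv n c c'"
  unfolding biequiv_def using assms by (simp add: Sn_comp Hs_Sn mult.assoc)

text \<open>The analogue of transposing a matrix. It turns maps back to \<open>Ind n c0\<close> into
  elements of \<open>biequiv n c0 c\<close>, so that both arguments of the later form live in one
  space.\<close>

lemma biequiv_flip:
  assumes "v \<in> biequiv n c c'" shows "(\<lambda>x. v (iv x)) \<in> biequiv n c' c"
proof (rule biequivI)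
  fix h g assume h: "h \<in> Hs n c'" and g: "g \<in> Sn n"
  show "v (iv (h \<circ> g)) = chi n c' h * v (iv g)"
    using biequiv_right[OF assms Sn_iv[OF g] Hs_iv[OF h]] h g by (simp add: Sn_iv_distrib[of _ n] Hs_Sn chi_iv mult.commute)
next
  fix g k assume k: "k \<in> Hs n c" and g: "g \<in> Sn n"
  show "v (iv (g \<circ> k)) = v (iv g) * chi n c k"
    using biequiv_left[OF assms Hs_iv[OF k] Sn_iv[OF g]] k g by (simp add: Sn_iv_distrib[of _ n] Hs_Sn chi_iv mult.commute)
qed

text \<open>The matrix of the homomorphism with kernel \<open>v\<close>; \<open>vof\<close> below is the inverse construction.\<close>

definition hmat :: "nat \<Rightarrow> labelling \<Rightarrow> labelling \<Rightarrow> ((nat \<Rightarrow> nat) \<Rightarrow> 'a::field) \<Rightarrow> 'a mat" where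
  "hmat n c c' v = mat (tdim n c') (tdim n c) (\<lambda>(i, j). v (iv (tr n c j) \<circ> tr n c' i))"

lemma hmat_rhom:
  assumes v: "v \<in> biequiv n c c'"
  shows "hmat n c c' v \<in> rhom n (Ind n c) (Ind n c')"
proof -
  have "hmat n c c' v * snd (Ind n c) g = snd (Ind n c') g * hmat n c c' v" if g: "g \<in> Sn n" for g
  proof (rule eq_matI)
    fix i j assume "i < dim_row (snd (Ind n c') g * hmat n c c' v)" "j < dim_col (snd (Ind n c') g * hmat n c c' v)"
    then have i: "i < tdim n c'" and j: "j < tdim n c" using g by (auto simp: snd_Ind hmat_def)
    let ?r = "tr n c" and ?s = "tr n c'"
    have rj: "?r j \<in> Sn n" and si: "?s i \<in> Sn n" using i j tr_mem(1) by auto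
    let ?l = "idx n c (g \<circ> ?r j)" and ?m = "idx n c' (iv g \<circ> ?s i)"
    have x: "g \<circ> ?r j \<in> Sn n" and y: "iv g \<circ> ?s i \<in> Sn n" using rj si g by (auto intro: Sn_intros)
    have rl: "?r ?l \<in> Sn n" and sm: "?s ?m \<in> Sn n" using idx(1)[OF x] idx(1)[OF y] tr_mem(1) by blast+
    \<comment> \<open>In either product a single summand survives, and both survivors equal
      \<open>v\<close> at \<open>iv (tr n c j) \<circ> iv g \<circ> tr n c' i\<close>.\<close>
    have "(hmat n c c' v * snd (Ind n c) g) $$ (i, j) = (\<Sum>l<tdim n c. v (iv (?r l) \<circ> ?s i) *
       (if c \<circ> iv (g \<circ> ?r j) = c \<circ> iv (?r l) then chi n c (iv (?r l) \<circ> g \<circ> ?r j) else 0))"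
      using i j g by (simp add: hmat_def snd_Ind scalar_prod_def atLeast0LessThan)
    also have "\<dots> = (\<Sum>l<tdim n c. if c \<circ> iv (g \<circ> ?r j) = c \<circ> iv (?r l) then v (iv (?r l) \<circ> ?s i) * chi n c (iv (?r l) \<circ> g \<circ> ?r j) else 0)"
      by (intro sum.cong) auto
    also have "\<dots> = v (iv (?r ?l) \<circ> ?s i) * chi n c (iv (?r ?l) \<circ> g \<circ> ?r j)" by (rule sum_idx[OF x])
    also have "\<dots> = v (iv (iv (?r ?l) \<circ> (g \<circ> ?r j)) \<circ> (iv (?r ?l) \<circ> ?s i))"
      using biequiv_left[OF v Hs_iv[OF idx_Hs[OF x]], of "iv (?r ?l) \<circ> ?s i"] rl si chi_iv[OF idx_Hs[OF x], where ?'a = 'a]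
      by (simp add: Sn_comp Sn_iv o_assoc mult.commute)
    also have "iv (iv (?r ?l) \<circ> (g \<circ> ?r j)) \<circ> (iv (?r ?l) \<circ> ?s i) = iv (?r j) \<circ> (iv g \<circ> ?s i)"
      using rl rj g by (simp add: Sn_iv_distrib[of _ n] Sn_intros Sn_iv_iv[of _ n] o_assoc[symmetric] Sn_cancel)
    finally have 1: "(hmat n c c' v * snd (Ind n c) g) $$ (i, j) = v (iv (?r j) \<circ> (iv g \<circ> ?s i))" .
    have w: "c' \<circ> iv (g \<circ> ?s m) = c' \<circ> iv (?s i) \<longleftrightarrow> c' \<circ> iv (iv g \<circ> ?s i) = c' \<circ> iv (?s m)" if "m < tdim n c'" for m
    proof -
      have "?s m \<in> Sn n" using that tr_mem(1) by blast
      then show ?thesis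
        using same_word_iff[of "iv g \<circ> ?s i" n "?s m" c'] same_word_iff[of "?s i" n "g \<circ> ?s m" c'] g si
        by (auto simp: Sn_iv_distrib[of _ n] Sn_intros Sn_iv_iv[of _ n] o_assoc)
    qed
    have "(snd (Ind n c') g * hmat n c c' v) $$ (i, j) = (\<Sum>m<tdim n c'.
       (if c' \<circ> iv (g \<circ> ?s m) = c' \<circ> iv (?s i) then chi n c' (iv (?s i) \<circ> g \<circ> ?s m) else 0) * v (iv (?r j) \<circ> ?s m))"
      using i j g by (simp add: hmat_def snd_Ind scalar_prod_def atLeast0LessThan)
    also have "\<dots> = (\<Sum>m<tdim n c'. if c' \<circ> iv (iv g \<circ> ?s i) = c' \<circ> iv (?s m) then
        chi n c' (iv (?s i) \<circ> g \<circ> ?s m) * v (iv (?r j) \<circ> ?s m) else 0)"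
      using w by (intro sum.cong) auto
    also have "\<dots> = chi n c' (iv (?s i) \<circ> g \<circ> ?s ?m) * v (iv (?r j) \<circ> ?s ?m)" by (rule sum_idx[OF y])
    also have "iv (?s i) \<circ> g \<circ> ?s ?m = iv (iv (?s ?m) \<circ> (iv g \<circ> ?s i))"
      using sm si g by (simp add: Sn_iv_distrib[of _ n] Sn_intros Sn_iv_iv[of _ n] o_assoc)
    also have "chi n c' \<dots> = chi n c' (iv (?s ?m) \<circ> (iv g \<circ> ?s i))" by (rule chi_iv[OF idx_Hs[OF y]])
    also have "\<dots> * v (iv (?r j) \<circ> ?s ?m) = v (iv (?r j) \<circ> ?s ?m \<circ> (iv (?s ?m) \<circ> (iv g \<circ> ?s i)))"
      using biequiv_right[OF v _ idx_Hs[OF y], of "iv (?r j) \<circ> ?s ?m"] rj sm by (simp add: Sn_intros mult.commute)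
    also have "iv (?r j) \<circ> ?s ?m \<circ> (iv (?s ?m) \<circ> (iv g \<circ> ?s i)) = iv (?r j) \<circ> (iv g \<circ> ?s i)"
      using sm by (simp add: o_assoc[symmetric] Sn_cancel)
    finally show "(hmat n c c' v * snd (Ind n c) g) $$ (i, j) = (snd (Ind n c') g * hmat n c c' v) $$ (i, j)"
      using 1 by (simp add: o_def)
  qed (use g in \<open>auto simp: hmat_def snd_Ind\<close>)
  then show ?thesis by (simp add: rhom_def fst_Ind hmat_def)
qed

text \<open>Extends the entries of \<open>P\<close> from coset representatives to all pairs of
  permutations; the characters compensate for the choice of representatives.\<close>

definition vker :: "nat \<Rightarrow> labelling \<Rightarrow> labelling \<Rightarrow> 'a::field mat \<Rightarrow> (nat \<Rightarrow> nat) \<Rightarrow> (nat \<Rightarrow> nat) \<Rightarrow> 'a" where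
  "vker n c c' P x y = chi n c' (iv (tr n c' (idx n c' x)) \<circ> x) * P $$ (idx n c' x, idx n c y) * chi n c (iv (tr n c (idx n c y)) \<circ> y)"

definition vof :: "nat \<Rightarrow> labelling \<Rightarrow> labelling \<Rightarrow> 'a::field mat \<Rightarrow> (nat \<Rightarrow> nat) \<Rightarrow> 'a" where
  "vof n c c' P x = vker n c c' P x id"

lemma chi_idx_mult: "x \<in> Sn n \<Longrightarrow> k \<in> Hs n c \<Longrightarrow>
   chi n c (iv (tr n c (idx n c (x \<circ> k))) \<circ> (x \<circ> k)) = (chi n c (iv (tr n c (idx n c x)) \<circ> x) * chi n c k :: 'a::field)"
  unfolding idx_mult_right using chi_comp[OF idx_Hs[of x n c], of k, where ?'a = 'a] by (simp add: o_assoc)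

lemma vker_right: "x \<in> Sn n \<Longrightarrow> k \<in> Hs n c' \<Longrightarrow> vker n c c' P (x \<circ> k) y = chi n c' k * vker n c c' P x y"
  by (simp only: vker_def chi_idx_mult) (simp add: idx_mult_right)

lemma vker_right2: "y \<in> Sn n \<Longrightarrow> k \<in> Hs n c \<Longrightarrow> vker n c c' P x (y \<circ> k) = chi n c k * vker n c c' P x y"
  by (simp only: vker_def chi_idx_mult) (simp add: idx_mult_right)

lemma vker_tr: "i < tdim n c' \<Longrightarrow> j < tdim n c \<Longrightarrow> vker n c c' P (tr n c' i) (tr n c j) = P $$ (i, j)"
  by (simp add: vker_def idx_tr Sn_iv_comp[OF tr_mem(1)] chi_id)

text \<open>This invariance is the intertwining property of \<open>P\<close>. It is checked with
  representatives and then carried to all pairs by the characters.\<close>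

lemma vker_equiv:
  assumes P: "P \<in> rhom n (Ind n c) (Ind n c')" and g: "g \<in> Sn n" and x: "x \<in> Sn n" and y: "y \<in> Sn n"
  shows "vker n c c' P (g \<circ> x) (g \<circ> y) = vker n c c' P x y"
proof -
  let ?r = "tr n c" and ?s = "tr n c'"
  have Pc: "P \<in> carrier_mat (tdim n c') (tdim n c)" using rhom_carrier[OF P] by (simp add: fst_Ind)
  have A: "vker n c c' P (?s i) (g \<circ> ?r j) = vker n c c' P (iv g \<circ> ?s i) (?r j)"
    if i: "i < tdim n c'" and j: "j < tdim n c" and g: "g \<in> Sn n" for i j g
  proof -
    have rj: "?r j \<in> Sn n" and si: "?s i \<in> Sn n" using i j tr_mem(1) by auto
    let ?l = "idx n c (g \<circ> ?r j)" and ?m = "idx n c' (iv g \<circ> ?s i)"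
    have x: "g \<circ> ?r j \<in> Sn n" and y: "iv g \<circ> ?s i \<in> Sn n" using rj si g by (auto intro: Sn_intros)
    have rl: "?r ?l \<in> Sn n" and sm: "?s ?m \<in> Sn n" using idx(1)[OF x] idx(1)[OF y] tr_mem(1) by blast+
    have "(P * snd (Ind n c) g) $$ (i, j) = (\<Sum>l<tdim n c. P $$ (i, l) *
       (if c \<circ> iv (g \<circ> ?r j) = c \<circ> iv (?r l) then chi n c (iv (?r l) \<circ> g \<circ> ?r j) else 0))"
      using i j g Pc by (simp add: snd_Ind scalar_prod_def atLeast0LessThan)
    also have "\<dots> = (\<Sum>l<tdim n c. if c \<circ> iv (g \<circ> ?r j) = c \<circ> iv (?r l) then P $$ (i, l) * chi n c (iv (?r l) \<circ> g \<circ> ?r j) else 0)"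
      by (intro sum.cong) auto
    also have "\<dots> = P $$ (i, ?l) * chi n c (iv (?r ?l) \<circ> g \<circ> ?r j)" by (rule sum_idx[OF x])
    also have "\<dots> = vker n c c' P (?s i) (g \<circ> ?r j)" using i si
      by (simp add: vker_def idx_tr Sn_iv_comp[of _ n] chi_id o_assoc)
    finally have 1: "(P * snd (Ind n c) g) $$ (i, j) = vker n c c' P (?s i) (g \<circ> ?r j)" .
    have w: "c' \<circ> iv (g \<circ> ?s m) = c' \<circ> iv (?s i) \<longleftrightarrow> c' \<circ> iv (iv g \<circ> ?s i) = c' \<circ> iv (?s m)" if "m < tdim n c'" for m
    proof -
      have "?s m \<in> Sn n" using that tr_mem(1) by blast
      then show ?thesis
        using same_word_iff[of "iv g \<circ> ?s i" n "?s m" c'] same_word_iff[of "?s i" n "g \<circ> ?s m" c'] g si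
        by (auto simp: Sn_iv_distrib[of _ n] Sn_intros Sn_iv_iv[of _ n] o_assoc)
    qed
    have "(snd (Ind n c') g * P) $$ (i, j) = (\<Sum>m<tdim n c'.
       (if c' \<circ> iv (g \<circ> ?s m) = c' \<circ> iv (?s i) then chi n c' (iv (?s i) \<circ> g \<circ> ?s m) else 0) * P $$ (m, j))"
      using i j g Pc by (simp add: snd_Ind scalar_prod_def atLeast0LessThan)
    also have "\<dots> = (\<Sum>m<tdim n c'. if c' \<circ> iv (iv g \<circ> ?s i) = c' \<circ> iv (?s m) then
        chi n c' (iv (?s i) \<circ> g \<circ> ?s m) * P $$ (m, j) else 0)"
      using w by (intro sum.cong) auto
    also have "\<dots> = chi n c' (iv (?s i) \<circ> g \<circ> ?s ?m) * P $$ (?m, j)" by (rule sum_idx[OF y])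
    also have "iv (?s i) \<circ> g \<circ> ?s ?m = iv (iv (?s ?m) \<circ> (iv g \<circ> ?s i))"
      using sm si g by (simp add: Sn_iv_distrib[of _ n] Sn_intros Sn_iv_iv[of _ n] o_assoc)
    also have "chi n c' \<dots> = chi n c' (iv (?s ?m) \<circ> (iv g \<circ> ?s i))" by (rule chi_iv[OF idx_Hs[OF y]])
    also have "\<dots> * P $$ (?m, j) = vker n c c' P (iv g \<circ> ?s i) (?r j)"
      using j rj by (simp add: vker_def idx_tr Sn_iv_comp[of _ n] chi_id)
    finally show ?thesis using 1 rhom_eq[OF P g] by simp
  qed
  have B: "vker n c c' P x' (g \<circ> y') = vker n c c' P (iv g \<circ> x') y'"
    if x': "x' \<in> Sn n" and y': "y' \<in> Sn n" and g: "g \<in> Sn n" for x' y' g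
  proof -
    let ?i = "idx n c' x'" and ?j = "idx n c y'"
    have si: "?s ?i \<in> Sn n" and rj: "?r ?j \<in> Sn n" using idx(1)[OF x'] idx(1)[OF y'] tr_mem(1) by blast+
    have ex: "x' = ?s ?i \<circ> (iv (?s ?i) \<circ> x')" and ey: "y' = ?r ?j \<circ> (iv (?r ?j) \<circ> y')"
      using si rj by (simp_all add: Sn_cancel)
    let ?k = "iv (?s ?i) \<circ> x'" and ?h = "iv (?r ?j) \<circ> y'"
    have k: "?k \<in> Hs n c'" and h: "?h \<in> Hs n c" using idx_Hs x' y' by auto
    have "vker n c c' P x' (g \<circ> y') = vker n c c' P (?s ?i \<circ> ?k) (g \<circ> ?r ?j \<circ> ?h)"
      using ex ey by (simp add: o_assoc[symmetric])
    also have "\<dots> = chi n c' ?k * (chi n c ?h * vker n c c' P (?s ?i) (g \<circ> ?r ?j))"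
      unfolding vker_right[OF si k] vker_right2[OF Sn_comp[OF g rj] h] ..
    also have "vker n c c' P (?s ?i) (g \<circ> ?r ?j) = vker n c c' P (iv g \<circ> ?s ?i) (?r ?j)"
      using A idx(1)[OF x'] idx(1)[OF y'] g by blast
    also have "chi n c' ?k * (chi n c ?h * \<dots>) = vker n c c' P (iv g \<circ> ?s ?i \<circ> ?k) (?r ?j \<circ> ?h)"
      unfolding vker_right[OF Sn_comp[OF Sn_iv[OF g] si] k] vker_right2[OF rj h] ..
    finally have "vker n c c' P x' (g \<circ> y') = vker n c c' P (iv g \<circ> (?s ?i \<circ> ?k)) (?r ?j \<circ> ?h)"
      by (simp add: o_def)
    then show ?thesis by (simp only: ex[symmetric] ey[symmetric])
  qed
  show ?thesis using B[of "g \<circ> x" y g] g x y by (simp add: Sn_comp Sn_cancel)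
qed

lemma vof_biequiv:
  assumes P: "P \<in> rhom n (Ind n c) (Ind n c')"
  shows "vof n c c' P \<in> biequiv n c c'"
proof (rule biequivI)
  fix h g assume h: "h \<in> Hs n c" and g: "g \<in> Sn n"
  have "vof n c c' P (h \<circ> g) = vker n c c' P g (id \<circ> iv h)"
    using vker_equiv[OF P Sn_iv[OF Hs_Sn[OF h]], of "h \<circ> g" id] h g
    by (simp add: vof_def Sn_intros Hs_Sn Sn_cancel[OF Hs_Sn[OF h]])
  also have "\<dots> = chi n c h * vof n c c' P g"
    unfolding vker_right2[OF Sn_id Hs_iv[OF h]] chi_iv[OF h] vof_def ..
  finally show "vof n c c' P (h \<circ> g) = chi n c h * vof n c c' P g" .
next
  fix g k assume "g \<in> Sn n" "k \<in> Hs n c'"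
  then show "vof n c c' P (g \<circ> k) = vof n c c' P g * chi n c' k"
    using vker_right by (simp add: vof_def mult.commute)
qed

lemma hmat_vof:
  assumes P: "P \<in> rhom n (Ind n c) (Ind n c')"
  shows "hmat n c c' (vof n c c' P) = P"
proof (rule eq_matI)
  have Pc: "P \<in> carrier_mat (tdim n c') (tdim n c)" using rhom_carrier[OF P] by (simp add: fst_Ind)
  fix i j assume "i < dim_row P" "j < dim_col P"
  then have ij: "i < tdim n c'" "j < tdim n c" using Pc by auto
  have "vof n c c' P (iv (tr n c j) \<circ> tr n c' i) = vker n c c' P (tr n c' i) (tr n c j)"
    using vker_equiv[OF P tr_mem(1)[OF ij(2)], of "iv (tr n c j) \<circ> tr n c' i" id] ij tr_mem(1)[OF ij(2)] tr_mem(1)[OF ij(1)]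
    by (simp add: vof_def Sn_intros Sn_cancel)
  then show "hmat n c c' (vof n c c' P) $$ (i, j) = P $$ (i, j)" using ij by (simp add: hmat_def vker_tr)
qed (use rhom_carrier[OF P] in \<open>auto simp: fst_Ind hmat_def\<close>)

lemma vof_hmat:
  assumes v: "v \<in> biequiv n c c'" and x: "x \<in> Sn n"
  shows "vof n c c' (hmat n c c' v) x = v x"
proof -
  let ?i = "idx n c' x" and ?j = "idx n c id"
  let ?r = "tr n c ?j" and ?s = "tr n c' ?i"
  have s: "?s \<in> Sn n" and r: "?r \<in> Sn n" using idx(1)[OF x] idx(1)[OF Sn_id] tr_mem(1) by blast+
  have k: "iv ?s \<circ> x \<in> Hs n c'" by (rule idx_Hs[OF x])
  have h: "iv ?r \<in> Hs n c" using idx_Hs[OF Sn_id, of n c] by simp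
  have "vof n c c' (hmat n c c' v) x = chi n c' (iv ?s \<circ> x) * v (iv ?r \<circ> ?s) * chi n c (iv ?r)"
    using idx(1)[OF x, of c'] idx(1)[OF Sn_id, of n c] by (simp add: vof_def vker_def hmat_def)
  also have "v (iv ?r \<circ> ?s) = chi n c (iv ?r) * v ?s" by (rule biequiv_left[OF v h s])
  also have "chi n c' (iv ?s \<circ> x) * (chi n c (iv ?r) * v ?s) * chi n c (iv ?r) = v ?s * chi n c' (iv ?s \<circ> x)"
    using chi_square[of n c "iv ?r", where ?'a = 'a] by (simp add: mult.assoc mult.commute mult.left_commute)
  also have "\<dots> = v x" using biequiv_right[OF v s k] s by (simp add: Sn_cancel)
  finally show ?thesis .
qed

lemma vof_add:
  assumes "P \<in> carrier_mat (tdim n c') (tdim n c)" "Q \<in> carrier_mat (tdim n c') (tdim n c)" "x \<in> Sn n"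
  shows "vof n c c' (P + Q) x = vof n c c' P x + vof n c c' Q x"
  using assms idx(1)[OF assms(3), of c'] idx(1)[OF Sn_id, of n c]
  by (simp add: vof_def vker_def algebra_simps)

lemma hmat_cong: "(\<And>x. x \<in> Sn n \<Longrightarrow> v x = w x) \<Longrightarrow> hmat n c c' v = hmat n c c' w"
  unfolding hmat_def by (intro cong_mat) (auto simp: Sn_intros tr_mem)

section \<open>Composition as convolution\<close>

definition conv :: "nat \<Rightarrow> labelling \<Rightarrow> ((nat \<Rightarrow> nat) \<Rightarrow> 'a::field) \<Rightarrow> ((nat \<Rightarrow> nat) \<Rightarrow> 'a) \<Rightarrow> (nat \<Rightarrow> nat) \<Rightarrow> 'a" where
  "conv n c v2 v1 x = csum n c (\<lambda>y. v2 (iv y \<circ> x) * v1 y)"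

lemma conv_rinv:
  assumes "v1 \<in> biequiv n c c'" "v2 \<in> biequiv n c' c''" "x \<in> Sn n"
  shows "rinv n c' (\<lambda>y. v2 (iv y \<circ> x) * v1 y)"
  unfolding rinv_def
proof (intro ballI)
  fix y k assume y: "y \<in> Sn n" and k: "k \<in> Hs n c'"
  have "v2 (iv (y \<circ> k) \<circ> x) = chi n c' k * v2 (iv y \<circ> x)"
    using biequiv_left[OF assms(2) Hs_iv[OF k], of "iv y \<circ> x"] y k assms(3)
    by (simp add: Sn_iv_distrib[of _ n] Hs_Sn Sn_intros o_assoc chi_iv)
  then show "v2 (iv (y \<circ> k) \<circ> x) * v1 (y \<circ> k) = v2 (iv y \<circ> x) * v1 y"
    using biequiv_right[OF assms(1) y k] chi_square[of n c' k, where ?'a = 'a]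
    by (simp add: mult.assoc mult.left_commute mult.commute)
qed

text \<open>Matrix multiplication sums over the cosets of the middle Young subgroup; the translation
  by \<open>tr n c j\<close> is absorbed by \<open>csum_translate\<close>.\<close>

lemma hmat_mult:
  assumes v: "v1 \<in> biequiv n c c'" "v2 \<in> biequiv n c' c''"
  shows "hmat n c' c'' v2 * hmat n c c' v1 = hmat n c c'' (conv n c' v2 v1)"
proof (rule eq_matI)
  fix i j assume "i < dim_row (hmat n c c'' (conv n c' v2 v1))" "j < dim_col (hmat n c c'' (conv n c' v2 v1))"
  then have ij: "i < tdim n c''" "j < tdim n c" by (auto simp: hmat_def)
  have t: "tr n c j \<in> Sn n" "tr n c'' i \<in> Sn n" using ij tr_mem(1) by auto
  have "(hmat n c' c'' v2 * hmat n c c' v1) $$ (i, j) =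
     (\<Sum>l<tdim n c'. v2 (iv (tr n c' l) \<circ> tr n c'' i) * v1 (iv (tr n c j) \<circ> tr n c' l))"
    using ij by (simp add: hmat_def scalar_prod_def atLeast0LessThan)
  also have "\<dots> = csum n c' (\<lambda>y. (\<lambda>y. v2 (iv y \<circ> (iv (tr n c j) \<circ> tr n c'' i)) * v1 y) (iv (tr n c j) \<circ> y))"
    unfolding csum_def
    using t tr_mem(1)[of _ n c'] by (intro sum.cong refl) (simp add: Sn_iv_distrib[of _ n] Sn_intros Sn_iv_iv[of _ n] o_assoc[symmetric] Sn_cancel)
  also have "\<dots> = csum n c' (\<lambda>y. v2 (iv y \<circ> (iv (tr n c j) \<circ> tr n c'' i)) * v1 y)"
    using t by (intro csum_translate conv_rinv[OF v]) (auto intro: Sn_intros)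
  finally show "(hmat n c' c'' v2 * hmat n c c' v1) $$ (i, j) = hmat n c c'' (conv n c' v2 v1) $$ (i, j)"
    using ij by (simp add: hmat_def conv_def)
qed (auto simp: hmat_def)

lemma conv_biequiv:
  assumes v: "v1 \<in> biequiv n c c'" "v2 \<in> biequiv n c' c''"
  shows "conv n c' v2 v1 \<in> biequiv n c c''"
proof (rule biequivI)
  fix h g assume h: "h \<in> Hs n c" and g: "g \<in> Sn n"
  note hS = Hs_Sn[OF h]
  have "conv n c' v2 v1 (h \<circ> g) = csum n c' (\<lambda>y. v2 (iv (h \<circ> y) \<circ> (h \<circ> g)) * v1 (h \<circ> y))"
    unfolding conv_def using csum_translate[OF conv_rinv[OF v, of "h \<circ> g"] hS] hS g by (simp add: Sn_comp)
  also have "\<dots> = (\<Sum>l<tdim n c'. chi n c h * (v2 (iv (tr n c' l) \<circ> g) * v1 (tr n c' l)))"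
    unfolding csum_def using tr_mem(1)[of _ n c'] hS g h biequiv_left[OF v(1) h]
    by (intro sum.cong refl) (simp add: Sn_iv_distrib[of _ n] o_assoc[symmetric] Sn_cancel)
  finally show "conv n c' v2 v1 (h \<circ> g) = chi n c h * conv n c' v2 v1 g"
    by (simp add: conv_def csum_def sum_distrib_left)
next
  fix g k assume g: "g \<in> Sn n" and k: "k \<in> Hs n c''"
  have "v2 (iv (tr n c' l) \<circ> (g \<circ> k)) = v2 (iv (tr n c' l) \<circ> g) * chi n c'' k" if "l < tdim n c'" for l
    using biequiv_right[OF v(2) _ k, of "iv (tr n c' l) \<circ> g"] g tr_mem(1)[OF that] by (simp add: o_assoc Sn_intros)
  then show "conv n c' v2 v1 (g \<circ> k) = conv n c' v2 v1 g * chi n c'' k"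
    by (simp add: conv_def csum_def sum_distrib_right sum_distrib_left mult.assoc mult.left_commute mult.commute)
qed

lemma vof_mult:
  assumes "P \<in> rhom n (Ind n c) (Ind n c')" "Q \<in> rhom n (Ind n c') (Ind n c'')" "x \<in> Sn n"
  shows "vof n c c'' (Q * P) x = conv n c' (vof n c' c'' Q) (vof n c c' P) x"
proof -
  have "Q * P = hmat n c c'' (conv n c' (vof n c' c'' Q) (vof n c c' P))"
    using hmat_mult[OF vof_biequiv[OF assms(1)] vof_biequiv[OF assms(2)]]
    unfolding hmat_vof[OF assms(1)] hmat_vof[OF assms(2)] .
  then show ?thesis
    using vof_hmat[OF conv_biequiv[OF vof_biequiv[OF assms(1)] vof_biequiv[OF assms(2)]] assms(3)] by simp
qed

section \<open>Straightening\<close>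

text \<open>Bijections between the fibres over each label are chosen and glued.\<close>

lemma ex_bij_of_counts:
  assumes "finite A" "finite B" "\<And>l. card {i\<in>A. f i = l} = card {i\<in>B. g i = l}"
  shows "\<exists>s. bij_betw s A B \<and> (\<forall>i\<in>A. g (s i) = f i)"
proof -
  have "\<exists>s. bij_betw s {i\<in>A. f i = l} {i\<in>B. g i = l}" for l
    using assms by (intro finite_same_card_bij) auto
  then obtain s where s: "bij_betw (s l) {i\<in>A. f i = l} {i\<in>B. g i = l}" for l by metis
  have m: "s (f i) i \<in> B" "g (s (f i) i) = f i" if "i \<in> A" for i
    using s[of "f i"] that by (auto simp: bij_betw_def)
  have "bij_betw (\<lambda>i. s (f i) i) A B"
    unfolding bij_betw_def
  proof
    show "inj_on (\<lambda>i. s (f i) i) A"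
    proof (rule inj_onI)
      fix i j assume ij: "i \<in> A" "j \<in> A" "s (f i) i = s (f j) j"
      then have "f i = f j" using m by metis
      then show "i = j" using ij s[of "f i"] by (auto simp: bij_betw_def inj_on_def)
    qed
    show "(\<lambda>i. s (f i) i) ` A = B"
    proof
      show "(\<lambda>i. s (f i) i) ` A \<subseteq> B" using m by auto
      show "B \<subseteq> (\<lambda>i. s (f i) i) ` A"
      proof
        fix b assume b: "b \<in> B"
        then have "b \<in> s (g b) ` {i\<in>A. f i = g b}" using s[of "g b"] by (auto simp: bij_betw_def)
        then obtain i where "i \<in> A" "f i = g b" "b = s (g b) i" by blast
        then show "b \<in> (\<lambda>i. s (f i) i) ` A" by (intro image_eqI[of _ _ i]) auto
      qed
    qed
  qed
  then show ?thesis using m by blast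
qed

lemma ex_perm_of_counts:
  assumes "\<And>l. card {i\<in>{1..n}. f i = l} = card {i\<in>{1..n}. g i = l}"
  shows "\<exists>s\<in>Sn n. \<forall>i\<in>{1..n}. g (s i) = f i"
proof -
  from ex_bij_of_counts[of "{1..n}" "{1..n}" f g] assms obtain s where
    s: "bij_betw s {1..n} {1..n}" "\<forall>i\<in>{1..n}. g (s i) = f i" by auto
  define s' where "s' i = (if i \<in> {1..n} then s i else i)" for i
  have "bij_betw s' {1..n} {1..n}" using s(1) by (rule bij_betw_cong[THEN iffD1, rotated]) (auto simp: s'_def)
  then have "s' permutes {1..n}" by (rule bij_imp_permutes) (auto simp: s'_def)
  then show ?thesis using s(2) by (intro bexI[of _ s']) (auto simp: s'_def Sn_def)
qed

lemma Sn_outside: "g \<in> Sn n \<Longrightarrow> i \<notin> {1..n} \<Longrightarrow> g i = i"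
  by (auto simp: Sn_def permutes_def)

lemma Sn_iv_app: "g \<in> Sn n \<Longrightarrow> iv g (g i) = i" "g \<in> Sn n \<Longrightarrow> g (iv g i) = i"
  using Sn_bij[of g n] by (simp_all add: bij_is_inj bij_is_surj surj_f_inv_f)

lemma card_Sn_collect:
  assumes "g \<in> Sn n"
  shows "card {i\<in>{1..n}. Q (g i)} = card {i\<in>{1..n}. Q i}"
proof -
  have "bij_betw g {i\<in>{1..n}. Q (g i)} {i\<in>{1..n}. Q i}"
  proof (rule bij_betwI[of _ _ _ "iv g"])
    show "g \<in> {i\<in>{1..n}. Q (g i)} \<rightarrow> {i\<in>{1..n}. Q i}" using Sn_in[OF assms] by auto
    show "iv g \<in> {i\<in>{1..n}. Q i} \<rightarrow> {i\<in>{1..n}. Q (g i)}"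
      using Sn_in[OF Sn_iv[OF assms]] Sn_iv_app[OF assms] by auto
  qed (auto simp: Sn_iv_app[OF assms])
  then show ?thesis by (rule bij_betw_same_card)
qed

lemma transpose_Sn: "i \<in> {1..n} \<Longrightarrow> j \<in> {1..n} \<Longrightarrow> transpose i j \<in> Sn n"
  unfolding Sn_def by (auto intro: permutes_swap_id)

lemma transpose_Hs:
  assumes "i \<in> {1..n}" "j \<in> {1..n}" "c i = c j" shows "transpose i j \<in> Hs n c"
  using assms by (auto simp: Hs_def transpose_Sn fun_eq_iff transpose_def)

lemma rsgn_transpose:
  assumes "i \<noteq> j" "i \<in> A \<longleftrightarrow> j \<in> A"
  shows "rsgn A (transpose i j) = (if i \<in> A then - 1 else (1::'a::field))"
proof (cases "i \<in> A")
  case True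
  then have "res A (transpose i j) = transpose i j" using assms by (auto simp: res_def transpose_def)
  then show ?thesis using True assms by (simp add: rsgn_def sign_swap_id)
next
  case False
  then have "res A (transpose i j) = id" using assms by (auto simp: res_def transpose_def)
  then show ?thesis using False by (simp add: rsgn_def)
qed

lemma chi_transpose:
  assumes "i \<in> {1..n}" "j \<in> {1..n}" "c i = c j" "i \<noteq> j"
  shows "chi n c (transpose i j) = (if fst (c i) then - 1 else (1::'a::field))"
  using assms unfolding chi_def by (subst rsgn_transpose) (auto simp: oddp_def)

lemma conj_transpose:
  assumes "y \<in> Sn n" shows "iv y \<circ> transpose i j \<circ> y = transpose (iv y i) (iv y j)"
proof
  fix x show "(iv y \<circ> transpose i j \<circ> y) x = transpose (iv y i) (iv y j) x"
    using Sn_iv_app[OF assms] by (auto simp: transpose_def)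
qed

text \<open>The transposition of \<open>i\<close> and \<open>j\<close> lies in the first Young
  subgroup; moved across \<open>y\<close> it becomes one in the second. Biequivariance makes the two
  signs agree where \<open>v y\<close> is nonzero, and 1 differs from -1.\<close>

lemma support_parity:
  fixes v :: "(nat \<Rightarrow> nat) \<Rightarrow> 'a::field"
  assumes two: "(2::'a) \<noteq> 0" and v: "v \<in> biequiv n c0 c" and y: "y \<in> Sn n" "v y \<noteq> 0"
    and ij: "i \<in> {1..n}" "j \<in> {1..n}" "i \<noteq> j" "c0 i = c0 j" "c (iv y i) = c (iv y j)"
  shows "fst (c0 i) = fst (c (iv y i))"
proof -
  let ?t = "transpose i j" and ?k = "transpose (iv y i) (iv y j)"
  have in': "iv y i \<in> {1..n}" "iv y j \<in> {1..n}" using Sn_in[OF Sn_iv[OF y(1)]] ij by auto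
  have ne: "iv y i \<noteq> iv y j" using ij(3) Sn_iv_app(2)[OF y(1)] by metis
  have e: "?t \<circ> y = y \<circ> ?k"
    unfolding conj_transpose[OF y(1), symmetric] by (simp only: o_assoc Sn_comp_iv[OF y(1)] id_comp)
  have "chi n c0 ?t * v y = v (?t \<circ> y)" by (rule biequiv_left[OF v transpose_Hs[OF ij(1,2,4)] y(1), symmetric])
  also have "\<dots> = v y * chi n c ?k" unfolding e by (rule biequiv_right[OF v y(1) transpose_Hs[OF in' ij(5)]])
  finally have "chi n c0 ?t * v y = chi n c ?k * v y" by (simp only: mult.commute)
  then have "chi n c0 ?t = (chi n c ?k :: 'a)" using y(2) by simp
  then have "(if fst (c0 i) then - 1 else (1::'a)) = (if fst (c (iv y i)) then - 1 else 1)"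
    unfolding chi_transpose[OF ij(1,2,4,3)] chi_transpose[OF in' ij(5) ne] .
  moreover have "(-1::'a) \<noteq> 1" using two by (metis add.right_inverse one_add_one)
  ultimately show ?thesis by (auto split: if_splits)
qed

section \<open>Signed double coset functions\<close>

text \<open>The chosen factorization \<open>(h, k)\<close> does not matter as soon as the signs
  cancel on every pair with \<open>h \<circ> g \<circ> k = g\<close>; this is the hypothesis
  \<open>comp\<close> below.\<close>

definition dcos :: "nat \<Rightarrow> labelling \<Rightarrow> labelling \<Rightarrow> (nat \<Rightarrow> nat) \<Rightarrow> (nat \<Rightarrow> nat) \<Rightarrow> 'a::field" where
  "dcos n c c' g x = (if \<exists>h\<in>Hs n c. \<exists>k\<in>Hs n c'. x = h \<circ> g \<circ> k
     then (case (SOME hk. fst hk \<in> Hs n c \<and> snd hk \<in> Hs n c' \<and> x = fst hk \<circ> g \<circ> snd hk) of (h, k) \<Rightarrow> chi n c h * chi n c' k) else 0)"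

lemma dcos_value:
  assumes g: "g \<in> Sn n"
    and comp: "\<And>h k. h \<in> Hs n c \<Longrightarrow> k \<in> Hs n c' \<Longrightarrow> h \<circ> g \<circ> k = g \<Longrightarrow> chi n c h * chi n c' k = (1::'a::field)"
    and h: "h \<in> Hs n c" and k: "k \<in> Hs n c'"
  shows "dcos n c c' g (h \<circ> g \<circ> k) = chi n c h * (chi n c' k :: 'a)"
proof -
  let ?P = "\<lambda>hk. fst hk \<in> Hs n c \<and> snd hk \<in> Hs n c' \<and> h \<circ> g \<circ> k = fst hk \<circ> g \<circ> snd hk"
  have "?P (h, k)" using h k by simp
  then have s: "?P (SOME hk. ?P hk)" by (rule someI[of ?P "(h, k)"])
  define a b where "a = fst (SOME hk. ?P hk)" and "b = snd (SOME hk. ?P hk)"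
  have a: "a \<in> Hs n c" and b: "b \<in> Hs n c'" and e: "h \<circ> g \<circ> k = a \<circ> g \<circ> b" using s unfolding a_def b_def by auto
  have "dcos n c c' g (h \<circ> g \<circ> k) = chi n c a * (chi n c' b :: 'a)"
    unfolding dcos_def a_def b_def using h k by (auto simp: case_prod_beta)
  also have "\<dots> = chi n c h * chi n c' k"
  proof -
    \<comment> \<open>Two factorizations of one element differ by a pair that stabilizes
      \<open>g\<close>, on which the signs cancel.\<close>
    have "(iv a \<circ> h) \<circ> g \<circ> (k \<circ> iv b) = iv a \<circ> (h \<circ> g \<circ> k) \<circ> iv b" by (simp add: o_assoc)
    also have "\<dots> = iv a \<circ> a \<circ> g \<circ> (b \<circ> iv b)" unfolding e by (simp add: o_assoc)
    also have "\<dots> = g" using Sn_iv_comp[OF Hs_Sn[OF a]] Sn_comp_iv[OF Hs_Sn[OF b]] by simp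
    finally have "chi n c (iv a \<circ> h) * chi n c' (k \<circ> iv b) = (1::'a)"
      using comp[of "iv a \<circ> h" "k \<circ> iv b"] a b h k by (simp add: Hs_comp Hs_iv)
    then have "(chi n c a * chi n c h) * (chi n c' k * chi n c' b) = (1::'a)"
      using a b h k by (simp add: chi_comp Hs_iv chi_iv)
    then have "chi n c a * chi n c' b * (chi n c h * chi n c' k) = (1::'a)" by (simp add: ac_simps)
    then have "chi n c a * chi n c' b * (chi n c h * chi n c' k) * (chi n c h * chi n c' k) = (chi n c h * chi n c' k :: 'a)" by simp
    moreover have "(chi n c h * chi n c' k) * (chi n c h * chi n c' k) = (1::'a)"
    proof -
      have "(chi n c h * chi n c' k) * (chi n c h * chi n c' k) = (chi n c h * chi n c h) * (chi n c' k * chi n c' k :: 'a)" by (simp only: ac_simps)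
      then show ?thesis by (simp only: chi_square mult_1)
    qed
    ultimately show ?thesis by (metis mult.assoc mult.right_neutral)
  qed
  finally show ?thesis .
qed

lemma dcos_biequiv:
  assumes g: "g \<in> Sn n"
    and comp: "\<And>h k. h \<in> Hs n c \<Longrightarrow> k \<in> Hs n c' \<Longrightarrow> h \<circ> g \<circ> k = g \<Longrightarrow> chi n c h * chi n c' k = (1::'a::field)"
  shows "(dcos n c c' g :: _ \<Rightarrow> 'a) \<in> biequiv n c c'"
  unfolding biequiv_def
proof (intro CollectI ballI)
  fix h x k assume h: "h \<in> Hs n c" and x: "x \<in> Sn n" and k: "k \<in> Hs n c'"
  show "dcos n c c' g (h \<circ> x \<circ> k) = chi n c h * dcos n c c' g x * (chi n c' k :: 'a)"
  proof (cases "\<exists>a\<in>Hs n c. \<exists>b\<in>Hs n c'. x = a \<circ> g \<circ> b")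
    case True
    then obtain a b where ab: "a \<in> Hs n c" "b \<in> Hs n c'" "x = a \<circ> g \<circ> b" by blast
    have "h \<circ> x \<circ> k = (h \<circ> a) \<circ> g \<circ> (b \<circ> k)" unfolding ab by (simp add: o_assoc)
    then have "dcos n c c' g (h \<circ> x \<circ> k) = chi n c (h \<circ> a) * (chi n c' (b \<circ> k) :: 'a)"
      by (simp only:) (rule dcos_value[OF g comp Hs_comp[OF h ab(1)] Hs_comp[OF ab(2) k]])
    moreover have "dcos n c c' g x = chi n c a * (chi n c' b :: 'a)"
      unfolding ab(3) by (rule dcos_value[OF g comp ab(1,2)])
    ultimately show ?thesis by (simp only: chi_comp[OF h ab(1)] chi_comp[OF ab(2) k] mult.assoc)
  next
    case False
    have "\<not> (\<exists>a\<in>Hs n c. \<exists>b\<in>Hs n c'. h \<circ> x \<circ> k = a \<circ> g \<circ> b)"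
    proof
      assume "\<exists>a\<in>Hs n c. \<exists>b\<in>Hs n c'. h \<circ> x \<circ> k = a \<circ> g \<circ> b"
      then obtain a b where ab: "a \<in> Hs n c" "b \<in> Hs n c'" "h \<circ> x \<circ> k = a \<circ> g \<circ> b" by blast
      have "x = iv h \<circ> (h \<circ> x \<circ> k) \<circ> iv k"
        using Sn_iv_comp[OF Hs_Sn[OF h]] Sn_comp_iv[OF Hs_Sn[OF k]] by (metis comp_id id_comp o_assoc)
      also have "\<dots> = (iv h \<circ> a) \<circ> g \<circ> (b \<circ> iv k)" unfolding ab by (simp add: o_assoc)
      finally show False using False ab h k Hs_comp Hs_iv by blast
    qed
    then show ?thesis using False by (simp add: dcos_def)
  qed
qed

lemma dcos_one:
  assumes g: "g \<in> Sn n"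
    and comp: "\<And>h k. h \<in> Hs n c \<Longrightarrow> k \<in> Hs n c' \<Longrightarrow> h \<circ> g \<circ> k = g \<Longrightarrow> chi n c h * chi n c' k = (1::'a::field)"
  shows "dcos n c c' g g = (1::'a)"
proof -
  have "dcos n c c' g (id \<circ> g \<circ> id) = chi n c id * (chi n c' id :: 'a)"
    by (rule dcos_value[OF g comp Hs_id Hs_id])
  then show ?thesis by (simp add: chi_id)
qed

lemma dcos_nonzero: "dcos n c c' g x \<noteq> (0::'a::field) \<Longrightarrow> \<exists>h\<in>Hs n c. \<exists>k\<in>Hs n c'. x = h \<circ> g \<circ> k"
  by (auto simp: dcos_def split: if_splits)

section \<open>Dominance of labellings and the straightening induction\<close>

definition ncount :: "nat \<Rightarrow> labelling \<Rightarrow> bool \<times> nat \<Rightarrow> nat" where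
  "ncount n c j = card {i\<in>{1..n}. c i \<le> j}"

text \<open>The lexicographic order on letters, with \<open>False < True\<close>, makes this the dominance order on pairs.\<close>

definition dominated :: "nat \<Rightarrow> labelling \<Rightarrow> labelling \<Rightarrow> bool" where
  "dominated n c c0 \<longleftrightarrow> (\<forall>j. ncount n c j \<le> ncount n c0 j)"

text \<open>The number of positions where the word of \<open>g\<close> still shows the original
  letter; straightening pushes it up.\<close>

definition agree :: "nat \<Rightarrow> labelling \<Rightarrow> (nat \<Rightarrow> nat) \<Rightarrow> nat" where
  "agree n c0 g = card {i\<in>{1..n}. c0 (iv g i) = c0 i}"

lemma rsgn_eqI: "(\<And>i. h i \<noteq> i \<Longrightarrow> i \<in> A \<longleftrightarrow> i \<in> B) \<Longrightarrow> rsgn A h = rsgn B h"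
  unfolding rsgn_def res_def by (rule arg_cong[where f = "\<lambda>f. of_int (sign f)"]) (metis (mono_tags))

text \<open>Conjugation by \<open>g\<close> carries the odd points of \<open>c\<close> to the odd
  letters of the word, so that signs can be compared position by position.\<close>

lemma chi_word_conj:
  assumes g: "g \<in> Sn n" and r: "r \<in> Hs n c"
  shows "chi n c r = rsgn (oddp n (c \<circ> iv g)) (g \<circ> r \<circ> iv g)"
proof -
  have "g ` oddp n c = oddp n (c \<circ> iv g)"
  proof
    show "g ` oddp n c \<subseteq> oddp n (c \<circ> iv g)" using Sn_in[OF g] Sn_iv_app[OF g] by (auto simp: oddp_def)
    show "oddp n (c \<circ> iv g) \<subseteq> g ` oddp n c"
    proof
      fix x assume "x \<in> oddp n (c \<circ> iv g)"
      then have "iv g x \<in> oddp n c" using Sn_in[OF Sn_iv[OF g]] by (auto simp: oddp_def)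
      then show "x \<in> g ` oddp n c" using Sn_iv_app(2)[OF g] by (metis imageI)
    qed
  qed
  then show ?thesis using rsgn_conj[OF g Hs_Sn[OF r] Hs_oddp[OF r], symmetric] by (simp add: chi_def)
qed

text \<open>Straightening: the double coset function of \<open>g0\<close> agrees, up to double cosets with more
  fixed letters, with a composition through the module of the strictly larger weight obtained by
  copying the letter \<open>j\<close> from the word of \<open>g0\<close> into \<open>c0\<close>, where \<open>j\<close> is the least letter that moves.\<close>

lemma straightening_step:
  fixes v :: "(nat \<Rightarrow> nat) \<Rightarrow> 'a::field"
  assumes two: "(2::'a) \<noteq> 0" and v: "v \<in> biequiv n c0 c0" and g0: "g0 \<in> Sn n" "v g0 \<noteq> 0" "g0 \<notin> Hs n c0"
  obtains c v1 v2 where "\<not> dominated n c c0" "v1 \<in> biequiv n c0 c" "v2 \<in> biequiv n c c0" "conv n c v2 v1 g0 = (1::'a)"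
    "\<And>x. x \<in> Sn n \<Longrightarrow> conv n c v2 v1 x \<noteq> 0 \<Longrightarrow>
       agree n c0 g0 < agree n c0 x \<or> (\<exists>h\<in>Hs n c0. \<exists>k\<in>Hs n c0. x = h \<circ> g0 \<circ> k)"
proof -
  define x where "x = c0 \<circ> iv g0"
  define Bad where "Bad = {i\<in>{1..n}. x i \<noteq> c0 i}"
  have "Bad \<noteq> {}"
  proof
    assume "Bad = {}"
    then have "x i = c0 i" for i using Sn_outside[OF Sn_iv[OF g0(1)], of i] by (cases "i \<in> {1..n}") (auto simp: Bad_def x_def)
    then have "c0 \<circ> iv g0 = c0 \<circ> iv id" by (auto simp: x_def)
    then have "iv (iv g0) \<in> Hs n c0" using same_word_iff[OF g0(1) Sn_id, of c0] Hs_iv[of "iv g0" n c0] by simp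
    then show False using g0 by (simp add: Sn_iv_iv)
  qed
  define j where "j = Min (c0 ` Bad)"
  have fB: "finite (c0 ` Bad)" by (simp add: Bad_def)
  have "j \<in> c0 ` Bad" unfolding j_def using fB \<open>Bad \<noteq> {}\<close> by (intro Min_in) auto
  then obtain i0 where i0: "i0 \<in> {1..n}" "x i0 \<noteq> c0 i0" "c0 i0 = j" by (auto simp: Bad_def)
  have jmin: "j \<le> c0 i" if "i \<in> {1..n}" "x i \<noteq> c0 i" for i
    unfolding j_def using that fB by (intro Min_le) (auto simp: Bad_def)
  \<comment> \<open>Where \<open>x\<close> has \<open>j\<close> and \<open>c0\<close> does not,
    \<open>c0\<close> is larger by minimality of \<open>j\<close>. So letters only decrease from
    \<open>c0\<close> to \<open>y\<close>, and somewhere strictly.\<close>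
  define y where "y i = (if x i = j then j else c0 i)" for i
  have xcount: "card {i\<in>{1..n}. x i = l} = card {i\<in>{1..n}. c0 i = l}" for l
    using card_Sn_collect[OF Sn_iv[OF g0(1)], of "\<lambda>i. c0 i = l"] by (simp add: x_def)
  have out: "x i = c0 i" if "i \<notin> {1..n}" for i
    using Sn_outside[OF Sn_iv[OF g0(1)] that] by (simp add: x_def)
  have cell: "fst (c0 i) = fst (x i)" if "i \<in> {1..n}" "i' \<in> {1..n}" "i \<noteq> i'" "c0 i = c0 i'" "x i = x i'" for i i'
    using support_parity[OF two v g0(1,2) that(1-4)] that(5) by (simp add: x_def)
  have moved: "i \<in> {1..n}" if "h i \<noteq> i" "h \<in> Sn n" for h i using Sn_outside[OF that(2)] that(1) by blast
  have nd: "\<not> dominated n y c0"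
  proof -
    obtain i1 where i1: "i1 \<in> {1..n}" "x i1 = j" "c0 i1 \<noteq> j"
    proof (rule ccontr)
      assume "\<not> thesis"
      then have "{i\<in>{1..n}. x i = j} \<subseteq> {i\<in>{1..n}. c0 i = j}" using that by blast
      then have "{i\<in>{1..n}. x i = j} = {i\<in>{1..n}. c0 i = j}" using xcount[of j] by (intro card_subset_eq) auto
      then show False using i0 by auto
    qed
    have "\<not> c0 i1 \<le> j" using jmin[OF i1(1)] i1 by auto
    moreover have "y i1 \<le> j" using i1 by (simp add: y_def)
    moreover have "{i\<in>{1..n}. c0 i \<le> j} \<subseteq> {i\<in>{1..n}. y i \<le> j}" by (auto simp: y_def)
    ultimately have "{i\<in>{1..n}. c0 i \<le> j} \<subset> {i\<in>{1..n}. y i \<le> j}" using i1 by blast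
    then have "card {i\<in>{1..n}. c0 i \<le> j} < card {i\<in>{1..n}. y i \<le> j}" by (intro psubset_card_mono) auto
    then show ?thesis unfolding dominated_def ncount_def using leD by blast
  qed
  \<comment> \<open>A pair stabilizing the identity is \<open>h\<close> with its inverse, so
    \<open>h\<close> preserves \<open>c0\<close> and \<open>y\<close>. If \<open>h\<close> moves a
    point where these two letters differ, that point and its image share their letters in
    \<open>c0\<close> and in \<open>x\<close>, and \<open>cell\<close> gives equal parities.\<close>
  have comp1: "chi n c0 h * chi n y k = (1::'a)" if h: "h \<in> Hs n c0" and k: "k \<in> Hs n y" and e: "h \<circ> id \<circ> k = id" for h k
  proof -
    have k': "k = iv h" using e Sn_cancel(2)[OF Hs_Sn[OF h], of k] by simp
    have hy: "h \<in> Hs n y" using Hs_iv[OF k] k' Sn_iv_iv[OF Hs_Sn[OF h]] by simp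
    have "rsgn (oddp n c0) h = (rsgn (oddp n y) h :: 'a)"
    proof (rule rsgn_eqI)
      fix i assume m: "h i \<noteq> i"
      have i: "i \<in> {1..n}" and hi: "h i \<in> {1..n}" using moved[OF m Hs_Sn[OF h]] Sn_in[OF Hs_Sn[OF h], of i] by auto
      have "fst (c0 i) = fst (y i)"
      proof (cases "x i = j \<and> c0 i \<noteq> j")
        case True
        then have "y (h i) = j" using Hs_eq[OF hy, of i] by (simp add: y_def)
        then have "x (h i) = j" using True Hs_eq[OF h, of i] by (auto simp: y_def split: if_splits)
        then show ?thesis using cell[OF i hi] m True Hs_eq[OF h, of i] by (auto simp: y_def)
      qed (auto simp: y_def)
      then show "i \<in> oddp n c0 \<longleftrightarrow> i \<in> oddp n y" using i by (simp add: oddp_def)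
    qed
    then have "chi n c0 h = (chi n y h :: 'a)" by (simp add: chi_def)
    then show ?thesis unfolding k' chi_iv[OF hy] by (simp add: chi_square)
  qed
  \<comment> \<open>The same for \<open>g0\<close>: now \<open>k\<close> preserves \<open>y\<close>
    and \<open>x\<close>, and the sign of \<open>r\<close> is read off at the odd letters of
    \<open>x\<close>.\<close>
  have comp2: "chi n y k * chi n c0 r = (1::'a)" if k: "k \<in> Hs n y" and r: "r \<in> Hs n c0" and e: "k \<circ> g0 \<circ> r = g0" for k r
  proof -
    have kS: "k \<in> Sn n" and rS: "r \<in> Sn n" using k r Hs_Sn by auto
    have "g0 \<circ> iv r \<circ> iv g0 = k \<circ> g0 \<circ> r \<circ> iv r \<circ> iv g0" by (simp add: e)
    also have "\<dots> = k" by (simp only: o_assoc[symmetric] Sn_cancel[OF rS] Sn_comp_iv[OF g0(1)] comp_id)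
    finally have k': "k = g0 \<circ> iv r \<circ> iv g0" by simp
    have "x \<circ> k = c0 \<circ> (iv g0 \<circ> (g0 \<circ> (iv r \<circ> iv g0)))" unfolding x_def k' by (simp add: o_assoc)
    also have "\<dots> = c0 \<circ> iv r \<circ> iv g0" by (simp only: Sn_cancel[OF g0(1)] o_assoc[symmetric])
    also have "c0 \<circ> iv r = c0" using Hs_iv[OF r] by (simp add: Hs_def)
    finally have xk: "x (k i) = x i" for i by (auto simp: x_def fun_eq_iff)
    have "rsgn (oddp n y) k = (rsgn (oddp n x) k :: 'a)"
    proof (rule rsgn_eqI)
      fix i assume m: "k i \<noteq> i"
      have i: "i \<in> {1..n}" and ki: "k i \<in> {1..n}" using moved[OF m kS] Sn_in[OF kS, of i] by auto
      have "fst (y i) = fst (x i)"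
      proof (cases "x i = j")
        case False
        then have "y i = c0 i" "y (k i) = c0 (k i)" using xk[of i] by (auto simp: y_def)
        then have "c0 (k i) = c0 i" using Hs_eq[OF k, of i] by simp
        then show ?thesis using cell[OF i ki] m xk[of i] \<open>y i = c0 i\<close> by auto
      qed (auto simp: y_def)
      then show "i \<in> oddp n y \<longleftrightarrow> i \<in> oddp n x" using i by (simp add: oddp_def)
    qed
    moreover have "chi n c0 (iv r) = (rsgn (oddp n x) k :: 'a)"
      using chi_word_conj[OF g0(1) Hs_iv[OF r]] unfolding k' x_def .
    ultimately have "chi n y k = (chi n c0 r :: 'a)" using chi_iv[OF r, where ?'a = 'a] by (simp add: chi_def)
    then show ?thesis by (simp add: chi_square)
  qed
  define v1 where "v1 = (dcos n c0 y id :: _ \<Rightarrow> 'a)"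
  define v2 where "v2 = (dcos n y c0 g0 :: _ \<Rightarrow> 'a)"
  have b1: "v1 \<in> biequiv n c0 y" unfolding v1_def by (rule dcos_biequiv[OF Sn_id comp1])
  have b2: "v2 \<in> biequiv n y c0" unfolding v2_def by (rule dcos_biequiv[OF g0(1) comp2])
  have yj: "y i = j" if "c0 i = j" for i using that by (simp add: y_def)
  have yc: "y i = c0 i" if "y i \<noteq> j" for i using that by (auto simp: y_def split: if_splits)
  have set_eq: "{i\<in>{1..n}. y i = j \<and> x i \<noteq> j} = {i\<in>{1..n}. c0 i = j \<and> x i \<noteq> j}" by (auto simp: y_def)
  \<comment> \<open>Agreement of \<open>\<xi>\<close> is agreement of \<open>x\<close> with
    \<open>b\<close>, the rearrangement of \<open>c0\<close> by \<open>k\<close>. Off the positions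
    with \<open>y = j\<close> nothing changes. On them \<open>c0\<close> already spends as many
    letters \<open>j\<close> as possible on the set \<open>X\<close> where \<open>x\<close> differs
    from \<open>j\<close>. So agreement cannot drop, and equality forces \<open>b = j\<close> on
    \<open>X\<close>.\<close>
  have main: "agree n c0 g0 < agree n c0 \<xi> \<or> (\<exists>h\<in>Hs n c0. \<exists>k\<in>Hs n c0. \<xi> = h \<circ> g0 \<circ> k)"
    if r: "r \<in> Hs n c0" and k: "k \<in> Hs n y" and r2: "r2 \<in> Hs n c0" and \<xi>: "\<xi> = r \<circ> k \<circ> g0 \<circ> r2" for r k r2 \<xi>
  proof -
    have S: "r \<in> Sn n" "k \<in> Sn n" "r2 \<in> Sn n" using r k r2 Hs_Sn by auto
    define b where "b i = c0 (k i)" for i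
    have ag: "agree n c0 \<xi> = card {i\<in>{1..n}. x i = b i}"
    proof -
      have "iv \<xi> = iv r2 \<circ> iv g0 \<circ> iv k \<circ> iv r"
        unfolding \<xi> using S g0(1) by (simp add: Sn_iv_distrib[of _ n] Sn_intros o_assoc)
      then have e: "c0 (iv \<xi> i) = x (iv k (iv r i))" for i
        using Hs_eq[OF Hs_iv[OF r2]] by (simp add: x_def)
      have "agree n c0 \<xi> = card {i\<in>{1..n}. x (iv k (iv r i)) = c0 (r (iv r i))}"
        unfolding agree_def e using Sn_iv_app(2)[OF S(1)] by simp
      also have "\<dots> = card {i\<in>{1..n}. x (iv k i) = c0 (r i)}"
        using card_Sn_collect[OF Sn_iv[OF S(1)], of "\<lambda>i. x (iv k i) = c0 (r i)"] .
      also have "\<dots> = card {i\<in>{1..n}. x (iv k i) = c0 (k (iv k i))}"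
        unfolding Hs_eq[OF r] using Sn_iv_app(2)[OF S(2)] by simp
      also have "\<dots> = card {i\<in>{1..n}. x i = c0 (k i)}"
        using card_Sn_collect[OF Sn_iv[OF S(2)], of "\<lambda>i. x i = c0 (k i)"] .
      finally show ?thesis by (simp add: b_def)
    qed
    have ag0: "agree n c0 g0 = card {i\<in>{1..n}. x i = c0 i}" by (simp add: agree_def x_def)
    have yk: "y (k i) = y i" for i using Hs_eq[OF k] .
    have b1: "b i = c0 i" if "y i \<noteq> j" for i using yc[of i] yc[of "k i"] that yk[of i] by (auto simp: b_def)
    have b2: "y i = j" if "b i = j" for i using yj[of "k i"] yk[of i] that by (simp add: b_def)
    have bl: "card {i\<in>{1..n}. y i = j \<and> b i = l} = card {i\<in>{1..n}. y i = j \<and> c0 i = l}" for l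
      using card_Sn_collect[OF S(2), of "\<lambda>i. y i = j \<and> c0 i = l"] by (simp add: b_def yk)
    define A where "A = {i\<in>{1..n}. y i \<noteq> j \<and> x i = c0 i}"
    define X where "X = {i\<in>{1..n}. y i = j \<and> x i \<noteq> j}"
    have fin: "finite A" "finite X" by (auto simp: A_def X_def)
    have "{i\<in>{1..n}. x i = c0 i} = A \<union> {i\<in>{1..n}. c0 i = j \<and> x i = j}"
      using yj by (auto simp: A_def y_def)
    moreover have "A \<inter> {i\<in>{1..n}. c0 i = j \<and> x i = j} = {}" by (auto simp: A_def y_def)
    ultimately have c1: "agree n c0 g0 = card A + card {i\<in>{1..n}. c0 i = j \<and> x i = j}"
      unfolding ag0 by (simp add: card_Un_disjoint fin)
    have "{i\<in>{1..n}. c0 i = j} = {i\<in>{1..n}. c0 i = j \<and> x i = j} \<union> X" unfolding X_def set_eq by auto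
    moreover have "{i\<in>{1..n}. c0 i = j \<and> x i = j} \<inter> X = {}" by (auto simp: X_def)
    ultimately have c2: "card {i\<in>{1..n}. c0 i = j} = card {i\<in>{1..n}. c0 i = j \<and> x i = j} + card X"
      by (simp add: card_Un_disjoint fin)
    have c3: "card {i\<in>{1..n}. b i = j} = card {i\<in>{1..n}. c0 i = j}"
    proof -
      have "{i\<in>{1..n}. b i = j} = {i\<in>{1..n}. y i = j \<and> b i = j}" using b2 by auto
      moreover have "{i\<in>{1..n}. c0 i = j} = {i\<in>{1..n}. y i = j \<and> c0 i = j}" using yj by auto
      ultimately show ?thesis using bl by simp
    qed
    have "{i\<in>{1..n}. b i = j} = {i\<in>{1..n}. b i = j \<and> x i = j} \<union> {i\<in>X. b i = j}" using b2 by (auto simp: X_def)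
    moreover have "{i\<in>{1..n}. b i = j \<and> x i = j} \<inter> {i\<in>X. b i = j} = {}" by (auto simp: X_def)
    ultimately have c4: "card {i\<in>{1..n}. b i = j} = card {i\<in>{1..n}. b i = j \<and> x i = j} + card {i\<in>X. b i = j}"
      by (simp add: card_Un_disjoint fin)
    have sub: "A \<union> {i\<in>{1..n}. b i = j \<and> x i = j} \<subseteq> {i\<in>{1..n}. x i = b i}" using b1 by (auto simp: A_def)
    have "A \<inter> {i\<in>{1..n}. b i = j \<and> x i = j} = {}" using b2 by (auto simp: A_def)
    then have c5: "card A + card {i\<in>{1..n}. b i = j \<and> x i = j} \<le> agree n c0 \<xi>"
      unfolding ag using card_mono[OF _ sub] by (simp add: card_Un_disjoint fin)
    have c6: "card {i\<in>X. b i = j} \<le> card X" by (intro card_mono fin) auto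
    show ?thesis
    proof (cases "agree n c0 g0 < agree n c0 \<xi>")
      case False
      then have "card {i\<in>X. b i = j} = card X" using c1 c2 c3 c4 c5 c6 by simp
      then have "{i\<in>X. b i = j} = X" by (intro card_subset_eq fin) auto
      then have Xb: "b i = j" if "i \<in> {1..n}" "y i = j" "x i \<noteq> j" for i using that by (auto simp: X_def)
      have Xc: "c0 i = j" if "y i = j" "x i \<noteq> j" for i using that by (auto simp: y_def split: if_splits)
      have bc: "b i = c0 i" if "i \<in> {1..n}" "y i = j" "x i \<noteq> j" for i using Xb[OF that] Xc[OF that(2,3)] by simp
      have part: "card {i\<in>{1..n}. y i = j \<and> b i = l \<and> x i = m} = card {i\<in>{1..n}. y i = j \<and> c0 i = l \<and> x i = m}" if "m \<noteq> j" for l m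
        using bc that by (intro arg_cong[where f = card] Collect_cong) metis
      have compl: "card {i\<in>{1..n}. y i = j \<and> f i = l} = card {i\<in>{1..n}. y i = j \<and> f i = l \<and> x i = j} + card {i\<in>{1..n}. y i = j \<and> f i = l \<and> x i \<noteq> j}"
        for f l by (subst card_Un_disjoint[symmetric]) (auto intro!: arg_cong[where f = card])
      have part0: "card {i\<in>{1..n}. y i = j \<and> b i = l \<and> x i \<noteq> j} = card {i\<in>{1..n}. y i = j \<and> c0 i = l \<and> x i \<noteq> j}" for l
        using bc by (intro arg_cong[where f = card] Collect_cong) metis
      have part': "card {i\<in>{1..n}. y i = j \<and> b i = l \<and> x i = m} = card {i\<in>{1..n}. y i = j \<and> c0 i = l \<and> x i = m}" for l m
        using part[of m l] compl[of b l] compl[of c0 l] bl[of l] part0[of l] by (cases "m = j") auto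
      have split: "card {i\<in>{1..n}. f i = l \<and> x i = m} = card {i\<in>{1..n}. y i = j \<and> f i = l \<and> x i = m} + card {i\<in>{1..n}. y i \<noteq> j \<and> f i = l \<and> x i = m}"
        for f l m by (subst card_Un_disjoint[symmetric]) (auto intro!: arg_cong[where f = card])
      have off: "{i\<in>{1..n}. y i \<noteq> j \<and> b i = l \<and> x i = m} = {i\<in>{1..n}. y i \<noteq> j \<and> c0 i = l \<and> x i = m}" for l m using b1 by auto
      \<comment> \<open>In the case of equality the pairs \<open>(b, x)\<close> and
        \<open>(c0, x)\<close> have the same multiplicities; a permutation \<open>s\<close> carrying
        one to the other exhibits \<open>\<xi>\<close> in the double coset of
        \<open>g0\<close>.\<close>
      have "card {i\<in>{1..n}. (b i, x i) = lm} = card {i\<in>{1..n}. (c0 i, x i) = lm}" for lm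
        using split[of b "fst lm" "snd lm"] split[of c0 "fst lm" "snd lm"] part'[of "fst lm" "snd lm"] off[of "fst lm" "snd lm"]
        by (simp add: prod_eq_iff)
      from ex_perm_of_counts[OF this] obtain s where s: "s \<in> Sn n" "\<And>i. i \<in> {1..n} \<Longrightarrow> (c0 (s i), x (s i)) = (b i, x i)" by auto
      have s': "c0 (s i) = b i \<and> x (s i) = x i" for i
        using s(2)[of i] Sn_outside[OF s(1), of i] Sn_outside[OF S(2), of i] by (cases "i \<in> {1..n}") (auto simp: b_def)
      have rho: "k \<circ> iv s \<in> Hs n c0"
        using s' Sn_iv_app(2)[OF s(1)] by (auto simp: Hs_def Sn_intros S s(1) fun_eq_iff b_def) metis
      have r': "iv g0 \<circ> s \<circ> g0 \<in> Hs n c0"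
      proof -
        have "c0 ((iv g0 \<circ> s \<circ> g0) i) = c0 i" for i
          using s'[of "g0 i"] Sn_iv_app(1)[OF g0(1)] by (simp add: x_def)
        then show ?thesis by (auto simp: Hs_def Sn_intros g0(1) s(1) fun_eq_iff)
      qed
      have "\<xi> = (r \<circ> (k \<circ> iv s)) \<circ> g0 \<circ> ((iv g0 \<circ> s \<circ> g0) \<circ> r2)"
        unfolding \<xi> using g0(1) s(1) by (simp add: o_assoc[symmetric] Sn_cancel)
      then show ?thesis using Hs_comp[OF r rho] Hs_comp[OF r' r2] by blast
    qed simp
  qed
  have supp: "\<exists>r\<in>Hs n c0. \<exists>k\<in>Hs n y. \<exists>k'\<in>Hs n y. \<exists>r2\<in>Hs n c0. \<eta> = r \<circ> k \<and> \<xi> = r \<circ> (k \<circ> k') \<circ> g0 \<circ> r2"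
    if e1: "\<eta> \<in> Sn n" and e2: "v1 \<eta> \<noteq> 0" and e3: "v2 (iv \<eta> \<circ> \<xi>) \<noteq> 0" for \<eta> \<xi>
  proof -
    obtain r k where rk: "r \<in> Hs n c0" "k \<in> Hs n y" "\<eta> = r \<circ> k" using dcos_nonzero[OF e2[unfolded v1_def]] by auto
    obtain k' r2 where kr: "k' \<in> Hs n y" "r2 \<in> Hs n c0" "iv \<eta> \<circ> \<xi> = k' \<circ> g0 \<circ> r2" using dcos_nonzero[OF e3[unfolded v2_def]] by blast
    have "\<xi> = \<eta> \<circ> (iv \<eta> \<circ> \<xi>)" using e1 by (simp add: Sn_cancel)
    also have "\<dots> = \<eta> \<circ> (k' \<circ> g0 \<circ> r2)" by (simp only: kr(3))
    finally have "\<xi> = r \<circ> (k \<circ> k') \<circ> g0 \<circ> r2" by (simp only: rk(3) o_assoc)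
    then show ?thesis using rk kr by blast
  qed
  \<comment> \<open>Only the trivial coset contributes. Another one, of
    \<open>\<eta> = r \<circ> k\<close>, gives the word \<open>y \<circ> iv r\<close>, which also
    has \<open>j\<close> wherever \<open>c0\<close> or \<open>x\<close> does; counting leaves no
    room for further letters \<open>j\<close>, so this word is \<open>y\<close> itself.\<close>
  have at_g0: "conv n y v2 v1 g0 = 1"
  proof -
    have zero: "v2 (iv \<eta> \<circ> g0) * v1 \<eta> = 0" if \<eta>: "\<eta> \<in> Sn n" "y \<circ> iv \<eta> \<noteq> y" for \<eta>
    proof (rule ccontr)
      assume "v2 (iv \<eta> \<circ> g0) * v1 \<eta> \<noteq> 0"
      then obtain r k k' r2 where h: "r \<in> Hs n c0" "k \<in> Hs n y" "k' \<in> Hs n y" "r2 \<in> Hs n c0"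
        "\<eta> = r \<circ> k" "g0 = r \<circ> (k \<circ> k') \<circ> g0 \<circ> r2" using supp[OF \<eta>(1)] by fastforce
      define q where "q = r \<circ> (k \<circ> k')"
      have S: "r \<in> Sn n" "k \<in> Sn n" "k' \<in> Sn n" "r2 \<in> Sn n" using h Hs_Sn by auto
      have qS: "q \<in> Sn n" using S by (simp add: q_def Sn_comp)
      define y' where "y' = y \<circ> iv r"
      have y'r: "y' (r i) = y i" for i using Sn_iv_app(1)[OF S(1)] by (simp add: y'_def)
      have y'q: "y' (q i) = y i" for i
        using y'r[of "k (k' i)"] Hs_eq[OF h(2), of "k' i"] Hs_eq[OF h(3), of i] by (simp add: q_def)
      have xq: "x (q i) = x i" for i
      proof -
        have "iv g0 = iv r2 \<circ> iv g0 \<circ> iv q"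
        proof -
          have "iv g0 = iv (q \<circ> g0 \<circ> r2)" using h(6) by (simp add: q_def)
          then show ?thesis using qS g0(1) S by (simp add: Sn_iv_distrib[of _ n] Sn_intros o_assoc)
        qed
        then have "iv g0 (q i) = iv r2 (iv g0 (iv q (q i)))" by (metis comp_apply)
        then have "c0 (iv g0 (q i)) = c0 (iv g0 i)" using Hs_eq[OF Hs_iv[OF h(4)]] Sn_iv_app(1)[OF qS] by simp
        then show ?thesis by (simp add: x_def)
      qed
      have cj: "y' i = j" if "c0 i = j" for i
        using y'r[of "iv r i"] Sn_iv_app(2)[OF S(1)] yj[of "iv r i"] Hs_eq[OF Hs_iv[OF h(1)], of i] that by simp
      have xj: "y' i = j" if "x i = j" for i
        using y'q[of "iv q i"] xq[of "iv q i"] Sn_iv_app(2)[OF qS] that by (simp add: y_def)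
      have "card {i\<in>{1..n}. y' i = j \<and> x i \<noteq> j} = card {i\<in>{1..n}. y i = j \<and> x i \<noteq> j}"
        using card_Sn_collect[OF qS, of "\<lambda>i. y' i = j \<and> x i \<noteq> j"] by (simp add: y'q xq)
      then have "{i\<in>{1..n}. c0 i = j \<and> x i \<noteq> j} = {i\<in>{1..n}. y' i = j \<and> x i \<noteq> j}"
        unfolding set_eq using cj by (intro card_subset_eq) auto
      then have y'j: "y' i = j \<longleftrightarrow> y i = j" if "i \<in> {1..n}" for i
        using that cj xj by (auto simp: y_def)
      have y'c: "y' i = c0 i" if "y' i \<noteq> j" for i
        using y'r[of "iv r i"] Sn_iv_app(2)[OF S(1)] yc[of "iv r i"] Hs_eq[OF Hs_iv[OF h(1)], of i] that by simp
      have "y' i = y i" for i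
        using y'j[of i] y'c[of i] yc[of i] Sn_outside[OF Sn_iv[OF S(1)], of i] by (cases "i \<in> {1..n}") (auto simp: y'_def)
      then have "y \<circ> iv r = y" by (auto simp: y'_def fun_eq_iff)
      then have "y \<circ> iv \<eta> = y" using word_mult_right[OF S(1) h(2)] h(5) by simp
      then show False using \<eta>(2) by blast
    qed
    let ?F = "\<lambda>\<eta>. v2 (iv \<eta> \<circ> g0) * v1 \<eta>"
    have yW: "y \<in> words n y" unfolding words_def using Sn_id by (intro image_eqI[of _ _ id]) auto
    have ri: "rinv n y ?F" by (rule conv_rinv[OF b1 b2 g0(1)])
    have "conv n y v2 v1 g0 = (\<Sum>w\<in>words n y. ?F (wrep n y w))"
      unfolding conv_def by (rule csum_words[OF ri])
    also have "\<dots> = (\<Sum>w\<in>{y}. ?F (wrep n y w))"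
      using yW finite_words zero wrep[of _ n y] by (intro sum.mono_neutral_right) auto
    also have "\<dots> = ?F id" using wrep[OF yW] by (simp add: rinv_word[OF ri _ Sn_id])
    also have "\<dots> = v2 g0 * v1 id" by simp
    also have "v1 id = 1" unfolding v1_def by (rule dcos_one[OF Sn_id comp1])
    also have "v2 g0 = 1" unfolding v2_def by (rule dcos_one[OF g0(1) comp2])
    finally show ?thesis by simp
  qed
  have "agree n c0 g0 < agree n c0 \<xi> \<or> (\<exists>h\<in>Hs n c0. \<exists>k\<in>Hs n c0. \<xi> = h \<circ> g0 \<circ> k)"
    if "\<xi> \<in> Sn n" "conv n y v2 v1 \<xi> \<noteq> 0" for \<xi>
  proof -
    have "\<exists>l<tdim n y. v2 (iv (tr n y l) \<circ> \<xi>) * v1 (tr n y l) \<noteq> 0"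
      using that(2) unfolding conv_def csum_def by (meson lessThan_iff sum.neutral)
    then obtain l where "l < tdim n y" "v2 (iv (tr n y l) \<circ> \<xi>) \<noteq> 0" "v1 (tr n y l) \<noteq> 0" by auto
    then show ?thesis using supp[of "tr n y l" \<xi>] tr_mem(1)[of l n y] main Hs_comp by metis
  qed
  then show thesis using that[OF nd b1 b2 at_g0] by blast
qed

definition idf :: "nat \<Rightarrow> labelling \<Rightarrow> (nat \<Rightarrow> nat) \<Rightarrow> 'a::field" where
  "idf n c x = (if x \<in> Hs n c then chi n c x else 0)"

lemma hmat_idf: "hmat n c c (idf n c) = (1\<^sub>m (tdim n c) :: 'a::field mat)"
proof (rule eq_matI)
  fix i j assume "i < dim_row (1\<^sub>m (tdim n c) :: 'a mat)" "j < dim_col (1\<^sub>m (tdim n c) :: 'a mat)"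
  then have ij: "i < tdim n c" "j < tdim n c" by auto
  have "iv (tr n c j) \<circ> tr n c i \<in> Hs n c \<longleftrightarrow> i = j"
    using same_word_iff[of "tr n c j" n "tr n c i" c] ij tr_mem(1)[of _ n c] tr_inj[of i n c j] by auto
  then show "hmat n c c (idf n c) $$ (i, j) = (1\<^sub>m (tdim n c) :: 'a mat) $$ (i, j)"
    using ij by (auto simp: hmat_def idf_def Sn_iv_comp[OF tr_mem(1)] chi_id)
qed (auto simp: hmat_def)

lemma agree_less:
  assumes "g \<in> Sn n" "g \<notin> Hs n c0" shows "agree n c0 g < n"
proof -
  have "{i\<in>{1..n}. c0 (iv g i) = c0 i} \<noteq> {1..n}"
  proof
    assume "{i\<in>{1..n}. c0 (iv g i) = c0 i} = {1..n}"
    then have "c0 (iv g i) = c0 i" for i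
      using Sn_outside[OF Sn_iv[OF assms(1)], of i] by (cases "i \<in> {1..n}") (auto simp: set_eq_iff)
    then have "iv g \<in> Hs n c0" using Sn_iv[OF assms(1)] by (auto simp: Hs_def fun_eq_iff)
    then show False using Hs_iv[of "iv g" n c0] assms by (simp add: Sn_iv_iv)
  qed
  then have "{i\<in>{1..n}. c0 (iv g i) = c0 i} \<subset> {1..n}" by blast
  then show ?thesis unfolding agree_def using psubset_card_mono[of "{1..n}" "{i\<in>{1..n}. c0 (iv g i) = c0 i}"] by simp
qed

lemma biequiv_smult: "v \<in> biequiv n c c' \<Longrightarrow> (\<lambda>x. a * v x) \<in> biequiv n c c'"
  by (simp add: biequiv_def mult.assoc mult.left_commute)

lemma biequiv_minus: "v \<in> biequiv n c c' \<Longrightarrow> w \<in> biequiv n c c' \<Longrightarrow> (\<lambda>x. v x - w x) \<in> biequiv n c c'"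
  by (simp add: biequiv_def algebra_simps)

definition nondom :: "nat \<Rightarrow> labelling \<Rightarrow> 'a::field rep set" where
  "nondom n c0 = {Ind n c |c. \<not> dominated n c c0}"

lemma nondom_rep: "X \<in> nondom n c0 \<Longrightarrow> is_rep n X"
  unfolding nondom_def using is_rep_Ind by blast

text \<open>Each step removes an element outside the Young subgroup from the support of
  \<open>v\<close> and adds only elements of larger agreement. Once the support lies in the Young
  subgroup, \<open>v\<close> is a multiple of the identity kernel.\<close>

lemma straightening:
  fixes v :: "(nat \<Rightarrow> nat) \<Rightarrow> 'a::field"
  assumes two: "(2::'a) \<noteq> 0" and "v \<in> biequiv n c0 c0"
  shows "\<exists>a A. factor_sum n (nondom n c0) (Ind n c0) A \<and> hmat n c0 c0 v = a \<cdot>\<^sub>m 1\<^sub>m (tdim n c0) + A"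
proof -
  \<comment> \<open>As the base exceeds the order of the group, one element outweighs all elements
    of larger agreement together, and the weight \<open>m\<close> drops at each step.\<close>
  define M where "M = card (Sn n) + 1"
  define m where "m v = (\<Sum>g\<in>{g\<in>Sn n. v g \<noteq> 0}. M ^ (n - agree n c0 g))" for v :: "(nat \<Rightarrow> nat) \<Rightarrow> 'a"
  show ?thesis using assms(2)
  proof (induction "m v" arbitrary: v rule: less_induct)
    case less
    show ?case
    proof (cases "\<exists>g0\<in>Sn n. v g0 \<noteq> 0 \<and> g0 \<notin> Hs n c0")
      case False
      have "v x = v id * idf n c0 x" if "x \<in> Sn n" for x
      proof (cases "x \<in> Hs n c0")
        case True
        then show ?thesis using biequiv_left[OF less.prems True Sn_id] by (simp add: idf_def)
      next
        case F: False
        then show ?thesis using False that by (auto simp: idf_def)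
      qed
      then have "hmat n c0 c0 v = hmat n c0 c0 (\<lambda>x. v id * idf n c0 x)" by (rule hmat_cong)
      also have "\<dots> = v id \<cdot>\<^sub>m hmat n c0 c0 (idf n c0)" by (rule eq_matI) (auto simp: hmat_def)
      also have "\<dots> = v id \<cdot>\<^sub>m 1\<^sub>m (tdim n c0) + 0\<^sub>m (fst (Ind n c0 :: 'a rep)) (fst (Ind n c0 :: 'a rep))"
        by (simp add: hmat_idf fst_Ind)
      finally show ?thesis using factor_sum.zero by blast
    next
      case True
      then obtain g0 where g0: "g0 \<in> Sn n" "v g0 \<noteq> 0" "g0 \<notin> Hs n c0" by blast
      from straightening_step[OF two less.prems g0] obtain c v1 v2 where
        nd: "\<not> dominated n c c0" and v1: "v1 \<in> biequiv n c0 c" and v2: "v2 \<in> biequiv n c c0" and one: "conv n c v2 v1 g0 = (1::'a)"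
        and sp: "\<And>x. x \<in> Sn n \<Longrightarrow> conv n c v2 v1 x \<noteq> 0 \<Longrightarrow>
          agree n c0 g0 < agree n c0 x \<or> (\<exists>h\<in>Hs n c0. \<exists>k\<in>Hs n c0. x = h \<circ> g0 \<circ> k)" by blast
      define w where "w x = v g0 * v1 x" for x
      have w: "w \<in> biequiv n c0 c" unfolding w_def by (rule biequiv_smult[OF v1])
      have cw: "conv n c v2 w x = v g0 * conv n c v2 v1 x" for x
        by (simp add: conv_def csum_def w_def sum_distrib_left mult.left_commute)
      define v' where "v' x = v x - conv n c v2 w x" for x
      have v': "v' \<in> biequiv n c0 c0" unfolding v'_def by (intro biequiv_minus less.prems conv_biequiv[OF w v2])
      have z: "v' (h \<circ> g0 \<circ> k) = 0" if "h \<in> Hs n c0" "k \<in> Hs n c0" for h k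
        using biequivD[OF v' that(1) g0(1) that(2)] by (simp add: v'_def cw one)
      have sub: "{g\<in>Sn n. v' g \<noteq> 0} \<subseteq> ({g\<in>Sn n. v g \<noteq> 0} - {g0}) \<union> {g\<in>Sn n. agree n c0 g0 < agree n c0 g}"
      proof
        fix g assume g: "g \<in> {g\<in>Sn n. v' g \<noteq> 0}"
        have "g \<noteq> g0" using g z[OF Hs_id Hs_id] by auto
        moreover have "conv n c v2 v1 g = 0 \<or> agree n c0 g0 < agree n c0 g" using sp[of g] g z by auto
        ultimately show "g \<in> ({g\<in>Sn n. v g \<noteq> 0} - {g0}) \<union> {g\<in>Sn n. agree n c0 g0 < agree n c0 g}"
          using g by (auto simp: v'_def cw)
      qed
      have lt: "agree n c0 g0 < n" by (rule agree_less[OF g0(1,3)])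
      let ?f = "\<lambda>g. M ^ (n - agree n c0 g)"
      have "m v' \<le> sum ?f (({g\<in>Sn n. v g \<noteq> 0} - {g0}) \<union> {g\<in>Sn n. agree n c0 g0 < agree n c0 g})"
        unfolding m_def using finite_Sn by (intro sum_mono2 sub) auto
      also have "\<dots> \<le> sum ?f ({g\<in>Sn n. v g \<noteq> 0} - {g0}) + sum ?f {g\<in>Sn n. agree n c0 g0 < agree n c0 g}"
        using finite_Sn by (subst sum.union_inter[symmetric]) auto
      also have "sum ?f {g\<in>Sn n. agree n c0 g0 < agree n c0 g} \<le> (\<Sum>g\<in>{g\<in>Sn n. agree n c0 g0 < agree n c0 g}. M ^ (n - Suc (agree n c0 g0)))"
        by (intro sum_mono power_increasing) (auto simp: M_def)
      also have "\<dots> \<le> card (Sn n) * M ^ (n - Suc (agree n c0 g0))"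
        using card_mono[OF finite_Sn, of "{g\<in>Sn n. agree n c0 g0 < agree n c0 g}"] by auto
      also have "\<dots> < M * M ^ (n - Suc (agree n c0 g0))" by (simp add: M_def)
      also have "\<dots> = ?f g0" using lt by (metis Suc_diff_Suc power_Suc)
      also have "sum ?f ({g\<in>Sn n. v g \<noteq> 0} - {g0}) + ?f g0 = m v"
        unfolding m_def using g0 finite_Sn by (subst sum.remove[of _ g0]) (auto simp: add.commute)
      finally have "m v' < m v" by simp
      from less.hyps[OF this v'] obtain a A where
        A: "factor_sum n (nondom n c0) (Ind n c0) A" "hmat n c0 c0 v' = a \<cdot>\<^sub>m 1\<^sub>m (tdim n c0) + A" by blast
      have "factor_sum n (nondom n c0) (Ind n c0) (A + hmat n c c0 v2 * hmat n c0 c w)"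
        using nd by (intro factor_sum.add[where X = "Ind n c"] A hmat_rhom w v2) (auto simp: nondom_def)
      moreover have "hmat n c0 c0 v = a \<cdot>\<^sub>m 1\<^sub>m (tdim n c0) + (A + hmat n c c0 v2 * hmat n c0 c w)"
      proof -
        have Ac: "A \<in> carrier_mat (tdim n c0) (tdim n c0)"
          using rhom_carrier[OF factor_sum_rhom[OF A(1) is_rep_Ind nondom_rep]] by (simp add: fst_Ind)
        have "hmat n c0 c0 v = hmat n c0 c0 v' + hmat n c0 c0 (conv n c v2 w)"
          by (rule eq_matI) (auto simp: hmat_def v'_def)
        also have "\<dots> = a \<cdot>\<^sub>m 1\<^sub>m (tdim n c0) + A + hmat n c c0 v2 * hmat n c0 c w"
          by (simp only: A(2) hmat_mult[OF w v2])
        also have "\<dots> = a \<cdot>\<^sub>m 1\<^sub>m (tdim n c0) + (A + hmat n c c0 v2 * hmat n c0 c w)"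
          using Ac by (intro assoc_add_mat[of _ "tdim n c0" "tdim n c0"]) (auto simp: hmat_def)
        finally show ?thesis .
      qed
      ultimately show ?thesis by blast
    qed
  qed
qed

section \<open>Sums invariant under a map of \<open>p\<close>-power order\<close>

text \<open>A nontrivial orbit has length a positive power of \<open>p\<close>; its constant summand
  is added a multiple of \<open>p\<close> times and vanishes in characteristic \<open>p\<close>.
  Orbits are removed one by one.\<close>

lemma sum_fixed_points:
  fixes F :: "'b \<Rightarrow> 'a::field"
  assumes p: "prime p" "CHAR('a) = p" and fin: "finite S"
    and cl: "\<And>s. s \<in> S \<Longrightarrow> \<zeta> s \<in> S" and per: "\<And>s. s \<in> S \<Longrightarrow> (\<zeta> ^^ (p ^ N)) s = s"
    and inv: "\<And>s. s \<in> S \<Longrightarrow> F (\<zeta> s) = F s"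
  shows "sum F S = sum F {s\<in>S. \<zeta> s = s}"
  using fin cl per inv
proof (induction "card S" arbitrary: S rule: less_induct)
  case less
  show ?case
  proof (cases "\<exists>s\<in>S. \<zeta> s \<noteq> s")
    case False
    then have "{s\<in>S. \<zeta> s = s} = S" by auto
    then show ?thesis by simp
  next
    case True
    then obtain s where s: "s \<in> S" "\<zeta> s \<noteq> s" by blast
    have pw: "(\<zeta> ^^ i) t \<in> S \<and> F ((\<zeta> ^^ i) t) = F t" if "t \<in> S" for i t
      using that less.prems(2,4) by (induction i) auto
    define d where "d = (LEAST d. d > 0 \<and> (\<zeta> ^^ d) s = s)"
    have "p ^ N > 0 \<and> (\<zeta> ^^ (p ^ N)) s = s" using p less.prems(3)[OF s(1)] by (simp add: prime_gt_0_nat)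
    then have d: "d > 0" "(\<zeta> ^^ d) s = s" unfolding d_def by (metis (mono_tags, lifting) LeastI)+
    have dmin: "e = 0" if "e < d" "(\<zeta> ^^ e) s = s" for e
      using that not_less_Least[of e "\<lambda>d. d > 0 \<and> (\<zeta> ^^ d) s = s"] by (auto simp: d_def)
    have dmod: "(\<zeta> ^^ i) s = (\<zeta> ^^ (i mod d)) s" for i using funpow_mod_eq[OF d(2)] by simp
    have "p ^ N mod d = 0" using dmin[of "p ^ N mod d"] dmod[of "p ^ N"] d(1) less.prems(3)[OF s(1)] by simp
    then have "d dvd p ^ N" by auto
    then obtain e where e: "d = p ^ e" using p(1) divides_primepow_nat by blast
    have "e \<noteq> 0" using e d(2) s(2) by (intro notI) simp
    then have "p dvd d" using e by simp
    then have d0: "of_nat d = (0::'a)" using p(2) of_nat_eq_0_iff_char_dvd by blast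
    define O' where "O' = (\<lambda>i. (\<zeta> ^^ i) s) ` {..<d}"
    have inj: "inj_on (\<lambda>i. (\<zeta> ^^ i) s) {..<d}"
    proof (rule linorder_inj_onI)
      fix i j assume ij: "i < j" "i \<in> {..<d}" "j \<in> {..<d}"
      show "(\<zeta> ^^ i) s \<noteq> (\<zeta> ^^ j) s"
      proof
        assume "(\<zeta> ^^ i) s = (\<zeta> ^^ j) s"
        then have "(\<zeta> ^^ (d - i)) ((\<zeta> ^^ i) s) = (\<zeta> ^^ (d - i)) ((\<zeta> ^^ j) s)" by simp
        then have "(\<zeta> ^^ (d - i + i)) s = (\<zeta> ^^ (d - i + j)) s" by (simp add: funpow_add)
        moreover have "d - i + j = d + (j - i)" using ij by auto
        ultimately have "(\<zeta> ^^ (d + (j - i))) s = s" using d(2) ij by simp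
        moreover have "(d + (j - i)) mod d = j - i"
          by (simp only: mod_add_self1) (rule mod_less, use ij in auto)
        ultimately have "(\<zeta> ^^ (j - i)) s = s" using dmod[of "d + (j - i)"] by simp
        moreover have "j - i < d" using ij by auto
        ultimately show False using dmin[of "j - i"] ij by auto
      qed
    qed auto
    have OS: "O' \<subseteq> S" using pw s(1) by (auto simp: O'_def)
    have cO: "card O' = d" using card_image[OF inj] by (simp add: O'_def)
    have all: "(\<zeta> ^^ i) s \<in> O'" for i using dmod[of i] d(1) by (auto simp: O'_def)
    have "sum F O' = (\<Sum>i<d. F s)" unfolding O'_def by (subst sum.reindex[OF inj]) (simp add: pw[OF s(1)])
    also have "\<dots> = 0" using d0 by simp
    finally have sO: "sum F O' = 0" .
    have cl': "\<zeta> t \<in> S - O'" if t: "t \<in> S - O'" for t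
    proof -
      have "\<zeta> t \<notin> O'"
      proof
        assume "\<zeta> t \<in> O'"
        then obtain i where "\<zeta> t = (\<zeta> ^^ i) s" by (auto simp: O'_def)
        then have "(\<zeta> ^^ (p ^ N - 1)) (\<zeta> t) = (\<zeta> ^^ (p ^ N - 1 + i)) s" by (simp add: funpow_add)
        moreover have "(\<zeta> ^^ (p ^ N - 1)) (\<zeta> t) = (\<zeta> ^^ Suc (p ^ N - 1)) t" by (simp only: funpow_swap1 funpow.simps o_apply)
        moreover have "Suc (p ^ N - 1) = p ^ N" using p(1) by (simp add: prime_gt_0_nat)
        moreover have "(\<zeta> ^^ (p ^ N)) t = t" using less.prems(3) t by blast
        ultimately have "t = (\<zeta> ^^ (p ^ N - 1 + i)) s" by metis
        then show False using t all by simp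
      qed
      then show ?thesis using t less.prems(2) by blast
    qed
    have nf: "\<zeta> t \<noteq> t" if "t \<in> O'" for t
    proof
      assume f: "\<zeta> t = t"
      from that obtain i where i: "i < d" "t = (\<zeta> ^^ i) s" by (auto simp: O'_def)
      have ft: "(\<zeta> ^^ k) t = t" for k using f by (induction k) auto
      have "s = (\<zeta> ^^ (d - i)) t" using i d(2) by (simp flip: funpow_add[unfolded o_def, THEN fun_cong] add: funpow_add[symmetric, THEN fun_cong, unfolded o_apply])
      then show False using ft s(2) f by simp
    qed
    have "sum F S = sum F (S - O') + sum F O'" using OS less.prems(1) by (subst sum.subset_diff[OF OS]) auto
    also have "\<dots> = sum F (S - O')" by (simp add: sO)
    also have "\<dots> = sum F {t\<in>S - O'. \<zeta> t = t}"
    proof (rule less.hyps)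
      show "card (S - O') < card S" using OS less.prems(1) cO d(1) s(1)
        by (metis Diff_subset all card_gt_0_iff card_seteq finite_Diff funpow_0 linorder_not_le Diff_iff)
    qed (use less.prems cl' in auto)
    also have "{t\<in>S - O'. \<zeta> t = t} = {t\<in>S. \<zeta> t = t}" using nf by auto
    finally show ?thesis .
  qed
qed

section \<open>The column form\<close>

text \<open>\<open>c0\<close> gives the row and \<open>col\<close> the column of a box; \<open>z\<close> preserves rows and permutes columns.\<close>

locale tableau =
  fixes n p N :: nat and c0 :: labelling and col :: "nat \<Rightarrow> 'k" and z :: "nat \<Rightarrow> nat"
  assumes prime_p: "prime p" and odd_p: "odd p"
    and box_inj: "\<lbrakk>i \<in> {1..n}; j \<in> {1..n}; c0 i = c0 j; col i = col j\<rbrakk> \<Longrightarrow> i = j"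
    and col_parity: "\<lbrakk>i \<in> {1..n}; j \<in> {1..n}; col i = col j\<rbrakk> \<Longrightarrow> fst (c0 i) = fst (c0 j)"
    and col_down: "\<lbrakk>i \<in> {1..n}; c0 i = (b, Suc k)\<rbrakk> \<Longrightarrow> \<exists>j\<in>{1..n}. col j = col i \<and> c0 j = (b, k)"
    and z_row: "z \<in> Hs n c0" and z_order: "z ^^ (p ^ N) = id"
    and z_col: "\<lbrakk>i \<in> {1..n}; j \<in> {1..n}; col i = col j\<rbrakk> \<Longrightarrow> col (z i) = col (z j)"
    and z_odd: "\<lbrakk>i \<in> {1..n}; fst (c0 i)\<rbrakk> \<Longrightarrow> z i \<noteq> i"
begin

lemma zS: "z \<in> Sn n" using z_row by (rule Hs_Sn)

abbreviation "Col \<equiv> Hs n col"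

text \<open>Alternating on even points and trivial on odd ones, opposite to the row character
  \<open>chi\<close>: a column antisymmetrizes exactly where the rows symmetrize, and
  conversely.\<close>

definition eps :: "(nat \<Rightarrow> nat) \<Rightarrow> 'a::field" where
  "eps \<pi> = rsgn {i\<in>{1..n}. \<not> fst (c0 i)} \<pi>"

lemma Col_even: "\<pi> \<in> Col \<Longrightarrow> \<pi> x \<in> {i\<in>{1..n}. \<not> fst (c0 i)} \<longleftrightarrow> x \<in> {i\<in>{1..n}. \<not> fst (c0 i)}"
  using Sn_in[OF Hs_Sn, of \<pi> n col x] col_parity[of "\<pi> x" x] Hs_eq[of \<pi> n col x] by auto

lemma eps_comp:
  assumes p: "\<pi> \<in> Col" and s: "\<sigma> \<in> Col"
  shows "eps (\<pi> \<circ> \<sigma>) = eps \<pi> * (eps \<sigma> :: 'a::field)"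
  unfolding eps_def by (rule rsgn_comp[OF Hs_Sn[OF p] Col_even[OF p] Hs_Sn[OF s] Col_even[OF s]])

lemma eps_id: "eps id = (1::'a::field)" by (simp add: eps_def rsgn_id)

definition form :: "labelling \<Rightarrow> ((nat \<Rightarrow> nat) \<Rightarrow> 'a::field) \<Rightarrow> ((nat \<Rightarrow> nat) \<Rightarrow> 'a) \<Rightarrow> 'a" where
  "form c v' v = csum n c (\<lambda>y. (\<Sum>\<pi>\<in>Col. eps \<pi> * v' (iv \<pi> \<circ> y)) * v y)"

definition phi :: "((nat \<Rightarrow> nat) \<Rightarrow> 'a::field) \<Rightarrow> 'a" where
  "phi v = (\<Sum>\<pi>\<in>Col. eps \<pi> * v \<pi>)"

lemma phi_conv: "phi (conv n c v2 v1) = form c (\<lambda>x. v2 (iv x)) v1"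
proof -
  have "phi (conv n c v2 v1) = (\<Sum>\<pi>\<in>Col. \<Sum>l<tdim n c. eps \<pi> * (v2 (iv (tr n c l) \<circ> \<pi>) * v1 (tr n c l)))"
    by (simp add: phi_def conv_def csum_def sum_distrib_left)
  also have "\<dots> = (\<Sum>l<tdim n c. \<Sum>\<pi>\<in>Col. eps \<pi> * (v2 (iv (tr n c l) \<circ> \<pi>) * v1 (tr n c l)))"
    by (rule sum.swap)
  also have "\<dots> = (\<Sum>l<tdim n c. (\<Sum>\<pi>\<in>Col. eps \<pi> * v2 (iv (iv \<pi> \<circ> tr n c l))) * v1 (tr n c l))"
    unfolding sum_distrib_right using tr_mem(1)[of _ n c]
    by (intro sum.cong refl) (simp add: Sn_iv_distrib[of _ n] Sn_intros Hs_Sn Sn_iv_iv[OF Hs_Sn] mult.assoc)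
  finally show ?thesis by (simp add: form_def csum_def)
qed

lemma phi_cong: "(\<And>x. x \<in> Sn n \<Longrightarrow> v x = w x) \<Longrightarrow> phi v = phi w"
  unfolding phi_def by (intro sum.cong) (auto simp: Hs_Sn)

lemma phi_add: "phi (\<lambda>x. v x + w x) = phi v + phi w"
  by (simp add: phi_def algebra_simps sum.distrib)

lemma phi_smult: "phi (\<lambda>x. a * v x) = a * phi v"
  by (simp add: phi_def sum_distrib_left mult.left_commute)

text \<open>By \<open>box_inj\<close> only the identity preserves all rows and all columns, so a
  single term remains.\<close>

lemma phi_idf: "phi (idf n c0) = (1::'a::field)"
proof -
  have "\<pi> = id" if "\<pi> \<in> Col" "\<pi> \<in> Hs n c0" for \<pi>
  proof
    fix i
    show "\<pi> i = id i"
      using box_inj[of "\<pi> i" i] Hs_eq[OF that(1), of i] Hs_eq[OF that(2), of i] Sn_in[OF Hs_Sn[OF that(1)], of i]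
        Sn_outside[OF Hs_Sn[OF that(1)], of i] by (cases "i \<in> {1..n}") auto
  qed
  then have "phi (idf n c0) = (\<Sum>\<pi>\<in>{id}. eps \<pi> * (idf n c0 \<pi> :: 'a))"
    unfolding phi_def by (intro sum.mono_neutral_right) (auto simp: finite_Hs Hs_id idf_def)
  then show ?thesis by (simp add: idf_def Hs_id chi_id eps_id)
qed

lemma colsum_right:
  assumes v': "v' \<in> biequiv n c0 c" and y: "y \<in> Sn n" and k: "k \<in> Hs n c"
  shows "(\<Sum>\<pi>\<in>Col. eps \<pi> * v' (iv \<pi> \<circ> (y \<circ> k))) = (\<Sum>\<pi>\<in>Col. eps \<pi> * v' (iv \<pi> \<circ> y)) * (chi n c k :: 'a::field)"
proof -
  have "v' (iv \<pi> \<circ> (y \<circ> k)) = v' (iv \<pi> \<circ> y) * chi n c k" if "\<pi> \<in> Col" for \<pi>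
    using biequiv_right[OF v' _ k, of "iv \<pi> \<circ> y"] y Hs_Sn[OF that] by (simp add: Sn_intros o_assoc)
  then show ?thesis by (simp add: sum_distrib_right mult.assoc)
qed

lemma form_rinv:
  assumes "v' \<in> biequiv n c0 c" "v \<in> biequiv n c0 c"
  shows "rinv n c (\<lambda>y. (\<Sum>\<pi>\<in>Col. eps \<pi> * v' (iv \<pi> \<circ> y)) * (v y :: 'a::field))"
  unfolding rinv_def
proof (intro ballI)
  fix y k assume y: "y \<in> Sn n" and k: "k \<in> Hs n c"
  show "(\<Sum>\<pi>\<in>Col. eps \<pi> * v' (iv \<pi> \<circ> (y \<circ> k))) * v (y \<circ> k) = (\<Sum>\<pi>\<in>Col. eps \<pi> * v' (iv \<pi> \<circ> y)) * v y"
    unfolding colsum_right[OF assms(1) y k] biequiv_right[OF assms(2) y k]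
    using chi_square[of n c k, where ?'a = 'a] by (simp add: mult.assoc mult.left_commute[of _ "chi n c k"])
qed

section \<open>Reduction to words fixed by the rotation\<close>

lemma funpow_Sn: "g \<in> Sn n \<Longrightarrow> g ^^ i \<in> Sn n"
  by (induction i) (auto simp: Sn_id Sn_comp)

lemma funpow_Hs: "g \<in> Hs n c \<Longrightarrow> g ^^ i \<in> Hs n c"
  by (induction i) (auto simp: Hs_id[unfolded id_def] Hs_id Hs_comp)

lemma funpow_conj: "y \<in> Sn n \<Longrightarrow> (iv y \<circ> g \<circ> y) ^^ i = iv y \<circ> (g ^^ i) \<circ> y"
proof (induction i)
  case 0 then show ?case by (simp add: Sn_iv_comp)
next
  case (Suc i)
  have "(iv y \<circ> g \<circ> y) ^^ Suc i = iv y \<circ> g \<circ> y \<circ> (iv y \<circ> g ^^ i \<circ> y)"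
    by (simp only: funpow.simps(2) Suc.IH[OF Suc.prems])
  also have "\<dots> = iv y \<circ> (g \<circ> (y \<circ> (iv y \<circ> ((g ^^ i) \<circ> y))))" by (simp only: o_assoc)
  also have "\<dots> = iv y \<circ> (g ^^ Suc i) \<circ> y" 
    by (simp only: Sn_cancel[OF Suc.prems]) (simp only: funpow.simps(2) o_assoc)
  finally show ?case .
qed

text \<open>The value is 1 or -1, and an odd power of it is 1.\<close>

lemma chi_p_power_order:
  assumes h: "h \<in> Hs n c" and "h ^^ (p ^ N) = id"
  shows "chi n c h = (1::'a::field)"
proof -
  have "chi n c (h ^^ i) = (chi n c h ^ i :: 'a)" for i
  proof (induction i)
    case 0 then show ?case using chi_id[of n c, where ?'a = 'a] by (simp add: id_def)
  next
    case (Suc i) then show ?case by (simp only: funpow.simps(2) chi_comp[OF h funpow_Hs[OF h]] power_Suc)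
  qed
  then have one: "chi n c h ^ (p ^ N) = (1::'a)" using assms(2) chi_id by metis
  obtain m where m: "p ^ N = Suc (2 * m)" using odd_p by (metis evenE even_power oddE Suc_eq_plus1)
  have "chi n c h ^ (p ^ N) = (chi n c h * (chi n c h * chi n c h) ^ m :: 'a)"
    unfolding m by (simp add: power_mult power2_eq_square)
  also have "\<dots> = chi n c h" by (simp only: chi_square power_one mult_1_right)
  finally show ?thesis using one by simp
qed

text \<open>By \<open>z_col\<close> the rotation permutes the columns, so it normalizes the column
  group; this is what makes column sums invariant under \<open>z\<close>.\<close>

lemma conj_z_Col: "\<pi> \<in> Col \<Longrightarrow> z \<circ> \<pi> \<circ> iv z \<in> Col"
proof -
  assume p: "\<pi> \<in> Col"
  have "col ((z \<circ> \<pi> \<circ> iv z) i) = col i" for i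
  proof (cases "i \<in> {1..n}")
    case True
    have "iv z i \<in> {1..n}" "\<pi> (iv z i) \<in> {1..n}" using True Sn_in[OF Sn_iv[OF zS]] Sn_in[OF Hs_Sn[OF p]] by auto
    then have "col (z (\<pi> (iv z i))) = col (z (iv z i))" by (intro z_col) (auto simp: Hs_eq[OF p])
    then show ?thesis by (simp add: Sn_iv_app[OF zS])
  next
    case False
    then show ?thesis using Sn_outside[OF Sn_iv[OF zS] False] Sn_outside[OF Hs_Sn[OF p] False] Sn_outside[OF zS False] by simp
  qed
  then show ?thesis using p by (auto simp: Hs_def Sn_intros zS fun_eq_iff)
qed

lemma conj_z_bij: "bij_betw (\<lambda>\<pi>. z \<circ> \<pi> \<circ> iv z) Col Col"
  unfolding bij_betw_def
proof
  show i: "inj_on (\<lambda>\<pi>. z \<circ> \<pi> \<circ> iv z) Col"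
  proof (rule inj_onI)
    fix a b assume "z \<circ> a \<circ> iv z = z \<circ> b \<circ> iv z"
    then have "iv z \<circ> (z \<circ> (a \<circ> (iv z \<circ> z))) = iv z \<circ> (z \<circ> (b \<circ> (iv z \<circ> z)))" by (metis o_assoc)
    then show "a = b" by (simp add: Sn_cancel[OF zS] Sn_iv_comp[OF zS])
  qed
  show "(\<lambda>\<pi>. z \<circ> \<pi> \<circ> iv z) ` Col = Col"
    using conj_z_Col by (intro endo_inj_surj i finite_Hs) auto
qed

lemma eps_conj_z: "\<pi> \<in> Col \<Longrightarrow> eps (z \<circ> \<pi> \<circ> iv z) = (eps \<pi> :: 'a::field)"
proof -
  assume p: "\<pi> \<in> Col"
  let ?E = "{i\<in>{1..n}. \<not> fst (c0 i)}"
  have "z ` ?E = ?E"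
  proof
    show "z ` ?E \<subseteq> ?E" using Sn_in[OF zS] Hs_eq[OF z_row] by auto
    show "?E \<subseteq> z ` ?E"
    proof
      fix x assume "x \<in> ?E"
      then have "iv z x \<in> ?E" using Sn_in[OF Sn_iv[OF zS]] Hs_eq[OF Hs_iv[OF z_row]] by auto
      then show "x \<in> z ` ?E" using Sn_iv_app(2)[OF zS] by (metis (no_types, lifting) imageI)
    qed
  qed
  then show ?thesis using rsgn_conj[OF zS Hs_Sn[OF p] Col_even[OF p], where ?'a = 'a] by (simp add: eps_def)
qed

lemma colsum_z:
  assumes v': "v' \<in> biequiv n c0 c" and y: "y \<in> Sn n"
  shows "(\<Sum>\<pi>\<in>Col. eps \<pi> * v' (iv \<pi> \<circ> (z \<circ> y))) = (\<Sum>\<pi>\<in>Col. eps \<pi> * (v' (iv \<pi> \<circ> y) :: 'a::field))"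
proof -
  have "(\<Sum>\<pi>\<in>Col. eps \<pi> * v' (iv \<pi> \<circ> (z \<circ> y))) = (\<Sum>\<pi>\<in>Col. eps (z \<circ> \<pi> \<circ> iv z) * v' (iv (z \<circ> \<pi> \<circ> iv z) \<circ> (z \<circ> y)))"
    by (rule sum.reindex_bij_betw[OF conj_z_bij, symmetric])
  also have "\<dots> = (\<Sum>\<pi>\<in>Col. eps \<pi> * v' (iv \<pi> \<circ> y))"
  proof (intro sum.cong refl)
    fix \<pi> assume p: "\<pi> \<in> Col"
    have "iv (z \<circ> \<pi> \<circ> iv z) \<circ> (z \<circ> y) = z \<circ> (iv \<pi> \<circ> y)"
      using zS Hs_Sn[OF p] y by (simp add: Sn_iv_distrib[of _ n] Sn_intros Sn_iv_iv[of _ n] o_assoc[symmetric] Sn_cancel)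
    then show "eps (z \<circ> \<pi> \<circ> iv z) * v' (iv (z \<circ> \<pi> \<circ> iv z) \<circ> (z \<circ> y)) = eps \<pi> * v' (iv \<pi> \<circ> y)"
      using biequiv_left[OF v' z_row, of "iv \<pi> \<circ> y"] Hs_Sn[OF p] y chi_p_power_order[OF z_row z_order, where ?'a = 'a] eps_conj_z[OF p, where ?'a = 'a]
      by (simp add: Sn_intros)
  qed
  finally show ?thesis .
qed

text \<open>The rotation acts on words by composition and preserves each summand: column sums by
  conjugation with \<open>z\<close>, values of \<open>v\<close> because \<open>z\<close> is a row
  permutation of sign 1. Then \<open>sum_fixed_points\<close> applies.\<close>

lemma form_fixed:
  assumes ch: "CHAR('a::field) = p" and v': "v' \<in> biequiv n c0 c" and v: "v \<in> biequiv n c0 c"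
  shows "form c v' v = (\<Sum>w\<in>{w\<in>words n c. w \<circ> iv z = w}. (\<Sum>\<pi>\<in>Col. eps \<pi> * v' (iv \<pi> \<circ> wrep n c w)) * (v (wrep n c w) :: 'a))"
proof -
  let ?F = "\<lambda>y. (\<Sum>\<pi>\<in>Col. eps \<pi> * v' (iv \<pi> \<circ> y)) * v y"
  note ri = form_rinv[OF v' v]
  have "form c v' v = (\<Sum>w\<in>words n c. ?F (wrep n c w))" unfolding form_def by (rule csum_words[OF ri])
  also have "\<dots> = (\<Sum>w\<in>{w\<in>words n c. w \<circ> iv z = w}. ?F (wrep n c w))"
  proof (rule sum_fixed_points[OF prime_p ch finite_words])
    fix w assume w: "w \<in> words n c"
    have e: "c \<circ> iv (z \<circ> wrep n c w) = w \<circ> iv z"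
      using wrep[OF w] zS by (simp add: Sn_iv_distrib[of _ n] o_assoc)
    have zw: "z \<circ> wrep n c w \<in> Sn n" using wrep[OF w] zS by (simp add: Sn_comp)
    show w': "w \<circ> iv z \<in> words n c" unfolding e[symmetric] words_def using zw by blast
    have "((\<lambda>w. w \<circ> iv z) ^^ i) w = w \<circ> (iv z ^^ i)" for i
    proof (induction i)
      case (Suc i)
      have "((\<lambda>w. w \<circ> iv z) ^^ Suc i) w = ((\<lambda>w. w \<circ> iv z) ^^ i) w \<circ> iv z" by simp
      also have "\<dots> = w \<circ> (iv z ^^ i \<circ> iv z)" by (simp only: Suc o_assoc)
      also have "\<dots> = w \<circ> iv z ^^ Suc i" by (simp only: funpow_Suc_right)
      finally show ?case .
    qed simp
    moreover have "iv z ^^ (p ^ N) = id"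
    proof -
      have "z ^^ i \<circ> iv z ^^ i = id" for i
      proof (induction i)
        case (Suc i)
        have "z ^^ Suc i \<circ> iv z ^^ Suc i = z ^^ i \<circ> (z \<circ> (iv z \<circ> iv z ^^ i))"
          by (simp only: funpow_Suc_right[of i z] funpow.simps(2)[of i "iv z"] o_assoc)
        then show ?case using Suc by (simp only: Sn_cancel[OF zS])
      qed simp
      then show ?thesis using z_order by (metis id_comp)
    qed
    ultimately show "((\<lambda>w. w \<circ> iv z) ^^ (p ^ N)) w = w" by simp
    have "?F (wrep n c (w \<circ> iv z)) = ?F (z \<circ> wrep n c w)"
      by (rule rinv_word[OF ri]) (use wrep[OF w'] zw e in auto)
    also have "\<dots> = ?F (wrep n c w)"
      unfolding colsum_z[OF v' wrep(1)[OF w]] biequiv_left[OF v z_row wrep(1)[OF w]] chi_p_power_order[OF z_row z_order] by simp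
    finally show "?F (wrep n c (w \<circ> iv z)) = ?F (wrep n c w)" .
  qed
  finally show ?thesis .
qed

section \<open>Vanishing column sums and dominance\<close>

text \<open>The transposition of \<open>i\<close> and \<open>j\<close> lies in the column group and,
  moved across \<open>y\<close>, in the Young subgroup of \<open>c\<close>. If box and letter have
  the same parity, exactly one of the two signs is -1, so the sum equals its own negative.\<close>

lemma colsum_zero:
  assumes two: "(2::'a::field) \<noteq> 0" and v': "v' \<in> biequiv n c0 c" and y: "y \<in> Sn n"
    and ij: "i \<in> {1..n}" "j \<in> {1..n}" "i \<noteq> j" "col i = col j" "c (iv y i) = c (iv y j)" "fst (c (iv y i)) = fst (c0 i)"
  shows "(\<Sum>\<pi>\<in>Col. eps \<pi> * (v' (iv \<pi> \<circ> y) :: 'a)) = 0"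
proof -
  let ?t = "transpose i j" and ?k = "transpose (iv y i) (iv y j)"
  let ?S = "\<Sum>\<pi>\<in>Col. eps \<pi> * (v' (iv \<pi> \<circ> y) :: 'a)"
  have in': "iv y i \<in> {1..n}" "iv y j \<in> {1..n}" using Sn_in[OF Sn_iv[OF y]] ij by auto
  have ne: "iv y i \<noteq> iv y j" using ij(3) Sn_iv_app(2)[OF y] by metis
  have e: "?t \<circ> y = y \<circ> ?k"
    unfolding conj_transpose[OF y, symmetric] by (simp only: o_assoc Sn_comp_iv[OF y] id_comp)
  have t: "?t \<in> Col" by (rule transpose_Hs[OF ij(1,2,4)])
  have tt: "?t \<circ> ?t = id" by simp
  have ivt: "iv ?t = ?t" by simp
  have b: "bij_betw (\<lambda>\<pi>. ?t \<circ> \<pi>) Col Col"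
    by (rule bij_betwI[of _ _ _ "\<lambda>\<pi>. ?t \<circ> \<pi>"]) (auto simp: Hs_comp[OF t] o_assoc)
  have "?S = (\<Sum>\<pi>\<in>Col. eps (?t \<circ> \<pi>) * v' (iv (?t \<circ> \<pi>) \<circ> y))"
    by (rule sum.reindex_bij_betw[OF b, symmetric])
  also have "\<dots> = (\<Sum>\<pi>\<in>Col. eps ?t * (eps \<pi> * v' (iv \<pi> \<circ> (y \<circ> ?k))))"
  proof (intro sum.cong refl)
    fix \<pi> assume p: "\<pi> \<in> Col"
    have "iv (?t \<circ> \<pi>) \<circ> y = iv \<pi> \<circ> (y \<circ> ?k)"
      using Sn_iv_distrib[OF Hs_Sn[OF t] Hs_Sn[OF p]] by (simp only: ivt e[symmetric] o_assoc)
    then show "eps (?t \<circ> \<pi>) * v' (iv (?t \<circ> \<pi>) \<circ> y) = eps ?t * (eps \<pi> * v' (iv \<pi> \<circ> (y \<circ> ?k)))"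
      by (simp only: eps_comp[OF t p] mult.assoc)
  qed
  also have "\<dots> = eps ?t * (?S * chi n c ?k)"
    unfolding colsum_right[OF v' y transpose_Hs[OF in' ij(5)], symmetric] by (simp add: sum_distrib_left)
  also have "eps ?t = (if fst (c0 i) then 1 else (-1::'a))"
    unfolding eps_def using ij col_parity[OF ij(1,2,4)] by (subst rsgn_transpose) auto
  also have "chi n c ?k = (if fst (c0 i) then -1 else (1::'a))"
    using chi_transpose[OF in' ij(5) ne, where ?'a = 'a] ij(6) by simp
  finally show ?thesis using two by (auto simp: o_def split: if_splits)
qed

lemma two_nonzero: "CHAR('a::field) = p \<Longrightarrow> (2::'a) \<noteq> 0"
proof
  assume c: "CHAR('a) = p" and "(2::'a) = 0"
  then have "of_nat 2 = (0::'a)" by simp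
  then have "p dvd 2" using c of_nat_eq_0_iff_char_dvd[of 2, where ?'a = 'a] by simp
  then have "p = 2" using prime_p primes_dvd_imp_eq two_is_prime_nat by blast
  then show False using odd_p by simp
qed

text \<open>In a fixed word \<open>i\<close> and \<open>z i\<close> carry the same letter, and they
  lie in the same row, so \<open>support_parity\<close> applies.\<close>

lemma fixed_word_moved:
  assumes two: "(2::'a::field) \<noteq> 0" and v: "v \<in> biequiv n c0 c" and y: "y \<in> Sn n" "v y \<noteq> (0::'a)"
    and w: "c \<circ> iv y \<circ> iv z = c \<circ> iv y" and i: "i \<in> {1..n}" "z i \<noteq> i"
  shows "fst (c (iv y i)) = fst (c0 i)"
proof -
  have "c (iv y (iv z (z i))) = c (iv y (z i))" using fun_cong[OF w, of "z i"] by simp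
  then have "c (iv y (z i)) = c (iv y i)" by (simp add: Sn_iv_app[OF zS])
  then show ?thesis
    using support_parity[OF two v y i(1), of "z i"] i Sn_in[OF zS, of i] Hs_eq[OF z_row, of i] by auto
qed

lemma column_down: "i \<in> {1..n} \<Longrightarrow> k \<le> snd (c0 i) \<Longrightarrow> \<exists>j\<in>{1..n}. col j = col i \<and> c0 j = (fst (c0 i), k)"
proof (induction "snd (c0 i) - k" arbitrary: k)
  case 0 then show ?case by (intro bexI[of _ i]) (auto simp: prod_eq_iff)
next
  case (Suc d)
  then have "\<exists>j\<in>{1..n}. col j = col i \<and> c0 j = (fst (c0 i), Suc k)" by (intro Suc.hyps) auto
  then obtain j where j: "j \<in> {1..n}" "col j = col i" "c0 j = (fst (c0 i), Suc k)" by blast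
  show ?case using col_down[OF j(1,3)] j(2) by auto
qed

text \<open>Counted column by column. Letters of the parity of a column are distinct in it, so at
  most \<open>kj + 1\<close> of them have number up to \<open>kj\<close>; the column has no gaps, so
  it either has that many boxes up to row \<open>kj\<close> or ends before. Odd letters in an even
  column are counted only for \<open>j\<close> beyond the whole column, and an odd column has no
  even letters.\<close>

lemma column_count:
  assumes odd_w: "\<And>i. i \<in> {1..n} \<Longrightarrow> fst (c0 i) \<Longrightarrow> fst (w i)"
    and dist: "\<And>i j. i \<in> {1..n} \<Longrightarrow> j \<in> {1..n} \<Longrightarrow> i \<noteq> j \<Longrightarrow> col i = col j \<Longrightarrow> w i = w j \<Longrightarrow> fst (w i) \<noteq> fst (c0 i)"
  shows "ncount n w j \<le> ncount n c0 j"
proof -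
  obtain bj kj where j: "j = (bj, kj)" by force
  have fib: "ncount n c j = (\<Sum>\<gamma>\<in>col ` {1..n}. card {i\<in>{1..n}. col i = \<gamma> \<and> c i \<le> j})" for c :: labelling
  proof -
    have "card {i\<in>{1..n}. c i \<le> j} = card (\<Union>\<gamma>\<in>col ` {1..n}. {i\<in>{1..n}. col i = \<gamma> \<and> c i \<le> j})"
      by (intro arg_cong[where f = card]) auto
    also have "\<dots> = (\<Sum>\<gamma>\<in>col ` {1..n}. card {i\<in>{1..n}. col i = \<gamma> \<and> c i \<le> j})"
      by (rule card_UN_disjoint) auto
    finally show ?thesis by (simp add: ncount_def)
  qed
  have "card {i\<in>{1..n}. col i = \<gamma> \<and> w i \<le> j} \<le> card {i\<in>{1..n}. col i = \<gamma> \<and> c0 i \<le> j}" if "\<gamma> \<in> col ` {1..n}" for \<gamma>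
  proof -
    from that obtain i1 where i1: "i1 \<in> {1..n}" "col i1 = \<gamma>" by auto
    define b where "b = fst (c0 i1)"
    have b: "fst (c0 i) = b" if "i \<in> {1..n}" "col i = \<gamma>" for i using col_parity[of i i1] that i1 by (simp add: b_def)
    let ?G = "{i\<in>{1..n}. col i = \<gamma>}"
    let ?A = "{i\<in>{1..n}. col i = \<gamma> \<and> w i \<le> j}" and ?R = "{i\<in>{1..n}. col i = \<gamma> \<and> c0 i \<le> j}"
    have AG: "card ?A \<le> card ?G" by (intro card_mono) auto
    consider "b = bj" | "\<not> b" "bj" | "b" "\<not> bj" by blast
    then show ?thesis
    proof cases
      case 1
      show ?thesis
      proof (cases "\<exists>i\<in>?G. kj < snd (c0 i)")
        case True
        then obtain i where i: "i \<in> {1..n}" "col i = \<gamma>" "kj < snd (c0 i)" by auto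
        have "\<exists>j. j \<in> {1..n} \<and> col j = \<gamma> \<and> c0 j = (b, k)" if "k \<le> kj" for k
          using column_down[OF i(1), of k] that i(3) unfolding b[OF i(1,2)] i(2) Bex_def by auto
        then have "\<forall>k\<in>{..kj}. \<exists>j. j \<in> {1..n} \<and> col j = \<gamma> \<and> c0 j = (b, k)" by blast
        from bchoice[OF this] obtain f where
          "\<forall>k\<in>{..kj}. f k \<in> {1..n} \<and> col (f k) = \<gamma> \<and> c0 (f k) = (b, k)" by blast
        then have f: "f k \<in> {1..n}" "col (f k) = \<gamma>" "c0 (f k) = (b, k)" if "k \<le> kj" for k using that by auto
        have "inj_on f {..kj}" using f(3) by (intro inj_onI) (metis atMost_iff prod.inject)
        moreover have "f ` {..kj} \<subseteq> ?R" using f 1 by (auto simp: j)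
        ultimately have R: "kj + 1 \<le> card ?R" using card_inj_on_le[of f "{..kj}" ?R] by simp
        have fw: "fst (w i) = b" if "i \<in> ?A" for i
          using that odd_w[of i] b[of i] 1 by (cases b) (auto simp: j less_eq_prod_def)
        have "inj_on w ?A"
        proof (rule inj_onI, rule ccontr)
          fix i k assume ik: "i \<in> ?A" "k \<in> ?A" "w i = w k" "i \<noteq> k"
          then have "fst (w i) \<noteq> fst (c0 i)" using dist[of i k] by auto
          then show False using fw[OF ik(1)] b[of i] ik(1) by auto
        qed
        moreover have "w ` ?A \<subseteq> {b} \<times> {..kj}"
        proof
          fix l assume "l \<in> w ` ?A"
          then obtain i where i: "i \<in> ?A" "l = w i" by blast
          then show "l \<in> {b} \<times> {..kj}" using fw[OF i(1)] 1 by (auto simp: j less_eq_prod_def mem_Times_iff)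
        qed
        ultimately have "card ?A \<le> card ({b} \<times> {..kj})" by (intro card_inj_on_le[of w]) auto
        then show ?thesis using R by (simp add: card_cartesian_product)
      next
        case False
        then have "?R = ?G" using b 1 by (auto simp: j less_eq_prod_def)
        then show ?thesis using AG by simp
      qed
    next
      case 2
      then have "?R = ?G" using b by (auto simp: j less_eq_prod_def)
      then show ?thesis using AG by simp
    next
      case 3
      then have "?A = {}" using b odd_w by (auto simp: j less_eq_prod_def)
      then show ?thesis by (metis card.empty zero_le)
    qed
  qed
  then show ?thesis unfolding fib by (rule sum_mono)
qed

text \<open>A nonzero summand comes from a fixed word. Its odd boxes are all moved, hence carry odd
  letters, and a column repeats only letters of the other parity; this is the situation of
  \<open>column_count\<close>.\<close>

lemma form_nonzero_dominated:
  assumes ch: "CHAR('a::field) = p" and v': "v' \<in> biequiv n c0 c" and v: "v \<in> biequiv n c0 c"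
    and nz: "form c v' v \<noteq> (0::'a)"
  shows "dominated n c c0"
proof -
  note two = two_nonzero[OF ch]
  from sum.not_neutral_contains_not_neutral[OF nz[unfolded form_fixed[OF ch v' v]]] obtain w
    where w: "w \<in> words n c" "w \<circ> iv z = w" "(\<Sum>\<pi>\<in>Col. eps \<pi> * v' (iv \<pi> \<circ> wrep n c w)) * v (wrep n c w) \<noteq> 0"
    by auto
  define y where "y = wrep n c w"
  have y: "y \<in> Sn n" "c \<circ> iv y = w" using wrep[OF w(1)] by (auto simp: y_def)
  have 1: "(\<Sum>\<pi>\<in>Col. eps \<pi> * v' (iv \<pi> \<circ> y)) \<noteq> 0" "v y \<noteq> 0" using w(3) by (auto simp: y_def)
  have wi: "w i = c (iv y i)" for i using fun_cong[OF y(2), of i] by simp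
  have "ncount n c j = ncount n w j" for j
    using card_Sn_collect[OF Sn_iv[OF y(1)], of "\<lambda>i. c i \<le> j"] by (simp add: ncount_def wi)
  moreover have "ncount n w j \<le> ncount n c0 j" for j
  proof (rule column_count)
    fix i assume i: "i \<in> {1..n}" "fst (c0 i)"
    show "fst (w i)" using fixed_word_moved[OF two v y(1) 1(2) _ i(1) z_odd[OF i]] y(2) w(2) i(2) wi by simp
  next
    fix i k assume "i \<in> {1..n}" "k \<in> {1..n}" "i \<noteq> k" "col i = col k" "w i = w k"
    then show "fst (w i) \<noteq> fst (c0 i)" using colsum_zero[OF two v' y(1), of i k] 1(1) wi by auto
  qed
  ultimately show ?thesis by (simp add: dominated_def)
qed

end

section \<open>The column functional is multiplicative\<close>

lemma idf_biequiv: "(idf n c :: _ \<Rightarrow> 'a::field) \<in> biequiv n c c"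
proof (rule biequivI)
  fix h g assume h: "h \<in> Hs n c" and g: "g \<in> Sn n"
  have "h \<circ> g \<in> Hs n c \<longleftrightarrow> g \<in> Hs n c"
    using Hs_comp[OF h] Hs_comp[OF Hs_iv[OF h], of "h \<circ> g"] Sn_cancel(2)[OF Hs_Sn[OF h], of g] by auto
  then show "idf n c (h \<circ> g) = chi n c h * (idf n c g :: 'a)" using h by (simp add: idf_def chi_comp)
next
  fix g k assume g: "g \<in> Sn n" and k: "k \<in> Hs n c"
  have "g \<circ> k \<in> Hs n c \<longleftrightarrow> g \<in> Hs n c"
    using Hs_comp[OF _ k, of g] Hs_comp[OF _ Hs_iv[OF k], of "g \<circ> k"] Sn_comp_iv[OF Hs_Sn[OF k]]
    by (auto simp: o_assoc[symmetric])
  then show "idf n c (g \<circ> k) = (idf n c g :: 'a) * chi n c k" using k by (simp add: idf_def chi_comp)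
qed

lemma factor_sum_sandwich:
  assumes "factor_sum n S M A" and M: "is_rep n M" and Y: "is_rep n Y" and S: "\<And>X. X \<in> S \<Longrightarrow> is_rep n X"
    and P: "P \<in> rhom n Y M" and Q: "Q \<in> rhom n M Y"
  shows "factor_sum n S Y (Q * A * P)"
  using assms(1)
proof induction
  case zero
  show ?case unfolding right_mult_zero_mat[OF rhom_carrier[OF Q]] left_mult_zero_mat[OF rhom_carrier[OF P]]
    by (rule factor_sum.zero)
next
  case (add A X F G)
  note X = S[OF add(2)]
  note c = rhom_carrier[OF Q] rhom_carrier[OF P] rhom_carrier[OF add(3)] rhom_carrier[OF add(4)]
    rhom_carrier[OF factor_sum_rhom[OF add(1) M S]]
  note A = c(5)
  have "Q * (A + G * F) * P = (Q * A + Q * (G * F)) * P"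
    by (simp only: mult_add_distrib_mat[OF c(1) A mult_carrier_mat[OF c(4,3)]])
  also have "\<dots> = Q * A * P + Q * (G * F) * P"
    by (rule add_mult_distrib_mat[OF mult_carrier_mat[OF c(1) A] mult_carrier_mat[OF c(1) mult_carrier_mat[OF c(4,3)]] c(2)])
  also have "Q * (G * F) * P = Q * G * (F * P)" by (rule mat_mult4[OF c(1,4,3,2), symmetric])
  finally show ?case
    using factor_sum.add[OF add(5) add(2) rhom_mult[OF Y M X P add(3)] rhom_mult[OF X M Y add(4) Q]] by simp
qed

context tableau
begin

definition Phi :: "'a::field mat \<Rightarrow> 'a" where "Phi P = phi (vof n c0 c0 P)"

lemma M0: "is_rep n (Ind n c0 :: 'a::field rep)" by (rule is_rep_Ind)

lemma Phi_add:
  assumes "A \<in> rhom n (Ind n c0) (Ind n c0)" "B \<in> rhom n (Ind n c0) (Ind n c0)"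
  shows "Phi (A + B) = Phi A + (Phi B :: 'a::field)"
proof -
  have "A \<in> carrier_mat (tdim n c0) (tdim n c0)" "B \<in> carrier_mat (tdim n c0) (tdim n c0)"
    using rhom_carrier[OF assms(1)] rhom_carrier[OF assms(2)] by (auto simp: fst_Ind)
  then show ?thesis unfolding Phi_def phi_add[symmetric] by (intro phi_cong vof_add)
qed

lemma Phi_smult:
  assumes "A \<in> rhom n (Ind n c0) (Ind n c0)"
  shows "Phi (a \<cdot>\<^sub>m A) = a * (Phi A :: 'a::field)"
proof -
  have c: "A \<in> carrier_mat (tdim n c0) (tdim n c0)" using rhom_carrier[OF assms(1)] by (auto simp: fst_Ind)
  show ?thesis unfolding Phi_def phi_smult[symmetric]
  proof (rule phi_cong)
    fix x assume "x \<in> Sn n"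
    then show "vof n c0 c0 (a \<cdot>\<^sub>m A) x = a * vof n c0 c0 A x"
      using c idx(1)[of x n c0] idx(1)[OF Sn_id, of n c0] by (simp add: vof_def vker_def)
  qed
qed

lemma Phi_one: "Phi (1\<^sub>m (tdim n c0)) = (1::'a::field)"
  unfolding Phi_def hmat_idf[symmetric] phi_idf[symmetric] by (intro phi_cong vof_hmat idf_biequiv)

lemma Phi_mult_form:
  assumes "F \<in> rhom n (Ind n c0) (Ind n c)" "G \<in> rhom n (Ind n c) (Ind n c0)"
  shows "Phi (G * F) = form c (\<lambda>x. vof n c c0 G (iv x)) (vof n c0 c F :: _ \<Rightarrow> 'a::field)"
  unfolding Phi_def phi_conv[symmetric] by (intro phi_cong vof_mult assms)

lemma Phi_nondom:
  assumes ch: "CHAR('a::field) = p" and nd: "\<not> dominated n c c0"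
    and "F \<in> rhom n (Ind n c0) (Ind n c)" "G \<in> rhom n (Ind n c) (Ind n c0)"
  shows "Phi (G * F) = (0::'a)"
  unfolding Phi_mult_form[OF assms(3,4)]
  using form_nonzero_dominated[OF ch biequiv_flip[OF vof_biequiv[OF assms(4)]] vof_biequiv[OF assms(3)]] nd by blast

lemma Phi_zero: "Phi (0\<^sub>m (tdim n c0) (tdim n c0)) = (0::'a::field)"
proof -
  have z: "0\<^sub>m (tdim n c0) (tdim n c0) \<in> rhom n (Ind n c0 :: 'a rep) (Ind n c0)"
    using rhom_zero[OF M0 M0, where ?'a = 'a] by (simp add: fst_Ind)
  have "Phi (0\<^sub>m (tdim n c0) (tdim n c0) + 0\<^sub>m (tdim n c0) (tdim n c0)) = Phi (0\<^sub>m (tdim n c0) (tdim n c0)) + (Phi (0\<^sub>m (tdim n c0) (tdim n c0)) :: 'a)"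
    by (rule Phi_add[OF z z])
  then show ?thesis by (metis add_cancel_right_right left_add_zero_mat zero_carrier_mat)
qed

lemma Phi_factor_sum:
  assumes ch: "CHAR('a::field) = p" and "factor_sum n (nondom n c0) (Ind n c0 :: 'a rep) A"
    and C: "C \<in> rhom n (Ind n c0) (Ind n c0)"
  shows "Phi (C * A) = 0"
  using assms(2)
proof induction
  case zero
  show ?case unfolding right_mult_zero_mat[OF rhom_carrier[OF C]] unfolding fst_Ind by (rule Phi_zero)
next
  case (add A X F G)
  from add(2) obtain c where c: "X = Ind n c" "\<not> dominated n c c0" by (auto simp: nondom_def)
  have A: "A \<in> rhom n (Ind n c0) (Ind n c0)" by (rule factor_sum_rhom[OF add(1) M0 nondom_rep])
  have F: "F \<in> rhom n (Ind n c0) (Ind n c)" and G: "G \<in> rhom n (Ind n c) (Ind n c0)" using add c by auto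
  note cr = rhom_carrier[OF C] rhom_carrier[OF A] rhom_carrier[OF G] rhom_carrier[OF F]
  have CG: "C * G \<in> rhom n (Ind n c) (Ind n c0)" by (rule rhom_mult[OF is_rep_Ind M0 M0 G C])
  have "C * (A + G * F) = C * A + C * (G * F)" by (rule mult_add_distrib_mat[OF cr(1,2) mult_carrier_mat[OF cr(3,4)]])
  also have "C * (G * F) = C * G * F" by (rule assoc_mult_mat[OF cr(1,3,4), symmetric])
  finally have "Phi (C * (A + G * F)) = Phi (C * A) + Phi (C * G * F)"
    using Phi_add[OF rhom_mult[OF M0 M0 M0 A C] rhom_mult[OF M0 is_rep_Ind M0 F CG]] by simp
  then show ?case using add(5) Phi_nondom[OF ch c(2) F CG] by simp
qed

text \<open>Straightening provides some scalar. Applying \<open>Phi\<close>, which is 1 at the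
  identity and kills maps through modules that are not dominated, identifies it.\<close>

lemma rhom_decompose:
  assumes ch: "CHAR('a::field) = p" and B: "B \<in> rhom n (Ind n c0 :: 'a rep) (Ind n c0)"
  obtains A where "factor_sum n (nondom n c0) (Ind n c0) A" "B = Phi B \<cdot>\<^sub>m 1\<^sub>m (tdim n c0) + A"
proof -
  from straightening[OF two_nonzero[OF ch] vof_biequiv[OF B]] obtain a A where
    A: "factor_sum n (nondom n c0) (Ind n c0) A" "B = a \<cdot>\<^sub>m 1\<^sub>m (tdim n c0) + A" unfolding hmat_vof[OF B] by blast
  have Ar: "A \<in> rhom n (Ind n c0) (Ind n c0)" by (rule factor_sum_rhom[OF A(1) M0 nondom_rep])
  have one: "1\<^sub>m (tdim n c0) \<in> rhom n (Ind n c0 :: 'a rep) (Ind n c0)" using rhom_one[OF M0, where ?'a = 'a] by (simp add: fst_Ind)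
  have Ac: "A \<in> carrier_mat (tdim n c0) (tdim n c0)" using rhom_carrier[OF Ar] by (simp add: fst_Ind)
  have "Phi A = 0" using Phi_factor_sum[OF ch A(1) one] left_mult_one_mat[OF Ac] by simp
  then have "Phi B = a"
    unfolding A(2) Phi_add[OF rhom_smult[OF M0 M0 one] Ar] Phi_smult[OF one] Phi_one by simp
  then show thesis using that A by blast
qed

text \<open>\<open>B\<close> is the scalar \<open>Phi B\<close> up to maps through modules that are
  not dominated, and \<open>Phi\<close> kills those even after composition with
  \<open>A\<close>.\<close>

lemma Phi_mult:
  assumes ch: "CHAR('a::field) = p" and A: "A \<in> rhom n (Ind n c0) (Ind n c0)" and B: "B \<in> rhom n (Ind n c0) (Ind n c0)"
  shows "Phi (A * B) = Phi A * (Phi B :: 'a)"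
proof -
  from rhom_decompose[OF ch B] obtain B' where B': "factor_sum n (nondom n c0) (Ind n c0) B'" "B = Phi B \<cdot>\<^sub>m 1\<^sub>m (tdim n c0) + B'" .
  have Br: "B' \<in> rhom n (Ind n c0) (Ind n c0)" by (rule factor_sum_rhom[OF B'(1) M0 nondom_rep])
  have Ac: "A \<in> carrier_mat (tdim n c0) (tdim n c0)" and Bc: "B' \<in> carrier_mat (tdim n c0) (tdim n c0)"
    using rhom_carrier[OF Br] rhom_carrier[OF A] by (auto simp: fst_Ind)
  have "A * B = A * (Phi B \<cdot>\<^sub>m 1\<^sub>m (tdim n c0) + B')" using B'(2) by simp
  also have "\<dots> = A * (Phi B \<cdot>\<^sub>m 1\<^sub>m (tdim n c0)) + A * B'"
    by (rule mult_add_distrib_mat[OF Ac smult_carrier_mat[OF one_carrier_mat] Bc])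
  also have "A * (Phi B \<cdot>\<^sub>m 1\<^sub>m (tdim n c0)) = Phi B \<cdot>\<^sub>m A"
    by (simp only: mult_smult_distrib[OF Ac one_carrier_mat] right_mult_one_mat[OF Ac])
  finally have "Phi (A * B) = Phi (Phi B \<cdot>\<^sub>m A) + Phi (A * B')"
    using Phi_add[OF rhom_smult[OF M0 M0 A] rhom_mult[OF M0 M0 M0 Br A]] by simp
  then show ?thesis using Phi_factor_sum[OF ch B'(1) A] Phi_smult[OF A] by (simp add: mult.commute)
qed

lemma form_cong: "(\<And>x. x \<in> Sn n \<Longrightarrow> v' x = u' x) \<Longrightarrow> (\<And>x. x \<in> Sn n \<Longrightarrow> v x = u x) \<Longrightarrow> form c v' v = form c u' u"
  unfolding form_def csum_def using tr_mem(1)[of _ n c] Hs_Sn[of _ n col]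
  by (intro sum.cong refl arg_cong2[where f = "(*)"]) (auto intro!: sum.cong simp: Sn_intros)

text \<open>\<open>Phi\<close> takes the value 0 or 1 at the idempotent \<open>P Q\<close>. At value
  0 the idempotent would be a sum of maps through modules that are not dominated, and locality would
  make \<open>Y\<close> a summand of one of them.\<close>

lemma multiplicity_functional:
  fixes Y :: "'a::field rep"
  assumes ch: "CHAR('a) = p" and Y: "indecomposable n Y" and sm: "is_summand n Y (Ind n c0)"
    and nd: "\<And>c. \<not> dominated n c c0 \<Longrightarrow> \<not> is_summand n Y (Ind n c)"
  shows "\<exists>P0 Q0. multiplicity_functional n (Ind n c0) Y Phi P0 Q0"
proof -
  have Yr: "is_rep n Y" using Y by (simp add: indecomposable_def)
  from summand_split[OF M0 Yr sm] obtain P Q where PQ: "P \<in> rhom n Y (Ind n c0)" "Q \<in> rhom n (Ind n c0) Y" "Q * P = 1\<^sub>m (fst Y)" .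
  note c = rhom_carrier[OF PQ(1)] rhom_carrier[OF PQ(2)]
  have e: "P * Q \<in> rhom n (Ind n c0) (Ind n c0)" by (rule rhom_mult[OF M0 Yr M0 PQ(2,1)])
  have "P * Q * (P * Q) = P * Q" unfolding mat_mult4[OF c c] PQ(3) right_mult_one_mat[OF c(1)] ..
  then have "Phi (P * Q) * Phi (P * Q) = Phi (P * Q)" using Phi_mult[OF ch e e] by simp
  moreover have "Phi (P * Q) \<noteq> 0"
  proof
    assume z: "Phi (P * Q) = 0"
    from rhom_decompose[OF ch e] obtain A where A: "factor_sum n (nondom n c0) (Ind n c0) A" "P * Q = Phi (P * Q) \<cdot>\<^sub>m 1\<^sub>m (tdim n c0) + A" .
    have "A \<in> carrier_mat (tdim n c0) (tdim n c0)"
      using rhom_carrier[OF factor_sum_rhom[OF A(1) M0 nondom_rep]] by (simp add: fst_Ind)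
    then have "P * Q = A" using A(2) unfolding z by (intro eq_matI) auto
    then have fs: "factor_sum n (nondom n c0) Y (Q * (P * Q) * P)"
      using factor_sum_sandwich[OF A(1) M0 Yr nondom_rep PQ(1,2)] by simp
    have one: "1\<^sub>m (fst Y) * (Q * (P * Q) * P) = 1\<^sub>m (fst Y)"
      unfolding mat_mult4[OF c(2,1) c(2,1), symmetric] PQ(3) by simp
    have "\<exists>X\<in>nondom n c0. is_summand n Y X"
      by (rule indecomposable_factor_sum_unit[OF Y nondom_rep fs rhom_one[OF Yr] one])
    then show False using nd by (auto simp: nondom_def)
  qed
  ultimately have "Phi (P * Q) = 1" by simp
  then have "multiplicity_functional n (Ind n c0) Y Phi P Q"
    by (intro multiplicity_functional.intro M0 Y PQ Phi_add Phi_mult[OF ch])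
  then show ?thesis by blast
qed

definition form_system :: "labelling \<Rightarrow> nat \<Rightarrow> (nat \<Rightarrow> (nat \<Rightarrow> nat) \<Rightarrow> 'a::field) \<Rightarrow> (nat \<Rightarrow> (nat \<Rightarrow> nat) \<Rightarrow> 'a) \<Rightarrow> bool" where
  "form_system c r v' v \<longleftrightarrow> (\<forall>i<r. v' i \<in> biequiv n c0 c \<and> v i \<in> biequiv n c0 c) \<and>
     (\<forall>i<r. \<forall>j<r. form c (v' i) (v j) = (if i = j then 1 else 0))"

text \<open>The dictionary between matrices and kernels turns \<open>dual_system\<close> into
  \<open>form_system\<close>; maps back to \<open>Ind n c0\<close> enter through
  \<open>biequiv_flip\<close>.\<close>

theorem le_ks_mult_form:
  fixes Y :: "'a::field rep"
  assumes ch: "CHAR('a) = p" and Y: "indecomposable n Y" and sm: "is_summand n Y (Ind n c0)"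
    and nd: "\<And>c. \<not> dominated n c c0 \<Longrightarrow> \<not> is_summand n Y (Ind n c)"
  shows "r \<le> ks_mult n (Ind n c) Y \<longleftrightarrow> (\<exists>v' v :: nat \<Rightarrow> (nat \<Rightarrow> nat) \<Rightarrow> 'a. form_system c r v' v)"
proof -
  from multiplicity_functional[OF assms] obtain P0 Q0 where "multiplicity_functional n (Ind n c0) Y Phi P0 Q0" by blast
  then interpret mf: multiplicity_functional n "Ind n c0" Y Phi P0 Q0 .
  show ?thesis unfolding mf.le_ks_mult_iff[OF is_rep_Ind]
  proof safe
    fix F G assume s: "mf.dual_system (Ind n c) r F G"
    then have h: "F i \<in> rhom n (Ind n c0) (Ind n c)" "G i \<in> rhom n (Ind n c) (Ind n c0)" if "i < r" for i
      using that by (auto simp: mf.dual_system_def)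
    have "form_system c r (\<lambda>i x. vof n c c0 (G i) (iv x)) (\<lambda>i. vof n c0 c (F i))"
      using s Phi_mult_form[OF h(1) h(2)] biequiv_flip[OF vof_biequiv[OF h(2)]] vof_biequiv[OF h(1)]
      by (auto simp: mf.dual_system_def form_system_def)
    then show "\<exists>v' v :: nat \<Rightarrow> (nat \<Rightarrow> nat) \<Rightarrow> 'a. form_system c r v' v" by blast
  next
    fix v' v :: "nat \<Rightarrow> (nat \<Rightarrow> nat) \<Rightarrow> 'a" assume s: "form_system c r v' v"
    then have h: "v' i \<in> biequiv n c0 c" "v i \<in> biequiv n c0 c" if "i < r" for i using that by (auto simp: form_system_def)
    have "Phi (hmat n c c0 (\<lambda>x. v' i (iv x)) * hmat n c0 c (v j)) = form c (v' i) (v j)" if "i < r" "j < r" for i j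
    proof -
      note b = biequiv_flip[OF h(1)[OF that(1)]] h(2)[OF that(2)]
      show ?thesis unfolding Phi_mult_form[OF hmat_rhom[OF b(2)] hmat_rhom[OF b(1)]]
        by (intro form_cong) (simp_all add: vof_hmat[OF b(1)] vof_hmat[OF b(2)] Sn_intros Sn_iv_iv[of _ n])
    qed
    then have "mf.dual_system (Ind n c) r (\<lambda>i. hmat n c0 c (v i)) (\<lambda>i. hmat n c c0 (\<lambda>x. v' i (iv x)))"
      using s hmat_rhom[OF h(2)] hmat_rhom[OF biequiv_flip[OF h(1)]]
      by (auto simp: mf.dual_system_def form_system_def)
    then show "\<exists>F G. mf.dual_system (Ind n c) r F G" by blast
  qed
qed

end

section \<open>Blowing up every point by \<open>p\<close>\<close>

text \<open>The points \<open>enc p i 0, \<dots>, enc p i (p - 1)\<close> form the block of \<open>i\<close>; \<open>blk\<close> and \<open>rem\<close> recover \<open>i\<close> and the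
  position, and \<open>blk p 0 = 0\<close>.\<close>

definition enc :: "nat \<Rightarrow> nat \<Rightarrow> nat \<Rightarrow> nat" where "enc p i r = p * (i - 1) + r + 1"
definition blk :: "nat \<Rightarrow> nat \<Rightarrow> nat" where "blk p j = (j + p - 1) div p"
definition rem :: "nat \<Rightarrow> nat \<Rightarrow> nat" where "rem p j = (j - 1) mod p"
definition lift :: "nat \<Rightarrow> (nat \<Rightarrow> nat) \<Rightarrow> nat \<Rightarrow> nat" where
  "lift p g j = (if j = 0 then 0 else enc p (g (blk p j)) (rem p j))"

context
  fixes p :: nat assumes p0: "p > 0"
begin

lemma blk_0: "blk p 0 = 0" using p0 by (simp add: blk_def)

lemma blk_pos: "j \<ge> 1 \<Longrightarrow> blk p j = (j - 1) div p + 1"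
proof -
  assume "j \<ge> 1"
  then have e: "j + p - 1 = (j - 1) + p" by simp
  show ?thesis unfolding blk_def e by (rule div_add_self2) (use p0 in auto)
qed

lemma blk_ge1: "j \<ge> 1 \<Longrightarrow> blk p j \<ge> 1" by (simp add: blk_pos)

lemma enc_ge1: "enc p i r \<ge> 1" by (simp add: enc_def)

lemma rem_less: "rem p j < p" using p0 by (simp add: rem_def)

lemma blk_enc: "i \<ge> 1 \<Longrightarrow> r < p \<Longrightarrow> blk p (enc p i r) = i"
  unfolding blk_pos[OF enc_ge1] by (simp add: enc_def)

lemma rem_enc: "r < p \<Longrightarrow> rem p (enc p i r) = r" by (simp add: rem_def enc_def)

lemma enc_blk: "j \<ge> 1 \<Longrightarrow> enc p (blk p j) (rem p j) = j"
  by (simp add: blk_pos rem_def enc_def)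

lemma blk_le_iff: "blk p j \<le> n \<longleftrightarrow> j \<le> p * n"
proof (cases "j = 0")
  case True then show ?thesis by (simp add: blk_0)
next
  case False
  have "blk p j \<le> n \<longleftrightarrow> (j - 1) div p < n" using False by (simp add: blk_pos Suc_le_eq)
  also have "\<dots> \<longleftrightarrow> j - 1 < n * p" using p0 by (simp add: div_less_iff_less_mult)
  also have "\<dots> \<longleftrightarrow> j \<le> p * n" using False by (auto simp: mult.commute)
  finally show ?thesis .
qed

lemma blk_in: "blk p j \<in> {1..n} \<longleftrightarrow> j \<in> {1..p * n}"
  using blk_le_iff[of j n] blk_ge1[of j] blk_0 by (cases "j = 0") auto

lemma enc_in: "i \<in> {1..n} \<Longrightarrow> r < p \<Longrightarrow> enc p i r \<in> {1..p * n}"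
  using blk_in[of "enc p i r" n] blk_enc[of i r] by simp

lemma card_blk: "card {j\<in>{1..p * n}. Q (blk p j)} = p * card {i\<in>{1..n}. Q i}"
proof -
  have "bij_betw (\<lambda>(i, r). enc p i r) ({i\<in>{1..n}. Q i} \<times> {..<p}) {j\<in>{1..p * n}. Q (blk p j)}"
  proof (rule bij_betwI[of _ _ _ "\<lambda>j. (blk p j, rem p j)"])
    show "(\<lambda>(i, r). enc p i r) \<in> {i\<in>{1..n}. Q i} \<times> {..<p} \<rightarrow> {j\<in>{1..p * n}. Q (blk p j)}"
    proof (rule Pi_I)
      fix x assume x: "x \<in> {i\<in>{1..n}. Q i} \<times> {..<p}"
      obtain i r where xr: "x = (i, r)" by force
      then have "i \<in> {1..n}" "Q i" "r < p" using x by auto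
      then show "(case x of (i, r) \<Rightarrow> enc p i r) \<in> {j\<in>{1..p * n}. Q (blk p j)}"
        using enc_in[of i n r] blk_enc[of i r] by (simp add: xr)
    qed
    show "(\<lambda>j. (blk p j, rem p j)) \<in> {j\<in>{1..p * n}. Q (blk p j)} \<rightarrow> {i\<in>{1..n}. Q i} \<times> {..<p}"
    proof (rule Pi_I)
      fix j assume "j \<in> {j\<in>{1..p * n}. Q (blk p j)}"
      then show "(blk p j, rem p j) \<in> {i\<in>{1..n}. Q i} \<times> {..<p}" using blk_in[of j n] rem_less[of j] by (simp add: mem_Times_iff del: atLeastAtMost_iff)
    qed
  next
    fix x assume "x \<in> {i\<in>{1..n}. Q i} \<times> {..<p}"
    then show "(blk p (case x of (i, r) \<Rightarrow> enc p i r), rem p (case x of (i, r) \<Rightarrow> enc p i r)) = x"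
      by (cases x) (simp add: blk_enc rem_enc)
  next
    fix j assume "j \<in> {j\<in>{1..p * n}. Q (blk p j)}"
    then show "(case (blk p j, rem p j) of (i, r) \<Rightarrow> enc p i r) = j" by (simp add: enc_blk)
  qed
  from bij_betw_same_card[OF this] show ?thesis by (simp add: card_cartesian_product mult.commute)
qed

lemma Sn_ge1: "g \<in> Sn n \<Longrightarrow> i \<ge> 1 \<Longrightarrow> g i \<ge> 1"
  using Sn_in[of g n i] Sn_outside[of g n i] by (cases "i \<in> {1..n}") auto

lemma Sn_zero: "g \<in> Sn n \<Longrightarrow> g 0 = 0" using Sn_outside[of g n 0] by simp

lemma lift_enc: "i \<ge> 1 \<Longrightarrow> r < p \<Longrightarrow> lift p g (enc p i r) = enc p (g i) r"
  using enc_ge1[of i r] by (simp add: lift_def blk_enc rem_enc)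

lemma blk_lift: "g \<in> Sn n \<Longrightarrow> blk p (lift p g j) = g (blk p j)"
  using Sn_ge1[of g n "blk p j"] blk_ge1[of j] Sn_zero[of g n]
  by (cases "j = 0") (auto simp: lift_def blk_0 blk_enc rem_less)

lemma rem_lift: "j \<ge> 1 \<Longrightarrow> rem p (lift p g j) = rem p j" by (simp add: lift_def rem_enc rem_less)

lemma eq_by_blk: "i \<ge> 1 \<Longrightarrow> j \<ge> 1 \<Longrightarrow> blk p i = blk p j \<Longrightarrow> rem p i = rem p j \<Longrightarrow> i = j"
  by (metis enc_blk)

lemma lift_comp: "h \<in> Sn n \<Longrightarrow> lift p (g \<circ> h) = lift p g \<circ> lift p h"
proof
  fix j assume h: "h \<in> Sn n"
  show "lift p (g \<circ> h) j = (lift p g \<circ> lift p h) j"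
    using lift_enc[of "h (blk p j)" "rem p j" g] Sn_ge1[OF h, of "blk p j"] blk_ge1[of j] rem_less[of j]
    by (cases "j = 0") (auto simp: lift_def)
qed

lemma lift_id: "lift p id = id" by (auto simp: lift_def enc_blk)

lemma lift_Sn:
  assumes g: "g \<in> Sn n" shows "lift p g \<in> Sn (p * n)"
proof -
  have "lift p g \<circ> lift p (iv g) = id" "lift p (iv g) \<circ> lift p g = id"
    using lift_comp[OF Sn_iv[OF g], of g] lift_comp[OF g, of "iv g"] Sn_iv_comp[OF g] Sn_comp_iv[OF g] by (simp_all add: lift_id)
  then have b: "bij (lift p g)" using o_bij by blast
  have "lift p g j = j" if "j \<notin> {1..p * n}" for j
  proof (cases "j = 0")
    case True then show ?thesis by (simp add: lift_def)
  next
    case False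
    then have "g (blk p j) = blk p j" using that blk_in[of j n] by (intro Sn_outside[OF g]) auto
    then show ?thesis using False by (simp add: lift_def enc_blk)
  qed
  then show ?thesis using b unfolding Sn_def permutes_def by (auto simp: bij_def) (metis bij_pointE b)+
qed

lemma iv_lift: "g \<in> Sn n \<Longrightarrow> iv (lift p g) = lift p (iv g)"
proof -
  assume g: "g \<in> Sn n"
  have e: "lift p g \<circ> lift p (iv g) = id"
    using lift_comp[OF Sn_iv[OF g], of g] Sn_comp_iv[OF g] by (simp add: lift_id)
  have "iv (lift p g) = iv (lift p g) \<circ> (lift p g \<circ> lift p (iv g))" by (simp add: e)
  also have "\<dots> = lift p (iv g)" by (rule Sn_cancel(2)[OF lift_Sn[OF g]])
  finally show ?thesis .
qed

lemma word_lift: "g \<in> Sn n \<Longrightarrow> (c \<circ> blk p) \<circ> iv (lift p g) = c \<circ> iv g \<circ> blk p"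
  by (auto simp: iv_lift[of g n] blk_lift[OF Sn_iv] fun_eq_iff)

lemma lift_Hs: "h \<in> Hs n c \<Longrightarrow> lift p h \<in> Hs (p * n) (c \<circ> blk p)"
  using lift_Sn[OF Hs_Sn, of h n c] blk_lift[OF Hs_Sn, of h n c] by (auto simp: Hs_def fun_eq_iff)

text \<open>A transposition lifts to a product of \<open>p\<close> disjoint transpositions, one for
  each position inside the blocks, and \<open>p\<close> is odd.\<close>

lemma sign_lift:
  assumes "odd p" "g \<in> Sn n" shows "sign (lift p g) = sign g"
proof -
  have tr: "sign (lift p (transpose a b)) = - 1" if ab: "a \<in> {1..n}" "b \<in> {1..n}" "a \<noteq> b" for a b
  proof -
    \<comment> \<open>\<open>Q m\<close> performs the transpositions at the first \<open>m\<close>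
      positions.\<close>
    define Q where "Q = rec_nat id (\<lambda>m f. transpose (enc p a m) (enc p b m) \<circ> f)"
    have Q0: "Q 0 = id" and QS: "Q (Suc m) = transpose (enc p a m) (enc p b m) \<circ> Q m" for m by (simp_all add: Q_def)
    have ne: "enc p a m \<noteq> enc p b m" if "m < p" for m using blk_enc[of a m] blk_enc[of b m] ab that by auto
    have Qv: "Q m j = (if j \<ge> 1 \<and> rem p j < m then lift p (transpose a b) j else j)" if "m \<le> p" for m j
      using that
    proof (induction m)
      case 0 then show ?case by (simp add: Q0)
    next
      case (Suc m)
      have mp: "m < p" using Suc by simp
      show ?case
      proof (cases "j \<ge> 1 \<and> rem p j \<le> m")
        case True
        show ?thesis
        proof (cases "rem p j = m")
          case rm: True
          have j: "j = enc p (blk p j) m" using enc_blk[of j] True rm by simp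
          have "transpose (enc p a m) (enc p b m) j = enc p (transpose a b (blk p j)) m"
          proof -
            have "j = enc p a m \<longleftrightarrow> blk p j = a" "j = enc p b m \<longleftrightarrow> blk p j = b"
              using j blk_enc[of a m] blk_enc[of b m] ab mp by auto
            then show ?thesis using j by (auto simp: transpose_def)
          qed
          then show ?thesis using Suc rm True by (simp add: QS lift_def)
        next
          case rm: False
          have r: "rem p (lift p (transpose a b) j) = rem p j" using True rem_lift by blast
          have "lift p (transpose a b) j \<noteq> enc p a m" "lift p (transpose a b) j \<noteq> enc p b m"
            using r rm rem_enc[OF mp, of a] rem_enc[OF mp, of b] by auto
          then show ?thesis using Suc rm True by (simp add: QS transpose_def)
        qed
      next
        case False
        have "j \<noteq> enc p a m" "j \<noteq> enc p b m" using False rem_enc[OF mp] enc_ge1 by auto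
        then show ?thesis using Suc False by (auto simp: QS transpose_def)
      qed
    qed
    have "Q p = lift p (transpose a b)"
    proof
      fix j show "Q p j = lift p (transpose a b) j" using Qv[of p j] rem_less[of j] by (auto simp: lift_def)
    qed
    moreover have "permutation (Q m) \<and> sign (Q m) = (- 1) ^ m" if "m \<le> p" for m
      using that
    proof (induction m)
      case 0 then show ?case by (simp add: Q0)
    next
      case (Suc m)
      then have s: "sign (transpose (enc p a m) (enc p b m)) = - 1" using ne[of m] by (simp add: sign_swap_id)
      from Suc have pm: "permutation (Q m)" "sign (Q m) = (- 1) ^ m" by auto
      show ?case unfolding QS sign_compose[OF permutation_swap_id pm(1)] s pm(2)
        by (intro conjI permutation_compose[OF permutation_swap_id pm(1)]) simp
    qed
    ultimately show ?thesis using assms(1) by (metis order.refl power_minus_odd power_one)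
  qed
  show ?thesis
  proof (rule permutes_induct[of g "{1..n}" "\<lambda>g. sign (lift p g) = sign g"])
    show "g permutes {1..n}" using assms(2) by (simp add: Sn_def)
    show "finite {1..n}" by simp
    show "sign (lift p id) = sign (id :: nat \<Rightarrow> nat)" by (simp add: lift_id)
  next
    fix a b g assume ab: "a \<in> {1..n}" "b \<in> {1..n}" "a \<noteq> b" and IH: "sign (lift p g) = sign g" and g: "g permutes {1..n}"
    have gS: "g \<in> Sn n" and tS: "transpose a b \<in> Sn n" using g ab transpose_Sn by (auto simp: Sn_def)
    have "sign (lift p (transpose a b \<circ> g)) = sign (lift p (transpose a b)) * sign (lift p g)"
      unfolding lift_comp[OF gS] by (intro sign_compose Sn_permutation[OF lift_Sn[OF tS]] Sn_permutation[OF lift_Sn[OF gS]])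
    then show "sign (lift p (transpose a b \<circ> g)) = sign (transpose a b \<circ> g)"
      using tr[OF ab] IH ab by (simp add: sign_compose[OF Sn_permutation[OF tS] Sn_permutation[OF gS]] sign_swap_id)
  qed
qed

lemma rsgn_lift:
  assumes "odd p" "h \<in> Sn n" "\<And>x. h x \<in> A \<longleftrightarrow> x \<in> A" and A: "A \<subseteq> {1..n}"
  shows "rsgn {j\<in>{1..p * n}. blk p j \<in> A} (lift p h) = (rsgn A h :: 'a::field)"
proof -
  have "res {j\<in>{1..p * n}. blk p j \<in> A} (lift p h) = lift p (res A h)"
  proof
    fix j
    have "blk p j \<in> A \<Longrightarrow> j \<in> {1..p * n}" using A blk_in[of j n] by auto
    then show "res {j\<in>{1..p * n}. blk p j \<in> A} (lift p h) j = lift p (res A h) j"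
      by (cases "j = 0") (auto simp: res_def lift_def enc_blk)
  qed
  then show ?thesis unfolding rsgn_def by (simp add: sign_lift[OF assms(1) res_Sn[OF assms(2,3)]])
qed

lemma chi_lift:
  assumes "odd p" "h \<in> Hs n c" shows "chi (p * n) (c \<circ> blk p) (lift p h) = (chi n c h :: 'a::field)"
proof -
  have "oddp (p * n) (c \<circ> blk p) = {j\<in>{1..p * n}. blk p j \<in> oddp n c}"
    using blk_in by (auto simp: oddp_def)
  moreover have "oddp n c \<subseteq> {1..n}" by (auto simp: oddp_def)
  ultimately show ?thesis unfolding chi_def
    using rsgn_lift[OF assms(1) Hs_Sn[OF assms(2)] Hs_oddp[OF assms(2)], where ?'a = 'a] by simp
qed

lemma biequiv_lift:
  assumes "odd p" "v \<in> biequiv (p * n) (c \<circ> blk p) (c' \<circ> blk p)"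
  shows "(\<lambda>g. v (lift p g)) \<in> biequiv n c c'"
  unfolding biequiv_def
proof (intro CollectI ballI)
  fix h g k assume h: "h \<in> Hs n c" and g: "g \<in> Sn n" and k: "k \<in> Hs n c'"
  have "lift p (h \<circ> g \<circ> k) = lift p h \<circ> lift p g \<circ> lift p k"
    using lift_comp[OF Hs_Sn[OF k]] lift_comp[OF g] by simp
  then show "v (lift p (h \<circ> g \<circ> k)) = chi n c h * v (lift p g) * chi n c' k"
    using biequivD[OF assms(2) lift_Hs[OF h] lift_Sn[OF g] lift_Hs[OF k]] chi_lift[OF assms(1) h, where ?'a = 'a] chi_lift[OF assms(1) k, where ?'a = 'a]
    by simp
qed

definition rot :: "nat \<Rightarrow> nat \<Rightarrow> nat" where
  "rot n j = (if j \<in> {1..p * n} then enc p (blk p j) ((rem p j + 1) mod p) else j)"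

lemma rot_enc: "i \<in> {1..n} \<Longrightarrow> r < p \<Longrightarrow> rot n (enc p i r) = enc p i ((r + 1) mod p)"
  using enc_in[of i n r] blk_enc[of i r] by (simp add: rot_def rem_enc)

lemma blk_rot: "blk p (rot n j) = blk p j"
  using p0 blk_ge1[of j] by (auto simp: rot_def blk_enc)

lemma rem_rot: "j \<in> {1..p * n} \<Longrightarrow> rem p (rot n j) = (rem p j + 1) mod p"
  using p0 by (simp add: rot_def rem_enc)

lemma rot_pow: "i \<in> {1..n} \<Longrightarrow> r < p \<Longrightarrow> (rot n ^^ k) (enc p i r) = enc p i ((r + k) mod p)"
proof (induction k)
  case (Suc k)
  then have "(rot n ^^ Suc k) (enc p i r) = rot n (enc p i ((r + k) mod p))" by simp
  also have "\<dots> = enc p i (((r + k) mod p + 1) mod p)" using Suc p0 by (intro rot_enc) auto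
  finally show ?case by (simp add: mod_Suc_eq)
qed simp

lemma rot_order: "rot n ^^ p = id"
proof
  fix j
  show "(rot n ^^ p) j = id j"
  proof (cases "j \<in> {1..p * n}")
    case True
    then have "blk p j \<in> {1..n}" using blk_in by blast
    from rot_pow[OF this rem_less, of p j] show ?thesis using True enc_blk[of j] rem_less[of j] by simp
  next
    case False
    then have "(rot n ^^ k) j = j" for k by (induction k) (auto simp: rot_def)
    then show ?thesis by simp
  qed
qed

lemma rot_Sn: "rot n \<in> Sn (p * n)"
proof -
  have "rot n \<circ> (rot n ^^ (p - 1)) = id" "(rot n ^^ (p - 1)) \<circ> rot n = id"
    using rot_order[of n] p0 by (cases p; simp add: funpow_swap1 fun_eq_iff)+
  then have b: "bij (rot n)" using o_bij by blast
  moreover have "rot n j = j" if "j \<notin> {1..p * n}" for j unfolding rot_def if_not_P[OF that] ..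
  ultimately show ?thesis unfolding Sn_def permutes_def by (auto simp: bij_def) (metis bij_pointE b)+
qed

end

section \<open>The blown-up tableau and the pullback of its form\<close>

context tableau
begin

lemma p0: "p > 0" using prime_p by (simp add: prime_gt_0_nat)
lemma p1: "p > 1" using prime_p by (rule prime_gt_1_nat)

definition colp :: "nat \<Rightarrow> 'k \<times> nat" where "colp j = (col (blk p j), rem p j)"

text \<open>Each column is replaced by \<open>p\<close> copies, one for each position. The rotation
  is \<open>rot\<close>, not the lift of \<open>z\<close>: it has order \<open>p\<close>, which
  explains the parameter 1, and moves every point, so \<open>z_odd\<close> holds whatever
  \<open>z\<close> was.\<close>

lemma lifted_tableau: "tableau (p * n) p 1 (c0 \<circ> blk p) colp (rot p n)"
proof
  show "prime p" "odd p" by (rule prime_p, rule odd_p)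
next
  fix i j assume ij: "i \<in> {1..p * n}" "j \<in> {1..p * n}" "(c0 \<circ> blk p) i = (c0 \<circ> blk p) j" "colp i = colp j"
  then have "blk p i = blk p j" using box_inj[of "blk p i" "blk p j"] blk_in[OF p0, of i n] blk_in[OF p0, of j n] by (simp add: colp_def)
  then show "i = j" using eq_by_blk[OF p0, of i j] ij by (simp add: colp_def)
next
  fix i j assume ij: "i \<in> {1..p * n}" "j \<in> {1..p * n}" "colp i = colp j"
  then show "fst ((c0 \<circ> blk p) i) = fst ((c0 \<circ> blk p) j)"
    using col_parity[of "blk p i" "blk p j"] blk_in[OF p0, of i n] blk_in[OF p0, of j n] by (simp add: colp_def)
next
  fix i b k assume i: "i \<in> {1..p * n}" "(c0 \<circ> blk p) i = (b, Suc k)"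
  then obtain j where j: "j \<in> {1..n}" "col j = col (blk p i)" "c0 j = (b, k)"
    using col_down[of "blk p i" b k] blk_in[OF p0, of i n] by auto
  then have "enc p j (rem p i) \<in> {1..p * n}" "blk p (enc p j (rem p i)) = j" "rem p (enc p j (rem p i)) = rem p i"
    using enc_in[OF p0 j(1)] blk_enc[OF p0, of j] rem_enc[OF p0] rem_less[OF p0, of i] by auto
  then show "\<exists>j\<in>{1..p * n}. colp j = colp i \<and> (c0 \<circ> blk p) j = (b, k)"
    using j by (intro bexI[of _ "enc p j (rem p i)"]) (auto simp: colp_def)
next
  show "rot p n \<in> Hs (p * n) (c0 \<circ> blk p)"
    using rot_Sn[OF p0, of n] blk_rot[OF p0, of n] by (auto simp: Hs_def fun_eq_iff)
  show "rot p n ^^ p ^ 1 = id" using rot_order[OF p0] by simp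
next
  fix i j assume "i \<in> {1..p * n}" "j \<in> {1..p * n}" "colp i = colp j"
  then show "colp (rot p n i) = colp (rot p n j)"
    using rem_rot[OF p0, of i n] rem_rot[OF p0, of j n] blk_rot[OF p0, of n] by (simp add: colp_def)
next
  fix i assume i: "i \<in> {1..p * n}"
  show "rot p n i \<noteq> i"
  proof
    assume "rot p n i = i"
    then have e: "(rem p i + 1) mod p = rem p i" using rem_rot[OF p0 i] by simp
    show False
    proof (cases "rem p i + 1 < p")
      case True then show ?thesis using e by simp
    next
      case False
      then have "rem p i + 1 = p" using rem_less[OF p0, of i] by simp
      then show ?thesis using e p1 by simp
    qed
  qed
qed

text \<open>A word fixed by \<open>rot\<close> is constant on blocks. The word it induces below has
  the right letters because counts above are \<open>p\<close> times counts below.\<close>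

lemma fixed_words_lift:
  "bij_betw (\<lambda>x. x \<circ> blk p) (words n c) {w \<in> words (p * n) (c \<circ> blk p). w \<circ> iv (rot p n) = w}"
  unfolding bij_betw_def
proof
  have zS: "rot p n \<in> Sn (p * n)" by (rule rot_Sn[OF p0])
  show "inj_on (\<lambda>x. x \<circ> blk p) (words n c)"
  proof (rule inj_onI)
    fix x y assume xy: "x \<in> words n c" "y \<in> words n c" "x \<circ> blk p = y \<circ> blk p"
    have x0: "x 0 = c 0" "y 0 = c 0" using xy Sn_zero[OF p0 Sn_iv] by (auto simp: words_def)
    show "x = y"
    proof
      fix i show "x i = y i"
        using fun_cong[OF xy(3), of "enc p i 0"] blk_enc[OF p0, of i 0] p0 x0 by (cases "i = 0") auto
    qed
  qed
  show "(\<lambda>x. x \<circ> blk p) ` words n c = {w \<in> words (p * n) (c \<circ> blk p). w \<circ> iv (rot p n) = w}"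
  proof (intro equalityI subsetI)
    fix w assume "w \<in> (\<lambda>x. x \<circ> blk p) ` words n c"
    then obtain g where g: "g \<in> Sn n" "w = c \<circ> iv g \<circ> blk p" by (auto simp: words_def)
    have "w = (c \<circ> blk p) \<circ> iv (lift p g)" unfolding g(2) by (rule word_lift[OF p0 g(1), symmetric])
    then have "w \<in> words (p * n) (c \<circ> blk p)" unfolding words_def using lift_Sn[OF p0 g(1)] by blast
    moreover have "w \<circ> iv (rot p n) = w"
    proof
      fix j have "blk p (iv (rot p n) j) = blk p j" using blk_rot[OF p0, of n "iv (rot p n) j"] Sn_iv_app(2)[OF zS, of j] by simp
      then show "(w \<circ> iv (rot p n)) j = w j" by (simp add: g(2))
    qed
    ultimately show "w \<in> {w \<in> words (p * n) (c \<circ> blk p). w \<circ> iv (rot p n) = w}" by blast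
  next
    fix w assume "w \<in> {w \<in> words (p * n) (c \<circ> blk p). w \<circ> iv (rot p n) = w}"
    then obtain g where g: "g \<in> Sn (p * n)" "w = c \<circ> blk p \<circ> iv g" and wz: "w \<circ> iv (rot p n) = w" by (auto simp: words_def)
    have wr: "w (rot p n j) = w j" for j using fun_cong[OF wz, of "rot p n j"] by (simp add: Sn_iv_app[OF zS])
    have wrk: "w ((rot p n ^^ k) j) = w j" for k j by (induction k) (auto simp: wr)
    define x where "x i = (if i = 0 then c 0 else w (enc p i 0))" for i
    have out: "w j = c (blk p j)" if "j \<notin> {1..p * n}" for j using Sn_outside[OF Sn_iv[OF g(1)] that] by (simp add: g(2))
    have wx: "w j = x (blk p j)" for j
    proof (cases "j \<in> {1..p * n}")
      case True
      then have b: "blk p j \<in> {1..n}" using blk_in[OF p0] by blast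
      have "(rot p n ^^ rem p j) (enc p (blk p j) 0) = j"
        using rot_pow[OF p0 b p0, of "rem p j"] rem_less[OF p0, of j] enc_blk[OF p0, of j] True by simp
      then have "w j = w (enc p (blk p j) 0)" using wrk[of "rem p j" "enc p (blk p j) 0"] by simp
      then show ?thesis using b by (simp add: x_def)
    next
      case False
      show ?thesis
      proof (cases "j = 0")
        case True then show ?thesis using out[OF False] blk_0[OF p0] by (simp add: x_def)
      next
        case j0: False
        have "blk p j \<notin> {1..n}" using False blk_in[OF p0, of j n] by blast
        have "blk p (enc p (blk p j) 0) = blk p j" using blk_enc[OF p0 _ p0] blk_ge1[OF p0, of j] j0 by simp
        then have "enc p (blk p j) 0 \<notin> {1..p * n}" using False blk_in[OF p0, of _ n] by metis
        then have "w (enc p (blk p j) 0) = c (blk p j)" using out \<open>blk p (enc p (blk p j) 0) = blk p j\<close> by simp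
        then show ?thesis using out[OF False] blk_ge1[OF p0, of j] j0 by (simp add: x_def)
      qed
    qed
    have xo: "x i = c i" if "i \<notin> {1..n}" for i
    proof (cases "i = 0")
      case False
      have b: "blk p (enc p i 0) = i" using blk_enc[OF p0 _ p0] False by simp
      then have "enc p i 0 \<notin> {1..p * n}" using that blk_in[OF p0, of "enc p i 0" n] unfolding b by blast
      then show ?thesis using out b False by (simp add: x_def)
    qed (simp add: x_def)
    have "card {i\<in>{1..n}. x i = l} = card {i\<in>{1..n}. c i = l}" for l
    proof -
      have "p * card {i\<in>{1..n}. x i = l} = card {j\<in>{1..p * n}. x (blk p j) = l}" by (rule card_blk[OF p0, symmetric])
      also have "\<dots> = card {j\<in>{1..p * n}. c (blk p (iv g j)) = l}" unfolding wx[symmetric] by (simp add: g(2))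
      also have "\<dots> = card {j\<in>{1..p * n}. c (blk p j) = l}" by (rule card_Sn_collect[OF Sn_iv[OF g(1)], of "\<lambda>j. c (blk p j) = l"])
      also have "\<dots> = p * card {i\<in>{1..n}. c i = l}" by (rule card_blk[OF p0])
      finally show ?thesis using p0 by simp
    qed
    from ex_perm_of_counts[OF this] obtain s where s: "s \<in> Sn n" "\<forall>i\<in>{1..n}. c (s i) = x i" by blast
    have "x = c \<circ> s"
    proof
      fix i show "x i = (c \<circ> s) i" using s(2) xo[of i] Sn_outside[OF s(1), of i] by (cases "i \<in> {1..n}") auto
    qed
    then have "x = c \<circ> iv (iv s)" using Sn_iv_iv[OF s(1)] by simp
    then have "x \<in> words n c" unfolding words_def using Sn_iv[OF s(1)] by blast
    moreover have "w = x \<circ> blk p" using wx by auto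
    ultimately show "w \<in> (\<lambda>x. x \<circ> blk p) ` words n c" by blast
  qed
qed

text \<open>Elements of the new column group keep the position inside the block; those commuting
  with \<open>rot\<close> then move whole blocks.\<close>

lemma fixed_columns_lift:
  "bij_betw (lift p) Col {\<pi> \<in> Hs (p * n) colp. rot p n \<circ> \<pi> \<circ> iv (rot p n) = \<pi>}"
  unfolding bij_betw_def
proof
  let ?z = "rot p n"
  have zS: "?z \<in> Sn (p * n)" by (rule rot_Sn[OF p0])
  show "inj_on (lift p) Col"
  proof (rule inj_onI)
    fix a b assume ab: "a \<in> Col" "b \<in> Col" "lift p a = lift p b"
    show "a = b"
    proof
      fix i show "a i = b i"
      proof (cases "i = 0")
        case True then show ?thesis using Sn_zero[OF p0 Hs_Sn[OF ab(1)]] Sn_zero[OF p0 Hs_Sn[OF ab(2)]] by simp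
      next
        case False
        have "blk p (lift p a (enc p i 0)) = a i" "blk p (lift p b (enc p i 0)) = b i"
          using blk_lift[OF p0 Hs_Sn[OF ab(1)]] blk_lift[OF p0 Hs_Sn[OF ab(2)]] blk_enc[OF p0 _ p0] False by simp_all
        then show ?thesis using ab(3) by simp
      qed
    qed
  qed
  show "lift p ` Col = {\<pi> \<in> Hs (p * n) colp. ?z \<circ> \<pi> \<circ> iv ?z = \<pi>}"
  proof (intro equalityI subsetI)
    fix q assume "q \<in> lift p ` Col"
    then obtain \<pi> where \<pi>: "\<pi> \<in> Col" "q = lift p \<pi>" by blast
    note S = Hs_Sn[OF \<pi>(1)]
    have qS: "q \<in> Sn (p * n)" unfolding \<pi>(2) by (rule lift_Sn[OF p0 S])
    have "colp (q j) = colp j" for j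
      using blk_lift[OF p0 S, of j] rem_lift[OF p0, of j] Hs_eq[OF \<pi>(1)] by (cases "j = 0") (auto simp: colp_def \<pi>(2) lift_def)
    then have "q \<in> Hs (p * n) colp" using qS by (auto simp: Hs_def fun_eq_iff)
    moreover have "?z (q j) = q (?z j)" for j
    proof (cases "j \<in> {1..p * n}")
      case True
      then have b: "blk p j \<in> {1..n}" using blk_in[OF p0] by blast
      have pb: "\<pi> (blk p j) \<in> {1..n}" using b Sn_in[OF S] by blast
      have j: "j = enc p (blk p j) (rem p j)" using enc_blk[OF p0, of j] True by simp
      have "?z (q j) = enc p (\<pi> (blk p j)) ((rem p j + 1) mod p)"
        using rot_enc[OF p0 pb rem_less[OF p0]] True by (simp add: \<pi>(2) lift_def)
      moreover have "q (?z j) = enc p (\<pi> (blk p j)) ((rem p j + 1) mod p)"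
        using lift_enc[OF p0, of "blk p j" "(rem p j + 1) mod p" \<pi>] rot_enc[OF p0 b rem_less[OF p0]] True j b p0 by (simp add: \<pi>(2) rot_def)
      ultimately show ?thesis by simp
    next
      case False
      then show ?thesis using Sn_outside[OF qS False] Sn_outside[OF zS False] by simp
    qed
    then have "?z \<circ> q \<circ> iv ?z = q" by (auto simp: fun_eq_iff Sn_iv_app[OF zS])
    ultimately show "q \<in> {\<pi> \<in> Hs (p * n) colp. ?z \<circ> \<pi> \<circ> iv ?z = \<pi>}" by blast
  next
    fix q assume "q \<in> {\<pi> \<in> Hs (p * n) colp. ?z \<circ> \<pi> \<circ> iv ?z = \<pi>}"
    then have q: "q \<in> Hs (p * n) colp" and qz: "?z \<circ> q \<circ> iv ?z = q" by auto
    note qS = Hs_Sn[OF q]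
    have com: "?z (q j) = q (?z j)" for j using fun_cong[OF qz, of "?z j"] by (simp add: Sn_iv_app[OF zS])
    have comk: "(?z ^^ k) (q j) = q ((?z ^^ k) j)" for k j by (induction k) (auto simp: com)
    define a where "a i = (if i = 0 then 0 else blk p (q (enc p i 0)))" for i
    have q0: "rem p (q j) = rem p j" "col (blk p (q j)) = col (blk p j)" for j using Hs_eq[OF q, of j] by (auto simp: colp_def)
    have qa: "q j = lift p a j" for j
    proof (cases "j \<in> {1..p * n}")
      case True
      then have b: "blk p j \<in> {1..n}" using blk_in[OF p0] by blast
      let ?e = "enc p (blk p j) 0"
      have "?e \<in> {1..p * n}" by (rule enc_in[OF p0 b p0])
      then have qe: "q ?e \<in> {1..p * n}" using Sn_in[OF qS] by blast
      then have ab: "blk p (q ?e) \<in> {1..n}" using blk_in[OF p0] by blast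
      have "rem p (q ?e) = 0" using q0(1)[of ?e] rem_enc[OF p0 p0] by simp
      then have qe': "q ?e = enc p (blk p (q ?e)) 0" using enc_blk[OF p0, of "q ?e"] qe by simp
      have "j = (?z ^^ rem p j) ?e"
        using rot_pow[OF p0 b p0, of "rem p j"] rem_less[OF p0, of j] enc_blk[OF p0, of j] True by simp
      then have "q j = (?z ^^ rem p j) (q ?e)" using comk[of "rem p j" ?e] by simp
      also have "\<dots> = enc p (blk p (q ?e)) (rem p j)"
        using qe' rot_pow[OF p0 ab p0, of "rem p j"] rem_less[OF p0, of j] by simp
      finally show ?thesis using True b by (simp add: lift_def a_def)
    next
      case False
      show ?thesis
      proof (cases "j = 0")
        case True then show ?thesis using Sn_outside[OF qS False] by (simp add: lift_def)
      next
        case j0: False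
        have b: "blk p (enc p (blk p j) 0) = blk p j" using blk_enc[OF p0 _ p0] blk_ge1[OF p0, of j] j0 by simp
        then have "enc p (blk p j) 0 \<notin> {1..p * n}" using False blk_in[OF p0, of _ n] by metis
        then have "a (blk p j) = blk p j" using Sn_outside[OF qS] b blk_ge1[OF p0, of j] j0 by (simp add: a_def)
        then show ?thesis using Sn_outside[OF qS False] j0 by (simp add: lift_def enc_blk[OF p0])
      qed
    qed
    have ain: "a i \<in> {1..n}" if "i \<in> {1..n}" for i
    proof -
      have "q (enc p i 0) \<in> {1..p * n}" using enc_in[OF p0 that p0] Sn_in[OF qS] by blast
      then have "blk p (q (enc p i 0)) \<in> {1..n}" using blk_in[OF p0] by blast
      moreover have "i \<noteq> 0" using that by auto
      ultimately show ?thesis unfolding a_def by simp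
    qed
    have aout: "a i = i" if "i \<notin> {1..n}" for i
    proof (cases "i = 0")
      case False
      then have b: "blk p (enc p i 0) = i" using blk_enc[OF p0 _ p0] by simp
      have "enc p i 0 \<notin> {1..p * n}" using that blk_in[OF p0, of "enc p i 0" n] unfolding b by blast
      then show ?thesis using Sn_outside[OF qS, of "enc p i 0"] b False by (simp add: a_def)
    qed (simp add: a_def)
    have "inj_on a {1..n}"
    proof (rule inj_onI)
      fix i k assume ik: "i \<in> {1..n}" "k \<in> {1..n}" "a i = a k"
      have "q (enc p i 0) = q (enc p k 0)"
        using qa[of "enc p i 0"] qa[of "enc p k 0"] lift_enc[OF p0 _ p0, of i a] lift_enc[OF p0 _ p0, of k a] ik by simp
      then have "enc p i 0 = enc p k 0" using Sn_iv_app(1)[OF qS] by metis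
      moreover have "blk p (enc p i 0) = i" using blk_enc[OF p0 _ p0, of i] ik(1) by simp
      moreover have "blk p (enc p k 0) = k" using blk_enc[OF p0 _ p0, of k] ik(2) by simp
      ultimately show "i = k" by metis
    qed
    moreover then have "a ` {1..n} = {1..n}" using ain by (intro endo_inj_surj) auto
    ultimately have "bij_betw a {1..n} {1..n}" by (simp add: bij_betw_def)
    then have "a permutes {1..n}" by (rule bij_imp_permutes) (rule aout)
    moreover have "col (a i) = col i" for i
    proof (cases "i \<in> {1..n}")
      case True
      then have "blk p (enc p i 0) = i" using blk_enc[OF p0 _ p0] by simp
      then show ?thesis using q0(2)[of "enc p i 0"] True by (simp add: a_def)
    qed (simp add: aout)
    ultimately have "a \<in> Col" by (auto simp: Hs_def Sn_def fun_eq_iff)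
    moreover have "q = lift p a" using qa by auto
    ultimately show "q \<in> lift p ` Col" by blast
  qed
qed

lemma eps_lift: "\<pi> \<in> Col \<Longrightarrow> tableau.eps (p * n) (c0 \<circ> blk p) (lift p \<pi>) = (eps \<pi> :: 'a::field)"
proof -
  assume p: "\<pi> \<in> Col"
  interpret up: tableau "p * n" p 1 "c0 \<circ> blk p" colp "rot p n" by (rule lifted_tableau)
  let ?E = "{i\<in>{1..n}. \<not> fst (c0 i)}"
  have "{j\<in>{1..p * n}. \<not> fst ((c0 \<circ> blk p) j)} = {j\<in>{1..p * n}. blk p j \<in> ?E}"
    using blk_in[OF p0, of _ n] by auto
  moreover have "?E \<subseteq> {1..n}" by auto
  ultimately show ?thesis unfolding up.eps_def eps_def
    using rsgn_lift[OF p0 odd_p Hs_Sn[OF p] Col_even[OF p], where ?'a = 'a] by simp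
qed

text \<open>The fixed point principle for \<open>rot\<close> is used twice: on words, through
  \<open>form_fixed\<close>, and on the column group under conjugation. What survives in both places
  is the diagonal copy.\<close>

lemma form_lift:
  assumes ch: "CHAR('a::field) = p" and v': "v' \<in> biequiv (p * n) (c0 \<circ> blk p) (c \<circ> blk p)"
    and v: "v \<in> biequiv (p * n) (c0 \<circ> blk p) (c \<circ> blk p)"
  shows "tableau.form (p * n) (c0 \<circ> blk p) colp (c \<circ> blk p) v' v = form c (\<lambda>g. v' (lift p g)) (\<lambda>g. v (lift p g) :: 'a)"
proof -
  interpret up: tableau "p * n" p 1 "c0 \<circ> blk p" colp "rot p n" by (rule lifted_tableau)
  let ?z = "rot p n" and ?c = "c \<circ> blk p"
  let ?F = "\<lambda>y. (\<Sum>\<pi>\<in>up.Col. up.eps \<pi> * v' (iv \<pi> \<circ> y)) * v y"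
  let ?f = "\<lambda>y. (\<Sum>\<pi>\<in>Col. eps \<pi> * v' (lift p (iv \<pi> \<circ> y))) * v (lift p y)"
  have inner: "(\<Sum>\<pi>\<in>up.Col. up.eps \<pi> * v' (iv \<pi> \<circ> lift p y)) = (\<Sum>\<pi>\<in>Col. eps \<pi> * v' (lift p (iv \<pi> \<circ> y)))"
    if y: "y \<in> Sn n" for y
  proof -
    note yS = lift_Sn[OF p0 y]
    have "(\<Sum>\<pi>\<in>up.Col. up.eps \<pi> * v' (iv \<pi> \<circ> lift p y))
       = (\<Sum>\<pi>\<in>{\<pi>\<in>up.Col. ?z \<circ> \<pi> \<circ> iv ?z = \<pi>}. up.eps \<pi> * v' (iv \<pi> \<circ> lift p y))"
    proof (rule sum_fixed_points[OF prime_p ch finite_Hs, where N = 1])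
      fix \<pi> assume \<pi>: "\<pi> \<in> up.Col"
      note S = Hs_Sn[OF \<pi>]
      show "?z \<circ> \<pi> \<circ> iv ?z \<in> up.Col" by (rule up.conj_z_Col[OF \<pi>])
      have "((\<lambda>\<pi>. ?z \<circ> \<pi> \<circ> iv ?z) ^^ k) \<pi> = (?z ^^ k) \<circ> \<pi> \<circ> iv (?z ^^ k)" for k
      proof (induction k)
        case 0 show ?case by simp
      next
        case (Suc k)
        have d: "iv (?z \<circ> ?z ^^ k) = iv (?z ^^ k) \<circ> iv ?z"
          by (rule Sn_iv_distrib[OF up.zS up.funpow_Sn[OF up.zS]])
        have "((\<lambda>\<pi>. ?z \<circ> \<pi> \<circ> iv ?z) ^^ Suc k) \<pi> = ?z \<circ> ((\<lambda>\<pi>. ?z \<circ> \<pi> \<circ> iv ?z) ^^ k) \<pi> \<circ> iv ?z"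
          by (simp only: funpow.simps(2) o_apply)
        also have "\<dots> = ?z \<circ> ((?z ^^ k) \<circ> \<pi> \<circ> iv (?z ^^ k)) \<circ> iv ?z" by (simp only: Suc)
        also have "\<dots> = (?z ^^ Suc k) \<circ> \<pi> \<circ> iv (?z ^^ Suc k)" by (simp only: funpow.simps(2) d o_assoc)
        finally show ?case .
      qed
      then show "((\<lambda>\<pi>. ?z \<circ> \<pi> \<circ> iv ?z) ^^ (p ^ 1)) \<pi> = \<pi>" using rot_order[OF p0, of n] by simp
      \<comment> \<open>Conjugating a column permutation by \<open>rot\<close> costs a factor
        \<open>rot\<close> on the left and \<open>?k\<close> on the right. As \<open>rot\<close>
        preserves blocks, \<open>?k\<close> lies in the Young subgroup, and its \<open>p\<close>-th
        power is the identity, so its sign is 1.\<close>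
      let ?k = "iv (lift p y) \<circ> iv ?z \<circ> lift p y"
      have k: "?k \<in> Hs (p * n) ?c"
      proof -
        have "?c (?k j) = ?c j" for j
        proof -
          have "blk p (iv ?z i) = blk p i" for i using blk_rot[OF p0, of n "iv ?z i"] Sn_iv_app(2)[OF up.zS, of i] by simp
          then show ?thesis using blk_lift[OF p0 Sn_iv[OF y]] blk_lift[OF p0 y] Sn_iv_app(1)[OF y] by (simp add: iv_lift[OF p0 y])
        qed
        then show ?thesis using yS up.zS by (auto simp: Hs_def Sn_intros fun_eq_iff)
      qed
      have k1: "?k ^^ (p ^ 1) = iv (lift p y) \<circ> (iv ?z ^^ p) \<circ> lift p y"
        using up.funpow_conj[OF yS, where g = "iv ?z" and i = p] by (simp only: power_one_right)
      have k2: "iv ?z ^^ p = id"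
      proof -
        have "?z ^^ i \<circ> iv ?z ^^ i = id" for i
        proof (induction i)
          case (Suc i)
          have "?z ^^ Suc i \<circ> iv ?z ^^ Suc i = ?z ^^ i \<circ> (?z \<circ> (iv ?z \<circ> iv ?z ^^ i))"
            by (simp only: funpow_Suc_right[of i ?z] funpow.simps(2)[of i "iv ?z"] o_assoc)
          then show ?case using Suc by (simp only: Sn_cancel[OF up.zS])
        qed simp
        from this[of p] show ?thesis by (simp only: rot_order[OF p0] id_comp)
      qed
      have "?k ^^ (p ^ 1) = id" unfolding k1 k2 by (simp only: comp_id Sn_iv_comp[OF yS])
      then have ck: "chi (p * n) ?c ?k = (1::'a)" by (rule up.chi_p_power_order[OF k])
      have "iv (?z \<circ> \<pi> \<circ> iv ?z) \<circ> lift p y = ?z \<circ> (iv \<pi> \<circ> lift p y \<circ> ?k)"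
        using up.zS S yS by (simp add: Sn_iv_distrib[of _ "p * n"] Sn_intros Sn_iv_iv[of _ "p * n"] o_assoc[symmetric] Sn_cancel)
      then have "v' (iv (?z \<circ> \<pi> \<circ> iv ?z) \<circ> lift p y) = v' (?z \<circ> (iv \<pi> \<circ> lift p y \<circ> ?k))" by simp
      also have "\<dots> = v' (iv \<pi> \<circ> lift p y \<circ> ?k)"
        using biequiv_left[OF v' up.z_row, of "iv \<pi> \<circ> lift p y \<circ> ?k"] S yS up.zS up.chi_p_power_order[OF up.z_row up.z_order, where ?'a = 'a]
        by (simp add: Sn_intros)
      also have "\<dots> = v' (iv \<pi> \<circ> lift p y)" using biequiv_right[OF v' _ k, of "iv \<pi> \<circ> lift p y"] S yS ck by (simp add: Sn_intros)
      finally show "up.eps (?z \<circ> \<pi> \<circ> iv ?z) * v' (iv (?z \<circ> \<pi> \<circ> iv ?z) \<circ> lift p y) = up.eps \<pi> * v' (iv \<pi> \<circ> lift p y)"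
        by (simp only: up.eps_conj_z[OF \<pi>])
    qed
    also have "\<dots> = (\<Sum>\<pi>\<in>Col. up.eps (lift p \<pi>) * v' (iv (lift p \<pi>) \<circ> lift p y))"
      by (rule sum.reindex_bij_betw[OF fixed_columns_lift, symmetric])
    also have "\<dots> = (\<Sum>\<pi>\<in>Col. eps \<pi> * v' (lift p (iv \<pi> \<circ> y)))"
      by (intro sum.cong refl) (simp add: eps_lift iv_lift[OF p0 Hs_Sn] lift_comp[OF p0 y])
    finally show ?thesis .
  qed
  note b = biequiv_lift[OF p0 odd_p v'] biequiv_lift[OF p0 odd_p v]
  have "up.form ?c v' v = (\<Sum>w\<in>{w\<in>words (p * n) ?c. w \<circ> iv ?z = w}. ?F (wrep (p * n) ?c w))"
    by (rule up.form_fixed[OF ch v' v])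
  also have "\<dots> = (\<Sum>x\<in>words n c. ?F (wrep (p * n) ?c (x \<circ> blk p)))"
    by (rule sum.reindex_bij_betw[OF fixed_words_lift, symmetric])
  also have "\<dots> = (\<Sum>x\<in>words n c. ?f (wrep n c x))"
  proof (intro sum.cong refl)
    fix x assume x: "x \<in> words n c"
    let ?y = "wrep n c x"
    have y: "?y \<in> Sn n" "c \<circ> iv ?y = x" using wrep[OF x] by auto
    have w: "?c \<circ> iv (lift p ?y) = x \<circ> blk p" unfolding word_lift[OF p0 y(1)] y(2) ..
    have xw: "x \<circ> blk p \<in> words (p * n) ?c" unfolding w[symmetric] words_def using lift_Sn[OF p0 y(1)] by blast
    have "?F (wrep (p * n) ?c (x \<circ> blk p)) = ?F (lift p ?y)"
      by (rule rinv_word[OF up.form_rinv[OF v' v] wrep(1)[OF xw] lift_Sn[OF p0 y(1)]]) (simp only: wrep(2)[OF xw] w)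
    then show "?F (wrep (p * n) ?c (x \<circ> blk p)) = ?f ?y" by (simp only: inner[OF y(1)])
  qed
  also have "\<dots> = form c (\<lambda>g. v' (lift p g)) (\<lambda>g. v (lift p g))"
    unfolding form_def by (rule csum_words[OF form_rinv[OF b], symmetric])
  finally show ?thesis .
qed

end

section \<open>Extension of kernels from the diagonal copy\<close>

text \<open>Odd letters stand exactly in the odd rows; this is the condition on the support under
  which a kernel extends.\<close>

definition parmatch :: "nat \<Rightarrow> labelling \<Rightarrow> labelling \<Rightarrow> (nat \<Rightarrow> nat) \<Rightarrow> bool" where
  "parmatch n c0 c y \<longleftrightarrow> (\<forall>i\<in>{1..n}. fst (c (iv y i)) = fst (c0 i))"

lemma parmatch_right: "y \<in> Sn n \<Longrightarrow> k \<in> Hs n c \<Longrightarrow> parmatch n c0 c (y \<circ> k) = parmatch n c0 c y"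
  using word_mult_right[of y n k c] unfolding parmatch_def by (metis comp_apply)

lemma parmatch_left_imp:
  assumes h: "h \<in> Sn n" "\<And>i. i \<in> {1..n} \<Longrightarrow> fst (c0 (h i)) = fst (c0 i)" and y: "y \<in> Sn n" and m: "parmatch n c0 c y"
  shows "parmatch n c0 c (iv h \<circ> y)"
  unfolding parmatch_def
proof
  fix i assume i: "i \<in> {1..n}"
  have "iv (iv h \<circ> y) = iv y \<circ> h" using h y by (simp add: Sn_iv_distrib[of _ n] Sn_iv Sn_iv_iv[of _ n])
  then show "fst (c (iv (iv h \<circ> y) i)) = fst (c0 i)" using m i h(2)[OF i] Sn_in[OF h(1), of i] by (simp add: parmatch_def)
qed

lemma parmatch_left:
  assumes h: "h \<in> Hs n c0" and y: "y \<in> Sn n"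
  shows "parmatch n c0 c (h \<circ> y) = parmatch n c0 c y"
proof
  assume "parmatch n c0 c y"
  then have "parmatch n c0 c (iv (iv h) \<circ> y)"
    using parmatch_left_imp[OF Sn_iv[OF Hs_Sn[OF h]] _ y] Hs_eq[OF Hs_iv[OF h]] by simp
  then show "parmatch n c0 c (h \<circ> y)" by (simp add: Sn_iv_iv[OF Hs_Sn[OF h]])
next
  assume "parmatch n c0 c (h \<circ> y)"
  then have "parmatch n c0 c (iv h \<circ> (h \<circ> y))"
    using parmatch_left_imp[OF Hs_Sn[OF h] _ Sn_comp[OF Hs_Sn[OF h] y]] Hs_eq[OF h] by simp
  then show "parmatch n c0 c y" by (simp only: Sn_cancel[OF Hs_Sn[OF h]])
qed

lemma biequiv_parmatch:
  assumes v: "v \<in> biequiv n c0 c"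
  shows "(\<lambda>y. if parmatch n c0 c y then v y else 0) \<in> biequiv n c0 c"
  by (rule biequivI) (auto simp: parmatch_left parmatch_right biequiv_left[OF v] biequiv_right[OF v])

text \<open>A double coset of two Young subgroups is determined by the table that counts, for each
  row and each letter, the positions carrying both.\<close>

lemma same_contingency_double_coset:
  assumes g: "g \<in> Sn n" "g' \<in> Sn n"
    and cnt: "\<And>l m. card {i\<in>{1..n}. (c0 i, c (iv g' i)) = (l, m)} = card {i\<in>{1..n}. (c0 i, c (iv g i)) = (l, m)}"
  shows "\<exists>r\<in>Hs n c0. \<exists>s\<in>Hs n c. g' = r \<circ> g \<circ> s"
proof -
  have "card {i\<in>{1..n}. (c0 i, c (iv g' i)) = lm} = card {i\<in>{1..n}. (c0 i, c (iv g i)) = lm}" for lm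
    using cnt[of "fst lm" "snd lm"] by simp
  from ex_perm_of_counts[OF this] obtain s where s: "s \<in> Sn n"
    "\<And>i. i \<in> {1..n} \<Longrightarrow> (c0 (s i), c (iv g (s i))) = (c0 i, c (iv g' i))" by blast
  have s': "c0 (s i) = c0 i \<and> c (iv g (s i)) = c (iv g' i)" for i
    using s(2)[of i] Sn_outside[OF s(1), of i] Sn_outside[OF Sn_iv[OF g(1)], of i] Sn_outside[OF Sn_iv[OF g(2)], of i]
    by (cases "i \<in> {1..n}") auto
  have sH: "s \<in> Hs n c0" using s(1) s' by (auto simp: Hs_def fun_eq_iff)
  have "iv (iv s \<circ> g) = iv g \<circ> s" using s(1) g by (simp add: Sn_iv_distrib[of _ n] Sn_iv Sn_iv_iv[of _ n])
  then have "c \<circ> iv (iv s \<circ> g) = c \<circ> iv g'" using s' by (auto simp: fun_eq_iff)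
  then have t: "iv (iv s \<circ> g) \<circ> g' \<in> Hs n c" using same_word_iff[of "iv s \<circ> g" n g' c] s(1) g by (simp add: Sn_intros)
  have "g' = iv s \<circ> g \<circ> (iv (iv s \<circ> g) \<circ> g')"
    using Sn_cancel(1)[of "iv s \<circ> g" n g'] s(1) g by (simp add: Sn_intros)
  then show ?thesis using Hs_iv[OF sH] t by blast
qed

context tableau
begin

abbreviation "c0p \<equiv> c0 \<circ> blk p"

text \<open>The table of a lift is \<open>p\<close> times the table below, so lifting does not merge
  double cosets.\<close>

lemma lifted_double_coset:
  assumes g: "g \<in> Sn n" "g' \<in> Sn n" and a: "a \<in> Hs (p * n) c0p" and b: "b \<in> Hs (p * n) (c \<circ> blk p)"
    and e: "a \<circ> lift p g \<circ> b = lift p g'"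
  shows "\<exists>r\<in>Hs n c0. \<exists>s\<in>Hs n c. g' = r \<circ> g \<circ> s"
proof (rule same_contingency_double_coset[OF g])
  fix l m
  have aS: "a \<in> Sn (p * n)" and bS: "b \<in> Sn (p * n)" using a b Hs_Sn by auto
  have gS: "lift p g \<in> Sn (p * n)" by (rule lift_Sn[OF p0 g(1)])
  have w: "c (iv g' (blk p j)) = c (iv g (blk p (iv a j)))" for j
  proof -
    have "c \<circ> iv g' \<circ> blk p = (c \<circ> blk p) \<circ> iv (a \<circ> lift p g \<circ> b)" unfolding e by (rule word_lift[OF p0 g(2), symmetric])
    also have "\<dots> = (c \<circ> blk p) \<circ> iv (a \<circ> lift p g)" by (rule word_mult_right[OF Sn_comp[OF aS gS] b])
    also have "\<dots> = (c \<circ> blk p) \<circ> iv (lift p g) \<circ> iv a" using aS gS by (simp add: Sn_iv_distrib[of _ "p * n"] o_assoc)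
    also have "\<dots> = c \<circ> iv g \<circ> blk p \<circ> iv a" by (simp only: word_lift[OF p0 g(1)])
    finally show ?thesis by (auto dest: fun_cong[of _ _ j])
  qed
  have ca: "c0 (blk p (iv a j)) = c0 (blk p j)" for j using Hs_eq[OF Hs_iv[OF a], of j] by simp
  have "p * card {i\<in>{1..n}. (c0 i, c (iv g' i)) = (l, m)} = card {j\<in>{1..p * n}. (c0 (blk p j), c (iv g' (blk p j))) = (l, m)}"
    by (rule card_blk[OF p0, symmetric])
  also have "\<dots> = card {j\<in>{1..p * n}. (c0 (blk p (iv a j)), c (iv g (blk p (iv a j)))) = (l, m)}" by (simp only: w ca)
  also have "\<dots> = card {j\<in>{1..p * n}. (c0 (blk p j), c (iv g (blk p j))) = (l, m)}"
    by (rule card_Sn_collect[OF Sn_iv[OF aS], of "\<lambda>j. (c0 (blk p j), c (iv g (blk p j))) = (l, m)"])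
  also have "\<dots> = p * card {i\<in>{1..n}. (c0 i, c (iv g i)) = (l, m)}" by (rule card_blk[OF p0])
  finally show "card {i\<in>{1..n}. (c0 i, c (iv g' i)) = (l, m)} = card {i\<in>{1..n}. (c0 i, c (iv g i)) = (l, m)}"
    using p0 by simp
qed

text \<open>When parities match, conjugation by \<open>lift p g\<close> carries the odd points of
  one labelling onto those of the other, so the two signs agree. At a mismatch, a transposition
  inside a block would have different signs on the two sides.\<close>

lemma lifted_stabilizer_sign:
  assumes g: "g \<in> Sn n" "parmatch n c0 c g" and a: "a \<in> Hs (p * n) c0p" and b: "b \<in> Hs (p * n) (c \<circ> blk p)"
    and e: "a \<circ> lift p g \<circ> b = lift p g"
  shows "chi (p * n) c0p a * chi (p * n) (c \<circ> blk p) b = (1::'a::field)"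
proof -
  have gS: "lift p g \<in> Sn (p * n)" by (rule lift_Sn[OF p0 g(1)])
  have bS: "b \<in> Sn (p * n)" using b Hs_Sn by auto
  have "lift p g \<circ> iv b \<circ> iv (lift p g) = a \<circ> lift p g \<circ> b \<circ> iv b \<circ> iv (lift p g)" by (simp only: e)
  also have "\<dots> = a" by (simp only: o_assoc[symmetric] Sn_cancel[OF bS] Sn_comp_iv[OF gS] comp_id)
  finally have a': "lift p g \<circ> iv b \<circ> iv (lift p g) = a" .
  have "oddp (p * n) ((c \<circ> blk p) \<circ> iv (lift p g)) = oddp (p * n) c0p"
    unfolding word_lift[OF p0 g(1)] using g(2) blk_in[OF p0, of _ n] by (auto simp: oddp_def parmatch_def)
  then have "chi (p * n) (c \<circ> blk p) (iv b) = (chi (p * n) c0p a :: 'a)"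
    using chi_word_conj[OF gS Hs_iv[OF b]] unfolding a' chi_def by simp
  then show ?thesis unfolding chi_iv[OF b] by (simp add: chi_square)
qed

text \<open>The extension is supported on the double cosets of lifts. It is well defined because
  lifting does not merge double cosets and stabilizers have trivial sign where \<open>v\<close> is
  nonzero.\<close>

lemma lift_function:
  fixes v :: "(nat \<Rightarrow> nat) \<Rightarrow> 'a::field"
  assumes v: "v \<in> biequiv n c0 c" and pm: "\<And>y. y \<in> Sn n \<Longrightarrow> v y \<noteq> 0 \<Longrightarrow> parmatch n c0 c y"
  shows "\<exists>u\<in>biequiv (p * n) c0p (c \<circ> blk p). \<forall>g\<in>Sn n. u (lift p g) = v g"
proof -
  let ?H = "Hs (p * n) c0p" and ?K = "Hs (p * n) (c \<circ> blk p)"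
  let ?X = "chi (p * n) c0p :: _ \<Rightarrow> 'a" and ?Y = "chi (p * n) (c \<circ> blk p) :: _ \<Rightarrow> 'a"
  define R where "R x e \<longleftrightarrow> (\<exists>h\<in>?H. \<exists>g\<in>Sn n. \<exists>k\<in>?K. x = h \<circ> lift p g \<circ> k \<and> e = ?X h * v g * ?Y k)" for x e
  have wd: "?X h * v g * ?Y k = ?X h' * v g' * ?Y k'"
    if h: "h \<in> ?H" and g: "g \<in> Sn n" and k: "k \<in> ?K" and h': "h' \<in> ?H" and g': "g' \<in> Sn n" and k': "k' \<in> ?K"
      and e: "h \<circ> lift p g \<circ> k = h' \<circ> lift p g' \<circ> k'" for h g k h' g' k'
  proof -
    define a where "a = iv h' \<circ> h"
    define b where "b = k \<circ> iv k'"
    have a: "a \<in> ?H" unfolding a_def by (intro Hs_comp Hs_iv h h')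
    have b: "b \<in> ?K" unfolding b_def by (intro Hs_comp Hs_iv k k')
    have ha: "h = h' \<circ> a" unfolding a_def by (simp only: Sn_cancel[OF Hs_Sn[OF h']])
    have kb: "k = b \<circ> k'" unfolding b_def by (simp only: o_assoc[symmetric] Sn_iv_comp[OF Hs_Sn[OF k']] comp_id)
    have "a \<circ> lift p g \<circ> b = iv h' \<circ> (h \<circ> lift p g \<circ> k) \<circ> iv k'" unfolding a_def b_def by (simp only: o_assoc)
    also have "\<dots> = iv h' \<circ> (h' \<circ> (lift p g' \<circ> (k' \<circ> iv k')))" unfolding e by (simp only: o_assoc)
    also have "\<dots> = lift p g'" by (simp only: Sn_cancel[OF Hs_Sn[OF h']] Sn_comp_iv[OF Hs_Sn[OF k']] comp_id)
    finally have ab: "a \<circ> lift p g \<circ> b = lift p g'" .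
    from lifted_double_coset[OF g g' a b ab] obtain r s where rs: "r \<in> Hs n c0" "s \<in> Hs n c" "g' = r \<circ> g \<circ> s" by blast
    have vg': "v g' = chi n c0 r * v g * chi n c s" unfolding rs(3) by (rule biequivD[OF v rs(1) g rs(2)])
    show ?thesis
    proof (cases "v g = 0")
      case True then show ?thesis by (simp add: vg')
    next
      case False
      have lr: "lift p r \<in> ?H" and ls: "lift p s \<in> ?K" using lift_Hs[OF p0 rs(1)] lift_Hs[OF p0 rs(2)] by auto
      \<comment> \<open>Dividing by the lifts of \<open>r\<close> and \<open>s\<close> leaves a pair
        that stabilizes \<open>lift p g\<close>, to which \<open>lifted_stabilizer_sign\<close>
        applies.\<close>
      define a' where "a' = iv (lift p r) \<circ> a"
      define b' where "b' = b \<circ> iv (lift p s)"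
      have a': "a' \<in> ?H" unfolding a'_def by (intro Hs_comp Hs_iv a lr)
      have b': "b' \<in> ?K" unfolding b'_def by (intro Hs_comp Hs_iv b ls)
      have lg': "lift p g' = lift p r \<circ> lift p g \<circ> lift p s"
        unfolding rs(3) lift_comp[OF p0 Hs_Sn[OF rs(2)]] lift_comp[OF p0 g] ..
      have "a' \<circ> lift p g \<circ> b' = iv (lift p r) \<circ> (a \<circ> lift p g \<circ> b) \<circ> iv (lift p s)" unfolding a'_def b'_def by (simp only: o_assoc)
      also have "\<dots> = iv (lift p r) \<circ> (lift p r \<circ> (lift p g \<circ> (lift p s \<circ> iv (lift p s))))" unfolding ab lg' by (simp only: o_assoc)
      also have "\<dots> = lift p g" by (simp only: Sn_cancel[OF Hs_Sn[OF lr]] Sn_comp_iv[OF Hs_Sn[OF ls]] comp_id)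
      finally have one: "?X a' * ?Y b' = 1"
        by (rule lifted_stabilizer_sign[OF g pm[OF g False] a' b'])
      have aa: "a = lift p r \<circ> a'" unfolding a'_def by (simp only: Sn_cancel[OF Hs_Sn[OF lr]])
      have bb: "b = b' \<circ> lift p s" unfolding b'_def by (simp only: o_assoc[symmetric] Sn_iv_comp[OF Hs_Sn[OF ls]] comp_id)
      have Xa: "?X a = chi n c0 r * ?X a'" unfolding aa chi_comp[OF lr a'] chi_lift[OF p0 odd_p rs(1)] ..
      have Yb: "?Y b = ?Y b' * chi n c s" unfolding bb chi_comp[OF b' ls] chi_lift[OF p0 odd_p rs(2)] ..
      have "?X h * v g * ?Y k = ?X h' * ?X a * v g * (?Y b * ?Y k')" unfolding ha kb chi_comp[OF h' a] chi_comp[OF b k'] ..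
      also have "\<dots> = (?X a' * ?Y b') * (?X h' * (chi n c0 r * v g * chi n c s) * ?Y k')" unfolding Xa Yb by (simp only: ac_simps)
      also have "\<dots> = ?X h' * v g' * ?Y k'" unfolding one vg' by (simp only: mult_1)
      finally show ?thesis .
    qed
  qed
  have Runiq: "e = e'" if "R x e" "R x e'" for x e e' using that wd unfolding R_def by metis
  define u where "u x = (if \<exists>e. R x e then (THE e. R x e) else 0)" for x
  have uR: "u x = e" if "R x e" for x e using that Runiq unfolding u_def by (metis (mono_tags, lifting) theI)
  have "u \<in> biequiv (p * n) c0p (c \<circ> blk p)"
    unfolding biequiv_def
  proof (intro CollectI ballI)
    fix a x b assume a: "a \<in> ?H" and x: "x \<in> Sn (p * n)" and b: "b \<in> ?K"
    have step: "R (a \<circ> x \<circ> b) (?X a * e * ?Y b)" if "R x e" and a: "a \<in> ?H" and b: "b \<in> ?K" for a x b e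
    proof -
      from \<open>R x e\<close> obtain h g k where t: "h \<in> ?H" "g \<in> Sn n" "k \<in> ?K" "x = h \<circ> lift p g \<circ> k" "e = ?X h * v g * ?Y k" unfolding R_def by blast
      have "a \<circ> x \<circ> b = (a \<circ> h) \<circ> lift p g \<circ> (k \<circ> b)" unfolding t by (simp only: o_assoc)
      moreover have "?X a * e * ?Y b = ?X (a \<circ> h) * v g * ?Y (k \<circ> b)"
        unfolding chi_comp[OF a t(1)] chi_comp[OF t(3) b] t(5) by (simp only: ac_simps)
      ultimately show ?thesis unfolding R_def using Hs_comp[OF a t(1)] Hs_comp[OF t(3) b] t(2) by blast
    qed
    show "u (a \<circ> x \<circ> b) = ?X a * u x * ?Y b"
    proof (cases "\<exists>e. R x e")
      case True
      then obtain e where e: "R x e" by blast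
      show ?thesis using uR[OF step[OF e a b]] uR[OF e] by simp
    next
      case False
      have "\<not> (\<exists>e. R (a \<circ> x \<circ> b) e)"
      proof
        assume "\<exists>e. R (a \<circ> x \<circ> b) e"
        then obtain e where "R (a \<circ> x \<circ> b) e" by blast
        from step[OF this Hs_iv[OF a] Hs_iv[OF b]] have "\<exists>e. R (iv a \<circ> (a \<circ> x \<circ> b) \<circ> iv b) e" by blast
        moreover have "iv a \<circ> (a \<circ> x \<circ> b) \<circ> iv b = iv a \<circ> (a \<circ> (x \<circ> (b \<circ> iv b)))" by (simp only: o_assoc)
        moreover have "\<dots> = x" by (simp only: Sn_cancel[OF Hs_Sn[OF a]] Sn_comp_iv[OF Hs_Sn[OF b]] comp_id)
        ultimately show False using False by simp
      qed
      then show ?thesis using False by (simp add: u_def)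
    qed
  qed
  moreover have "u (lift p g) = v g" if g: "g \<in> Sn n" for g
  proof (rule uR)
    show "R (lift p g) (v g)" unfolding R_def
      using Hs_id[of "p * n" c0p] Hs_id[of "p * n" "c \<circ> blk p"] g
      by (intro bexI[of _ id] bexI[of _ g]) (auto simp: chi_id)
  qed
  ultimately show ?thesis by blast
qed

text \<open>Column permutations do not change the parity of a row, so a column sum is kept or
  discarded as a whole; at the fixed words where it is discarded, \<open>v\<close> vanishes by
  \<open>H\<close>.\<close>

lemma form_parmatch:
  fixes v v' :: "(nat \<Rightarrow> nat) \<Rightarrow> 'a::field"
  assumes ch: "CHAR('a) = p" and v': "v' \<in> biequiv n c0 c" and v: "v \<in> biequiv n c0 c"
    and H: "\<And>y. y \<in> Sn n \<Longrightarrow> v y \<noteq> 0 \<Longrightarrow> c \<circ> iv y \<circ> iv z = c \<circ> iv y \<Longrightarrow> parmatch n c0 c y"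
  shows "form c (\<lambda>y. if parmatch n c0 c y then v' y else 0) (\<lambda>y. if parmatch n c0 c y then v y else 0) = form c v' v"
  unfolding form_fixed[OF ch biequiv_parmatch[OF v'] biequiv_parmatch[OF v]] form_fixed[OF ch v' v]
proof (intro sum.cong refl)
  fix w assume "w \<in> {w \<in> words n c. w \<circ> iv z = w}"
  then have w: "w \<in> words n c" "w \<circ> iv z = w" by auto
  define y where "y = wrep n c w"
  have y: "y \<in> Sn n" "c \<circ> iv y = w" using wrep[OF w(1)] by (auto simp: y_def)
  have "(\<Sum>\<pi>\<in>Col. eps \<pi> * (if parmatch n c0 c (iv \<pi> \<circ> y) then v' (iv \<pi> \<circ> y) else 0)) * (if parmatch n c0 c y then v y else 0)
    = (\<Sum>\<pi>\<in>Col. eps \<pi> * v' (iv \<pi> \<circ> y)) * v y"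
  proof (cases "parmatch n c0 c y")
    case True
    have "parmatch n c0 c (iv \<pi> \<circ> y)" if "\<pi> \<in> Col" for \<pi>
    proof (rule parmatch_left_imp[OF Hs_Sn[OF that] _ y(1) True])
      fix i assume i: "i \<in> {1..n}"
      show "fst (c0 (\<pi> i)) = fst (c0 i)"
        using col_parity[of "\<pi> i" i] Sn_in[OF Hs_Sn[OF that], of i] i Hs_eq[OF that, of i] by simp
    qed
    then show ?thesis using True by simp
  next
    case False
    then have "v y = 0" using H[OF y(1)] y(2) w(2) by auto
    then show ?thesis by simp
  qed
  then show "(\<Sum>\<pi>\<in>Col. eps \<pi> * (if parmatch n c0 c (iv \<pi> \<circ> wrep n c w) then v' (iv \<pi> \<circ> wrep n c w) else 0)) *
      (if parmatch n c0 c (wrep n c w) then v (wrep n c w) else 0) =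
    (\<Sum>\<pi>\<in>Col. eps \<pi> * v' (iv \<pi> \<circ> wrep n c w)) * v (wrep n c w)" unfolding y_def .
qed

text \<open>Restriction to the diagonal copy preserves the form, so the rank above is at most the
  rank below. This is the source of the inequality.\<close>

lemma form_system_lower:
  assumes ch: "CHAR('a::field) = p"
    and s: "tableau.form_system (p * n) c0p colp (c \<circ> blk p) r v' (v :: nat \<Rightarrow> (nat \<Rightarrow> nat) \<Rightarrow> 'a)"
  shows "form_system c r (\<lambda>i g. v' i (lift p g)) (\<lambda>i g. v i (lift p g))"
proof -
  interpret up: tableau "p * n" p 1 c0p colp "rot p n" by (rule lifted_tableau)
  have h: "v' i \<in> biequiv (p * n) c0p (c \<circ> blk p)" "v i \<in> biequiv (p * n) c0p (c \<circ> blk p)" if "i < r" for i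
    using s that by (auto simp: up.form_system_def)
  show ?thesis using s biequiv_lift[OF p0 odd_p h(1)] biequiv_lift[OF p0 odd_p h(2)] form_lift[OF ch h(1) h(2)]
    by (auto simp: form_system_def up.form_system_def)
qed

text \<open>Truncating kernels to matching parities keeps the form by \<open>form_parmatch\<close>,
  and truncated kernels extend by \<open>lift_function\<close>.\<close>

lemma form_system_raise:
  assumes ch: "CHAR('a::field) = p" and s: "form_system c r v' (v :: nat \<Rightarrow> (nat \<Rightarrow> nat) \<Rightarrow> 'a)"
    and H: "\<And>u y. (u :: (nat \<Rightarrow> nat) \<Rightarrow> 'a) \<in> biequiv n c0 c \<Longrightarrow> y \<in> Sn n \<Longrightarrow> u y \<noteq> 0 \<Longrightarrow>
      c \<circ> iv y \<circ> iv z = c \<circ> iv y \<Longrightarrow> parmatch n c0 c y"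
  shows "\<exists>w' w :: nat \<Rightarrow> (nat \<Rightarrow> nat) \<Rightarrow> 'a. tableau.form_system (p * n) c0p colp (c \<circ> blk p) r w' w"
proof -
  interpret up: tableau "p * n" p 1 c0p colp "rot p n" by (rule lifted_tableau)
  have h: "v' i \<in> biequiv n c0 c" "v i \<in> biequiv n c0 c" if "i < r" for i
    using s that by (auto simp: form_system_def)
  let ?m = "\<lambda>u y. if parmatch n c0 c y then u y else (0::'a)"
  have L: "\<exists>w\<in>biequiv (p * n) c0p (c \<circ> blk p). \<forall>g\<in>Sn n. w (lift p g) = ?m u g" if "u \<in> biequiv n c0 c" for u
    by (rule lift_function[OF biequiv_parmatch[OF that]]) (auto split: if_splits)
  have "\<forall>i\<in>{..<r}. \<exists>w. w \<in> biequiv (p * n) c0p (c \<circ> blk p) \<and> (\<forall>g\<in>Sn n. w (lift p g) = ?m (v i) g)" using L[OF h(2)] by blast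
  from bchoice[OF this] obtain w where w: "\<forall>i\<in>{..<r}. w i \<in> biequiv (p * n) c0p (c \<circ> blk p) \<and> (\<forall>g\<in>Sn n. w i (lift p g) = ?m (v i) g)" by blast
  have "\<forall>i\<in>{..<r}. \<exists>w. w \<in> biequiv (p * n) c0p (c \<circ> blk p) \<and> (\<forall>g\<in>Sn n. w (lift p g) = ?m (v' i) g)" using L[OF h(1)] by blast
  from bchoice[OF this] obtain w' where w': "\<forall>i\<in>{..<r}. w' i \<in> biequiv (p * n) c0p (c \<circ> blk p) \<and> (\<forall>g\<in>Sn n. w' i (lift p g) = ?m (v' i) g)" by blast
  have "up.form (c \<circ> blk p) (w' i) (w j) = form c (v' i) (v j)" if ij: "i < r" "j < r" for i j
  proof -
    have "up.form (c \<circ> blk p) (w' i) (w j) = form c (\<lambda>g. w' i (lift p g)) (\<lambda>g. w j (lift p g))"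
      using w w' ij by (intro form_lift[OF ch]) auto
    also have "\<dots> = form c (?m (v' i)) (?m (v j))" using w w' ij by (intro form_cong) auto
    also have "\<dots> = form c (v' i) (v j)" by (rule form_parmatch[OF ch h(1)[OF ij(1)] h(2)[OF ij(2)]]) (rule H[OF h(2)[OF ij(2)]])
    finally show ?thesis .
  qed
  then have "up.form_system (c \<circ> blk p) r w' w" using s w w' by (auto simp: form_system_def up.form_system_def)
  then show ?thesis by blast
qed

theorem ks_mult_lift:
  fixes Y1 Y2 :: "'a::field rep"
  assumes ch: "CHAR('a) = p"
    and Y1: "indecomposable n Y1" "is_summand n Y1 (Ind n c0)" "\<And>c. \<not> dominated n c c0 \<Longrightarrow> \<not> is_summand n Y1 (Ind n c)"
    and Y2: "indecomposable (p * n) Y2" "is_summand (p * n) Y2 (Ind (p * n) c0p)"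
      "\<And>c. \<not> dominated (p * n) c c0p \<Longrightarrow> \<not> is_summand (p * n) Y2 (Ind (p * n) c)"
  shows "ks_mult (p * n) (Ind (p * n) (c \<circ> blk p)) Y2 \<le> ks_mult n (Ind n c) Y1"
    and "(\<And>u y. (u :: (nat \<Rightarrow> nat) \<Rightarrow> 'a) \<in> biequiv n c0 c \<Longrightarrow> y \<in> Sn n \<Longrightarrow> u y \<noteq> 0 \<Longrightarrow>
      c \<circ> iv y \<circ> iv z = c \<circ> iv y \<Longrightarrow> parmatch n c0 c y) \<Longrightarrow>
      ks_mult (p * n) (Ind (p * n) (c \<circ> blk p)) Y2 = ks_mult n (Ind n c) Y1"
proof -
  interpret up: tableau "p * n" p 1 c0p colp "rot p n" by (rule lifted_tableau)
  have k1: "r \<le> ks_mult n (Ind n c) Y1 \<longleftrightarrow> (\<exists>v' v :: nat \<Rightarrow> (nat \<Rightarrow> nat) \<Rightarrow> 'a. form_system c r v' v)" for r c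
    by (rule le_ks_mult_form[OF ch Y1(1,2)]) (rule Y1(3))
  have k2: "r \<le> ks_mult (p * n) (Ind (p * n) c) Y2 \<longleftrightarrow> (\<exists>v' v :: nat \<Rightarrow> (nat \<Rightarrow> nat) \<Rightarrow> 'a. up.form_system c r v' v)" for r c
    by (rule up.le_ks_mult_form[OF ch Y2(1,2)]) (rule Y2(3))
  let ?k1 = "ks_mult n (Ind n c) Y1" and ?k2 = "ks_mult (p * n) (Ind (p * n) (c \<circ> blk p)) Y2"
  show le: "?k2 \<le> ?k1"
  proof -
    obtain v' v :: "nat \<Rightarrow> (nat \<Rightarrow> nat) \<Rightarrow> 'a" where "up.form_system (c \<circ> blk p) ?k2 v' v"
      using k2[of ?k2 "c \<circ> blk p"] by blast
    then show ?thesis unfolding k1 using form_system_lower[OF ch] by blast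
  qed
  show "?k2 = ?k1" if H: "\<And>u y. (u :: (nat \<Rightarrow> nat) \<Rightarrow> 'a) \<in> biequiv n c0 c \<Longrightarrow> y \<in> Sn n \<Longrightarrow> u y \<noteq> 0 \<Longrightarrow>
      c \<circ> iv y \<circ> iv z = c \<circ> iv y \<Longrightarrow> parmatch n c0 c y"
  proof (rule antisym[OF le])
    obtain v' v :: "nat \<Rightarrow> (nat \<Rightarrow> nat) \<Rightarrow> 'a" where s: "form_system c ?k1 v' v" using k1[of ?k1 c] by blast
    show "?k1 \<le> ?k2" unfolding k2 by (rule form_system_raise[OF ch s]) (rule H)
  qed
qed

end

section \<open>Labellings of pairs of compositions\<close>

definition psum :: "nat list \<Rightarrow> nat \<Rightarrow> nat" where "psum xs k = sum_list (take k xs)"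

lemma psum_0: "psum xs 0 = 0" by (simp add: psum_def)
lemma psum_Suc: "psum xs (Suc k) = psum xs k + nth0 xs k"
  by (auto simp: psum_def nth0_def take_Suc_conv_app_nth)
lemma psum_mono: "k \<le> l \<Longrightarrow> psum xs k \<le> psum xs l"
  by (rule lift_Suc_mono_le[of "psum xs"]) (auto simp: psum_Suc)
lemma psum_all: "length xs \<le> k \<Longrightarrow> psum xs k = sum_list xs" by (simp add: psum_def)
lemma psum_le: "psum xs k \<le> sum_list xs"
  using psum_mono[of k "max k (length xs)" xs] psum_all[of xs "max k (length xs)"] by simp

text \<open>Locates the block of a point from the partial sums; the strict inequality on the left
  skips blocks of length zero.\<close>

lemma Least_step_iff:
  fixes f :: "nat \<Rightarrow> nat"
  assumes m: "\<And>k l. k \<le> l \<Longrightarrow> f k \<le> f l" and "f 0 < i" and ex: "i \<le> f (Suc K)"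
  shows "(LEAST k. i \<le> f (Suc k)) = k \<longleftrightarrow> f k < i \<and> i \<le> f (Suc k)"
    and "(LEAST k. i \<le> f (Suc k)) \<le> k \<longleftrightarrow> i \<le> f (Suc k)"
proof -
  let ?L = "LEAST k. i \<le> f (Suc k)"
  have L: "i \<le> f (Suc ?L)" using ex by (rule LeastI)
  have le: "?L \<le> k" if "i \<le> f (Suc k)" for k using that by (rule Least_le)
  show "?L \<le> k \<longleftrightarrow> i \<le> f (Suc k)" using L le m[of "Suc ?L" "Suc k"] by (meson Suc_le_mono order.trans)
  have "f ?L < i"
  proof (cases ?L)
    case 0 then show ?thesis using assms(2) by simp
  next
    case (Suc l) then show ?thesis using le[of l] by (metis Suc_n_not_le_n not_le)
  qed
  moreover have "?L = k" if "f k < i" "i \<le> f (Suc k)" for k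
  proof (rule antisym)
    show "?L \<le> k" by (rule le[OF that(2)])
    show "k \<le> ?L"
    proof (rule ccontr)
      assume "\<not> k \<le> ?L"
      then have "f (Suc ?L) \<le> f k" by (intro m) simp
      then show False using L that(1) by simp
    qed
  qed
  ultimately show "?L = k \<longleftrightarrow> f k < i \<and> i \<le> f (Suc k)" using L by blast
qed

definition lab :: "nat list \<Rightarrow> nat list \<Rightarrow> labelling" where
  "lab a b i = (if i \<le> sum_list a then (False, LEAST k. i \<le> psum a (Suc k))
     else (True, LEAST k. i \<le> sum_list a + psum b (Suc k)))"

context
  fixes a b :: "nat list" and n :: nat assumes n: "sum_list a + sum_list b = n"
begin

lemma lab_False_iff:
  assumes i: "i \<in> {1..n}"
  shows "lab a b i = (False, k) \<longleftrightarrow> psum a k < i \<and> i \<le> psum a (Suc k)"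
proof (cases "i \<le> sum_list a")
  case True
  have "0 < i" "i \<le> psum a (Suc (length a))" using i True by (auto simp: psum_all)
  from Least_step_iff(1)[of "psum a" i "length a" k] this show ?thesis using True psum_mono[of _ _ a]
    by (simp add: lab_def psum_0)
next
  case False
  then show ?thesis using psum_le[of a "Suc k"] by (auto simp: lab_def)
qed

lemma lab_True_iff:
  assumes i: "i \<in> {1..n}"
  shows "lab a b i = (True, k) \<longleftrightarrow> sum_list a + psum b k < i \<and> i \<le> sum_list a + psum b (Suc k)"
proof (cases "i \<le> sum_list a")
  case False
  have "i \<le> sum_list a + psum b (Suc (length b))" using i n by (auto simp: psum_all)
  from Least_step_iff(1)[of "\<lambda>k. sum_list a + psum b k" i "length b" k] this show ?thesis using False psum_mono[of _ _ b]
    by (simp add: lab_def psum_0)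
next
  case True
  then show ?thesis by (auto simp: lab_def)
qed

lemma fst_lab: "fst (lab a b i) \<longleftrightarrow> sum_list a < i" by (auto simp: lab_def)

lemma card_lab: "card {i\<in>{1..n}. lab a b i = (q, k)} = nth0 (if q then b else a) k"
proof (cases q)
  case False
  have "{i\<in>{1..n}. lab a b i = (q, k)} = {psum a k<..psum a (Suc k)}"
    using lab_False_iff[of _ k] False psum_le[of a "Suc k"] n by auto
  then show ?thesis using False by (simp add: psum_Suc)
next
  case True
  have "{i\<in>{1..n}. lab a b i = (q, k)} = {sum_list a + psum b k<..sum_list a + psum b (Suc k)}"
    using lab_True_iff[of _ k] True psum_le[of b "Suc k"] n by auto
  then show ?thesis using True by (simp add: psum_Suc)
qed

lemma ncount_lab: "ncount n (lab a b) (q, k) = (if q then sum_list a + psum b (Suc k) else psum a (Suc k))"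
proof (cases q)
  case False
  have "{i\<in>{1..n}. lab a b i \<le> (q, k)} = {0<..psum a (Suc k)}"
  proof (intro Set.set_eqI iffI)
    fix i assume "i \<in> {i\<in>{1..n}. lab a b i \<le> (q, k)}"
    then have i: "i \<in> {1..n}" "lab a b i \<le> (q, k)" by auto
    then have s: "i \<le> sum_list a" using False fst_lab[of i] by (auto simp: less_eq_prod_def)
    then have "(LEAST k. i \<le> psum a (Suc k)) \<le> k" using i False by (simp add: lab_def less_eq_prod_def)
    then show "i \<in> {0<..psum a (Suc k)}"
      using Least_step_iff(2)[of "psum a" i "length a" k] i s psum_mono[of _ _ a] by (simp add: psum_0 psum_all)
  next
    fix i assume i: "i \<in> {0<..psum a (Suc k)}"
    then have s: "i \<le> sum_list a" using psum_le[of a "Suc k"] by simp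
    then have "(LEAST k. i \<le> psum a (Suc k)) \<le> k"
      using Least_step_iff(2)[of "psum a" i "length a" k] i psum_mono[of _ _ a] by (simp add: psum_0 psum_all)
    then show "i \<in> {i\<in>{1..n}. lab a b i \<le> (q, k)}" using i s n False by (simp add: lab_def less_eq_prod_def)
  qed
  then show ?thesis using False by (simp add: ncount_def)
next
  case True
  have "{i\<in>{1..n}. lab a b i \<le> (q, k)} = {0<..sum_list a + psum b (Suc k)}"
  proof (intro Set.set_eqI)
    fix i
    show "i \<in> {i\<in>{1..n}. lab a b i \<le> (q, k)} \<longleftrightarrow> i \<in> {0<..sum_list a + psum b (Suc k)}"
    proof (cases "i \<le> sum_list a")
      case F: True then show ?thesis using True n by (auto simp: lab_def less_eq_prod_def)
    next
      case F: False
      show ?thesis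
      proof (cases "i \<le> n")
        case i: True
        then have "(LEAST k. i \<le> sum_list a + psum b (Suc k)) \<le> k \<longleftrightarrow> i \<le> sum_list a + psum b (Suc k)"
          using Least_step_iff(2)[of "\<lambda>k. sum_list a + psum b k" i "length b" k] F psum_mono[of _ _ b] n by (simp add: psum_0 psum_all)
        then show ?thesis using F i True by (auto simp: lab_def less_eq_prod_def)
      next
        case i: False then show ?thesis using n psum_le[of b "Suc k"] by auto
      qed
    qed
  qed
  then show ?thesis using True by (simp add: ncount_def)
qed

text \<open>\<open>young_sub\<close> mentions only the blocks of the listed parts. They cover
  \<open>{1..n}\<close>, so preserving each of them is the same as preserving all labels.\<close>

lemma young_sub_Hs: "young_sub a b = Hs n (lab a b)"
proof -
  have ba: "block 0 a k = {i\<in>{1..n}. lab a b i = (False, k)}" for k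
    using lab_False_iff[of _ k] psum_le[of a "Suc k"] n by (auto simp: block_def psum_def[symmetric] simp del: take_Suc)
  have bb: "block (sum_list a) b k = {i\<in>{1..n}. lab a b i = (True, k)}" for k
    using lab_True_iff[of _ k] psum_le[of b "Suc k"] n by (auto simp: block_def psum_def[symmetric])
  have fib: "g ` {i\<in>{1..n}. lab a b i = l} = {i\<in>{1..n}. lab a b i = l}" if g: "g \<in> Hs n (lab a b)" for g l
  proof
    show "g ` {i\<in>{1..n}. lab a b i = l} \<subseteq> {i\<in>{1..n}. lab a b i = l}"
      using Sn_in[OF Hs_Sn[OF g]] Hs_eq[OF g] by auto
    show "{i\<in>{1..n}. lab a b i = l} \<subseteq> g ` {i\<in>{1..n}. lab a b i = l}"
    proof
      fix i assume i: "i \<in> {i\<in>{1..n}. lab a b i = l}"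
      then have "iv g i \<in> {i\<in>{1..n}. lab a b i = l}"
        using Sn_in[OF Sn_iv[OF Hs_Sn[OF g]], of i] Hs_eq[OF Hs_iv[OF g], of i] by simp
      then show "i \<in> g ` {i\<in>{1..n}. lab a b i = l}" using Sn_iv_app(2)[OF Hs_Sn[OF g], of i] by (metis (no_types, lifting) imageI)
    qed
  qed
  have conv: "g \<in> Hs n (lab a b)" if g: "g \<in> Sn n" and ga: "\<forall>k<length a. g ` block 0 a k = block 0 a k"
    and gb: "\<forall>k<length b. g ` block (sum_list a) b k = block (sum_list a) b k" for g
  proof -
    have "lab a b (g i) = lab a b i" for i
    proof (cases "i \<in> {1..n}")
      case True
      obtain q k where l: "lab a b i = (q, k)" by force
      show ?thesis
      proof (cases q)
        case False
        then have "psum a k < psum a (Suc k)" using lab_False_iff[OF True, of k] l by auto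
        then have "k < length a" by (auto simp: psum_Suc nth0_def split: if_splits)
        then have e: "g ` block 0 a k = block 0 a k" using ga by blast
        have "i \<in> block 0 a k" using True l False unfolding ba by simp
        then have "g i \<in> g ` block 0 a k" by (rule imageI)
        then have "g i \<in> block 0 a k" unfolding e .
        then show ?thesis using l False unfolding ba by simp
      next
        case T: True
        then have "psum b k < psum b (Suc k)" using lab_True_iff[OF True, of k] l by auto
        then have "k < length b" by (auto simp: psum_Suc nth0_def split: if_splits)
        then have e: "g ` block (sum_list a) b k = block (sum_list a) b k" using gb by blast
        have "i \<in> block (sum_list a) b k" using True l T unfolding bb by simp
        then have "g i \<in> g ` block (sum_list a) b k" by (rule imageI)
        then have "g i \<in> block (sum_list a) b k" unfolding e .
        then show ?thesis using l T unfolding bb by simp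
      qed
    next
      case False then show ?thesis using Sn_outside[OF g] by simp
    qed
    then show ?thesis using g by (auto simp: Hs_def fun_eq_iff)
  qed
  show ?thesis
  proof (intro Set.set_eqI iffI)
    fix g assume "g \<in> young_sub a b"
    then show "g \<in> Hs n (lab a b)" using conv n unfolding young_sub_def by blast
  next
    fix g assume g: "g \<in> Hs n (lab a b)"
    then show "g \<in> young_sub a b" using fib[OF g] Hs_Sn[OF g] n unfolding young_sub_def ba bb by simp
  qed
qed

lemma sgn_part_chi: "sgn_part a b = (chi n (lab a b) :: _ \<Rightarrow> 'a::field)"
proof -
  have "oddp n (lab a b) = {sum_list a + 1..sum_list a + sum_list b}" using n by (auto simp: oddp_def fst_lab)
  then show ?thesis by (auto simp: sgn_part_def chi_def rsgn_def res_def fun_eq_iff)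
qed

lemma Mmod_Ind: "Mmod a b = (Ind n (lab a b) :: 'a::field rep)"
  unfolding Mmod_def Ind_def by (simp only: n young_sub_Hs sgn_part_chi)

end

text \<open>Since \<open>blk p j \<le> m\<close> holds exactly when \<open>j \<le> p * m\<close>,
  the inequalities defining the two labels are equivalent at every argument, also outside the range
  of points.\<close>

lemma lab_scale: "p > 0 \<Longrightarrow> lab (scale p a) (scale p b) = lab a b \<circ> blk p"
proof -
  assume p: "p > 0"
  have s: "sum_list (scale p xs) = p * sum_list xs" "psum (scale p xs) k = p * psum xs k" for xs k
    by (simp_all add: scale_def psum_def sum_list_const_mult take_map)
  show ?thesis by (auto simp: fun_eq_iff lab_def s blk_le_iff[OF p] add_mult_distrib2[symmetric])
qed

lemma sum_list_scale: "sum_list (scale p xs) = p * sum_list xs"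
  by (simp add: scale_def sum_list_const_mult)

text \<open>The letter \<open>(q, k)\<close> corresponds to a partial sum of length
  \<open>k + 1\<close>, which is why \<open>dominates\<close> starts at 1.\<close>

lemma dominates_iff:
  assumes "sum_list a + sum_list b = n" "sum_list l + sum_list v = n"
  shows "dominates (l, v) (a, b) \<longleftrightarrow> dominated n (lab a b) (lab l v)"
proof
  assume d: "dominates (l, v) (a, b)"
  have "ncount n (lab a b) (q, k) \<le> ncount n (lab l v) (q, k)" for q k
    using d[unfolded dominates_def] unfolding ncount_lab[OF assms(1)] ncount_lab[OF assms(2)] psum_def by simp
  then show "dominated n (lab a b) (lab l v)" unfolding dominated_def by (metis surj_pair)
next
  assume d: "dominated n (lab a b) (lab l v)"
  show "dominates (l, v) (a, b)" unfolding dominates_def prod.case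
  proof (intro allI impI)
    fix k :: nat assume "k \<ge> 1"
    then obtain k' where k: "k = Suc k'" by (cases k) auto
    show "sum_list (take k a) \<le> sum_list (take k l) \<and> sum_list a + sum_list (take k b) \<le> sum_list l + sum_list (take k v)"
      using d[unfolded dominated_def, rule_format, of "(False, k')"] d[unfolded dominated_def, rule_format, of "(True, k')"]
      unfolding ncount_lab[OF assms(1)] ncount_lab[OF assms(2)] psum_def k by simp
  qed
qed

section \<open>Sorting a labelling into a pair of partitions\<close>

text \<open>Induction on the list: an index set that omits the head loses nothing by trading one of
  its entries for the head.\<close>

lemma sum_le_take_sorted:
  fixes xs :: "nat list"
  shows "sorted_wrt (\<ge>) xs \<Longrightarrow> I \<subseteq> {..<length xs} \<Longrightarrow> card I \<le> K \<Longrightarrow> (\<Sum>i\<in>I. xs ! i) \<le> sum_list (take K xs)"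
proof (induction xs arbitrary: I K)
  case Nil then show ?case by simp
next
  case (Cons x xs)
  have fin: "finite I" using Cons.prems(2) finite_subset by blast
  show ?case
  proof (cases K)
    case 0 then show ?thesis using Cons.prems(3) fin by simp
  next
    case (Suc K')
    define I' where "I' = {i. Suc i \<in> I}"
    have I'sub: "I' \<subseteq> {..<length xs}" using Cons.prems(2) by (auto simp: I'_def)
    have fI': "finite I'" using I'sub finite_subset by blast
    have eq: "I - {0} = Suc ` I'"
    proof (intro equalityI subsetI)
      fix i assume "i \<in> I - {0}" then show "i \<in> Suc ` I'" by (cases i) (auto simp: I'_def)
    qed (auto simp: I'_def)
    have s: "(\<Sum>i\<in>I - {0}. (x # xs) ! i) = (\<Sum>i\<in>I'. xs ! i)" unfolding eq by (subst sum.reindex) auto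
    have cI: "card (I - {0}) = card I'" unfolding eq by (rule card_image) simp
    show ?thesis
    proof (cases "0 \<in> I")
      case True
      then have "card I' \<le> K'" using Cons.prems(3) Suc cI fin by simp
      then have "(\<Sum>i\<in>I'. xs ! i) \<le> sum_list (take K' xs)" using Cons.IH[OF _ I'sub] Cons.prems(1) by simp
      then show ?thesis using s sum.remove[OF fin True, of "\<lambda>i. (x # xs) ! i"] Suc by simp
    next
      case False
      then have e: "I - {0} = I" by simp
      show ?thesis
      proof (cases "I' = {}")
        case True then show ?thesis using s e by simp
      next
        case F: False
        then obtain i where i: "i \<in> I'" by blast
        have "card (I' - {i}) \<le> K'" using cI e Cons.prems(3) Suc i fI' by simp
        then have "(\<Sum>i\<in>I' - {i}. xs ! i) \<le> sum_list (take K' xs)"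
          using Cons.IH[of "I' - {i}" K'] I'sub Cons.prems(1) by auto
        moreover have "xs ! i \<le> x" using Cons.prems(1) i I'sub by auto
        ultimately show ?thesis using s e sum.remove[OF fI' i, of "\<lambda>i. xs ! i"] Suc by simp
      qed
    qed
  qed
qed

lemma idf_conj:
  assumes f: "f \<in> Sn n" and \<rho>: "inj_on \<rho> (c ` {1..n})" "\<And>i. i \<in> {1..n} \<Longrightarrow> fst (\<rho> (c i)) = fst (c i)"
    and cf: "\<And>i. i \<in> {1..n} \<Longrightarrow> c' (f i) = \<rho> (c i)" and x: "x \<in> Sn n"
  shows "idf n c' (f \<circ> x \<circ> iv f) = (idf n c x :: 'a::field)"
proof -
  have mem: "f \<circ> x \<circ> iv f \<in> Hs n c' \<longleftrightarrow> x \<in> Hs n c"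
  proof
    assume h: "x \<in> Hs n c"
    have "c' ((f \<circ> x \<circ> iv f) i) = c' i" for i
    proof (cases "i \<in> {1..n}")
      case True
      then have "iv f i \<in> {1..n}" using Sn_in[OF Sn_iv[OF f]] by blast
      moreover then have "x (iv f i) \<in> {1..n}" using Sn_in[OF x] by blast
      ultimately have "c' (f (x (iv f i))) = c' (f (iv f i))" using cf Hs_eq[OF h, of "iv f i"] by simp
      then show ?thesis by (simp add: Sn_iv_app[OF f])
    next
      case False then show ?thesis using Sn_outside[of "f \<circ> x \<circ> iv f" n i] f x by (simp add: Sn_intros)
    qed
    then show "f \<circ> x \<circ> iv f \<in> Hs n c'" using f x by (auto simp: Hs_def Sn_intros fun_eq_iff)
  next
    assume h: "f \<circ> x \<circ> iv f \<in> Hs n c'"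
    have "c (x i) = c i" for i
    proof (cases "i \<in> {1..n}")
      case True
      then have xi: "x i \<in> {1..n}" using Sn_in[OF x] by blast
      have "c' (f (x i)) = c' (f i)" using Hs_eq[OF h, of "f i"] by (simp add: Sn_iv_app[OF f])
      then have "\<rho> (c (x i)) = \<rho> (c i)" using cf[OF True] cf[OF xi] by simp
      then show ?thesis using \<rho>(1) True xi by (meson imageI inj_onD)
    next
      case False then show ?thesis using Sn_outside[OF x] by simp
    qed
    then show "x \<in> Hs n c" using x by (auto simp: Hs_def fun_eq_iff)
  qed
  have "f ` oddp n c = oddp n c'"
  proof
    show "f ` oddp n c \<subseteq> oddp n c'" using Sn_in[OF f] cf \<rho>(2) by (auto simp: oddp_def)
    show "oddp n c' \<subseteq> f ` oddp n c"
    proof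
      fix i assume i: "i \<in> oddp n c'"
      then have "iv f i \<in> {1..n}" using Sn_in[OF Sn_iv[OF f], of i] by (auto simp: oddp_def)
      then have "iv f i \<in> oddp n c" using i cf[of "iv f i"] \<rho>(2)[of "iv f i"] by (simp add: oddp_def Sn_iv_app[OF f])
      then show "i \<in> f ` oddp n c" using Sn_iv_app(2)[OF f, of i] by (metis imageI)
    qed
  qed
  then have "chi n c' (f \<circ> x \<circ> iv f) = (chi n c x :: 'a)" if "x \<in> Hs n c"
    using rsgn_conj[OF f x Hs_oddp[OF that], where ?'a = 'a] by (simp add: chi_def)
  then show ?thesis using mem by (simp add: idf_def)
qed

text \<open>Conjugation by \<open>f\<close> matches the two Young subgroups together with their
  signs; the kernel sending \<open>x\<close> to \<open>idf n c' (f \<circ> x)\<close>, composed with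
  its flip, is the identity.\<close>

lemma relabel_summand:
  fixes Y :: "'a::field rep"
  assumes f: "f \<in> Sn n" and \<rho>: "inj_on \<rho> (c ` {1..n})" "\<And>i. i \<in> {1..n} \<Longrightarrow> fst (\<rho> (c i)) = fst (c i)"
    and cf: "\<And>i. i \<in> {1..n} \<Longrightarrow> c' (f i) = \<rho> (c i)"
  shows "is_summand n (Ind n c :: 'a rep) (Ind n c')"
proof -
  have conj: "idf n c' (f \<circ> x \<circ> iv f) = (idf n c x :: 'a)" if "x \<in> Sn n" for x
    by (rule idf_conj[OF f \<rho> cf that])
  define v where "v x = (idf n c' (f \<circ> x) :: 'a)" for x
  have Hs_conj: "f \<circ> h \<circ> iv f \<in> Hs n c' \<and> chi n c' (f \<circ> h \<circ> iv f) = (chi n c h :: 'a)" if h: "h \<in> Hs n c" for h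
  proof -
    have e: "idf n c' (f \<circ> h \<circ> iv f) = (chi n c h :: 'a)" using conj[OF Hs_Sn[OF h]] h by (simp add: idf_def)
    moreover have "chi n c h \<noteq> (0::'a)" using chi_square[of n c h, where ?'a = 'a] by auto
    ultimately show ?thesis by (auto simp: idf_def split: if_splits)
  qed
  have v: "v \<in> biequiv n c c'"
  proof (rule biequivI)
    fix h g assume h: "h \<in> Hs n c" and g: "g \<in> Sn n"
    have "f \<circ> (h \<circ> g) = (f \<circ> h \<circ> iv f) \<circ> (f \<circ> g)" using f by (simp add: o_assoc[symmetric] Sn_cancel)
    then show "v (h \<circ> g) = chi n c h * v g"
      using biequiv_left[OF idf_biequiv conjunct1[OF Hs_conj[OF h]] Sn_comp[OF f g], where ?'a = 'a] Hs_conj[OF h] by (simp add: v_def)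
  next
    fix g k assume g: "g \<in> Sn n" and k: "k \<in> Hs n c'"
    show "v (g \<circ> k) = v g * chi n c' k"
      using biequiv_right[OF idf_biequiv Sn_comp[OF f g] k, where ?'a = 'a] by (simp add: v_def o_assoc)
  qed
  have cv: "conv n c' (\<lambda>x. v (iv x)) v x = idf n c x" if x: "x \<in> Sn n" for x
  proof -
    let ?F = "\<lambda>y. v (iv (iv y \<circ> x)) * v y"
    have ri: "rinv n c' ?F" by (rule conv_rinv[OF v biequiv_flip[OF v] x])
    have W: "c' \<circ> f \<in> words n c'" unfolding words_def using Sn_iv[OF f] Sn_iv_iv[OF f] by (intro image_eqI[of _ _ "iv f"]) auto
    have z: "?F (wrep n c' w) = 0" if w: "w \<in> words n c'" "w \<noteq> c' \<circ> f" for w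
    proof (rule ccontr)
      assume "?F (wrep n c' w) \<noteq> 0"
      then have "f \<circ> wrep n c' w \<in> Hs n c'" by (auto simp: v_def idf_def split: if_splits)
      then have "c' \<circ> iv (iv f) = c' \<circ> iv (wrep n c' w)"
        using same_word_iff[OF Sn_iv[OF f] wrep(1)[OF w(1)], of c'] by (simp add: Sn_iv_iv[OF f])
      then show False using w wrep(2)[OF w(1)] by (simp add: Sn_iv_iv[OF f])
    qed
    have "conv n c' (\<lambda>x. v (iv x)) v x = (\<Sum>w\<in>words n c'. ?F (wrep n c' w))"
      unfolding conv_def by (rule csum_words[OF ri])
    also have "\<dots> = (\<Sum>w\<in>{c' \<circ> f}. ?F (wrep n c' w))"
      using W z by (intro sum.mono_neutral_right finite_words) auto
    also have "\<dots> = ?F (wrep n c' (c' \<circ> f))" by simp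
    also have "\<dots> = ?F (iv f)"
      by (rule rinv_word[OF ri wrep(1)[OF W] Sn_iv[OF f]]) (simp add: wrep(2)[OF W] Sn_iv_iv[OF f])
    also have "iv (iv (iv f) \<circ> x) = iv x \<circ> iv f" using f x by (simp add: Sn_iv_iv[of _ n] Sn_iv_distrib[of _ n])
    also have "v (iv x \<circ> iv f) * v (iv f) = idf n c (iv x)"
    proof -
      have "v (iv f) = 1" using Sn_comp_iv[OF f] by (simp add: v_def idf_def Hs_id chi_id)
      moreover have "v (iv x \<circ> iv f) = idf n c (iv x)" using conj[OF Sn_iv[OF x]] by (simp add: v_def o_assoc)
      ultimately show ?thesis by simp
    qed
    also have "\<dots> = idf n c x"
      using Hs_iv[of x n c] Hs_iv[of "iv x" n c] Sn_iv_iv[OF x] chi_iv[of x n c, where ?'a = 'a] by (auto simp: idf_def)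
    finally show ?thesis .
  qed
  have "hmat n c' c (\<lambda>x. v (iv x)) * hmat n c c' v = hmat n c c (idf n c)"
    unfolding hmat_mult[OF v biequiv_flip[OF v]] by (rule hmat_cong) (rule cv)
  then have "hmat n c' c (\<lambda>x. v (iv x)) * hmat n c c' v = 1\<^sub>m (fst (Ind n c :: 'a rep))"
    by (simp only: hmat_idf fst_Ind)
  then show ?thesis
    by (intro split_summand[OF is_rep_Ind is_rep_Ind hmat_rhom[OF v] hmat_rhom[OF biequiv_flip[OF v]]])
qed

text \<open>The property defining \<open>Y(\<lambda>|p\<mu>)\<close> speaks of pairs of partitions
  only, while straightening produces arbitrary labellings. Sorting the letter counts decreasingly,
  separately for each parity, keeps the module as a summand and can only enlarge partial
  sums.\<close>

lemma labelling_partition: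
  fixes c :: labelling
  shows "\<exists>a b. (a, b) \<in> P2 n \<and> is_summand n (Ind n c :: 'a::field rep) (Mmod a b) \<and>
    (\<forall>j. ncount n c j \<le> ncount n (lab a b) j)"
proof -
  define cnt where "cnt q k = card {i\<in>{1..n}. c i = (q, k)}" for q k
  define S where "S q = {k. cnt q k > 0}" for q
  have S_eq: "S q = snd ` {l \<in> c ` {1..n}. fst l = q}" for q
  proof (intro equalityI subsetI)
    fix k assume "k \<in> S q"
    then obtain i where "i \<in> {1..n}" "c i = (q, k)" unfolding S_def cnt_def
      by (metis (mono_tags, lifting) card_gt_0_iff empty_Collect_eq mem_Collect_eq)
    then show "k \<in> snd ` {l \<in> c ` {1..n}. fst l = q}" by force
  next
    fix k assume "k \<in> snd ` {l \<in> c ` {1..n}. fst l = q}"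
    then obtain i where "i \<in> {1..n}" "c i = (q, k)" by auto
    then show "k \<in> S q" unfolding S_def cnt_def by (auto simp: card_gt_0_iff)
  qed
  have finS: "finite (S q)" for q unfolding S_eq by simp
  define ks where "ks q = rev (sort_key (cnt q) (sorted_list_of_set (S q)))" for q
  have ks: "distinct (ks q)" "set (ks q) = S q" for q unfolding ks_def using finS[of q] by auto
  define x where "x q = map (cnt q) (ks q)" for q
  have xs: "sorted_wrt (\<ge>) (x q)" for q
  proof -
    have "sorted (map (cnt q) (sort_key (cnt q) (sorted_list_of_set (S q))))" by simp
    then show ?thesis unfolding x_def ks_def rev_map[symmetric] sorted_wrt_rev by (simp add: sorted_wrt_map)
  qed
  have xpos: "y > 0" if "y \<in> set (x q)" for y q using that ks(2)[of q] by (auto simp: x_def S_def)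
  have part: "is_partition (x q)" for q
  proof -
    have "x q = [] \<or> last (x q) \<noteq> 0" using xpos[of "last (x q)" q] by (metis last_in_set not_gr_zero)
    then show ?thesis using xs[of q] by (simp add: is_partition_def is_composition_def)
  qed
  have sumx: "sum_list (x q) = (\<Sum>k\<in>S q. cnt q k)" for q
    unfolding x_def using sum_list_distinct_conv_sum_set[OF ks(1)] ks(2) by simp
  have cset: "(\<Sum>k\<in>A. cnt q k) = card {i\<in>{1..n}. fst (c i) = q \<and> snd (c i) \<in> A}" if "finite A" for q A
  proof -
    have "(\<Sum>k\<in>A. cnt q k) = card (\<Union>k\<in>A. {i\<in>{1..n}. c i = (q, k)})"
      unfolding cnt_def using that by (subst card_UN_disjoint) auto
    also have "(\<Union>k\<in>A. {i\<in>{1..n}. c i = (q, k)}) = {i\<in>{1..n}. fst (c i) = q \<and> snd (c i) \<in> A}"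
      by (auto simp: prod_eq_iff)
    finally show ?thesis .
  qed
  have sumS: "(\<Sum>k\<in>S q. cnt q k) = card {i\<in>{1..n}. fst (c i) = q}" for q
  proof -
    have "snd (c i) \<in> S q" if "i \<in> {1..n}" "fst (c i) = q" for i unfolding S_eq using that by auto
    then have "{i\<in>{1..n}. fst (c i) = q \<and> snd (c i) \<in> S q} = {i\<in>{1..n}. fst (c i) = q}" by auto
    then show ?thesis using cset[OF finS[of q], of q] by simp
  qed
  have tot: "sum_list (x False) + sum_list (x True) = n"
  proof -
    have "card {i\<in>{1..n}. \<not> fst (c i)} + card {i\<in>{1..n}. fst (c i)} = card ({i\<in>{1..n}. \<not> fst (c i)} \<union> {i\<in>{1..n}. fst (c i)})"
      by (rule card_Un_disjoint[symmetric]) auto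
    also have "{i\<in>{1..n}. \<not> fst (c i)} \<union> {i\<in>{1..n}. fst (c i)} = {1..n}" by auto
    finally show ?thesis using sumx[of False] sumx[of True] sumS[of False] sumS[of True] by simp
  qed
  let ?c' = "lab (x False) (x True)"
  have P: "(x False, x True) \<in> P2 n" using part tot by (simp add: P2_def)
  define ix where "ix q k = (SOME m. m < length (ks q) \<and> ks q ! m = k)" for q k
  have ix: "ix q k < length (ks q)" "ks q ! ix q k = k" if "k \<in> S q" for q k
  proof -
    have "\<exists>m. m < length (ks q) \<and> ks q ! m = k" using that ks(2)[of q] by (metis in_set_conv_nth)
    then have "ix q k < length (ks q) \<and> ks q ! ix q k = k" unfolding ix_def by (rule someI_ex)
    then show "ix q k < length (ks q)" "ks q ! ix q k = k" by auto
  qed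
  define \<rho> where "\<rho> l = (fst l, ix (fst l) (snd l))" for l
  have inS: "snd (c i) \<in> S (fst (c i))" if "i \<in> {1..n}" for i unfolding S_eq using that by auto
  have \<rho>inj: "inj_on \<rho> (c ` {1..n})"
  proof (rule inj_onI)
    fix l m assume "l \<in> c ` {1..n}" "m \<in> c ` {1..n}" and e: "\<rho> l = \<rho> m"
    then have S: "snd l \<in> S (fst l)" "snd m \<in> S (fst m)" using inS by auto
    have "snd l = ks (fst (\<rho> l)) ! snd (\<rho> l)" unfolding \<rho>_def fst_conv snd_conv by (rule ix(2)[OF S(1), symmetric])
    also have "\<dots> = ks (fst (\<rho> m)) ! snd (\<rho> m)" unfolding e ..
    also have "\<dots> = snd m" unfolding \<rho>_def fst_conv snd_conv by (rule ix(2)[OF S(2)])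
    finally have "snd l = snd m" .
    then show "l = m" using e by (simp add: \<rho>_def prod_eq_iff)
  qed
  have counts: "card {i\<in>{1..n}. \<rho> (c i) = l} = card {i\<in>{1..n}. ?c' i = l}" for l
  proof -
    obtain q m where l: "l = (q, m)" by force
    have "card {i\<in>{1..n}. ?c' i = l} = nth0 (x q) m" unfolding l card_lab[OF tot] by (cases q) auto
    moreover have "card {i\<in>{1..n}. \<rho> (c i) = l} = nth0 (x q) m"
    proof (cases "m < length (ks q)")
      case True
      have "\<rho> (c i) = l \<longleftrightarrow> c i = (q, ks q ! m)" if i: "i \<in> {1..n}" for i
      proof
        assume "\<rho> (c i) = l"
        then have "fst (c i) = q" "ix q (snd (c i)) = m" by (auto simp: \<rho>_def l)
        then show "c i = (q, ks q ! m)" using ix(2)[of "snd (c i)" q] inS[OF i] by (auto simp: prod_eq_iff)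
      next
        assume e: "c i = (q, ks q ! m)"
        then have "ks q ! m \<in> S q" using inS[OF i] by simp
        then have "ix q (ks q ! m) = m" using ix[of "ks q ! m" q] nth_eq_iff_index_eq[OF ks(1)] True by auto
        then show "\<rho> (c i) = l" using e by (simp add: \<rho>_def l)
      qed
      then have "{i\<in>{1..n}. \<rho> (c i) = l} = {i\<in>{1..n}. c i = (q, ks q ! m)}" by auto
      then show ?thesis using True by (simp add: nth0_def x_def cnt_def)
    next
      case False
      have "\<rho> (c i) \<noteq> l" if i: "i \<in> {1..n}" for i
      proof
        assume "\<rho> (c i) = l"
        then have "fst (c i) = q" "ix q (snd (c i)) = m" by (auto simp: \<rho>_def l)
        then show False using ix(1)[OF inS[OF i]] False by simp
      qed
      then have "{i\<in>{1..n}. \<rho> (c i) = l} = {}" by auto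
      then show ?thesis using False by (simp add: nth0_def x_def)
    qed
    ultimately show ?thesis by simp
  qed
  from ex_perm_of_counts[OF counts] obtain f where f: "f \<in> Sn n" "\<forall>i\<in>{1..n}. ?c' (f i) = \<rho> (c i)" by blast
  have sm: "is_summand n (Ind n c :: 'a rep) (Ind n ?c')"
    by (rule relabel_summand[OF f(1) \<rho>inj]) (use f(2) in \<open>auto simp: \<rho>_def\<close>)
  \<comment> \<open>The letters up to \<open>K\<close> account for at most \<open>K + 1\<close>
    entries of the sorted list, so their counts add up to no more than its first
    \<open>K + 1\<close> entries.\<close>
  have top: "(\<Sum>k\<le>K. cnt q k) \<le> psum (x q) (Suc K)" for q K
  proof -
    define I where "I = {m. m < length (ks q) \<and> ks q ! m \<le> K}"
    have inj: "inj_on (\<lambda>m. ks q ! m) I" using ks(1)[of q] by (auto simp: I_def inj_on_def nth_eq_iff_index_eq)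
    have img: "(\<lambda>m. ks q ! m) ` I = {..K} \<inter> S q"
      using ks(2)[of q] by (auto simp: I_def in_set_conv_nth image_iff set_eq_iff) (metis in_set_conv_nth)+
    have "card I = card ({..K} \<inter> S q)" using card_image[OF inj] img by simp
    also have "\<dots> \<le> card {..K}" by (intro card_mono) auto
    finally have cI: "card I \<le> Suc K" by simp
    have "(\<Sum>k\<le>K. cnt q k) = (\<Sum>k\<in>{..K} \<inter> S q. cnt q k)" by (intro sum.mono_neutral_right) (auto simp: S_def)
    also have "\<dots> = (\<Sum>m\<in>I. cnt q (ks q ! m))" unfolding img[symmetric] by (subst sum.reindex[OF inj]) simp
    also have "\<dots> = (\<Sum>m\<in>I. x q ! m)" by (intro sum.cong) (auto simp: I_def x_def)
    also have "\<dots> \<le> psum (x q) (Suc K)" unfolding psum_def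
      by (rule sum_le_take_sorted[OF xs _ cI]) (auto simp: I_def x_def)
    finally show ?thesis .
  qed
  have "ncount n c (q, K) \<le> ncount n ?c' (q, K)" for q K
  proof (cases q)
    case False
    have "{i\<in>{1..n}. c i \<le> (q, K)} = {i\<in>{1..n}. fst (c i) = False \<and> snd (c i) \<in> {..K}}"
      using False by (auto simp: less_eq_prod_def)
    then have "ncount n c (q, K) = (\<Sum>k\<le>K. cnt False k)" unfolding ncount_def using cset[of "{..K}" False] by simp
    then show ?thesis unfolding ncount_lab[OF tot] using top[of False K] False by simp
  next
    case True
    have "{i\<in>{1..n}. c i \<le> (q, K)} = {i\<in>{1..n}. fst (c i) = False} \<union> {i\<in>{1..n}. fst (c i) = True \<and> snd (c i) \<in> {..K}}"
      using True by (auto simp: less_eq_prod_def)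
    then have "ncount n c (q, K) = card {i\<in>{1..n}. fst (c i) = False} + card {i\<in>{1..n}. fst (c i) = True \<and> snd (c i) \<in> {..K}}"
      unfolding ncount_def by (simp only:) (rule card_Un_disjoint, auto)
    also have "\<dots> = sum_list (x False) + (\<Sum>k\<le>K. cnt True k)" using sumx[of False] sumS[of False] cset[of "{..K}" True] by simp
    finally show ?thesis unfolding ncount_lab[OF tot] using top[of True K] True by simp
  qed
  then have "\<forall>j. ncount n c j \<le> ncount n ?c' j" by (metis surj_pair)
  moreover have "is_summand n (Ind n c :: 'a rep) (Mmod (x False) (x True))" using sm by (simp only: Mmod_Ind[OF tot])
  ultimately show ?thesis using P by blast
qed

lemma is_rep_Mmod: "is_rep (sum_list a + sum_list b) (Mmod a b)"
  unfolding Mmod_Ind[OF refl] by (rule is_rep_Ind)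

text \<open>\<open>labelling_partition\<close> replaces \<open>c\<close> by a pair of partitions
  with counts at least as large, and transitivity carries the defining property of \<open>Y\<close>
  over to \<open>c\<close>.\<close>

lemma signed_young_nondominated:
  fixes Y :: "'a::field rep"
  assumes Y: "is_signed_young p n lam mu Y" and n: "sum_list lam + p * sum_list mu = n"
    and nd: "\<not> dominated n c (lab lam (scale p mu))"
  shows "\<not> is_summand n Y (Ind n c)"
proof
  assume s: "is_summand n Y (Ind n c)"
  from labelling_partition[of n c, where ?'a = 'a] obtain a b where ab: "(a, b) \<in> P2 n"
    "is_summand n (Ind n c :: 'a rep) (Mmod a b)" "\<forall>j. ncount n c j \<le> ncount n (lab a b) j" by blast
  have sab: "sum_list a + sum_list b = n" using ab(1) by (simp add: P2_def)
  have Yr: "is_rep n Y" using Y by (simp add: is_signed_young_def indecomposable_def)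
  have Mr: "is_rep n (Mmod a b :: 'a rep)" using is_rep_Mmod[of a b, where ?'a = 'a] sab by simp
  have "is_summand n Y (Mmod a b)" by (rule summand_trans[OF Mr Yr is_rep_Ind s ab(2)])
  then have "dominates (lam, scale p mu) (a, b)" using Y ab(1) by (auto simp: is_signed_young_def)
  moreover have "sum_list lam + sum_list (scale p mu) = n" using n by (simp add: sum_list_scale)
  ultimately have "dominated n (lab a b) (lab lam (scale p mu))" using dominates_iff[OF sab] by simp
  then show False using nd ab(3) unfolding dominated_def by (meson order.trans)
qed

section \<open>The \<open>p\<close>-adic expansion of a partition\<close>

lemma composition_eqI:
  assumes "is_composition xs" "is_composition ys" "\<And>j. nth0 xs j = nth0 ys j"
  shows "xs = ys"
proof -
  have le: "length us \<le> length vs" if u: "is_composition us" and e: "\<And>j. nth0 us j = nth0 vs j" for us vs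
  proof (rule ccontr)
    assume "\<not> length us \<le> length vs"
    then have l: "length vs \<le> length us - 1" "us \<noteq> []" by auto
    then have "nth0 us (length us - 1) = last us" by (simp add: nth0_def last_conv_nth)
    moreover have "nth0 vs (length us - 1) = 0" using l by (simp add: nth0_def)
    ultimately show False using e u l(2) by (simp add: is_composition_def)
  qed
  have "length xs = length ys" using le[of xs ys] le[of ys xs] assms by (simp add: antisym)
  then show ?thesis using assms(3) by (intro nth_equalityI) (auto simp: nth0_def split: if_splits, metis)
qed

lemma composition_exists:
  assumes "\<And>j. N \<le> j \<Longrightarrow> f j = (0::nat)"
  shows "\<exists>xs. is_composition xs \<and> (\<forall>j. nth0 xs j = f j)"
  using assms
proof (induction N)
  case 0 then show ?case by (intro exI[of _ "[]"]) (auto simp: is_composition_def nth0_def)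
next
  case (Suc N)
  show ?case
  proof (cases "f N = 0")
    case True
    then have "f j = 0" if "N \<le> j" for j using Suc.prems[of j] that by (cases "j = N") auto
    then show ?thesis by (rule Suc.IH)
  next
    case False
    have "nth0 (map f [0..<Suc N]) j = f j" for j
      using Suc.prems[of j] by (cases "j < Suc N") (auto simp: nth0_def simp del: upt_Suc)
    moreover have "is_composition (map f [0..<Suc N])" using False by (simp add: is_composition_def)
    ultimately show ?thesis by blast
  qed
qed

lemma partition_iff_antimono: "is_partition xs \<longleftrightarrow> is_composition xs \<and> (\<forall>j. nth0 xs (Suc j) \<le> nth0 xs j)"
proof
  assume p: "is_partition xs"
  then have "nth0 xs (Suc j) \<le> nth0 xs j" for j
    using sorted_wrt_nth_less[of "(\<ge>)" xs j "Suc j"] by (auto simp: is_partition_def nth0_def)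
  then show "is_composition xs \<and> (\<forall>j. nth0 xs (Suc j) \<le> nth0 xs j)" using p by (simp add: is_partition_def)
next
  assume a: "is_composition xs \<and> (\<forall>j. nth0 xs (Suc j) \<le> nth0 xs j)"
  have "nth0 xs j \<le> nth0 xs i" if "i \<le> j" for i j
    using that by (induction j rule: dec_induct) (use a order.trans in blast)+
  then have "sorted_wrt (\<ge>) xs" unfolding sorted_wrt_iff_nth_less by (metis less_imp_le nth0_def order.strict_trans)
  then show "is_partition xs" using a by (simp add: is_partition_def)
qed

lemma nth0_le_sum_list: "nth0 xs j \<le> sum_list xs"
  by (auto simp: nth0_def intro: member_le_sum_list)

lemma nth0_beyond: "length xs \<le> j \<Longrightarrow> nth0 xs j = 0" by (simp add: nth0_def)

lemma sum_list_nth0: "length xs \<le> N \<Longrightarrow> sum_list xs = (\<Sum>j<N. nth0 xs j)"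
proof -
  assume "length xs \<le> N"
  then have "(\<Sum>j<N. nth0 xs j) = (\<Sum>j<length xs. nth0 xs j)"
    by (intro sum.mono_neutral_right) (auto simp: nth0_def)
  also have "\<dots> = sum_list xs" unfolding sum_list_sum_nth atLeast0LessThan by (intro sum.cong) (auto simp: nth0_def)
  finally show ?thesis ..
qed

lemma digit_sum: "(\<Sum>i<N. p ^ i * ((x div p ^ i) mod p)) = x mod p ^ N" for x p :: nat
proof (induction N)
  case (Suc N)
  have "x mod p ^ Suc N = p ^ N * ((x div p ^ N) mod p) + x mod p ^ N"
    by (simp only: power_Suc2 mod_mult2_eq)
  then show ?case using Suc by simp
qed simp

lemma digits_unique:
  fixes f g :: "nat \<Rightarrow> nat"
  assumes "\<And>i. f i < p" "\<And>i. g i < p" "(\<Sum>i<M. p ^ i * f i) = (\<Sum>i<M. p ^ i * g i)" "i < M"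
  shows "f i = g i"
  using assms
proof (induction M arbitrary: f g i)
  case (Suc M)
  have shift: "(\<Sum>i<Suc M. p ^ i * h i) = h 0 + p * (\<Sum>i<M. p ^ i * h (Suc i))" for h
    by (simp only: sum.lessThan_Suc_shift) (simp add: sum_distrib_left mult.assoc)
  let ?A = "\<Sum>i<M. p ^ i * f (Suc i)" and ?B = "\<Sum>i<M. p ^ i * g (Suc i)"
  have e: "f 0 + p * ?A = g 0 + p * ?B" using Suc.prems(3) unfolding shift .
  have "(f 0 + p * ?A) mod p = f 0" "(g 0 + p * ?B) mod p = g 0" using Suc.prems(1,2) by simp_all
  then have 0: "f 0 = g 0" using e by simp
  have "p > 0" using Suc.prems(1)[of 0] by simp
  then have AB: "?A = ?B" using e 0 by simp
  show ?case
  proof (cases i)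
    case 0 then show ?thesis using \<open>f 0 = g 0\<close> by simp
  next
    case (Suc k)
    have "f (Suc k) = g (Suc k)"
      by (rule Suc.IH[of "\<lambda>i. f (Suc i)" "\<lambda>i. g (Suc i)" k]) (use Suc.prems AB Suc in auto)
    then show ?thesis using Suc by simp
  qed
qed simp

lemma tail_sum_eq:
  fixes f :: "nat \<Rightarrow> nat"
  assumes "\<And>j. f (Suc j) \<le> f j" "f M = 0" "j \<le> M"
  shows "(\<Sum>m=j..<M. f m - f (Suc m)) = f j"
  using assms(3)
proof (induction j rule: inc_induct)
  case base then show ?case using assms(2) by simp
next
  case (step j) then show ?case using assms(1)[of j] by (simp add: sum.atLeast_Suc_lessThan)
qed

text \<open>A partition is given by the differences of its consecutive parts, and it is
  \<open>p\<close>-restricted when these are below \<open>p\<close>. So the base \<open>p\<close>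
  digits of the differences of \<open>lam\<close> serve as the differences of the
  \<open>L i\<close>, and tail sums recover the parts.\<close>

lemma padic_expansion_exists:
  assumes p: "p \<ge> 2" and lam: "is_partition lam"
  shows "\<exists>L. is_padic_expansion p lam L"
proof -
  define s where "s = sum_list lam"
  define M where "M = length lam"
  define df where "df j = nth0 lam j - nth0 lam (Suc j)" for j
  define dg where "dg i j = (df j div p ^ i) mod p" for i j
  define F where "F i j = (\<Sum>m=j..<M. dg i m)" for i j
  have "\<exists>xs. is_composition xs \<and> (\<forall>j. nth0 xs j = F i j)" for i
    by (rule composition_exists[of M]) (simp add: F_def)
  then obtain L where L: "is_composition (L i)" "nth0 (L i) j = F i j" for i j by metis
  have FS: "F i j = dg i j + F i (Suc j)" if "j < M" for i j using that by (simp add: F_def sum.atLeast_Suc_lessThan)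
  have F0: "F i j = 0" if "M \<le> j" for i j using that by (simp add: F_def)
  have dgp: "dg i j < p" for i j using p by (simp add: dg_def)
  have restr: "p_restricted p (L i)" for i
  proof -
    have "nth0 (L i) (Suc j) \<le> nth0 (L i) j \<and> nth0 (L i) j - nth0 (L i) (Suc j) < p" for j
      unfolding L(2) using FS[of j i] F0[of j i] F0[of "Suc j" i] dgp[of i j] p by (cases "j < M") auto
    then show ?thesis using L(1) by (simp add: p_restricted_def partition_iff_antimono)
  qed
  \<comment> \<open>A crude bound suffices: a difference is at most \<open>s\<close>, and
    \<open>s < 2 ^ s\<close>. It ensures that digits beyond position \<open>s\<close> vanish, as
    \<open>is_padic_expansion\<close> demands.\<close>
  have small: "df j < p ^ Suc s" for j
  proof -
    have "df j \<le> s" using nth0_le_sum_list[of lam j] by (simp add: df_def s_def)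
    also have "s < 2 ^ s" by (rule less_exp)
    also have "(2::nat) ^ s \<le> p ^ s" using p by (intro power_mono) auto
    also have "\<dots> \<le> p ^ Suc s" using p by (intro power_increasing) auto
    finally show ?thesis .
  qed
  have empty: "L i = []" if "s < i" for i
  proof -
    have "dg i j = 0" for j
    proof -
      have "df j < p ^ i" using small[of j] that p by (meson Suc_leI less_le_trans one_le_numeral order.trans power_increasing)
      then show ?thesis by (simp add: dg_def)
    qed
    then have "nth0 (L i) j = nth0 [] j" for j unfolding L(2) by (simp add: F_def nth0_def)
    then show ?thesis using L(1) by (intro composition_eqI) (auto simp: is_composition_def)
  qed
  have "nth0 lam j = (\<Sum>i\<le>s. p ^ i * nth0 (L i) j)" for j
  proof (cases "j \<le> M")
    case True
    have "(\<Sum>i\<le>s. p ^ i * nth0 (L i) j) = (\<Sum>i<Suc s. \<Sum>m=j..<M. p ^ i * dg i m)"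
      by (simp add: L(2) F_def sum_distrib_left lessThan_Suc_atMost)
    also have "\<dots> = (\<Sum>m=j..<M. \<Sum>i<Suc s. p ^ i * dg i m)" by (rule sum.swap)
    also have "\<dots> = (\<Sum>m=j..<M. df m)" unfolding dg_def digit_sum using small by (intro sum.cong) auto
    also have "\<dots> = nth0 lam j" unfolding df_def
      by (rule tail_sum_eq) (use lam True in \<open>auto simp: partition_iff_antimono M_def nth0_beyond\<close>)
    finally show ?thesis ..
  next
    case False
    then show ?thesis by (simp add: L(2) F0 nth0_beyond M_def)
  qed
  then show ?thesis using restr empty unfolding is_padic_expansion_def s_def by blast
qed

text \<open>Passing to differences of consecutive parts reduces this to the uniqueness of base
  \<open>p\<close> digits.\<close>

lemma padic_expansion_unique:
  assumes p: "p \<ge> 2" and L: "is_padic_expansion p lam L" and L': "is_padic_expansion p lam L'"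
  shows "L = L'"
proof
  fix i
  define s where "s = sum_list lam"
  have pr: "is_partition (L i)" "is_partition (L' i)" "nth0 (L i) j - nth0 (L i) (Suc j) < p" "nth0 (L' i) j - nth0 (L' i) (Suc j) < p" for i j
    using L L' by (auto simp: is_padic_expansion_def p_restricted_def)
  have mono: "nth0 (L i) (Suc j) \<le> nth0 (L i) j" "nth0 (L' i) (Suc j) \<le> nth0 (L' i) j" for i j
    using pr(1)[of i] pr(2)[of i] by (auto simp: partition_iff_antimono)
  show "L i = L' i"
  proof (cases "s < i")
    case True then show ?thesis using L L' by (simp add: is_padic_expansion_def s_def)
  next
    case False
    have ex: "nth0 lam j = (\<Sum>i<Suc s. p ^ i * nth0 (L i) j)" "nth0 lam j = (\<Sum>i<Suc s. p ^ i * nth0 (L' i) j)" for j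
      using L L' unfolding is_padic_expansion_def s_def lessThan_Suc_atMost by blast+
    have dif: "(\<Sum>i<Suc s. p ^ i * (K i j - K i (Suc j))) = (\<Sum>i<Suc s. p ^ i * K i j) - (\<Sum>i<Suc s. p ^ i * K i (Suc j))"
      if "\<And>i. K i (Suc j) \<le> K i j" for K :: "nat \<Rightarrow> nat \<Rightarrow> nat" and j
      unfolding diff_mult_distrib2 using that by (intro sum_subtractf_nat) auto
    have D: "nth0 (L i) j - nth0 (L i) (Suc j) = nth0 (L' i) j - nth0 (L' i) (Suc j)" for j
    proof (rule digits_unique[of "\<lambda>i. nth0 (L i) j - nth0 (L i) (Suc j)" p "\<lambda>i. nth0 (L' i) j - nth0 (L' i) (Suc j)" "Suc s"])
      show "(\<Sum>i<Suc s. p ^ i * (nth0 (L i) j - nth0 (L i) (Suc j))) = (\<Sum>i<Suc s. p ^ i * (nth0 (L' i) j - nth0 (L' i) (Suc j)))"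
        unfolding dif[of "\<lambda>i. nth0 (L i)", OF mono(1)] dif[of "\<lambda>i. nth0 (L' i)", OF mono(2)] ex(1)[symmetric] ex(2)[symmetric] ..
    qed (use pr False in auto)
    define M where "M = max (length (L i)) (length (L' i))"
    have z: "nth0 (L i) j = 0" "nth0 (L' i) j = 0" if "M \<le> j" for j using that by (auto simp: M_def nth0_beyond)
    have "nth0 (L i) j = nth0 (L' i) j" for j
    proof (cases "j \<le> M")
      case True
      show ?thesis
        using tail_sum_eq[of "nth0 (L i)" M j, OF mono(1) z(1) True] tail_sum_eq[of "nth0 (L' i)" M j, OF mono(2) z(2) True] D by simp
    qed (use z in auto)
    then show ?thesis using pr(1)[of i] pr(2)[of i] by (intro composition_eqI) (auto simp: is_partition_def)
  qed
qed

lemma padic_expansion: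
  assumes "p \<ge> 2" "is_partition lam"
  shows "is_padic_expansion p lam (padic p lam)"
  unfolding padic_def
  using padic_expansion_exists[OF assms] padic_expansion_unique[OF assms(1)] by (metis theI)

lemma padic_partition: "p \<ge> 2 \<Longrightarrow> is_partition lam \<Longrightarrow> is_partition (padic p lam i)"
  using padic_expansion[of p lam] by (auto simp: is_padic_expansion_def p_restricted_def)

lemma padic_nth0: "p \<ge> 2 \<Longrightarrow> is_partition lam \<Longrightarrow> nth0 lam j = (\<Sum>i\<le>sum_list lam. p ^ i * nth0 (padic p lam i) j)"
  using padic_expansion[of p lam] by (auto simp: is_padic_expansion_def)

lemma padic_empty: "p \<ge> 2 \<Longrightarrow> is_partition lam \<Longrightarrow> sum_list lam < i \<Longrightarrow> padic p lam i = []"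
  using padic_expansion[of p lam] by (auto simp: is_padic_expansion_def)

section \<open>The tableau of a signed Young module\<close>

lemma letter_composition:
  assumes fin: "finite S"
  shows "\<exists>xs. is_composition xs \<and> (\<forall>m. nth0 xs m = card {s\<in>S. g s = (\<beta>, m :: nat)}) \<and>
    sum_list xs = card {s\<in>S. fst (g s) = \<beta>}"
proof -
  define N where "N = Suc (Max (insert 0 ((snd \<circ> g) ` S)))"
  have bound: "snd (g s) < N" if "s \<in> S" for s
    using that fin by (simp add: N_def less_Suc_eq_le)
  have empty: "{s\<in>S. g s = (\<beta>, m)} = {}" if "N \<le> m" for m using bound that by force
  have "\<exists>xs. is_composition xs \<and> (\<forall>m. nth0 xs m = card {s\<in>S. g s = (\<beta>, m)})"
    by (rule composition_exists[of N]) (simp only: empty card.empty)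
  then obtain xs where xs: "is_composition xs" "\<And>m. nth0 xs m = card {s\<in>S. g s = (\<beta>, m)}" by blast
  define L where "L = max N (length xs)"
  have "sum_list xs = (\<Sum>m<L. nth0 xs m)" by (rule sum_list_nth0) (simp add: L_def)
  also have "\<dots> = card (\<Union>m\<in>{..<L}. {s\<in>S. g s = (\<beta>, m)})"
    unfolding xs(2) using fin by (subst card_UN_disjoint) auto
  also have "(\<Union>m\<in>{..<L}. {s\<in>S. g s = (\<beta>, m)}) = {s\<in>S. fst (g s) = \<beta>}"
    using bound by (force simp: L_def prod_eq_iff)
  finally show ?thesis using xs by blast
qed

type_synonym box = "(bool \<times> nat) \<times> nat \<times> nat \<times> nat"

locale signed_shape =
  fixes p n :: nat and lam mu :: "nat list"
  assumes prime_p: "prime p" and odd_p: "odd p"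
    and lam: "is_partition lam" and mu: "is_partition mu"
    and size: "sum_list lam + p * sum_list mu = n"
begin

lemma p2: "p \<ge> 2" using prime_p by (rule prime_ge_2_nat)
lemma p0: "p > 0" using p2 by simp

definition rows :: "bool \<Rightarrow> nat list" where "rows b = (if b then scale p mu else lam)"
definition digit :: "bool \<Rightarrow> nat \<Rightarrow> nat list" where "digit b = padic p (if b then mu else lam)"
text \<open>Odd rows are those of \<open>p\<mu>\<close>, so a box in the \<open>k\<close>-th digit
  of \<open>\<mu>\<close> stands for \<open>p ^ (k + 1)\<close> points.\<close>

definition lev :: "bool \<Rightarrow> nat \<Rightarrow> nat" where "lev b k = (if b then Suc k else k)"
text \<open>A common bound for the positions of nonempty digits in both expansions.\<close>

definition top :: nat where "top = sum_list lam + sum_list mu"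

abbreviation "base \<equiv> lab lam (scale p mu)"

lemma digit_partition: "is_partition (digit b k)"
  using padic_partition[OF p2] lam mu by (simp add: digit_def)

lemma digit_empty: "top < k \<Longrightarrow> digit b k = []"
  using padic_empty[OF p2, of "if b then mu else lam" k] lam mu by (auto simp: digit_def top_def)

lemma rows_digits: "nth0 (rows b) i = (\<Sum>k\<le>top. p ^ lev b k * nth0 (digit b k) i)"
proof -
  let ?x = "if b then mu else lam"
  have "nth0 ?x i = (\<Sum>k\<le>sum_list ?x. p ^ k * nth0 (digit b k) i)"
    unfolding digit_def using padic_nth0[OF p2, of ?x i] lam mu by simp
  also have "\<dots> = (\<Sum>k\<le>top. p ^ k * nth0 (digit b k) i)"
    by (rule sum.mono_neutral_left)
      (use padic_empty[OF p2, of ?x] lam mu in \<open>auto simp: top_def digit_def nth0_def split: if_splits\<close>)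
  finally have e: "nth0 ?x i = (\<Sum>k\<le>top. p ^ k * nth0 (digit b k) i)" .
  have "nth0 (rows b) i = (if b then p * nth0 ?x i else nth0 ?x i)"
    by (simp add: rows_def scale_def nth0_def)
  then show ?thesis unfolding e by (simp add: lev_def sum_distrib_left mult.assoc)
qed

text \<open>A box \<open>((b, i), (k, q, r))\<close> lies in row \<open>i\<close> of \<open>\<lambda>\<close> (\<open>b = False\<close>) or of \<open>p\<mu>\<close> (\<open>b = True\<close>). The row
  is cut into runs of length \<open>p ^ lev b k\<close>, one for each box of row \<open>i\<close> in the \<open>k\<close>-th \<open>p\<close>-adic digit;
  \<open>q\<close> numbers the runs and \<open>r\<close> is the position inside the run. Since each digit is a partition, the
  boxes with a given \<open>(b, k, q, r)\<close> form a column.\<close>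

definition fibre :: "bool \<times> nat \<Rightarrow> (nat \<times> nat \<times> nat) set" where
  "fibre l = (SIGMA k:{..top}. {..<nth0 (digit (fst l) k) (snd l)} \<times> {..<p ^ lev (fst l) k})"

definition boxes :: "box set" where "boxes = {x. snd x \<in> fibre (fst x)}"

lemma boxes_iff: "((b, i), (k, q, r)) \<in> boxes \<longleftrightarrow> q < nth0 (digit b k) i \<and> r < p ^ lev b k"
  using digit_empty[of k b] by (cases "k \<le> top") (auto simp: boxes_def fibre_def nth0_def)

lemma finite_fibre: "finite (fibre l)" by (simp add: fibre_def)

lemma card_fibre: "card (fibre (b, i)) = nth0 (rows b) i"
  by (simp add: fibre_def rows_digits mult.commute card_cartesian_product)

lemma finite_boxes: "finite boxes"
proof -
  have "snd l < length (rows (fst l))" if "fibre l \<noteq> {}" for l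
    using that card_fibre[of "fst l" "snd l"] finite_fibre[of l]
    by (metis card_0_eq nth0_beyond not_le_imp_less prod.collapse)
  then have "boxes \<subseteq> Sigma (Sigma UNIV (\<lambda>b. {..<length (rows b)})) fibre"
    by (force simp: boxes_def)
  then show ?thesis by (rule finite_subset) (intro finite_SigmaI finite_fibre, auto)
qed

lemma size': "sum_list lam + sum_list (scale p mu) = n" using size by (simp add: sum_list_scale)

lemma card_row: "card {i\<in>{1..n}. base i = l} = card {x\<in>boxes. fst x = l}"
proof -
  obtain b i where l: "l = (b, i)" by force
  have "{x\<in>boxes. fst x = l} = Pair l ` fibre l" by (auto simp: boxes_def)
  then have "card {x\<in>boxes. fst x = l} = card (fibre l)" by (simp add: card_image inj_on_def)
  then show ?thesis unfolding l card_fibre card_lab[OF size'] by (simp add: rows_def)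
qed

text \<open>Any bijection that respects rows will do. \<open>lab\<close> numbers the points of a row
  consecutively, but runs need not follow that order.\<close>

definition box :: "nat \<Rightarrow> box" where
  "box = (SOME s. bij_betw s {1..n} boxes \<and> (\<forall>i\<in>{1..n}. fst (s i) = base i))"

lemma box: "bij_betw box {1..n} boxes" "i \<in> {1..n} \<Longrightarrow> fst (box i) = base i"
proof -
  have "\<exists>s. bij_betw s {1..n} boxes \<and> (\<forall>i\<in>{1..n}. fst (s i) = base i)"
    by (rule ex_bij_of_counts[OF finite_atLeastAtMost finite_boxes card_row])
  then have "bij_betw box {1..n} boxes \<and> (\<forall>i\<in>{1..n}. fst (box i) = base i)"
    unfolding box_def by (rule someI_ex)
  then show "bij_betw box {1..n} boxes" "i \<in> {1..n} \<Longrightarrow> fst (box i) = base i" by auto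
qed

definition pos :: "box \<Rightarrow> nat" where "pos = inv_into {1..n} box"

lemma pos: "x \<in> boxes \<Longrightarrow> pos x \<in> {1..n}" "x \<in> boxes \<Longrightarrow> box (pos x) = x"
  using box(1) by (auto simp: pos_def bij_betw_def inv_into_into f_inv_into_f simp del: atLeastAtMost_iff)

lemma pos_box: "i \<in> {1..n} \<Longrightarrow> pos (box i) = i"
  using box(1) by (simp add: pos_def bij_betw_def)

lemma box_mem: "i \<in> {1..n} \<Longrightarrow> box i \<in> boxes" using box(1) by (auto simp: bij_betw_def)

fun turn :: "box \<Rightarrow> box" where
  "turn ((b, i), (k, q, r)) = ((b, i), (k, q, Suc r mod p ^ lev b k))"

lemma turn_mem: "x \<in> boxes \<Longrightarrow> turn x \<in> boxes"
  using p0 by (cases x rule: turn.cases) (auto simp: boxes_iff)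

lemma turn_pow: "(turn ^^ m) ((b, i), (k, q, r)) = ((b, i), (k, q, if m = 0 then r else (r + m) mod p ^ lev b k))"
  by (induction m) (auto simp: mod_Suc_eq)

definition colm :: "nat \<Rightarrow> bool \<times> nat \<times> nat \<times> nat" where "colm i = (fst (base i), snd (box i))"
definition z :: "nat \<Rightarrow> nat" where "z i = (if i \<in> {1..n} then pos (turn (box i)) else i)"

lemma z_mem: "i \<in> {1..n} \<Longrightarrow> z i \<in> {1..n}"
  using pos(1)[OF turn_mem[OF box_mem]] by (simp add: z_def del: atLeastAtMost_iff)

lemma box_z: "i \<in> {1..n} \<Longrightarrow> box (z i) = turn (box i)"
  using pos(2)[OF turn_mem[OF box_mem]] by (simp add: z_def del: atLeastAtMost_iff)

lemma z_pow: "i \<in> {1..n} \<Longrightarrow> (z ^^ m) i \<in> {1..n} \<and> box ((z ^^ m) i) = (turn ^^ m) (box i)"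
  by (induction m) (use z_mem box_z in \<open>simp_all del: atLeastAtMost_iff\<close>)

lemma z_pow_out: "i \<notin> {1..n} \<Longrightarrow> (z ^^ m) i = i"
  by (induction m) (simp_all add: z_def del: atLeastAtMost_iff)

text \<open>Every run length is a power of \<open>p\<close> with exponent at most
  \<open>Suc top\<close>, hence divides \<open>p ^ Suc top\<close>.\<close>

lemma z_order: "z ^^ (p ^ Suc top) = id"
proof
  fix i
  show "(z ^^ (p ^ Suc top)) i = id i"
  proof (cases "i \<in> {1..n}")
    case True
    obtain b j k q r where x: "box i = ((b, j), (k, q, r))" by (metis prod.collapse)
    have "q < nth0 (digit b k) j" and r: "r < p ^ lev b k" using box_mem[OF True] by (simp_all add: x boxes_iff)
    then have "k \<le> top" using digit_empty[of k b] by (cases "k \<le> top") (auto simp: nth0_def)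
    then have "p ^ lev b k dvd p ^ Suc top" by (intro le_imp_power_dvd) (simp add: lev_def)
    then obtain e where e: "p ^ Suc top = p ^ lev b k * e" by (auto simp: dvd_def)
    have "(r + p ^ Suc top) mod p ^ lev b k = r" unfolding e using r by simp
    then have "(turn ^^ (p ^ Suc top)) (box i) = box i" unfolding x turn_pow using p0 by simp
    then have "box ((z ^^ (p ^ Suc top)) i) = box i" using z_pow[OF True] by metis
    then show ?thesis using z_pow[OF True, of "p ^ Suc top"] pos_box True by (metis id_apply)
  next
    case False then show ?thesis by (simp add: z_pow_out del: power_Suc)
  qed
qed

lemma z_Sn: "z \<in> Sn n"
proof -
  have "p ^ Suc top \<noteq> 0" using p0 by simp
  then obtain M where M: "p ^ Suc top = Suc M" using not0_implies_Suc by blast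
  have c: "(z ^^ M) (z i) = i" for i
    using fun_cong[OF z_order[unfolded M funpow_Suc_right], of i] by simp
  have inj: "inj_on z {1..n}" by (rule inj_onI) (metis c)
  have "z ` {1..n} = {1..n}" by (rule endo_inj_surj[OF _ _ inj]) (use z_mem in auto)
  then have "bij_betw z {1..n} {1..n}" using inj by (simp add: bij_betw_def)
  then show ?thesis unfolding Sn_def by (auto intro!: bij_imp_permutes simp: z_def)
qed

lemma fst_turn: "fst (turn x) = fst x" by (cases x rule: turn.cases) simp

lemma turn_moves: "((b, i), (k, q, r)) \<in> boxes \<Longrightarrow> lev b k > 0 \<Longrightarrow> turn ((b, i), (k, q, r)) \<noteq> ((b, i), (k, q, r))"
proof
  assume x: "((b, i), (k, q, r)) \<in> boxes" and l: "lev b k > 0" and e: "turn ((b, i), (k, q, r)) = ((b, i), (k, q, r))"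
  have P: "p ^ lev b k > 1" using p2 l by (intro one_less_power) auto
  have m: "Suc r mod p ^ lev b k = r" using e by simp
  have "r < p ^ lev b k" using x by (simp add: boxes_iff)
  then consider "Suc r < p ^ lev b k" | "Suc r = p ^ lev b k" by linarith
  then show False using m P by cases auto
qed

lemma base_z: "i \<in> {1..n} \<Longrightarrow> base (z i) = base i"
  using box(2)[of "z i"] box(2)[of i] z_mem[of i] by (simp add: box_z fst_turn del: atLeastAtMost_iff)

text \<open>\<open>col_down\<close> holds because each digit is a partition, and
  \<open>z_odd\<close> because \<open>lev True k\<close> is positive, so that runs in the rows of
  \<open>p\<mu>\<close> have length at least \<open>p\<close>.\<close>

lemma tableau_boxes: "tableau n p (Suc top) base colm z"
proof
  show "prime p" "odd p" by (rule prime_p odd_p)+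
next
  fix i j assume ij: "i \<in> {1..n}" "j \<in> {1..n}" "base i = base j" "colm i = colm j"
  then have "box i = box j" using box(2)[of i] box(2)[of j] by (simp add: colm_def prod_eq_iff)
  then show "i = j" using pos_box ij by metis
next
  fix i j assume "colm i = colm j" then show "fst (base i) = fst (base j)" by (simp add: colm_def)
next
  fix i b m assume i: "i \<in> {1..n}" and bi: "base i = (b, Suc m)"
  obtain k q r where x: "box i = ((b, Suc m), (k, q, r))" using box(2)[OF i] bi by (metis prod.collapse)
  have "q < nth0 (digit b k) (Suc m)" "r < p ^ lev b k" using box_mem[OF i] by (simp_all add: x boxes_iff)
  moreover have "nth0 (digit b k) (Suc m) \<le> nth0 (digit b k) m" using digit_partition[of b k] by (simp add: partition_iff_antimono)
  ultimately have y: "((b, m), (k, q, r)) \<in> boxes" by (simp add: boxes_iff)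
  show "\<exists>j\<in>{1..n}. colm j = colm i \<and> base j = (b, m)"
  proof (rule bexI[of _ "pos ((b, m), (k, q, r))"])
    have "base (pos ((b, m), (k, q, r))) = (b, m)" using box(2)[OF pos(1)[OF y]] pos(2)[OF y] by simp
    then show "colm (pos ((b, m), (k, q, r))) = colm i \<and> base (pos ((b, m), (k, q, r))) = (b, m)"
      by (simp add: colm_def pos(2)[OF y] x bi)
  qed (rule pos(1)[OF y])
next
  have "base (z i) = base i" for i using base_z[of i] by (cases "i \<in> {1..n}") (simp_all add: z_def del: atLeastAtMost_iff)
  then show "z \<in> Hs n base" using z_Sn by (auto simp: Hs_def)
next
  show "z ^^ (p ^ Suc top) = id" by (rule z_order)
next
  fix i j assume i: "i \<in> {1..n}" and j: "j \<in> {1..n}" and c: "colm i = colm j"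
  obtain b i' k q r where x: "box i = ((b, i'), (k, q, r))" by (metis prod.collapse)
  obtain b' j' k' q' r' where y: "box j = ((b', j'), (k', q', r'))" by (metis prod.collapse)
  have "base i = (b, i')" "base j = (b', j')" using box(2)[OF i] box(2)[OF j] x y by simp_all
  then show "colm (z i) = colm (z j)"
    using c by (simp add: colm_def base_z[OF i] base_z[OF j] box_z[OF i] box_z[OF j] x y)
next
  fix i assume i: "i \<in> {1..n}" and odd: "fst (base i)"
  obtain b i' k q r where x: "box i = ((b, i'), (k, q, r))" by (metis prod.collapse)
  have "base i = (b, i')" using box(2)[OF i] by (simp add: x)
  then have "lev b k > 0" using odd by (simp add: lev_def)
  then have "turn (box i) \<noteq> box i" using turn_moves box_mem[OF i] by (simp add: x del: turn.simps)
  then show "z i \<noteq> i" using box_z[OF i] by metis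
qed

section \<open>Counting runs: fixed words and \<open>\<Lambda>\<close>\<close>

text \<open>The runs of a digit correspond to the boxes of its Young diagram; their number is what
  the digit contributes to \<open>nseq\<close>.\<close>

definition runs :: "bool \<Rightarrow> nat \<Rightarrow> (nat \<times> nat) set" where
  "runs b k = (SIGMA i:{..<length (digit b k)}. {..<nth0 (digit b k) i})"

lemma runs_iff: "(i, q) \<in> runs b k \<longleftrightarrow> q < nth0 (digit b k) i"
  by (auto simp: runs_def nth0_def)

lemma finite_runs: "finite (runs b k)" by (simp add: runs_def)

lemma card_runs: "card (runs b k) = sum_list (digit b k)"
  by (simp add: runs_def sum_list_nth0[OF order_refl])

text \<open>A predicate constant on runs is counted run by run, each run weighted with its length
  \<open>p ^ lev b k\<close>.\<close>

lemma card_boxes_constant: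
  assumes W: "\<And>b i k q r. ((b, i), (k, q, r)) \<in> boxes \<Longrightarrow> Q ((b, i), (k, q, r)) \<longleftrightarrow> R b k (i, q)"
  shows "card {x\<in>boxes. Q x} = (\<Sum>k\<le>top. p ^ k * card {s\<in>runs False k. R False k s}) +
    (\<Sum>k\<le>top. p ^ Suc k * card {s\<in>runs True k. R True k s})"
proof -
  let ?T = "SIGMA bk:(UNIV :: bool set) \<times> {..top}. {s\<in>runs (fst bk) (snd bk). R (fst bk) (snd bk) s} \<times> {..<p ^ lev (fst bk) (snd bk)}"
  let ?f = "\<lambda>t. ((fst (fst t), fst (fst (snd t))), (snd (fst t), snd (fst (snd t)), snd (snd t)))"
  have inj: "inj_on ?f ?T" by (auto simp: inj_on_def)
  have "?f ` ?T = {x\<in>boxes. Q x}"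
  proof (intro equalityI subsetI)
    fix x assume "x \<in> ?f ` ?T"
    then show "x \<in> {x\<in>boxes. Q x}" using W by (auto simp: boxes_iff runs_iff)
  next
    fix x assume x: "x \<in> {x\<in>boxes. Q x}"
    obtain b i k q r where e: "x = ((b, i), (k, q, r))" by (metis prod.collapse)
    have m: "q < nth0 (digit b k) i" "r < p ^ lev b k" using x by (simp_all add: e boxes_iff)
    then have "k \<le> top" using digit_empty[of k b] by (cases "k \<le> top") (auto simp: nth0_def)
    then have "((b, k), ((i, q), r)) \<in> ?T" using m x W by (auto simp: e runs_iff)
    then show "x \<in> ?f ` ?T" by (rule rev_image_eqI) (simp add: e)
  qed
  then have "card {x\<in>boxes. Q x} = card ?T" using card_image[OF inj] by simp
  also have "\<dots> = (\<Sum>bk\<in>UNIV \<times> {..top}. card {s\<in>runs (fst bk) (snd bk). R (fst bk) (snd bk) s} * p ^ lev (fst bk) (snd bk))"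
    by (subst card_SigmaI) (auto simp: finite_runs card_cartesian_product)
  also have "\<dots> = (\<Sum>b\<in>UNIV. \<Sum>k\<le>top. card {s\<in>runs b k. R b k s} * p ^ lev b k)"
    by (simp add: sum.cartesian_product split_def)
  finally show ?thesis by (simp add: UNIV_bool lev_def mult.commute)
qed

lemma nseq_eq:
  "nseq p lam mu 0 = sum_list (digit False 0)"
  "nseq p lam mu (Suc k) = sum_list (digit False (Suc k)) + sum_list (digit True k)"
  by (simp_all add: nseq_def digit_def)

lemma nseq_beyond: "Suc top < i \<Longrightarrow> nseq p lam mu i = 0"
  by (cases i) (simp_all add: nseq_eq digit_empty)

text \<open>Both expansions vanish above \<open>top\<close>, so the set whose maximum defines
  \<open>rmax\<close> is finite.\<close>

lemma rmax_bounds: "rmax p lam mu \<le> Suc top" "rmax p lam mu < i \<Longrightarrow> nseq p lam mu i = 0"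
proof -
  let ?A = "{i. nseq p lam mu i \<noteq> 0} \<union> {0}"
  have s: "i \<le> Suc top" if "i \<in> ?A" for i using that nseq_beyond[of i] by (cases "i \<le> Suc top") auto
  have f: "finite ?A" by (rule finite_subset[of _ "{..Suc top}"]) (use s in \<open>simp_all add: subset_iff\<close>)
  show "rmax p lam mu \<le> Suc top" unfolding rmax_def by (rule Max.boundedI[OF f]) (use s in simp_all)
  assume "rmax p lam mu < i"
  then have "i \<notin> ?A" using Max_ge[OF f, of i] unfolding rmax_def by linarith
  then show "nseq p lam mu i = 0" by simp
qed

text \<open>A word fixed by \<open>z\<close> is constant on runs, so counting its letters level by level produces an element
  of \<open>\<Lambda>\<close>. Parities can only differ on the boxes that \<open>z\<close> does not move, and these are counted by
  \<open>\<delta>\<^sub>0\<close>.\<close>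

lemma parmatch_of_Lambda:
  fixes u :: "(nat \<Rightarrow> nat) \<Rightarrow> 'a::field"
  assumes two: "(2::'a) \<noteq> 0" and ab: "sum_list a + sum_list b = n"
    and Lam: "\<And>g d. in_Lambda p lam mu a b g d \<Longrightarrow> d 0 = []"
    and u: "u \<in> biequiv n base (lab a b)" and y: "y \<in> Sn n" "u y \<noteq> 0"
    and w: "lab a b \<circ> iv y \<circ> iv z = lab a b \<circ> iv y"
  shows "parmatch n base (lab a b) y"
proof -
  interpret tableau n p "Suc top" base colm z by (rule tableau_boxes)
  define wd where "wd i = lab a b (iv y i)" for i
  define W where "W x = wd (pos x)" for x
  have wz: "wd (z i) = wd i" for i
    using fun_cong[OF w, of "z i"] by (simp add: wd_def Sn_iv_app[OF z_Sn])
  have Wbox: "W (box i) = wd i" if "i \<in> {1..n}" for i using pos_box[OF that] by (simp add: W_def)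
  have Wturn: "W (turn x) = W x" if x: "x \<in> boxes" for x
  proof -
    have "pos (turn x) = z (pos x)" using pos[OF x] by (simp add: z_def del: atLeastAtMost_iff)
    then show ?thesis by (simp add: W_def wz)
  qed
  \<comment> \<open>The letter of a run, read off at its first box.\<close>
  define W0 where "W0 b' k s = W ((b', fst s), (k, snd s, 0))" for b' k s
  have Wconst: "W ((b', i), (k, q, r)) = W0 b' k (i, q)" if "((b', i), (k, q, r)) \<in> boxes" for b' i k q r
    using that
  proof (induction r)
    case 0 then show ?case by (simp add: W0_def)
  next
    case (Suc r)
    then have m: "((b', i), (k, q, r)) \<in> boxes" and l: "Suc r < p ^ lev b' k" by (simp_all add: boxes_iff)
    show ?case using Wturn[OF m] Suc.IH[OF m] l by simp
  qed
  \<comment> \<open>Runs of length greater than 1 are moved by \<open>z\<close>, so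
    \<open>fixed_word_moved\<close> gives their letters the parity of the row.\<close>
  have parity: "fst (W0 b' k s) = b'" if s: "s \<in> runs b' k" and l: "lev b' k > 0" for b' k s
  proof -
    obtain i q where e: "s = (i, q)" by force
    have x: "((b', i), (k, q, 0)) \<in> boxes" using s p0 by (simp add: e runs_iff boxes_iff)
    let ?j = "pos ((b', i), (k, q, 0))"
    have j: "?j \<in> {1..n}" by (rule pos(1)[OF x])
    have "box (z ?j) \<noteq> box ?j" unfolding box_z[OF j] pos(2)[OF x] by (rule turn_moves[OF x l])
    then have "z ?j \<noteq> ?j" by metis
    from fixed_word_moved[OF two u y w j this] have "fst (wd ?j) = fst (base ?j)" by (simp add: wd_def)
    also have "\<dots> = b'" using box(2)[OF j] pos(2)[OF x] by simp
    finally show ?thesis by (simp add: W0_def W_def e)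
  qed
  have count: "nth0 (if \<beta> then b else a) m = (\<Sum>k\<le>top. p ^ k * card {s\<in>runs False k. W0 False k s = (\<beta>, m)}) +
    (\<Sum>k\<le>top. p ^ Suc k * card {s\<in>runs True k. W0 True k s = (\<beta>, m)})" for \<beta> m
  proof -
    have "nth0 (if \<beta> then b else a) m = card {i\<in>{1..n}. lab a b i = (\<beta>, m)}" by (simp only: card_lab[OF ab])
    also have "\<dots> = card {i\<in>{1..n}. wd i = (\<beta>, m)}" unfolding wd_def
      by (rule card_Sn_collect[OF Sn_iv[OF y(1)], symmetric])
    also have "\<dots> = card {x\<in>boxes. W x = (\<beta>, m)}"
    proof (rule bij_betw_same_card[of box])
      have "box ` {i\<in>{1..n}. wd i = (\<beta>, m)} = {x\<in>boxes. W x = (\<beta>, m)}"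
      proof (intro equalityI subsetI)
        fix x assume "x \<in> box ` {i\<in>{1..n}. wd i = (\<beta>, m)}"
        then show "x \<in> {x\<in>boxes. W x = (\<beta>, m)}" using Wbox box_mem by auto
      next
        fix x assume x: "x \<in> {x\<in>boxes. W x = (\<beta>, m)}"
        then have "pos x \<in> {i\<in>{1..n}. wd i = (\<beta>, m)}" using pos(1)[of x] by (simp add: W_def)
        then show "x \<in> box ` {i\<in>{1..n}. wd i = (\<beta>, m)}" using pos(2)[of x] x by (metis (no_types, lifting) image_eqI mem_Collect_eq)
      qed
      moreover have "inj_on box {i\<in>{1..n}. wd i = (\<beta>, m)}" by (rule inj_on_subset[OF bij_betw_imp_inj_on[OF box(1)]]) auto
      ultimately show "bij_betw box {i\<in>{1..n}. wd i = (\<beta>, m)} {x\<in>boxes. W x = (\<beta>, m)}" by (simp add: bij_betw_def)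
    qed
    also have "\<dots> = (\<Sum>k\<le>top. p ^ k * card {s\<in>runs False k. W0 False k s = (\<beta>, m)}) +
      (\<Sum>k\<le>top. p ^ Suc k * card {s\<in>runs True k. W0 True k s = (\<beta>, m)})"
      by (rule card_boxes_constant) (simp only: Wconst)
    finally show ?thesis .
  qed
  have "\<exists>xs. is_composition xs \<and> (\<forall>m. nth0 xs m = card {s\<in>runs b' k. W0 b' k s = (\<beta>, m)}) \<and>
    sum_list xs = card {s\<in>runs b' k. fst (W0 b' k s) = \<beta>}" for b' k \<beta>
    by (rule letter_composition[OF finite_runs])
  then obtain C where C: "is_composition (C b' k \<beta>)" "nth0 (C b' k \<beta>) m = card {s\<in>runs b' k. W0 b' k s = (\<beta>, m)}"
    "sum_list (C b' k \<beta>) = card {s\<in>runs b' k. fst (W0 b' k s) = \<beta>}" for b' k \<beta> m by metis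
  \<comment> \<open>\<open>g i\<close> collects the even and \<open>d i\<close> the odd letters of
    level \<open>i\<close>. From level 1 on, \<open>parity\<close> places them on even and on odd
    rows respectively; level 0 has only rows of \<open>\<lambda>\<close>, where both kinds of
    letters may occur.\<close>
  define g where "g i = C False i False" for i
  define d where "d i = (case i of 0 \<Rightarrow> C False 0 True | Suc k \<Rightarrow> C True k True)" for i
  have sizes: "sum_list (g i) + sum_list (d i) = nseq p lam mu i" for i
  proof (cases i)
    case 0
    have "card {s\<in>runs False 0. \<not> fst (W0 False 0 s)} + card {s\<in>runs False 0. fst (W0 False 0 s)} =
      card ({s\<in>runs False 0. \<not> fst (W0 False 0 s)} \<union> {s\<in>runs False 0. fst (W0 False 0 s)})"
      by (rule card_Un_disjoint[symmetric]) (auto simp: finite_runs)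
    also have "{s\<in>runs False 0. \<not> fst (W0 False 0 s)} \<union> {s\<in>runs False 0. fst (W0 False 0 s)} = runs False 0" by auto
    finally show ?thesis using 0 by (simp add: g_def d_def C(3) nseq_eq card_runs)
  next
    case (Suc k)
    have "{s\<in>runs False (Suc k). fst (W0 False (Suc k) s) = False} = runs False (Suc k)"
      using parity[of _ False "Suc k"] by (auto simp: lev_def)
    moreover have "{s\<in>runs True k. fst (W0 True k s) = True} = runs True k"
      using parity[of _ True k] by (auto simp: lev_def)
    ultimately show ?thesis unfolding Suc by (simp only: g_def d_def nat.case C(3) nseq_eq card_runs)
  qed
  have vanish: "nth0 (g i) m = 0" "nth0 (d i) m = 0" if "nseq p lam mu i = 0" for i m
    using sizes[of i] that nth0_le_sum_list[of "g i" m] nth0_le_sum_list[of "d i" m] by linarith+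
  have mixed: "card {s\<in>runs b' k. W0 b' k s = (\<beta>, m)} = 0" if "lev b' k > 0" "\<beta> \<noteq> b'" for b' k m \<beta>
  proof -
    have "{s\<in>runs b' k. W0 b' k s = (\<beta>, m)} = {}" using parity[OF _ that(1)] that(2) by fastforce
    then show ?thesis by (simp only: card.empty)
  qed
  have mT: "card {s\<in>runs True k. W0 True k s = (False, m)} = 0" for k m
    by (rule mixed) (simp_all add: lev_def)
  have mF: "card {s\<in>runs False k. W0 False k s = (True, m)} = 0" if "k \<noteq> 0" for k m
    by (rule mixed) (use that in \<open>simp_all add: lev_def\<close>)
  let ?r = "rmax p lam mu"
  \<comment> \<open>\<open>in_Lambda\<close> sums up to \<open>rmax\<close> only; beyond it
    \<open>nseq\<close>, and with it both compositions, vanish.\<close>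
  have trunc: "(\<Sum>i\<le>Suc top. p ^ i * h i) = (\<Sum>i\<le>?r. p ^ i * h i)" if "\<And>i. nseq p lam mu i = 0 \<Longrightarrow> h i = 0" for h :: "nat \<Rightarrow> nat"
    by (rule sum.mono_neutral_right) (use rmax_bounds that in auto)
  have A: "nth0 a m = (\<Sum>i\<le>?r. p ^ i * nth0 (g i) m)" for m
  proof -
    have "nth0 a m = (\<Sum>k\<le>top. p ^ k * nth0 (g k) m)"
      using count[of False m] by (simp only: mT g_def C(2)) simp
    also have "\<dots> = (\<Sum>i\<le>Suc top. p ^ i * nth0 (g i) m)"
      by (simp add: g_def C(2) runs_def digit_empty)
    finally show ?thesis using trunc[of "\<lambda>i. nth0 (g i) m"] vanish by simp
  qed
  have B: "nth0 b m = (\<Sum>i\<le>?r. p ^ i * nth0 (d i) m)" for m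
  proof -
    have "(\<Sum>k\<le>top. p ^ k * card {s\<in>runs False k. W0 False k s = (True, m)}) = (\<Sum>k\<in>{0}. p ^ k * card {s\<in>runs False k. W0 False k s = (True, m)})"
      by (rule sum.mono_neutral_right) (use mF in simp_all)
    then have "nth0 b m = nth0 (d 0) m + (\<Sum>k\<le>top. p ^ Suc k * nth0 (d (Suc k)) m)"
      using count[of True m] by (simp add: d_def C(2))
    also have "\<dots> = (\<Sum>i\<le>Suc top. p ^ i * nth0 (d i) m)" by (subst sum.atMost_Suc_shift) simp
    finally show ?thesis using trunc[of "\<lambda>i. nth0 (d i) m"] vanish by simp
  qed
  have "is_composition (g i)" "is_composition (d i)" for i using C(1) by (auto simp: g_def d_def split: nat.split)
  then have "in_Lambda p lam mu a b g d" unfolding in_Lambda_def Let_def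
    by (intro conjI allI impI) (rule A B sizes | assumption)+
  \<comment> \<open>The size of \<open>d 0\<close> is the number of odd letters on the unmoved
    boxes, the only places where a mismatch is still possible.\<close>
  then have "d 0 = []" by (rule Lam)
  then have "card {s\<in>runs False 0. fst (W0 False 0 s) = True} = 0" using C(3)[of False 0 True] by (simp add: d_def)
  then have level0: "\<not> fst (W0 False 0 s)" if "s \<in> runs False 0" for s
    using that by (cases s) (auto simp: finite_runs)
  show ?thesis unfolding parmatch_def
  proof
    fix i assume i: "i \<in> {1..n}"
    obtain b' j k q r where x: "box i = ((b', j), (k, q, r))" by (metis prod.collapse)
    have m: "((b', j), (k, q, r)) \<in> boxes" using box_mem[OF i] by (simp add: x)
    have s: "(j, q) \<in> runs b' k" using m by (simp add: boxes_iff runs_iff)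
    have "fst (W0 b' k (j, q)) = b'"
    proof (cases "lev b' k > 0")
      case True then show ?thesis by (rule parity[OF s])
    next
      case False
      then have "b' = False" "k = 0" by (auto simp: lev_def split: if_splits)
      then show ?thesis using level0 s by simp
    qed
    moreover have "lab a b (iv y i) = W0 b' k (j, q)" using Wbox[OF i] Wconst[OF m] by (simp add: x wd_def)
    moreover have "fst (base i) = b'" using box(2)[OF i] x by (metis fst_conv)
    ultimately show "fst (lab a b (iv y i)) = fst (base i)" by simp
  qed
qed
end

theorem theorem1p2:
  fixes p n :: nat and a b lam mu :: "nat list"
    and Y1 Y2 :: "'a::field rep"
  assumes "prime p" and "odd p" and "CHAR('a) = p"
    and "(a, b) \<in> P2 n"
    and "is_partition lam" and "is_partition mu"
    and "sum_list lam + p * sum_list mu = n"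
    and "is_signed_young p n lam mu Y1"
    and "is_signed_young p (p * n) (scale p lam) (scale p mu) Y2"
  shows "ks_mult (p * n) (Mmod (scale p a) (scale p b)) Y2 \<le> ks_mult n (Mmod a b) Y1 \<and>
         ((\<forall>g d. in_Lambda p lam mu a b g d \<longrightarrow> d 0 = []) \<longrightarrow>
          ks_mult (p * n) (Mmod (scale p a) (scale p b)) Y2 = ks_mult n (Mmod a b) Y1)"
proof -
  interpret signed_shape p n lam mu by unfold_locales (use assms in auto)
  interpret tableau n p "Suc top" base colm z by (rule tableau_boxes)
  have ab: "sum_list a + sum_list b = n" using assms(4) by (simp add: P2_def)
  have pab: "sum_list (scale p a) + sum_list (scale p b) = p * n" unfolding sum_list_scale ab[symmetric] by (simp add: algebra_simps)
  have M1: "Mmod a b = (Ind n (lab a b) :: 'a rep)" by (rule Mmod_Ind[OF ab])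
  have M2: "Mmod (scale p a) (scale p b) = (Ind (p * n) (lab a b \<circ> blk p) :: 'a rep)"
    unfolding Mmod_Ind[OF pab] lab_scale[OF p0] ..
  have n2: "sum_list (scale p lam) + p * sum_list (scale p mu) = p * n"
    unfolding sum_list_scale size[symmetric] by (simp add: algebra_simps)
  then have n2': "sum_list (scale p lam) + sum_list (scale p (scale p mu)) = p * n" by (simp add: sum_list_scale)
  \<comment> \<open>The larger label gets the blown-up labelling of the smaller one; its own
    \<open>p\<close>-adic tableau is never formed.\<close>
  have base2: "lab (scale p lam) (scale p (scale p mu)) = base \<circ> blk p" by (rule lab_scale[OF p0])
  have Y1: "indecomposable n Y1" "is_summand n Y1 (Ind n base)"
    using assms(8) by (simp_all add: is_signed_young_def Mmod_Ind[OF size'])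
  have Y2: "indecomposable (p * n) Y2" "is_summand (p * n) Y2 (Ind (p * n) (base \<circ> blk p))"
    using assms(9) by (simp_all add: is_signed_young_def Mmod_Ind[OF n2'] base2)
  have Y1d: "\<not> is_summand n Y1 (Ind n c)" if "\<not> dominated n c base" for c
    by (rule signed_young_nondominated[OF assms(8,7) that])
  have Y2d: "\<not> is_summand (p * n) Y2 (Ind (p * n) c)" if "\<not> dominated (p * n) c (base \<circ> blk p)" for c
    by (rule signed_young_nondominated[OF assms(9) n2]) (use that in \<open>simp only: base2 not_False_eq_True\<close>)
  show ?thesis
  proof (intro conjI impI)
    show "ks_mult (p * n) (Mmod (scale p a) (scale p b)) Y2 \<le> ks_mult n (Mmod a b) Y1"
      unfolding M1 M2 by (rule ks_mult_lift(1)[OF assms(3) Y1 Y1d Y2 Y2d])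
  next
    assume L: "\<forall>g d. in_Lambda p lam mu a b g d \<longrightarrow> d 0 = []"
    show "ks_mult (p * n) (Mmod (scale p a) (scale p b)) Y2 = ks_mult n (Mmod a b) Y1"
      unfolding M1 M2
    proof (rule ks_mult_lift(2)[OF assms(3) Y1 Y1d Y2 Y2d])
      fix u :: "(nat \<Rightarrow> nat) \<Rightarrow> 'a" and y
      assume "u \<in> biequiv n base (lab a b)" "y \<in> Sn n" "u y \<noteq> 0" "lab a b \<circ> iv y \<circ> iv z = lab a b \<circ> iv y"
      then show "parmatch n base (lab a b) y"
        by (intro parmatch_of_Lambda[OF two_nonzero[OF assms(3)] ab]) (use L in blast)+
    qed
  qed
qed

end
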